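(* Let $q$ be a prime power, $n\ge1$, $q_1,\ldots,q_{n-1}\in\mathbb F_q^\times$. Let $ch(\chi^{(n)}_{(q_1,\ldots,q_{n-1})}\uparrow_{U_n}^{G_n})(X_f: f\in\Phi)$ denote the characteristic of the induced character $\chi^{(n)}_{(q_1,\ldots,q_{n-1})}\uparrow_{U_n}^{G_n}$ expressed in the basis $\{\tilde P_{\bm\mu}\mid\bm\mu\in\mathcal P^\Phi\}$, i.e. as an element of $\otimes_{f\in\Phi}\Lambda_{\mathbb C}(X_f)$, and let $\rho_n=\rho\big(ch(\chi^{(n)}_{(q_1,\ldots,q_{n-1})}\uparrow_{U_n}^{G_n})\big)\in\Lambda_{\mathbb C}(Y)$. Then $$ch(\chi^{(n)}_{(q_1,\ldots,q_{n-1})}\uparrow_{U_n}^{G_n})(X_f: f\in\Phi)=t\circ\omega(\rho_n)=q^{n-1}(q-1)\,\omega\big(\tilde P_{(n)}(X_{x-1};q)\big).$$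
   Context: Groups and symmetric functions. $\mathbb F_q$ is the field with $q$ elements, $\bar{\mathbb F}_q$ its algebraic closure, $G_n=GL_n(\mathbb F_q)$, $U_n\le G_n$ the group of unipotent upper-triangular matrices. For a set $Z$ of infinitely many variables, $\Lambda_{\mathbb C}(Z)$ is the ring of symmetric functions in $Z$ over $\mathbb C$, with complete functions $h_r$, elementary functions $e_r$, power sums $p_r$, Schur functions $s_\lambda$; $Y=\{y_1,y_2,\ldots\}$. $\omega$ is the $\mathbb C$-algebra homomorphism of $\Lambda_{\mathbb C}(Z)$ (for $Z=Y$ or $Z=X_{x-1}$) with $\omega(e_r)=h_r$ for all $r\ge0$. $P_\lambda(Z;t)$ is the Hall-Littlewood symmetric function (the limit as $N\to\infty$ of $\sum_{w\in S_N/S_N^\lambda}w\big(z_1^{\lambda_1}\cdots z_N^{\lambda_N}\prod_{\lambda_i>\lambda_j}\frac{z_i-tz_j}{z_i-z_j}\big)$, $S_N^\lambda$ the stabilizer of $(\lambda_1,\ldots,\lambda_N)$). With $n(\lambda)=\sum_{i\ge1}(i-1)\lambda_i$, put $\tilde P_\lambda(Z;q)=q^{-n(\lambda)}P_\lambda(Z;q^{-1})$. Index sets. $F:z\mapsto z^q$ is the Frobenius. $\Phi$ is the set of $F$-orbits in $\bar{\mathbb F}_q^\times$, identified with the monic irreducible polynomials $f\neq x$ in $\mathbb F_q[x]$; $d(f)=\deg f$; $f_z\in\Phi$ is the orbit of $z$; $x-1$ corresponds to the orbit $\{1\}$. Let $M_n=\mathbb F_{q^n}^\times$ and $\hat M_n=\mathrm{Hom}(M_n,\mathbb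 C^\times)$; for $m\mid n$ embed $\hat M_m\subset\hat M_n$ by composing with the norm $M_n\to M_m$. $\Theta$ is the set of orbits of $\xi\mapsto\xi^q$ on $\bigcup_n\hat M_n$; $d(\varphi)=\deg(\varphi)=|\varphi|$. If $\xi\in\varphi$ and $d(\varphi)\mid n$ then $\xi\in\hat M_n$ and $\xi(z)$, $z\in M_n$, is its value there. For a partition-valued function $\bm\mu$ on $\Phi$, $\|\bm\mu\|=\sum_f d(f)|\bm\mu(f)|$, $\mathcal P^\Phi_n=\{\bm\mu:\|\bm\mu\|=n\}$, $\mathcal P^\Phi=\bigcup_{n\ge0}\mathcal P^\Phi_n$; similarly $\mathcal P^\Theta_n$. Characteristic map. For $f\in\Phi$ and $\varphi\in\Theta$ let $X_f=\{X_{1,f},X_{2,f},\ldots\}$ and $Y^\varphi$ be infinite sets of variables (of degree $d(f)$, resp. $d(\varphi)$). $\Lambda_{\mathbb C}=\otimes_{f\in\Phi}\Lambda_{\mathbb C}(X_f)$ is identified with $\otimes_{\varphi\in\Theta}\Lambda_{\mathbb C}(Y^\varphi)$ by $p_k(Y^\varphi)=(-1)^{n-1}\sum_{z\in M_n}\xi(z)\,p_{n/d(f_z)}(X_{f_z})$, where $\xi\in\varphi$, $n=k\,d(\varphi)$. Put $\tilde P_{\bm\mu}=\prod_f\tilde P_{\bm\mu(f)}(X_f;q^{d(f)})$ and $S_{\bm\lambda}=\prod_\varphi s_{\bm\lambda(\varphi)}(Y^\varphi)$. For $\bm\mu\in\mathcal P^\Phi_n$, $\pi_{\bm\mu}$ is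 the indicator function of the conjugacy class $K^{\bm\mu}$ of those $g\in G_n$ making $\mathbb F_q^n$ an $\mathbb F_q[x]$-module isomorphic to $\bigoplus_f\bigoplus_i\mathbb F_q[x]/(f^{\bm\mu(f)_i})$. $ch$ is the linear map from the direct sum over $n\ge0$ of the spaces of class functions on $G_n$ to $\Lambda_{\mathbb C}$ with $\pi_{\bm\mu}\mapsto\tilde P_{\bm\mu}$; it is a (Hopf algebra) isomorphism, and it maps the irreducible characters $\chi^{\bm\lambda}$ of $G_n$ bijectively to the $S_{\bm\lambda}$, $\bm\lambda\in\mathcal P_n^\Theta$. Plethysm map and change of variables. $\rho:\Lambda_{\mathbb C}\to\Lambda_{\mathbb C}(Y)$ is the $\mathbb C$-algebra homomorphism with $\rho(h_a(Y^\varphi))=h_a[p_b]:=h_a(y_1^b,y_2^b,\ldots)$, $b=d(\varphi)$. $t:\Lambda_{\mathbb C}(Y)\to\Lambda_{\mathbb C}(X_{x-1})$ replaces each $y_i$ by $X_{i,x-1}$. Linear characters. Fix a nontrivial additive character $\psi:\mathbb F_q\to\mathbb C^\times$. For $q_1,\ldots,q_{n-1}\in\mathbb F_q^\times$, $\chi^{(n)}_{(q_1,\ldots,q_{n-1})}(u)=\prod_{i=1}^{n-1}\psi(q_iu_{i,i+1})$ for $u\in U_n$; $\uparrow_{U_n}^{G_n}$ denotes induction. The induced character (hence $\rho_n$) does not depend on $q_1,\ldots,q_{n-1}$. *)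

theory Defs
  imports
    "HOL-Library.Multiset_Order"
    "HOL-Library.FuncSet"
    "HOL-Library.Cardinality"
    "HOL-Computational_Algebra.Polynomial_Factorial"
    "HOL-Algebra.Algebraic_Closure_Type"
    "Jordan_Normal_Form.Matrix"
begin

section \<open>Formal power series in arbitrarily many variables\<close>

text \<open>A monomial in variables of type \<open>'v\<close> is a finite multiset of variables, and a series
  assigns a complex coefficient to every monomial.\<close>

typedef 'v mseries = "UNIV :: ('v multiset \<Rightarrow> complex) set"
  morphisms coeff_of Series ..

setup_lifting type_definition_mseries

lemma mseries_eqI: "(\<And>m. coeff_of f m = coeff_of g m) \<Longrightarrow> f = g"
  by transfer auto

lemma finite_submultisets: "finite {a. a \<subseteq># (m :: 'v multiset)}"
proof (induction m)
  case empty
  then show ?case by simp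
next
  case (add x m)
  have "{a. a \<subseteq># add_mset x m} \<subseteq> {a. a \<subseteq># m} \<union> add_mset x ` {a. a \<subseteq># m}"
  proof
    fix a assume a: "a \<in> {a. a \<subseteq># add_mset x m}"
    show "a \<in> {a. a \<subseteq># m} \<union> add_mset x ` {a. a \<subseteq># m}"
    proof (cases "x \<in># a")
      case True
      then have "a = add_mset x (a - {#x#})" by simp
      moreover have "a - {#x#} \<subseteq># m" using a by (simp add: subset_eq_diff_conv)
      ultimately show ?thesis by blast
    next
      case False
      have "a - {#x#} \<subseteq># m" using a by (simp add: subset_eq_diff_conv)
      then show ?thesis using False by simp
    qed
  qed
  then show ?case using add by (meson finite_UnI finite_imageI finite_subset)
qed

lemma finite_splits: "finite {(a, b). a + b = (m :: 'v multiset)}"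
proof (rule finite_subset)
  show "{(a, b). a + b = m} \<subseteq> {a. a \<subseteq># m} \<times> {a. a \<subseteq># m}" by auto
  show "finite ({a. a \<subseteq># m} \<times> {a. a \<subseteq># m})" by (simp add: finite_submultisets)
qed

instantiation mseries :: (type) comm_ring_1
begin

lift_definition zero_mseries :: "'a mseries" is "\<lambda>m. 0" .
lift_definition one_mseries :: "'a mseries" is "\<lambda>m. if m = {#} then 1 else 0" .
lift_definition plus_mseries :: "'a mseries \<Rightarrow> 'a mseries \<Rightarrow> 'a mseries" is "\<lambda>f g m. f m + g m" .
lift_definition minus_mseries :: "'a mseries \<Rightarrow> 'a mseries \<Rightarrow> 'a mseries" is "\<lambda>f g m. f m - g m" .
lift_definition uminus_mseries :: "'a mseries \<Rightarrow> 'a mseries" is "\<lambda>f m. - f m" .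
lift_definition times_mseries :: "'a mseries \<Rightarrow> 'a mseries \<Rightarrow> 'a mseries"
  is "\<lambda>f g m. \<Sum>(a, b)\<in>{(a, b). a + b = m}. f a * g b" .

instance
proof
  fix f g h :: "'a mseries"
  show "f * g * h = f * (g * h)"
  proof (transfer, rule ext)
    fix f g h :: "'a multiset \<Rightarrow> complex" and m :: "'a multiset"
    let ?S = "\<lambda>m :: 'a multiset. {(a, b). a + b = m}"
    have "(\<Sum>(c, d)\<in>?S m. (\<Sum>(a, b)\<in>?S c. f a * g b) * h d) =
        (\<Sum>x\<in>?S m. \<Sum>y\<in>?S (fst x). f (fst y) * g (snd y) * h (snd x))"
      by (simp add: sum_distrib_right case_prod_beta)
    also have "\<dots> = (\<Sum>(x, y)\<in>(SIGMA x:?S m. ?S (fst x)). f (fst y) * g (snd y) * h (snd x))"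
      by (rule sum.Sigma) (auto intro: finite_splits)
    also have "\<dots> = (\<Sum>(x, y)\<in>(SIGMA x:?S m. ?S (snd x)). f (fst x) * (g (fst y) * h (snd y)))"
      by (rule sum.reindex_bij_witness
          [where i = "\<lambda>(x, y). ((fst x + fst y, snd y), (fst x, fst y))"
             and j = "\<lambda>(x, y). ((fst y, snd y + snd x), (snd y, snd x))"])
         (auto simp: ac_simps)
    also have "\<dots> = (\<Sum>x\<in>?S m. \<Sum>y\<in>?S (snd x). f (fst x) * (g (fst y) * h (snd y)))"
      by (rule sum.Sigma [symmetric]) (auto intro: finite_splits)
    also have "\<dots> = (\<Sum>(a, d)\<in>?S m. f a * (\<Sum>(b, c)\<in>?S d. g b * h c))"
      by (simp add: sum_distrib_left case_prod_beta)
    finally show "(\<Sum>(c, d)\<in>?S m. (\<Sum>(a, b)\<in>?S c. f a * g b) * h d) =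
        (\<Sum>(a, d)\<in>?S m. f a * (\<Sum>(b, c)\<in>?S d. g b * h c))" .
  qed
  show "f * g = g * f"
    by (transfer, rule ext,
        rule sum.reindex_bij_witness [where i = "\<lambda>(a, b). (b, a)" and j = "\<lambda>(a, b). (b, a)"])
       (auto simp: ac_simps)
  show "1 * f = f"
  proof (transfer, rule ext)
    fix f :: "'a multiset \<Rightarrow> complex" and m :: "'a multiset"
    have "(\<Sum>(a, b)\<in>{(a, b). a + b = m}. (if a = {#} then 1 else 0) * f b) =
        (\<Sum>(a, b)\<in>{({#} :: 'a multiset, m)}. (if a = {#} then 1 else 0) * f b)"
      by (rule sum.mono_neutral_right [OF finite_splits]) (auto split: if_splits)
    then show "(\<Sum>(a, b)\<in>{(a, b). a + b = m}. (if a = {#} then 1 else 0) * f b) = f m"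
      by simp
  qed
  show "(f + g) * h = f * h + g * h"
    by (transfer, rule ext) (simp add: case_prod_beta distrib_right sum.distrib)
  show "(0 :: 'a mseries) \<noteq> 1"
    by transfer (auto simp: fun_eq_iff)
qed (transfer; auto)+

end

text \<open>An integral domain for well-ordered variables: the least monomials (in the multiset order)
  of two nonzero series contribute a nonzero coefficient to the product.\<close>

instance mseries :: (wellorder) idom
proof
  fix f g :: "'a mseries"
  assume "f \<noteq> 0" "g \<noteq> 0"
  then show "f * g \<noteq> 0"
  proof transfer
    fix f g :: "'a multiset \<Rightarrow> complex"
    assume "f \<noteq> (\<lambda>m. 0)" "g \<noteq> (\<lambda>m. 0)"
    then obtain a0 b0 where a0: "f a0 \<noteq> 0" and b0: "g b0 \<noteq> 0"
      by (auto simp: fun_eq_iff)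
    define a where "a = (LEAST m. f m \<noteq> 0)"
    define b where "b = (LEAST m. g m \<noteq> 0)"
    have a: "f a \<noteq> 0" unfolding a_def using a0 by (rule LeastI)
    have b: "g b \<noteq> 0" unfolding b_def using b0 by (rule LeastI)
    have la: "a \<le> m" if "f m \<noteq> 0" for m unfolding a_def using that by (rule Least_le)
    have lb: "b \<le> m" if "g m \<noteq> 0" for m unfolding b_def using that by (rule Least_le)
    have "(case p of (x, y) \<Rightarrow> f x * g y) = 0"
      if "p \<in> {(x, y). x + y = a + b} - {(a, b)}" for p
    proof (rule ccontr)
      obtain x y where p: "p = (x, y)" by (cases p)
      assume "(case p of (x, y) \<Rightarrow> f x * g y) \<noteq> 0"
      then have le: "a \<le> x" "b \<le> y" by (simp_all add: la lb p)
      have eq: "x + y = a + b" "(x, y) \<noteq> (a, b)" using that by (simp_all add: p)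
      have "x = a"
      proof (rule ccontr)
        assume "x \<noteq> a"
        then have "a + b < x + y" using le by (intro add_less_le_mono) auto
        then show False using eq by simp
      qed
      then show False using eq by simp
    qed
    then have "(\<Sum>(x, y)\<in>{(x, y). x + y = a + b}. f x * g y) = (\<Sum>(x, y)\<in>{(a, b)}. f x * g y)"
      by (intro sum.mono_neutral_right finite_splits ballI) auto
    then have "(\<Sum>(x, y)\<in>{(x, y). x + y = a + b}. f x * g y) \<noteq> 0" using a b by simp
    then show "(\<lambda>m. \<Sum>(x, y)\<in>{(x, y). x + y = m}. f x * g y) \<noteq> (\<lambda>m. 0)" by metis
  qed
qed

lift_definition const :: "complex \<Rightarrow> 'v mseries" is "\<lambda>c m. if m = {#} then c else 0" .

lift_definition var :: "'v \<Rightarrow> 'v mseries" is "\<lambda>v m. if m = {#v#} then 1 else 0" .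

text \<open>Substitution of the monomial \<open>\<sigma> v\<close> for every variable \<open>v\<close>. It is meaningful when only
  finitely many monomials map to any given one, in particular when \<open>\<sigma>\<close> is injective with
  nonempty values pairwise disjoint, as in all uses below.\<close>

lift_definition monom_subst :: "('v \<Rightarrow> 'w multiset) \<Rightarrow> 'v mseries \<Rightarrow> 'w mseries"
  is "\<lambda>\<sigma> f m. \<Sum>m' | (\<Sum>v\<in>#m'. \<sigma> v) = m. f m'" .

section \<open>Symmetric functions\<close>

text \<open>Symmetric functions are written in the variables \<open>0, 1, 2, \<dots>\<close> (i.e. $y_{i+1}$ is the
  variable \<open>i\<close>); \<open>in_vars z g\<close> is $g(z_0, z_1, \ldots)$ for an injective sequence \<open>z\<close> of
  variables.\<close>

definition Sym :: "nat mseries set" where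
  "Sym = {f. (\<exists>D. \<forall>m. D < size m \<longrightarrow> coeff_of f m = 0) \<and>
             (\<forall>\<pi>. bij \<pi> \<longrightarrow> (\<forall>m. coeff_of f (image_mset \<pi> m) = coeff_of f m))}"

definition in_vars :: "(nat \<Rightarrow> 'v) \<Rightarrow> nat mseries \<Rightarrow> 'v mseries" where
  "in_vars z = monom_subst (\<lambda>i. {#z i#})"

definition Sym_in :: "(nat \<Rightarrow> 'v) \<Rightarrow> 'v mseries set" where
  "Sym_in z = in_vars z ` Sym"

lift_definition complete_sym :: "nat \<Rightarrow> nat mseries" is "\<lambda>r m. if size m = r then 1 else 0" .

lift_definition elementary_sym :: "nat \<Rightarrow> nat mseries"
  is "\<lambda>r m. if size m = r \<and> (\<forall>i. count m i \<le> 1) then 1 else 0" .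

lift_definition power_sum :: "nat \<Rightarrow> nat mseries"
  is "\<lambda>r m. if \<exists>i. m = replicate_mset r i then 1 else 0" .

definition calg_hom :: "'v mseries set \<Rightarrow> 'w mseries set \<Rightarrow> ('v mseries \<Rightarrow> 'w mseries) \<Rightarrow> bool" where
  "calg_hom A B h \<longleftrightarrow> h \<in> A \<rightarrow> B \<and>
     (\<forall>c. h (const c) = const c) \<and>
     (\<forall>f\<in>A. \<forall>g\<in>A. h (f + g) = h f + h g \<and> h (f * g) = h f * h g)"

definition is_omega :: "(nat \<Rightarrow> 'v) \<Rightarrow> ('v mseries \<Rightarrow> 'v mseries) \<Rightarrow> bool" where
  "is_omega z \<omega> \<longleftrightarrow> calg_hom (Sym_in z) (Sym_in z) \<omega> \<and>
     (\<forall>r. \<omega> (in_vars z (elementary_sym r)) = in_vars z (complete_sym r))"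

inductive_set subalgebra :: "'v mseries set \<Rightarrow> 'v mseries set" for S where
  incl: "f \<in> S \<Longrightarrow> f \<in> subalgebra S"
| const: "const c \<in> subalgebra S"
| add: "f \<in> subalgebra S \<Longrightarrow> g \<in> subalgebra S \<Longrightarrow> f + g \<in> subalgebra S"
| mult: "f \<in> subalgebra S \<Longrightarrow> g \<in> subalgebra S \<Longrightarrow> f * g \<in> subalgebra S"

text \<open>The \<open>i\<close>-th variable of the alphabet attached to \<open>s\<close>; alphabets of different \<open>s\<close> are
  disjoint, so the tensor product of the rings of symmetric functions in these alphabets is
  the subalgebra they generate.\<close>

definition alphabet :: "'s \<Rightarrow> nat \<Rightarrow> nat \<times> 's" where
  "alphabet s i = (i, s)"

definition Sym_tensor :: "'s set \<Rightarrow> (nat \<times> 's) mseries set" where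
  "Sym_tensor I = subalgebra (\<Union>s\<in>I. Sym_in (alphabet s))"

section \<open>Partitions and Hall-Littlewood functions\<close>

text \<open>A partition is the sequence of its parts padded by zeros, indexed from \<open>0\<close>.\<close>

definition is_partition :: "(nat \<Rightarrow> nat) \<Rightarrow> bool" where
  "is_partition \<nu> \<longleftrightarrow> antimono \<nu> \<and> finite {i. \<nu> i \<noteq> 0}"

definition part_size :: "(nat \<Rightarrow> nat) \<Rightarrow> nat" where
  "part_size \<nu> = (\<Sum>i | \<nu> i \<noteq> 0. \<nu> i)"

definition part_n :: "(nat \<Rightarrow> nat) \<Rightarrow> nat" where
  "part_n \<nu> = (\<Sum>i | \<nu> i \<noteq> 0. i * \<nu> i)"

definition one_row :: "nat \<Rightarrow> nat \<Rightarrow> nat" where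
  "one_row n i = (if i = 0 then n else 0)"

definition perms :: "nat \<Rightarrow> (nat \<Rightarrow> nat) set" where
  "perms N = {w. w permutes {..<N}}"

text \<open>The relation \<open>w\<^sup>-\<^sup>1 \<circ> w' \<in> S\<^sub>N\<^sup>\<nu>\<close>, whose classes are the left cosets of the stabilizer.\<close>

definition coset_rel :: "nat \<Rightarrow> (nat \<Rightarrow> nat) \<Rightarrow> ((nat \<Rightarrow> nat) \<times> (nat \<Rightarrow> nat)) set" where
  "coset_rel N \<nu> = {(w, w'). w \<in> perms N \<and> w' \<in> perms N \<and>
     (\<forall>i<N. \<nu> ((inv_into UNIV w \<circ> w') i) = \<nu> i)}"

text \<open>The summand of the Hall-Littlewood function, with \<open>w\<close> permuting the variables. The
  rational functions are taken inside the fraction field of the power series ring.\<close>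

definition HL_term :: "nat \<Rightarrow> (nat \<Rightarrow> nat) \<Rightarrow> complex \<Rightarrow> (nat \<Rightarrow> nat) \<Rightarrow> nat mseries fract" where
  "HL_term N \<nu> t w =
     (\<Prod>i<N. to_fract (var (w i)) ^ \<nu> i) *
     (\<Prod>(i, j)\<in>{(i, j). i < N \<and> j < N \<and> \<nu> j < \<nu> i}.
        to_fract (var (w i) - const t * var (w j)) / to_fract (var (w i) - var (w j)))"

definition HL_finite :: "nat \<Rightarrow> (nat \<Rightarrow> nat) \<Rightarrow> complex \<Rightarrow> nat mseries" where
  "HL_finite N \<nu> t =
     (THE p. to_fract p = (\<Sum>C\<in>perms N // coset_rel N \<nu>. the_elem (HL_term N \<nu> t ` C)))"

definition HL :: "(nat \<Rightarrow> nat) \<Rightarrow> complex \<Rightarrow> nat mseries" where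
  "HL \<nu> t = Series (\<lambda>m. lim (\<lambda>N. coeff_of (HL_finite N \<nu> t) m))"

definition HL_tilde :: "(nat \<Rightarrow> nat) \<Rightarrow> nat \<Rightarrow> nat mseries" where
  "HL_tilde \<nu> Q = const (1 / of_nat Q ^ part_n \<nu>) * HL \<nu> (1 / of_nat Q)"

section \<open>The index sets\<close>

text \<open>The finite field is the type \<open>'a\<close>, so $q$ is \<open>CARD('a)\<close>. A Frobenius orbit is represented by
  the monic irreducible polynomial whose roots form the orbit.\<close>

definition Phi :: "'a::{field,finite} poly set" where
  "Phi = {f. lead_coeff f = 1 \<and> irreducible f \<and> f \<noteq> [:0, 1:]}"

definition orbit_poly :: "'a::{field,finite} alg_closure \<Rightarrow> 'a poly" where
  "orbit_poly z = (THE f. f \<in> Phi \<and> poly (map_poly to_ac f) z = 0)"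

abbreviation x_minus_1 :: "'a::{field,finite} poly" where
  "x_minus_1 \<equiv> [:-1, 1:]"

text \<open>$M_n$ is the multiplicative group of the subfield of order $q^n$, i.e. of the fixed field
  of the $n$-th power of the Frobenius map.\<close>

definition Mgrp :: "nat \<Rightarrow> 'a::{field,finite} alg_closure set" where
  "Mgrp n = {z. z \<noteq> 0 \<and> z ^ (CARD('a) ^ n) = z}"

text \<open>Characters of $M_n$, extended by \<open>0\<close> outside $M_n$.\<close>

definition Mhat :: "nat \<Rightarrow> ('a::{field,finite} alg_closure \<Rightarrow> complex) set" where
  "Mhat n = {\<xi>. (\<forall>z\<in>Mgrp n. \<xi> z \<noteq> 0) \<and> (\<forall>z. z \<notin> Mgrp n \<longrightarrow> \<xi> z = 0) \<and>
                (\<forall>z\<in>Mgrp n. \<forall>w\<in>Mgrp n. \<xi> (z * w) = \<xi> z * \<xi> w)}"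

text \<open>The norm from $M_n$ to $M_m$, for \<open>m dvd n\<close>, and the resulting embedding of characters.\<close>

definition Mnorm :: "nat \<Rightarrow> nat \<Rightarrow> 'a::{field,finite} alg_closure \<Rightarrow> 'a alg_closure" where
  "Mnorm m n z = (\<Prod>i<n div m. z ^ (CARD('a) ^ (m * i)))"

definition Mhat_embed :: "nat \<Rightarrow> nat \<Rightarrow> ('a::{field,finite} alg_closure \<Rightarrow> complex) \<Rightarrow>
    'a alg_closure \<Rightarrow> complex" where
  "Mhat_embed m n \<xi> z = (if z \<in> Mgrp n then \<xi> (Mnorm m n z) else 0)"

text \<open>The union of all character groups along these embeddings is the direct limit: its elements
  are equivalence classes of pairs \<open>(n, \<xi>)\<close> with \<open>\<xi> \<in> Mhat n\<close>.\<close>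

type_synonym 'a level_char = "nat \<times> ('a alg_closure \<Rightarrow> complex)"

definition char_rel :: "('a::{field,finite} level_char \<times> 'a level_char) set" where
  "char_rel = {((m, \<alpha>), (n, \<beta>)). 0 < m \<and> 0 < n \<and> \<alpha> \<in> Mhat m \<and> \<beta> \<in> Mhat n \<and>
     (\<exists>N>0. m dvd N \<and> n dvd N \<and> Mhat_embed m N \<alpha> = Mhat_embed n N \<beta>)}"

definition char_union :: "'a::{field,finite} level_char set set" where
  "char_union = (SIGMA n:{0<..}. Mhat n) // char_rel"

definition char_frob :: "'a::{field,finite} level_char set \<Rightarrow> 'a level_char set" where
  "char_frob \<Xi> = (\<lambda>(n, \<xi>). (n, \<lambda>z. \<xi> z ^ CARD('a))) ` \<Xi>"

definition Theta :: "'a::{field,finite} level_char set set set" where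
  "Theta = (\<lambda>\<Xi>. range (\<lambda>k. (char_frob ^^ k) \<Xi>)) ` char_union"

text \<open>The value $\xi(z)$ obtained by viewing an element of the union as a character of $M_n$.\<close>

definition char_val :: "'a::{field,finite} level_char set \<Rightarrow> nat \<Rightarrow> 'a alg_closure \<Rightarrow> complex" where
  "char_val \<Xi> n = (THE \<xi>. (n, \<xi>) \<in> \<Xi>)"

definition P_Phi :: "('a::{field,finite} poly \<Rightarrow> nat \<Rightarrow> nat) set" where
  "P_Phi = {\<mu>. (\<forall>f\<in>Phi. is_partition (\<mu> f)) \<and> (\<forall>f. f \<notin> Phi \<longrightarrow> \<mu> f = (\<lambda>i. 0)) \<and>
               finite {f. \<mu> f \<noteq> (\<lambda>i. 0)}}"

definition P_norm :: "('a::{field,finite} poly \<Rightarrow> nat \<Rightarrow> nat) \<Rightarrow> nat" where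
  "P_norm \<mu> = (\<Sum>f | \<mu> f \<noteq> (\<lambda>i. 0). degree f * part_size (\<mu> f))"

section \<open>General linear groups and class functions\<close>

definition GL :: "nat \<Rightarrow> 'a::{field,finite} mat monoid" where
  "GL n = units_of (ring_mat TYPE('a) n ())"

definition unitriangular :: "nat \<Rightarrow> 'a::{field,finite} mat set" where
  "unitriangular n = {u \<in> carrier_mat n n.
     (\<forall>i<n. u $$ (i, i) = 1) \<and> (\<forall>i<n. \<forall>j<i. u $$ (i, j) = 0)}"

text \<open>The $\mathbb F_q[x]$-module structure on $\mathbb F_q^n$ in which $x$ acts by \<open>g\<close> (Horner scheme).\<close>

definition poly_act :: "nat \<Rightarrow> 'a::{field,finite} mat \<Rightarrow> 'a poly \<Rightarrow> 'a vec \<Rightarrow> 'a vec" where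
  "poly_act n g p v = fold_coeffs (\<lambda>a w. a \<cdot>\<^sub>v v + g *\<^sub>v w) p (0\<^sub>v n)"

text \<open>The module $\bigoplus_f \bigoplus_i \mathbb F_q[x]/(f^{\mu(f)_i})$, each quotient given by its
  reduced remainders; summands with $\mu(f)_i = 0$ are zero.\<close>

definition cyclic_sum :: "('a::{field,finite} poly \<Rightarrow> nat \<Rightarrow> nat) \<Rightarrow> ('a poly \<Rightarrow> nat \<Rightarrow> 'a poly) set" where
  "cyclic_sum \<mu> = {c. \<forall>f i. c f i mod f ^ \<mu> f i = c f i}"

definition conj_class :: "('a::{field,finite} poly \<Rightarrow> nat \<Rightarrow> nat) \<Rightarrow> 'a mat set" where
  "conj_class \<mu> = {g \<in> carrier (GL (P_norm \<mu>)).
     \<exists>T. bij_betw T (carrier_vec (P_norm \<mu>)) (cyclic_sum \<mu>) \<and>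
       (\<forall>v\<in>carrier_vec (P_norm \<mu>). \<forall>w\<in>carrier_vec (P_norm \<mu>).
          T (v + w) = (\<lambda>f i. T v f i + T w f i)) \<and>
       (\<forall>v\<in>carrier_vec (P_norm \<mu>). \<forall>p.
          T (poly_act (P_norm \<mu>) g p v) = (\<lambda>f i. (p * T v f i) mod f ^ \<mu> f i))}"

text \<open>The direct sum over all \<open>n\<close> of the spaces of class functions on \<open>GL n\<close>: matrices of different
  sizes are different, so its elements are functions on the disjoint union of the groups,
  zero on all but finitely many of them (and outside their union).\<close>

definition class_funs :: "('a::{field,finite} mat \<Rightarrow> complex) set" where
  "class_funs = {F. (\<forall>A. A \<notin> (\<Union>n. carrier (GL n)) \<longrightarrow> F A = 0) \<and>
     (\<forall>n. \<forall>g\<in>carrier (GL n). \<forall>x\<in>carrier (GL n). F (inv\<^bsub>GL n\<^esub> x \<otimes>\<^bsub>GL n\<^esub> g \<otimes>\<^bsub>GL n\<^esub> x) = F g) \<and>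
     (\<exists>N. \<forall>n>N. \<forall>g\<in>carrier (GL n). F g = 0)}"

definition induced_char :: "('g, 'b) monoid_scheme \<Rightarrow> 'g set \<Rightarrow> ('g \<Rightarrow> complex) \<Rightarrow> 'g \<Rightarrow> complex" where
  "induced_char G H \<chi> g = (if g \<in> carrier G
     then (\<Sum>x | x \<in> carrier G \<and> inv\<^bsub>G\<^esub> x \<otimes>\<^bsub>G\<^esub> g \<otimes>\<^bsub>G\<^esub> x \<in> H.
             \<chi> (inv\<^bsub>G\<^esub> x \<otimes>\<^bsub>G\<^esub> g \<otimes>\<^bsub>G\<^esub> x)) / of_nat (card H)
     else 0)"

definition nontrivial_additive_character :: "('a::{field,finite} \<Rightarrow> complex) \<Rightarrow> bool" where
  "nontrivial_additive_character \<psi> \<longleftrightarrow>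
     (\<forall>x. \<psi> x \<noteq> 0) \<and> (\<forall>x y. \<psi> (x + y) = \<psi> x * \<psi> y) \<and> (\<exists>x. \<psi> x \<noteq> 1)"

text \<open>Matrix entries are indexed from \<open>0\<close>, so $u_{i,i+1}$ is \<open>u $$ (i - 1, i)\<close>.\<close>

definition linear_char :: "('a::{field,finite} \<Rightarrow> complex) \<Rightarrow> nat \<Rightarrow> (nat \<Rightarrow> 'a) \<Rightarrow> 'a mat \<Rightarrow> complex" where
  "linear_char \<psi> n c u = (\<Prod>i\<in>{1..<n}. \<psi> (c i * u $$ (i - 1, i)))"

section \<open>The characteristic map and the maps between rings of symmetric functions\<close>

definition P_tilde :: "('a::{field,finite} poly \<Rightarrow> nat \<Rightarrow> nat) \<Rightarrow> (nat \<times> 'a poly) mseries" where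
  "P_tilde \<mu> = (\<Prod>f | \<mu> f \<noteq> (\<lambda>i. 0). in_vars (alphabet f) (HL_tilde (\<mu> f) (CARD('a) ^ degree f)))"

definition is_characteristic_map ::
    "(('a::{field,finite} mat \<Rightarrow> complex) \<Rightarrow> (nat \<times> 'a poly) mseries) \<Rightarrow> bool" where
  "is_characteristic_map ch \<longleftrightarrow>
     (\<forall>F\<in>class_funs. \<forall>G\<in>class_funs. ch (\<lambda>g. F g + G g) = ch F + ch G) \<and>
     (\<forall>a. \<forall>F\<in>class_funs. ch (\<lambda>g. a * F g) = const a * ch F) \<and>
     (\<forall>\<mu>\<in>P_Phi. ch (\<lambda>g. if g \<in> conj_class \<mu> then 1 else 0) = P_tilde \<mu>)"

text \<open>The identification of the ring in the variables $Y^\varphi$ with the one in the variables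
  $X_f$; here \<open>card \<phi>\<close> is $d(\varphi)$.\<close>

definition is_identification ::
    "((nat \<times> 'a::{field,finite} level_char set set) mseries \<Rightarrow> (nat \<times> 'a poly) mseries) \<Rightarrow> bool" where
  "is_identification \<iota> \<longleftrightarrow>
     calg_hom (Sym_tensor Theta) (Sym_tensor Phi) \<iota> \<and>
     bij_betw \<iota> (Sym_tensor Theta) (Sym_tensor Phi) \<and>
     (\<forall>\<phi>\<in>Theta. \<forall>\<Xi>\<in>\<phi>. \<forall>k n. 0 < k \<longrightarrow> n = k * card \<phi> \<longrightarrow>
        \<iota> (in_vars (alphabet \<phi>) (power_sum k)) =
        const ((- 1) ^ (n - 1)) *
          (\<Sum>z\<in>Mgrp n. const (char_val \<Xi> n z) *
             in_vars (alphabet (orbit_poly z)) (power_sum (n div degree (orbit_poly z)))))"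

text \<open>\<open>Y\<close> is the alphabet $y_1, y_2, \ldots$\<close>

definition Y :: "nat \<Rightarrow> nat" where
  "Y i = i"

text \<open>The plethysm $h[p_b]$ replaces every variable by its \<open>b\<close>-th power.\<close>

definition plethysm_p :: "nat \<Rightarrow> nat mseries \<Rightarrow> nat mseries" where
  "plethysm_p b = monom_subst (\<lambda>i. replicate_mset b (Y i))"

definition is_rho ::
    "((nat \<times> 'a::{field,finite} level_char set set) mseries \<Rightarrow> (nat \<times> 'a poly) mseries) \<Rightarrow>
     ((nat \<times> 'a poly) mseries \<Rightarrow> nat mseries) \<Rightarrow> bool" where
  "is_rho \<iota> \<rho> \<longleftrightarrow>
     calg_hom (Sym_tensor Phi) (Sym_in Y) \<rho> \<and>
     (\<forall>\<phi>\<in>Theta. \<forall>a. \<rho> (\<iota> (in_vars (alphabet \<phi>) (complete_sym a))) =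
        plethysm_p (card \<phi>) (complete_sym a))"

definition change_vars :: "nat mseries \<Rightarrow> (nat \<times> 'a::{field,finite} poly) mseries" where
  "change_vars = monom_subst (\<lambda>i. {#alphabet x_minus_1 i#})"

end

theory Submission
  imports
    Defs
    "HOL-Computational_Algebra.Polynomial_FPS"
    "HOL-Computational_Algebra.Fundamental_Theorem_Algebra"
    "Jordan_Normal_Form.Jordan_Normal_Form_Existence"
begin

text \<open>Let $R_n(y) = \sum_{i+j=n} (-y)^i e_i h_j$, the coefficient of $u^n$ in
  $\prod_i (1 - y z_i u)/(1 - z_i u)$, and write $\Gamma$ for the induced character.

  \<^item> $\Gamma(g)$ vanishes unless \<open>g\<close> is unipotent. If \<open>g\<close> is unipotent with
    $\dim\ker(g-1) = l$, then $\Gamma(g)$ is a sum over the matrices \<open>x\<close> with $x^{-1} g x$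
    unitriangular, i.e. over the flags adapted to $g - 1$ built one column at a time; summing over
    the last column first and telescoping gives $(-1)^{n+l} \prod_{i=1}^l (q^i - 1)$.

  \<^item> Removing the largest part of a partition gives recursions for Hall-Littlewood functions,
    from which $\sum_{\nu \vdash n} \prod_{j=1}^{\ell(\nu)} (1 - q^j) \tilde P_\nu(q) = R_n(q)$.
    Hence $ch(\Gamma) = (-1)^n R_n(q)$ in the variables $X_{x-1}$. The same recursion for a single
    part identifies $\tilde P_{(n)}$ with a multiple of $R_n(1/q)$, and \<open>\<omega>\<close> turns it into $R_n(q)$
    up to the stated factor.

  \<^item> Summing $p_k(Y^\varphi)$ over all characters of $M_n$ leaves only $z = 1$ by
    orthogonality, so \<open>\<rho>\<close> maps $p_n(X_{x-1})$ to $(-1)^{n-1} p_n(Y)$. Thus $t \circ \omega \circ \rho$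
    fixes every symmetric function of $X_{x-1}$, in particular $ch(\Gamma)$.\<close>

section \<open>Hall-Littlewood ratios over a field\<close>

text \<open>The obstacle is that Hall-Littlewood functions are given as coset sums of rational
  functions followed by a coefficientwise limit. The identities are therefore proved for finitely
  many distinct nonzero elements of a field, where one element can be removed at a time; only
  afterwards are these elements specialised to variables in the fraction field of the series ring.
  Polynomiality and existence of the limit come out of the recursion for the largest part.

  The sum over partitions is treated with an additional parameter y, set to q at the end: at t = 1/q
  the coefficient in front of P_nu is the value at y = q of a polynomial in y. Peeling columns off
  the diagram reduces the claim to a sum over subsets of the variables. There both sides satisfy the
  same difference equation under y -> t y and agree at y = 1, and the powers of t are distinct.

  On the group side a unipotent class enters only through the sizes of the kernels of (g - 1)^k.
  They give the parameter l, nilpotency and the disjointness of the classes; that every unipotent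
  element lies in some class comes from the Jordan form.\<close>

definition hl_ratio :: "('i \<Rightarrow> 'k::field) \<Rightarrow> 'k \<Rightarrow> 'i set \<Rightarrow> 'i set \<Rightarrow> 'k" where
  "hl_ratio x t I J = (\<Prod>i\<in>I. \<Prod>j\<in>J. (x i - t * x j) / (x i - x j))"

lemma hl_ratio_Un_right:
  "finite J \<Longrightarrow> finite J' \<Longrightarrow> J \<inter> J' = {} \<Longrightarrow>
    hl_ratio x t I (J \<union> J') = hl_ratio x t I J * hl_ratio x t I J'"
  by (simp add: hl_ratio_def prod.union_disjoint prod.distrib)

lemma hl_ratio_remove:
  "finite I \<Longrightarrow> i \<in> I \<Longrightarrow> hl_ratio x t I J = hl_ratio x t {i} J * hl_ratio x t (I - {i}) J"
  by (simp add: hl_ratio_def prod.remove)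

section \<open>Lagrange interpolation for Hall-Littlewood ratios\<close>

lemma poly_eqI_infinite:
  fixes p q :: "'k::idom poly"
  assumes "infinite A" "\<And>z. z \<in> A \<Longrightarrow> poly p z = poly q z"
  shows "p = q"
proof (rule ccontr)
  assume "p \<noteq> q"
  then have "finite {z. poly (p - q) z = 0}" by (intro poly_roots_finite) simp
  moreover have "A \<subseteq> {z. poly (p - q) z = 0}" using assms(2) by auto
  ultimately show False using assms(1) finite_subset by blast
qed

lemma degree_prod_linear: "finite S \<Longrightarrow> degree (\<Prod>j\<in>S. [:1, a j:] :: 'k::idom poly) \<le> card S"
proof (induction S rule: finite_induct)
  case (insert i S)
  have "degree (\<Prod>j\<in>insert i S. [:1, a j:]) \<le> degree [:1, a i:] + degree (\<Prod>j\<in>S. [:1, a j:])"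
    unfolding prod.insert[OF insert(1,2)] by (rule degree_mult_le)
  also have "\<dots> \<le> Suc (card S)"
    using insert degree_pCons_le[of 1 "[:a i:]"] by simp
  finally show ?case using insert(1,2) by (simp del: mult_pCons_left)
qed simp

lemma coeff_prod_linear:
  "finite S \<Longrightarrow> coeff (\<Prod>j\<in>S. [:1, a j:] :: 'k::idom poly) (card S) = (\<Prod>j\<in>S. a j)"
proof (induction S rule: finite_induct)
  case (insert i S)
  have "coeff (\<Prod>j\<in>S. [:1, a j:]) (Suc (card S)) = 0"
    using degree_prod_linear[OF insert(1), of a] by (intro coeff_eq_0) simp
  then show ?case using insert by simp
qed simp

text \<open>Interpolation in u: both sides have degree at most \<open>card S\<close> and agree at
  the \<open>card S\<close> + 1 nodes 0 and \<open>1 / x i\<close>. At the node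
  \<open>1 / x i\<close> only the summand of \<open>i\<close> survives on the left, and its ratio
  turns the factors 1 - u x_j into 1 - t u x_j.\<close>

lemma hl_ratio_lagrange_poly:
  fixes x :: "'i \<Rightarrow> 'k::field"
  assumes fin: "finite S" and inj: "inj_on x S" and nz: "\<And>i. i \<in> S \<Longrightarrow> x i \<noteq> 0"
  shows "[:0, 1 - t:] * (\<Sum>i\<in>S. smult (x i * hl_ratio x t {i} (S - {i})) (\<Prod>j\<in>S - {i}. [:1, - x j:])) =
    (\<Prod>j\<in>S. [:1, - (t * x j):]) - (\<Prod>j\<in>S. [:1, - x j:])" (is "?l = ?r")
proof (rule poly_eqI_degree)
  let ?A = "insert 0 ((\<lambda>i. 1 / x i) ` S)"
  have "inj_on (\<lambda>i. 1 / x i) S" using inj nz by (auto simp: inj_on_def)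
  then have card: "card ?A = Suc (card S)"
    using fin nz by (subst card_insert_disjoint) (auto simp: card_image)
  have "degree ?r \<le> card S" using fin by (intro degree_diff_le degree_prod_linear)
  then show "degree ?r < card ?A" using card by simp
  have "degree ?l \<le> card S"
  proof (cases "S = {}")
    case False
    have "degree ?l \<le> degree [:0, 1 - t:] +
        degree (\<Sum>i\<in>S. smult (x i * hl_ratio x t {i} (S - {i})) (\<Prod>j\<in>S - {i}. [:1, - x j:]))"
      by (rule degree_mult_le)
    also have "\<dots> \<le> 1 + (card S - 1)"
    proof (intro add_mono degree_sum_le fin)
      fix i assume i: "i \<in> S"
      have "degree (smult (x i * hl_ratio x t {i} (S - {i})) (\<Prod>j\<in>S - {i}. [:1, - x j:])) \<le>
          degree (\<Prod>j\<in>S - {i}. [:1, - x j:])" by (rule degree_smult_le)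
      also have "\<dots> \<le> card (S - {i})" using fin by (intro degree_prod_linear) simp
      finally show "degree (smult (x i * hl_ratio x t {i} (S - {i})) (\<Prod>j\<in>S - {i}. [:1, - x j:])) \<le> card S - 1"
        using fin i by simp
    qed (simp add: degree_pCons_le)
    also have "\<dots> = card S" using False fin by (simp add: Suc_leI card_gt_0_iff)
    finally show ?thesis .
  qed simp
  then show "degree ?l < card ?A" using card by simp
next
  fix z assume "z \<in> insert 0 ((\<lambda>i. 1 / x i) ` S)"
  then consider "z = 0" | i where "i \<in> S" "z = 1 / x i" by auto
  then show "poly ?l z = poly ?r z"
  proof cases
    case 1
    then show ?thesis by (simp add: poly_prod)
  next
    case (2 i)
    have zi: "z * x i = 1" using 2 nz by simp
    have "poly ?l z = z * (1 - t) * (\<Sum>k\<in>S. x k * hl_ratio x t {k} (S - {k}) * (\<Prod>j\<in>S - {k}. 1 - z * x j))"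
      by (simp add: poly_sum poly_prod algebra_simps)
    also have "(\<Sum>k\<in>S. x k * hl_ratio x t {k} (S - {k}) * (\<Prod>j\<in>S - {k}. 1 - z * x j)) =
        (\<Sum>k\<in>{i}. x k * hl_ratio x t {k} (S - {k}) * (\<Prod>j\<in>S - {k}. 1 - z * x j))"
      using fin 2 zi by (intro sum.mono_neutral_right) (auto intro!: prod_zero)
    also have "\<dots> = x i * (\<Prod>j\<in>S - {i}. (1 - t * z * x j))"
    proof -
      \<comment> \<open>The difference of the two sides is a multiple of \<open>1 - z * x i\<close>,
        which vanishes at this node.\<close>
      have "(x i - t * b) * (1 - z * b) = (1 - t * z * b) * (x i - b)" for b
      proof -
        have "(x i - t * b) * (1 - z * b) - (1 - t * z * b) * (x i - b) = b * (1 - t) * (1 - z * x i)"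
          by (simp add: algebra_simps)
        then show ?thesis using zi by simp
      qed
      then have "hl_ratio x t {i} (S - {i}) * (\<Prod>j\<in>S - {i}. 1 - z * x j) = (\<Prod>j\<in>S - {i}. 1 - t * z * x j)"
        unfolding hl_ratio_def by (simp add: prod.distrib[symmetric])
          (rule prod.cong, use 2 inj in \<open>auto simp: divide_simps inj_on_def\<close>)
      then show ?thesis by (simp add: mult.assoc)
    qed
    also have "z * (1 - t) * (x i * (\<Prod>j\<in>S - {i}. (1 - t * z * x j))) =
        (z * x i) * (1 - t) * (\<Prod>j\<in>S - {i}. (1 - t * z * x j))" by (simp only: ac_simps)
    also have "\<dots> = (1 - t * (z * x i)) * (\<Prod>j\<in>S - {i}. (1 - t * z * x j))" by (simp only: zi) simp
    also have "\<dots> = (\<Prod>j\<in>S. 1 - t * z * x j)"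
      using prod.remove[OF fin 2(1), of "\<lambda>j. 1 - t * z * x j"] by (simp only: mult.assoc)
    also have "\<dots> = poly ?r z"
    proof -
      have "(\<Prod>j\<in>S. 1 - z * x j) = 0" using fin 2 zi by (intro prod_zero) auto
      then show ?thesis by (simp add: poly_prod algebra_simps)
    qed
    finally show ?thesis .
  qed
qed

lemma hl_ratio_lagrange:
  fixes x :: "'i \<Rightarrow> 'k::field"
  assumes "finite S" "inj_on x S" "\<And>i. i \<in> S \<Longrightarrow> x i \<noteq> 0"
  shows "v * (1 - t) * (\<Sum>i\<in>S. x i * hl_ratio x t {i} (S - {i}) * (\<Prod>j\<in>S - {i}. 1 - v * x j)) =
    (\<Prod>j\<in>S. 1 - t * v * x j) - (\<Prod>j\<in>S. 1 - v * x j)"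
  using arg_cong[OF hl_ratio_lagrange_poly[OF assms], of "\<lambda>p. poly p v"]
  by (simp add: poly_sum poly_prod algebra_simps)

text \<open>Comparison of the coefficients of u^(card S) in the Lagrange identity, divided by the
  product of all - x_j. Up to the factor 1 - t, the ratios of a block of variables add up to the
  t-analogue of its size.\<close>

lemma sum_hl_ratio:
  fixes x :: "'i \<Rightarrow> 'k::field"
  assumes fin: "finite S" and inj: "inj_on x S" and nz: "\<And>i. i \<in> S \<Longrightarrow> x i \<noteq> 0"
  shows "(1 - t) * (\<Sum>i\<in>S. hl_ratio x t {i} (S - {i})) = 1 - t ^ card S"
proof (cases "S = {}")
  case False
  then obtain r where r: "card S = Suc r" using fin by (metis card_0_eq not0_implies_Suc)
  have cr: "card (S - {i}) = r" if "i \<in> S" for i using that r fin by simp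
  have "(1 - t) * (\<Sum>i\<in>S. x i * hl_ratio x t {i} (S - {i}) * (\<Prod>j\<in>S - {i}. - x j)) =
      (\<Prod>j\<in>S. - (t * x j)) - (\<Prod>j\<in>S. - x j)"
  proof -
    have "coeff (\<Prod>j\<in>S - {i}. [:1, - x j:]) r = (\<Prod>j\<in>S - {i}. - x j)" if "i \<in> S" for i
      using coeff_prod_linear[of "S - {i}" "\<lambda>j. - x j"] cr[OF that] fin by simp
    then show ?thesis
      using arg_cong[OF hl_ratio_lagrange_poly[OF assms, of t], of "\<lambda>p. coeff p (Suc r)"]
        coeff_prod_linear[OF fin, of "\<lambda>j. - x j"] coeff_prod_linear[OF fin, of "\<lambda>j. - (t * x j)"] r
      by (simp add: coeff_sum)
  qed
  moreover have "x i * hl_ratio x t {i} (S - {i}) * (\<Prod>j\<in>S - {i}. - x j) =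
      - hl_ratio x t {i} (S - {i}) * (\<Prod>j\<in>S. - x j)" if "i \<in> S" for i
    using that fin by (simp add: prod.remove)
  moreover have "(\<Prod>j\<in>S. - (t * x j)) = t ^ card S * (\<Prod>j\<in>S. - x j)"
    by (simp add: prod.distrib[symmetric] prod_constant[symmetric] del: prod_constant)
  ultimately have "(1 - t) * (\<Sum>i\<in>S. - hl_ratio x t {i} (S - {i}) * (\<Prod>j\<in>S. - x j)) =
      t ^ card S * (\<Prod>j\<in>S. - x j) - (\<Prod>j\<in>S. - x j)"
    by (metis (no_types, lifting) sum.cong)
  moreover have "P * ((1 - t) * h) = P * (1 - c)" if "(1 - t) * (- h * P) = c * P - P" for P h c
  proof -
    have "P * ((1 - t) * h) = - ((1 - t) * (- h * P))" by (simp add: ac_simps)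
    also have "\<dots> = P * (1 - c)" by (simp only: that) (simp add: algebra_simps)
    finally show ?thesis .
  qed
  ultimately have "(\<Prod>j\<in>S. - x j) * ((1 - t) * (\<Sum>i\<in>S. hl_ratio x t {i} (S - {i}))) =
      (\<Prod>j\<in>S. - x j) * (1 - t ^ card S)"
    unfolding sum_distrib_right[symmetric] sum_negf by blast
  moreover have "(\<Prod>j\<in>S. - x j) \<noteq> 0" using fin nz by simp
  ultimately show ?thesis by (metis mult_cancel_left)
qed simp

section \<open>A subset-sum identity with an additional parameter y\<close>

definition q_falling :: "'k::comm_ring_1 \<Rightarrow> 'k \<Rightarrow> nat \<Rightarrow> 'k" where
  "q_falling t y r = (\<Prod>j<r. t ^ j - y)"

text \<open>The product is a t-analogue of a falling factorial in y: the shift y -> t y lowers the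
  index by one and produces the factor 1 - t^(r+1), which \<open>sum_hl_ratio\<close> distributes
  over the elements of a set of size r + 1.\<close>

lemma q_falling_scale:
  "q_falling t (t * y) (Suc r) - q_falling t y (Suc r) = y * (1 - t ^ Suc r) * q_falling t y r"
proof -
  have "q_falling t (t * y) (Suc r) = (1 - t * y) * (t ^ r * q_falling t y r)"
    unfolding q_falling_def
    by (subst prod.lessThan_Suc_shift)
      (simp add: right_diff_distrib[symmetric] prod.distrib)
  then show ?thesis by (simp add: q_falling_def algebra_simps)
qed

text \<open>\<open>I\<close> stands for the set of variables with positive exponent. The factors
  over \<open>S - I\<close> disappear after division by the product of all 1 - u x_j, leaving
  complete functions in the variables of \<open>I\<close> alone.\<close>

definition hl_subset_sum :: "('i \<Rightarrow> 'k::field) \<Rightarrow> 'k \<Rightarrow> 'k \<Rightarrow> 'i set \<Rightarrow> 'k \<Rightarrow> 'k" where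
  "hl_subset_sum x t u S y = (\<Sum>I\<in>Pow S. q_falling t y (card I) * u ^ card I *
     hl_ratio x t I (S - I) * (\<Prod>i\<in>I. x i) * (\<Prod>j\<in>S - I. 1 - u * x j))"

text \<open>The shift of y produces 1 - t^(card I) in the summand of \<open>I\<close>. Writing this
  as a sum over \<open>i\<close> in \<open>I\<close> marks one element, and exchanging the two sums
  leaves sums of the same kind over the subsets of \<open>S - {i}\<close>.\<close>

lemma hl_subset_sum_scale:
  fixes x :: "'i \<Rightarrow> 'k::field"
  assumes fin: "finite S" and inj: "inj_on x S" and nz: "\<And>i. i \<in> S \<Longrightarrow> x i \<noteq> 0"
  shows "hl_subset_sum x t u S (t * y) - hl_subset_sum x t u S y =
    y * u * (1 - t) * (\<Sum>i\<in>S. x i * hl_ratio x t {i} (S - {i}) * hl_subset_sum x t u (S - {i}) y)"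
proof -
  define g where "g = (\<lambda>I. u ^ card I * hl_ratio x t I (S - I) * (\<Prod>i\<in>I. x i) * (\<Prod>j\<in>S - I. 1 - u * x j))"
  define k where "k = (\<lambda>i J. q_falling t y (card J) * u ^ card J * hl_ratio x t J (S - {i} - J) *
      (\<Prod>i\<in>J. x i) * (\<Prod>j\<in>S - {i} - J. 1 - u * x j))"
  have "hl_subset_sum x t u S (t * y) - hl_subset_sum x t u S y =
      (\<Sum>I\<in>Pow S. (q_falling t (t * y) (card I) - q_falling t y (card I)) * g I)"
    by (simp add: hl_subset_sum_def g_def sum_subtractf algebra_simps)
  also have "\<dots> = (\<Sum>I\<in>Pow S. \<Sum>i\<in>I. y * u * (1 - t) * (x i * hl_ratio x t {i} (S - {i}) * k i (I - {i})))"
  proof (rule sum.cong[OF refl])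
    fix I assume I: "I \<in> Pow S"
    then have finI: "finite I" using fin finite_subset by auto
    show "(q_falling t (t * y) (card I) - q_falling t y (card I)) * g I =
        (\<Sum>i\<in>I. y * u * (1 - t) * (x i * hl_ratio x t {i} (S - {i}) * k i (I - {i})))"
    proof (cases "I = {}")
      case False
      then obtain r where r: "card I = Suc r" using finI by (metis card_0_eq not0_implies_Suc)
      have "(1 - t) * (\<Sum>i\<in>I. hl_ratio x t {i} (I - {i})) = 1 - t ^ Suc r"
        using sum_hl_ratio[OF finI, of x t] inj nz I r by (auto intro: inj_on_subset)
      then have "(q_falling t (t * y) (card I) - q_falling t y (card I)) * g I =
          y * ((1 - t) * (\<Sum>i\<in>I. hl_ratio x t {i} (I - {i}))) * q_falling t y r * g I"
        by (simp add: r q_falling_scale)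
      also have "\<dots> = (\<Sum>i\<in>I. y * (1 - t) * q_falling t y r * (hl_ratio x t {i} (I - {i}) * g I))"
        by (simp add: sum_distrib_left sum_distrib_right ac_simps)
      also have "\<dots> = (\<Sum>i\<in>I. y * u * (1 - t) * (x i * hl_ratio x t {i} (S - {i}) * k i (I - {i})))"
      proof (rule sum.cong[OF refl])
        fix i assume i: "i \<in> I"
        have eq: "S - {i} - (I - {i}) = S - I" "(I - {i}) \<union> (S - I) = S - {i}" using i I by auto
        have "hl_ratio x t {i} (S - {i}) = hl_ratio x t {i} (I - {i}) * hl_ratio x t {i} (S - I)"
          by (subst eq(2)[symmetric], rule hl_ratio_Un_right) (use fin finI in auto)
        then have "hl_ratio x t {i} (S - {i}) * hl_ratio x t (I - {i}) (S - I) =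
            hl_ratio x t {i} (I - {i}) * hl_ratio x t I (S - I)"
          using hl_ratio_remove[OF finI i, of x t "S - I"] by simp
        moreover have "(\<Prod>i\<in>I. x i) = x i * (\<Prod>i\<in>I - {i}. x i)" using finI i by (simp add: prod.remove)
        moreover have "card (I - {i}) = r" using r i finI by simp
        ultimately show "y * (1 - t) * q_falling t y r * (hl_ratio x t {i} (I - {i}) * g I) =
            y * u * (1 - t) * (x i * hl_ratio x t {i} (S - {i}) * k i (I - {i}))"
          unfolding g_def k_def eq(1) by (simp add: r)
      qed
      finally show ?thesis .
    qed (simp add: q_falling_def)
  qed
  also have "\<dots> = (\<Sum>(I, i)\<in>(SIGMA I:Pow S. I). y * u * (1 - t) * (x i * hl_ratio x t {i} (S - {i}) * k i (I - {i})))"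
    using fin by (intro sum.Sigma) (auto intro: finite_subset)
  also have "\<dots> = (\<Sum>(i, J)\<in>(SIGMA i:S. Pow (S - {i})). y * u * (1 - t) * (x i * hl_ratio x t {i} (S - {i}) * k i J))"
    by (rule sum.reindex_bij_witness[where i = "\<lambda>(i, J). (insert i J, i)" and j = "\<lambda>(I, i). (i, I - {i})"]) auto
  also have "\<dots> = (\<Sum>i\<in>S. \<Sum>J\<in>Pow (S - {i}). y * u * (1 - t) * (x i * hl_ratio x t {i} (S - {i}) * k i J))"
    using fin by (intro sum.Sigma[symmetric]) auto
  also have "\<dots> = y * u * (1 - t) * (\<Sum>i\<in>S. x i * hl_ratio x t {i} (S - {i}) * hl_subset_sum x t u (S - {i}) y)"
    by (simp add: hl_subset_sum_def k_def sum_distrib_left ac_simps)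
  finally show ?thesis .
qed

text \<open>Induction on \<open>card S\<close>: by \<open>hl_subset_sum_scale\<close> and
  \<open>hl_ratio_lagrange\<close> both sides change by the same amount under y -> t y. Their
  difference is a polynomial in y that is constant on the powers of t and zero at y = 1, and these
  powers form an infinite set.\<close>

lemma hl_subset_sum_eq:
  fixes x :: "'i \<Rightarrow> 'k::field"
  assumes "finite S" "inj_on x S" "\<And>i. i \<in> S \<Longrightarrow> x i \<noteq> 0" and t: "inj (\<lambda>k::nat. t ^ k)"
  shows "hl_subset_sum x t u S y = (\<Prod>j\<in>S. 1 - u * y * x j)"
  using assms(1-3)
proof (induction "card S" arbitrary: S y rule: less_induct)
  case less
  define d where "d = (\<lambda>y. hl_subset_sum x t u S y - (\<Prod>j\<in>S. 1 - u * y * x j))"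
  have "d (t * y) = d y" for y
  proof -
    have "hl_subset_sum x t u S (t * y) - hl_subset_sum x t u S y =
        u * y * (1 - t) * (\<Sum>i\<in>S. x i * hl_ratio x t {i} (S - {i}) * hl_subset_sum x t u (S - {i}) y)"
      using hl_subset_sum_scale[OF less.prems(1,2), of t u y] less.prems(3) by (simp add: ac_simps)
    also have "(\<Sum>i\<in>S. x i * hl_ratio x t {i} (S - {i}) * hl_subset_sum x t u (S - {i}) y) =
        (\<Sum>i\<in>S. x i * hl_ratio x t {i} (S - {i}) * (\<Prod>j\<in>S - {i}. 1 - u * y * x j))"
    proof (rule sum.cong[OF refl])
      fix i assume "i \<in> S"
      then have "hl_subset_sum x t u (S - {i}) y = (\<Prod>j\<in>S - {i}. 1 - u * y * x j)"
        using less.prems card_Diff1_less[OF less.prems(1)]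
        by (intro less.hyps) (auto intro: inj_on_subset)
      then show "x i * hl_ratio x t {i} (S - {i}) * hl_subset_sum x t u (S - {i}) y =
        x i * hl_ratio x t {i} (S - {i}) * (\<Prod>j\<in>S - {i}. 1 - u * y * x j)" by simp
    qed
    also have "u * y * (1 - t) * \<dots> = (\<Prod>j\<in>S. 1 - t * (u * y) * x j) - (\<Prod>j\<in>S. 1 - u * y * x j)"
      using hl_ratio_lagrange[OF less.prems(1,2), of "u * y" t] less.prems(3) by simp
    finally show ?thesis by (simp add: d_def algebra_simps)
  qed
  then have dpow: "d (t ^ k) = d 1" for k :: nat by (induction k) simp_all
  have "d 1 = 0"
  proof -
    \<comment> \<open>At y = 1 the factor with index 0 is t^0 - 1, so only the empty set
      contributes.\<close>
    have "q_falling t 1 (card I) = 0" if "I \<in> Pow S - {{}}" for I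
    proof -
      have "0 < card I" using that less.prems(1) by (auto simp: card_gt_0_iff intro: finite_subset)
      then show ?thesis unfolding q_falling_def by (intro prod_zero) (auto intro!: bexI[of _ 0])
    qed
    then have "hl_subset_sum x t u S 1 = (\<Sum>I\<in>{{}}. q_falling t 1 (card I) * u ^ card I *
     hl_ratio x t I (S - I) * (\<Prod>i\<in>I. x i) * (\<Prod>j\<in>S - I. 1 - u * x j))"
      unfolding hl_subset_sum_def using less.prems(1) by (intro sum.mono_neutral_right) auto
    then show ?thesis by (simp add: d_def q_falling_def hl_ratio_def)
  qed
  define p where "p = (\<Sum>I\<in>Pow S. smult (u ^ card I * hl_ratio x t I (S - I) * (\<Prod>i\<in>I. x i) *
      (\<Prod>j\<in>S - I. 1 - u * x j)) (\<Prod>j<card I. [:t ^ j, -1:])) - (\<Prod>j\<in>S. [:1, - (u * x j):])"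
  have p: "poly p y = d y" for y
    by (simp add: p_def d_def hl_subset_sum_def q_falling_def poly_sum poly_prod algebra_simps)
  have "p = 0"
    by (rule poly_eqI_infinite[of "range (\<lambda>k::nat. t ^ k)"])
      (use t p dpow \<open>d 1 = 0\<close> in \<open>auto simp: finite_image_iff\<close>)
  then have "d y = 0" using p[of y] by simp
  then show ?case by (simp add: d_def)
qed

text \<open>The identity holds for every value of u, and distinct powers of t make the field
  infinite, so u may become an indeterminate.\<close>

lemma hl_subset_sum_poly:
  fixes x :: "'i \<Rightarrow> 'k::field"
  assumes S: "finite S" "inj_on x S" "\<And>i. i \<in> S \<Longrightarrow> x i \<noteq> 0" and t: "inj (\<lambda>k::nat. t ^ k)"
  shows "(\<Sum>I\<in>Pow S. smult (q_falling t y (card I) * hl_ratio x t I (S - I) * (\<Prod>i\<in>I. x i))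
      (monom 1 (card I) * (\<Prod>j\<in>S - I. [:1, - x j:]))) = (\<Prod>j\<in>S. [:1, - (y * x j):])"
proof (rule poly_eqI_infinite)
  show "infinite (UNIV :: 'k set)"
    using t finite_subset[OF subset_UNIV] by (metis finite_imageD infinite_UNIV_nat)
  fix u :: 'k
  show "poly (\<Sum>I\<in>Pow S. smult (q_falling t y (card I) * hl_ratio x t I (S - I) * (\<Prod>i\<in>I. x i))
      (monom 1 (card I) * (\<Prod>j\<in>S - I. [:1, - x j:]))) u = poly (\<Prod>j\<in>S. [:1, - (y * x j):]) u"
    using hl_subset_sum_eq[OF S t, of u y]
    by (simp add: hl_subset_sum_def poly_sum poly_prod poly_monom ac_simps)
qed

section \<open>Generating series of elementary and complete functions\<close>

definition E_fps :: "('i \<Rightarrow> 'k::field) \<Rightarrow> 'i set \<Rightarrow> 'k \<Rightarrow> 'k fps" where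
  "E_fps x S y = (\<Prod>j\<in>S. 1 - fps_const (y * x j) * fps_X)"

text \<open>The coefficients of \<open>E_fps x S y\<close> are the elementary functions times (-
  y)^n and those of \<open>H_fps x S\<close> the complete functions, so the product of the two
  series generates the functions R_n(y).\<close>

definition H_fps :: "('i \<Rightarrow> 'k::field) \<Rightarrow> 'i set \<Rightarrow> 'k fps" where
  "H_fps x S = inverse (E_fps x S 1)"

lemma E_fps_nth_0: "fps_nth (E_fps x S y) 0 = 1"
  by (induction S rule: infinite_finite_induct) (simp_all add: E_fps_def)

lemma E_H_fps: "E_fps x S 1 * H_fps x S = 1"
  unfolding H_fps_def using E_fps_nth_0[of x S 1] by (intro inverse_mult_eq_1') auto

lemma E_fps_Diff_mult_H_fps:
  assumes "finite S" "I \<subseteq> S"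
  shows "E_fps x (S - I) 1 * H_fps x S = H_fps x I"
proof -
  have "E_fps x S 1 = E_fps x (S - I) 1 * E_fps x I 1"
    unfolding E_fps_def using assms by (metis prod.subset_diff)
  then have "E_fps x (S - I) 1 * H_fps x S * (E_fps x I 1 * H_fps x I) = H_fps x I * (E_fps x S 1 * H_fps x S)"
    by (simp add: ac_simps)
  then show ?thesis by (simp add: E_H_fps)
qed

lemma fps_of_poly_prod_linear:
  "fps_of_poly (\<Prod>j\<in>S. [:1, - (y * x j):]) = E_fps x S y"
  by (simp add: E_fps_def fps_of_poly_prod fps_of_poly_pCons fps_const_neg[symmetric] del: fps_const_neg)

lemma hl_subset_sum_fps:
  fixes x :: "'i \<Rightarrow> 'k::field"
  assumes S: "finite S" "inj_on x S" "\<And>i. i \<in> S \<Longrightarrow> x i \<noteq> 0" and t: "inj (\<lambda>k::nat. t ^ k)"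
  shows "(\<Sum>I\<in>Pow S. fps_const (q_falling t y (card I) * hl_ratio x t I (S - I) * (\<Prod>i\<in>I. x i)) *
      fps_X ^ card I * H_fps x I) = E_fps x S y * H_fps x S"
proof -
  have "(\<Sum>I\<in>Pow S. fps_const (q_falling t y (card I) * hl_ratio x t I (S - I) * (\<Prod>i\<in>I. x i)) *
      fps_X ^ card I * E_fps x (S - I) 1) = E_fps x S y"
    using arg_cong[OF hl_subset_sum_poly[OF assms, of y], of fps_of_poly]
    unfolding fps_of_poly_prod_linear
    by (simp add: fps_of_poly_sum fps_of_poly_smult fps_of_poly_mult fps_of_poly_monom'
        fps_of_poly_prod_linear[where y = 1, simplified] mult.assoc)
  from arg_cong[OF this, of "\<lambda>f. f * H_fps x S"] show ?thesis
    using S(1) by (simp add: sum_distrib_right mult.assoc E_fps_Diff_mult_H_fps)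
qed

text \<open>Multiplying the Lagrange identity by \<open>H_fps x S\<close> turns the product over
  \<open>S - {i}\<close> into the geometric series of \<open>x i\<close>, whose coefficients are the
  powers in the sum.\<close>

lemma hl_ratio_power_sum:
  fixes x :: "'i \<Rightarrow> 'k::field"
  assumes S: "finite S" "inj_on x S" "\<And>i. i \<in> S \<Longrightarrow> x i \<noteq> 0" and "0 < n"
  shows "(1 - t) * (\<Sum>i\<in>S. x i ^ n * hl_ratio x t {i} (S - {i})) = fps_nth (E_fps x S t * H_fps x S) n"
proof -
  obtain m where n: "n = Suc m" using \<open>0 < n\<close> gr0_implies_Suc by blast
  have "fps_X * (\<Sum>i\<in>S. fps_const ((1 - t) * (x i * hl_ratio x t {i} (S - {i}))) * E_fps x (S - {i}) 1) =
      E_fps x S t - E_fps x S 1"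
    using arg_cong[OF hl_ratio_lagrange_poly[OF S, of t], of fps_of_poly]
    unfolding fps_of_poly_prod_linear fps_of_poly_diff
    by (simp add: fps_of_poly_sum fps_of_poly_smult fps_of_poly_mult fps_of_poly_pCons
        fps_of_poly_prod_linear[where y = 1, simplified] sum_distrib_left ac_simps
        fps_const_mult[symmetric] del: fps_const_mult)
  from arg_cong[OF this, of "\<lambda>f. f * H_fps x S"]
  have "fps_X * (\<Sum>i\<in>S. fps_const ((1 - t) * (x i * hl_ratio x t {i} (S - {i}))) * H_fps x {i}) =
      E_fps x S t * H_fps x S - 1"
    using S(1) by (simp add: sum_distrib_right mult.assoc E_fps_Diff_mult_H_fps E_H_fps left_diff_distrib)
  moreover have "H_fps x {i} = Abs_fps (\<lambda>n. x i ^ n)" for i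
  proof -
    have "E_fps x {i} 1 * Abs_fps (\<lambda>n. x i ^ n) = 1"
      by (rule fps_ext) (simp add: E_fps_def left_diff_distrib mult.assoc power_eq_if)
    then have "(E_fps x {i} 1 * H_fps x {i}) * Abs_fps (\<lambda>n. x i ^ n) = H_fps x {i}"
      by (simp only: mult.commute[of "E_fps x {i} 1"] mult.assoc mult_1_right)
    then show ?thesis by (simp only: E_H_fps mult_1_left)
  qed
  ultimately have "fps_nth (fps_X * (\<Sum>i\<in>S. fps_const ((1 - t) * (x i * hl_ratio x t {i} (S - {i}))) *
      Abs_fps (\<lambda>n. x i ^ n))) (Suc m) = fps_nth (E_fps x S t * H_fps x S) (Suc m)"
    by simp
  then show ?thesis by (simp add: n fps_sum_nth sum_distrib_left ac_simps)
qed

section \<open>Hall-Littlewood sums over exponent vectors\<close>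

definition compositions :: "'i set \<Rightarrow> nat \<Rightarrow> ('i \<Rightarrow> nat) set" where
  "compositions S n = {\<alpha> \<in> S \<rightarrow>\<^sub>E UNIV. sum \<alpha> S = n}"

definition pos_parts :: "'i set \<Rightarrow> ('i \<Rightarrow> nat) \<Rightarrow> nat multiset" where
  "pos_parts S \<alpha> = filter_mset (\<lambda>m. 0 < m) (image_mset \<alpha> (mset_set S))"

definition hl_weight :: "('i \<Rightarrow> 'k::field) \<Rightarrow> 'k \<Rightarrow> ('i \<Rightarrow> nat) \<Rightarrow> 'i set \<Rightarrow> 'k" where
  "hl_weight x t \<alpha> S = (\<Prod>i\<in>S. x i ^ \<alpha> i * hl_ratio x t {i} {j \<in> S. \<alpha> j < \<alpha> i})"

text \<open>There is one exponent vector for each rearrangement of the padded parts, i.e. for each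
  coset of the stabilizer. Indexing by vectors on an arbitrary finite \<open>S\<close>, instead of
  by permutations of an initial segment, lets a variable be removed.\<close>

definition HL_sum :: "('i \<Rightarrow> 'k::field) \<Rightarrow> 'k \<Rightarrow> 'i set \<Rightarrow> nat multiset \<Rightarrow> 'k" where
  "HL_sum x t S M = (\<Sum>\<alpha> | \<alpha> \<in> S \<rightarrow>\<^sub>E UNIV \<and> pos_parts S \<alpha> = M. hl_weight x t \<alpha> S)"

lemma finite_compositions [simp]: "finite S \<Longrightarrow> finite (compositions S n)"
proof (rule finite_subset[of _ "S \<rightarrow>\<^sub>E {..n}"])
  assume "finite S"
  then show "compositions S n \<subseteq> S \<rightarrow>\<^sub>E {..n}"
    by (auto simp: compositions_def PiE_iff extensional_def intro: member_le_sum)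
qed (auto intro: finite_PiE)

lemma sum_mset_pos_parts: "finite S \<Longrightarrow> sum_mset (pos_parts S \<alpha>) = sum \<alpha> S"
proof -
  have "sum_mset (filter_mset (\<lambda>m. 0 < m) N) = sum_mset N" for N :: "nat multiset"
    by (induction N) auto
  then show ?thesis by (simp add: pos_parts_def sum_unfold_sum_mset)
qed

lemma pos_parts_pos: "0 \<notin># pos_parts S \<alpha>"
  by (simp add: pos_parts_def)

text \<open>These are the column lengths of the diagram, i.e. the parts of the conjugate
  partition.\<close>

lemma size_filter_pos_parts:
  "finite S \<Longrightarrow> 0 < r \<Longrightarrow> size (filter_mset (\<lambda>m. r \<le> m) (pos_parts S \<alpha>)) = card {i \<in> S. r \<le> \<alpha> i}"
proof -
  assume S: "finite S" and r: "0 < r"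
  have "filter_mset (\<lambda>m. r \<le> m) (pos_parts S \<alpha>) = image_mset \<alpha> (mset_set {i \<in> S. r \<le> \<alpha> i})"
    unfolding pos_parts_def filter_filter_mset using r S
    by (subst filter_mset_cong[of _ _ _ "\<lambda>m. r \<le> m"])
      (auto simp: filter_mset_image_mset filter_mset_mset_set)
  then show ?thesis by simp
qed

lemma size_pos_parts: "finite S \<Longrightarrow> size (pos_parts S \<alpha>) = card {i \<in> S. 0 < \<alpha> i}"
  by (simp add: pos_parts_def filter_mset_image_mset)

lemma count_pos_parts:
  "finite S \<Longrightarrow> 0 < m \<Longrightarrow> count (pos_parts S \<alpha>) m = card {i \<in> S. \<alpha> i = m}"
proof -
  assume "finite S" "0 < m"
  then have "count (pos_parts S \<alpha>) m = size (filter_mset (\<lambda>k. k = m) (image_mset \<alpha> (mset_set S)))"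
    by (simp add: pos_parts_def filter_eq_replicate_mset)
  also have "\<dots> = card {i \<in> S. \<alpha> i = m}" using \<open>finite S\<close> by (simp add: filter_mset_image_mset)
  finally show ?thesis .
qed


lemma finite_HL_index: "finite S \<Longrightarrow> finite {\<alpha>. \<alpha> \<in> S \<rightarrow>\<^sub>E UNIV \<and> pos_parts S \<alpha> = M}"
  by (rule finite_subset[OF _ finite_compositions[of S "sum_mset M"]])
     (auto simp: compositions_def sum_mset_pos_parts)

lemma pos_parts_cong: "(\<And>i. i \<in> S \<Longrightarrow> \<alpha> i = \<beta> i) \<Longrightarrow> pos_parts S \<alpha> = pos_parts S \<beta>"
  by (cases "finite S") (auto simp: pos_parts_def intro!: arg_cong[of _ _ "filter_mset _"] image_mset_cong)

lemma pos_parts_remove: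
  "finite S \<Longrightarrow> i \<in> S \<Longrightarrow> 0 < \<alpha> i \<Longrightarrow> pos_parts S \<alpha> = add_mset (\<alpha> i) (pos_parts (S - {i}) \<alpha>)"
  by (simp add: pos_parts_def mset_set.remove)

text \<open>No other exponent exceeds that of \<open>i\<close>, so deleting \<open>i\<close> leaves
  the factors of the remaining variables unchanged. The left side pairs \<open>i\<close> with all of
  \<open>S - {i}\<close>, the weight of \<open>\<alpha>\<close> only with the strictly smaller
  exponents; the surplus is the ratio against the other maximal positions.\<close>

lemma hl_weight_remove_max:
  assumes S: "finite S" and i: "i \<in> S" and le: "\<And>j. j \<in> S \<Longrightarrow> \<alpha> j \<le> \<alpha> i"
    and \<beta>: "\<And>j. j \<in> S - {i} \<Longrightarrow> \<beta> j = \<alpha> j"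
  shows "x i ^ \<alpha> i * hl_ratio x t {i} (S - {i}) * hl_weight x t \<beta> (S - {i}) =
    hl_weight x t \<alpha> S * hl_ratio x t {i} ({j \<in> S. \<alpha> j = \<alpha> i} - {i})"
proof -
  have eq: "S - {i} = {j \<in> S. \<alpha> j < \<alpha> i} \<union> ({j \<in> S. \<alpha> j = \<alpha> i} - {i})"
    using le by (auto simp: order_le_less)
  have R: "hl_ratio x t {i} (S - {i}) =
      hl_ratio x t {i} {j \<in> S. \<alpha> j < \<alpha> i} * hl_ratio x t {i} ({j \<in> S. \<alpha> j = \<alpha> i} - {i})"
    by (subst eq, rule hl_ratio_Un_right) (use S in auto)
  have "hl_weight x t \<beta> (S - {i}) = (\<Prod>k\<in>S - {i}. x k ^ \<alpha> k * hl_ratio x t {k} {j \<in> S. \<alpha> j < \<alpha> k})"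
    unfolding hl_weight_def
  proof (rule prod.cong[OF refl])
    fix k assume k: "k \<in> S - {i}"
    have "{j \<in> S - {i}. \<beta> j < \<beta> k} = {j \<in> S. \<alpha> j < \<alpha> k}"
    proof -
      have "(j \<noteq> i \<and> \<beta> j < \<beta> k) = (\<alpha> j < \<alpha> k)" if "j \<in> S" for j
        using k le[of k] that by (cases "j = i") (auto simp: \<beta>)
      then show ?thesis by blast
    qed
    then show "x k ^ \<beta> k * hl_ratio x t {k} {j \<in> S - {i}. \<beta> j < \<beta> k} =
        x k ^ \<alpha> k * hl_ratio x t {k} {j \<in> S. \<alpha> j < \<alpha> k}" using k by (simp add: \<beta>)
  qed
  then have "hl_weight x t \<alpha> S = x i ^ \<alpha> i * hl_ratio x t {i} {j \<in> S. \<alpha> j < \<alpha> i} * hl_weight x t \<beta> (S - {i})"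
    by (simp add: hl_weight_def prod.remove[OF S i])
  then show ?thesis by (simp add: R ac_simps)
qed

text \<open>The variables carrying the largest part are split off one at a time; the factor
  $(1 - t^{\mathrm{mult}})/(1-t)$ counts them.\<close>

lemma HL_sum_remove_max:
  fixes x :: "'i \<Rightarrow> 'k::field"
  assumes S: "finite S" "inj_on x S" "\<And>i. i \<in> S \<Longrightarrow> x i \<noteq> 0"
    and m: "m \<in># M" "\<And>k. k \<in># M \<Longrightarrow> k \<le> m" "0 < m"
  shows "(1 - t) * (\<Sum>i\<in>S. x i ^ m * hl_ratio x t {i} (S - {i}) * HL_sum x t (S - {i}) (M - {#m#})) =
    (1 - t ^ count M m) * HL_sum x t S M"
proof -
  define D where "D = (\<lambda>S M. {\<alpha> :: 'i \<Rightarrow> nat. \<alpha> \<in> S \<rightarrow>\<^sub>E UNIV \<and> pos_parts S \<alpha> = M})"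
  have le: "\<alpha> j \<le> m" if "\<alpha> \<in> D S M" "j \<in> S" for \<alpha> j
  proof (cases "\<alpha> j = 0")
    case False
    then have "\<alpha> j \<in># pos_parts S \<alpha>" using that S by (simp add: pos_parts_def)
    then show ?thesis using m that by (auto simp: D_def)
  qed simp
  have finD: "finite (D S M)" if "finite S" for S M unfolding D_def by (rule finite_HL_index[OF that])
  have "(\<Sum>i\<in>S. x i ^ m * hl_ratio x t {i} (S - {i}) * HL_sum x t (S - {i}) (M - {#m#})) =
      (\<Sum>i\<in>S. \<Sum>\<alpha> | \<alpha> \<in> D S M \<and> \<alpha> i = m. hl_weight x t \<alpha> S * hl_ratio x t {i} ({j \<in> S. \<alpha> j = m} - {i}))"
  proof (rule sum.cong[OF refl])
    fix i assume i: "i \<in> S"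
    have "x i ^ m * hl_ratio x t {i} (S - {i}) * HL_sum x t (S - {i}) (M - {#m#}) =
        (\<Sum>\<beta>\<in>D (S - {i}) (M - {#m#}). x i ^ m * hl_ratio x t {i} (S - {i}) * hl_weight x t \<beta> (S - {i}))"
      by (simp add: HL_sum_def sum_distrib_left D_def)
    also have "\<dots> = (\<Sum>\<alpha> | \<alpha> \<in> D S M \<and> \<alpha> i = m. hl_weight x t \<alpha> S * hl_ratio x t {i} ({j \<in> S. \<alpha> j = m} - {i}))"
    proof (rule sum.reindex_bij_witness[where i = "\<lambda>\<alpha>. restrict \<alpha> (S - {i})" and j = "\<lambda>\<beta>. \<beta>(i := m)"])
      fix \<beta> assume \<beta>: "\<beta> \<in> D (S - {i}) (M - {#m#})"
      show "restrict (\<beta>(i := m)) (S - {i}) = \<beta>"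
        using \<beta> by (auto simp: D_def PiE_iff extensional_def fun_eq_iff)
      have "pos_parts S (\<beta>(i := m)) = add_mset m (pos_parts (S - {i}) \<beta>)"
        using pos_parts_remove[OF S(1) i, of "\<beta>(i := m)"] m(3)
          pos_parts_cong[of "S - {i}" "\<beta>(i := m)" \<beta>] by simp
      then have D: "\<beta>(i := m) \<in> D S M"
        using \<beta> m(1) i by (auto simp: D_def PiE_iff extensional_def)
      then show "\<beta>(i := m) \<in> {\<alpha>. \<alpha> \<in> D S M \<and> \<alpha> i = m}" by simp
      show "hl_weight x t (\<beta>(i := m)) S * hl_ratio x t {i} ({j \<in> S. (\<beta>(i := m)) j = m} - {i}) =
          x i ^ m * hl_ratio x t {i} (S - {i}) * hl_weight x t \<beta> (S - {i})"
        using hl_weight_remove_max[OF S(1) i, of "\<beta>(i := m)" \<beta> x t] le[OF D] by (auto simp: fun_upd_def)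
    next
      fix \<alpha> assume \<alpha>: "\<alpha> \<in> {\<alpha>. \<alpha> \<in> D S M \<and> \<alpha> i = m}"
      show "(restrict \<alpha> (S - {i}))(i := m) = \<alpha>"
        using \<alpha> by (auto simp: D_def PiE_iff extensional_def fun_eq_iff)
      have "pos_parts S \<alpha> = add_mset m (pos_parts (S - {i}) (restrict \<alpha> (S - {i})))"
        using pos_parts_remove[OF S(1) i, of \<alpha>] m(3) \<alpha>
          pos_parts_cong[of "S - {i}" "restrict \<alpha> (S - {i})" \<alpha>] by simp
      then show "restrict \<alpha> (S - {i}) \<in> D (S - {i}) (M - {#m#})"
        using \<alpha> by (simp add: D_def) (metis add_mset_remove_trivial)
    qed
    finally show "x i ^ m * hl_ratio x t {i} (S - {i}) * HL_sum x t (S - {i}) (M - {#m#}) =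
      (\<Sum>\<alpha> | \<alpha> \<in> D S M \<and> \<alpha> i = m. hl_weight x t \<alpha> S * hl_ratio x t {i} ({j \<in> S. \<alpha> j = m} - {i}))" .
  qed
  also have "\<dots> = (\<Sum>\<alpha>\<in>D S M. \<Sum>i | i \<in> S \<and> \<alpha> i = m. hl_weight x t \<alpha> S * hl_ratio x t {i} ({j \<in> S. \<alpha> j = m} - {i}))"
    by (rule sum.swap_restrict) (use S finD in auto)
  finally have "(1 - t) * (\<Sum>i\<in>S. x i ^ m * hl_ratio x t {i} (S - {i}) * HL_sum x t (S - {i}) (M - {#m#})) =
      (\<Sum>\<alpha>\<in>D S M. hl_weight x t \<alpha> S *
        ((1 - t) * (\<Sum>i | i \<in> S \<and> \<alpha> i = m. hl_ratio x t {i} ({j \<in> S. \<alpha> j = m} - {i}))))"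
    by (simp add: sum_distrib_left ac_simps)
  \<comment> \<open>For a fixed exponent vector the inner sum runs over the positions of the largest
    part, and there \<open>sum_hl_ratio\<close> applies.\<close>
  also have "\<dots> = (\<Sum>\<alpha>\<in>D S M. hl_weight x t \<alpha> S * (1 - t ^ count M m))"
  proof (rule sum.cong[OF refl])
    fix \<alpha> assume \<alpha>: "\<alpha> \<in> D S M"
    have "card {i \<in> S. \<alpha> i = m} = count M m"
      using \<alpha> count_pos_parts[OF S(1) m(3), of \<alpha>] by (simp add: D_def)
    moreover have "inj_on x {i \<in> S. \<alpha> i = m}" using S(2) by (rule inj_on_subset) auto
    ultimately show "hl_weight x t \<alpha> S *
        ((1 - t) * (\<Sum>i | i \<in> S \<and> \<alpha> i = m. hl_ratio x t {i} ({j \<in> S. \<alpha> j = m} - {i}))) =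
        hl_weight x t \<alpha> S * (1 - t ^ count M m)"
      using sum_hl_ratio[of "{i \<in> S. \<alpha> i = m}" x t] S by simp
  qed
  also have "\<dots> = (1 - t ^ count M m) * HL_sum x t S M"
    unfolding HL_sum_def D_def sum_distrib_right[symmetric] by (rule mult.commute)
  finally show ?thesis .
qed

lemma HL_sum_empty:
  assumes "finite S"
  shows "HL_sum x t S {#} = 1"
proof -
  have "{\<alpha>. \<alpha> \<in> S \<rightarrow>\<^sub>E UNIV \<and> pos_parts S \<alpha> = {#}} = {\<lambda>i\<in>S. 0}" (is "?A = ?B")
  proof
    show "?A \<subseteq> ?B"
    proof
      fix \<alpha> assume \<alpha>: "\<alpha> \<in> ?A"
      then have "sum \<alpha> S = 0" using sum_mset_pos_parts[OF assms, of \<alpha>] by simp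
      then have "\<alpha> i = 0" if "i \<in> S" for i using assms that by simp
      then show "\<alpha> \<in> ?B" using \<alpha> by (auto simp: PiE_iff extensional_def fun_eq_iff)
    qed
    show "?B \<subseteq> ?A" using assms by (auto simp: pos_parts_def)
  qed
  then show ?thesis by (simp add: HL_sum_def hl_weight_def hl_ratio_def)
qed

lemma HL_sum_one_row:
  fixes x :: "'i \<Rightarrow> 'k::field"
  assumes S: "finite S" "inj_on x S" "\<And>i. i \<in> S \<Longrightarrow> x i \<noteq> 0" and "0 < n" "t \<noteq> 1"
  shows "(1 - t) * HL_sum x t S {#n#} = fps_nth (E_fps x S t * H_fps x S) n"
  using HL_sum_remove_max[OF S, of n "{#n#}" t] hl_ratio_power_sum[OF S assms(4), of t] assms
  by (simp add: HL_sum_empty)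

section \<open>All partitions of n at once: peeling off columns\<close>

definition hl_comp_sum :: "('i \<Rightarrow> 'k::field) \<Rightarrow> 'k \<Rightarrow> 'k \<Rightarrow> 'i set \<Rightarrow> nat \<Rightarrow> 'k" where
  "hl_comp_sum x t y S n = (\<Sum>\<alpha>\<in>compositions S n. q_falling t y (card {i \<in> S. 0 < \<alpha> i}) *
     t ^ (\<Sum>r\<in>{2..n}. card {i \<in> S. r \<le> \<alpha> i} choose 2) * hl_weight x t \<alpha> S)"

text \<open>The exponent of t in \<open>hl_comp_sum\<close> omits the first column r = 1, which is
  carried by \<open>q_falling\<close>. At y = 0 it reappears as this binomial coefficient, and the
  total exponent becomes the statistic n of the partition.\<close>

lemma q_falling_0: "q_falling t 0 r = t ^ (r choose 2)"
proof (induction r)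
  case (Suc r)
  have "Suc r choose 2 = (r choose 2) + r" by (simp add: numeral_2_eq_2)
  then show ?case using Suc by (simp add: q_falling_def power_add)
qed (simp add: q_falling_def numeral_2_eq_2)

text \<open>A variable of \<open>I\<close> has a larger exponent than every variable outside
  \<open>I\<close>, and subtracting 1 changes no comparison inside \<open>I\<close>.\<close>

lemma hl_weight_support:
  assumes S: "finite S" and I: "I \<subseteq> S" and \<alpha>: "\<And>i. i \<in> I \<Longrightarrow> \<alpha> i = Suc (\<beta> i)" "\<And>i. i \<in> S - I \<Longrightarrow> \<alpha> i = 0"
  shows "hl_weight x t \<alpha> S = hl_ratio x t I (S - I) * (\<Prod>i\<in>I. x i) * hl_weight x t \<beta> I"
proof -
  have finI: "finite I" using S I finite_subset by auto
  have "hl_weight x t \<alpha> S = (\<Prod>i\<in>I. x i ^ \<alpha> i * hl_ratio x t {i} {j \<in> S. \<alpha> j < \<alpha> i})"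
    unfolding hl_weight_def
    by (rule prod.mono_neutral_right) (use S I \<alpha>(2) in \<open>auto simp: hl_ratio_def\<close>)
  also have "\<dots> = (\<Prod>i\<in>I. hl_ratio x t {i} (S - I) * x i * (x i ^ \<beta> i * hl_ratio x t {i} {j \<in> I. \<beta> j < \<beta> i}))"
  proof (rule prod.cong[OF refl])
    fix i assume i: "i \<in> I"
    have "{j \<in> S. \<alpha> j < \<alpha> i} = (S - I) \<union> {j \<in> I. \<beta> j < \<beta> i}"
    proof -
      have "(\<alpha> j < \<alpha> i) = (j \<in> I \<longrightarrow> \<beta> j < \<beta> i)" if "j \<in> S" for j
        using i that \<alpha> by (cases "j \<in> I") auto
      then show ?thesis using I by blast
    qed
    moreover have "hl_ratio x t {i} ((S - I) \<union> {j \<in> I. \<beta> j < \<beta> i}) =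
        hl_ratio x t {i} (S - I) * hl_ratio x t {i} {j \<in> I. \<beta> j < \<beta> i}"
      by (rule hl_ratio_Un_right) (use S finI in auto)
    ultimately show "x i ^ \<alpha> i * hl_ratio x t {i} {j \<in> S. \<alpha> j < \<alpha> i} =
        hl_ratio x t {i} (S - I) * x i * (x i ^ \<beta> i * hl_ratio x t {i} {j \<in> I. \<beta> j < \<beta> i})"
      by (simp add: \<alpha>(1)[OF i])
  qed
  finally show ?thesis by (simp add: prod.distrib hl_weight_def hl_ratio_def)
qed

text \<open>Removal of the first column: the support \<open>I\<close> is fixed and every positive
  exponent is lowered by one. Column r of the rest was column r + 1 before, so the old second column
  becomes the first, which is why the inner sum has y = 0.\<close>

lemma hl_comp_sum_support:
  fixes x :: "'i \<Rightarrow> 'k::field"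
  assumes S: "finite S"
  shows "hl_comp_sum x t y S n = (\<Sum>I\<in>Pow S. if card I \<le> n then
    q_falling t y (card I) * hl_ratio x t I (S - I) * (\<Prod>i\<in>I. x i) * hl_comp_sum x t 0 I (n - card I) else 0)"
proof -
  define w where "w = (\<lambda>y S n \<alpha>. q_falling t y (card {i \<in> S. 0 < \<alpha> i}) *
     t ^ (\<Sum>r\<in>{2..n}. card {i \<in> S. r \<le> \<alpha> i} choose 2) * hl_weight x t \<alpha> S)"
  define up where "up = (\<lambda>I (\<beta> :: 'i \<Rightarrow> nat). \<lambda>i\<in>S. if i \<in> I then Suc (\<beta> i) else 0)"
  have w: "w y S n (up I \<beta>) = q_falling t y (card I) * hl_ratio x t I (S - I) * (\<Prod>i\<in>I. x i) * w 0 I (n - card I) \<beta>"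
    if I: "I \<subseteq> S" and n: "card I \<le> n" and \<beta>: "\<beta> \<in> compositions I (n - card I)" for I \<beta>
  proof -
    have finI: "finite I" using S I finite_subset by auto
    have bound: "\<beta> i \<le> n - card I" if "i \<in> I" for i
      using \<beta> member_le_sum[of i I \<beta>] finI that by (auto simp: compositions_def)
    have supp: "{i \<in> S. 0 < up I \<beta> i} = I" using I by (auto simp: up_def)
    have wt: "hl_weight x t (up I \<beta>) S = hl_ratio x t I (S - I) * (\<Prod>i\<in>I. x i) * hl_weight x t \<beta> I"
      by (rule hl_weight_support[OF S I]) (use I in \<open>auto simp: up_def\<close>)
    have "(\<Sum>r\<in>{2..n}. card {i \<in> S. r \<le> up I \<beta> i} choose 2) =
        (card {i \<in> I. 0 < \<beta> i} choose 2) + (\<Sum>r\<in>{2..n - card I}. card {i \<in> I. r \<le> \<beta> i} choose 2)"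
    proof (cases "I = {}")
      case False
      then have cI: "0 < card I" using finI by (simp add: card_gt_0_iff)
      have "(\<Sum>r\<in>{2..n}. card {i \<in> S. r \<le> up I \<beta> i} choose 2) =
          (\<Sum>r\<in>{1..n - 1}. card {i \<in> S. Suc r \<le> up I \<beta> i} choose 2)"
        using cI n by (intro sum.reindex_bij_witness[of _ Suc "\<lambda>r. r - 1"]) auto
      also have "\<dots> = (\<Sum>r\<in>{1..n - 1}. card {i \<in> I. r \<le> \<beta> i} choose 2)"
      proof (rule sum.cong[OF refl])
        fix r assume "r \<in> {1..n - 1}"
        then have "{i \<in> S. Suc r \<le> up I \<beta> i} = {i \<in> I. r \<le> \<beta> i}" using I by (auto simp: up_def)
        then show "card {i \<in> S. Suc r \<le> up I \<beta> i} choose 2 = card {i \<in> I. r \<le> \<beta> i} choose 2" by simp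
      qed
      \<comment> \<open>The dropped columns are empty, since no exponent of \<open>\<beta>\<close>
        exceeds \<open>n - card I\<close>. The column r = 1 is split off next and becomes the
        \<open>q_falling\<close> factor at y = 0.\<close>
      also have "\<dots> = (\<Sum>r\<in>{1..n - card I}. card {i \<in> I. r \<le> \<beta> i} choose 2)"
      proof (rule sum.mono_neutral_right)
        show "\<forall>r\<in>{1..n - 1} - {1..n - card I}. card {i \<in> I. r \<le> \<beta> i} choose 2 = 0"
        proof
          fix r assume "r \<in> {1..n - 1} - {1..n - card I}"
          then have "{i \<in> I. r \<le> \<beta> i} = {}" using bound by fastforce
          then show "card {i \<in> I. r \<le> \<beta> i} choose 2 = 0" by (simp only: card.empty) simp
        qed
      qed (use cI in auto)
      also have "\<dots> = (card {i \<in> I. 0 < \<beta> i} choose 2) + (\<Sum>r\<in>{2..n - card I}. card {i \<in> I. r \<le> \<beta> i} choose 2)"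
      proof (cases "n - card I = 0")
        case True
        then have "{i \<in> I. 0 < \<beta> i} = {}" using bound by fastforce
        then show ?thesis using True by (simp only: card.empty) simp
      next
        case False
        then have "{1..n - card I} = insert 1 {2..n - card I}" by auto
        then show ?thesis by (simp add: Suc_le_eq)
      qed
      finally show ?thesis .
    qed (simp add: up_def)
    then show ?thesis by (simp add: w_def supp wt q_falling_0 power_add)
  qed
  have "hl_comp_sum x t y S n = sum (w y S n) (compositions S n)"
    by (simp add: hl_comp_sum_def w_def)
  also have "\<dots> = (\<Sum>(I, \<beta>)\<in>(SIGMA I:{I \<in> Pow S. card I \<le> n}. compositions I (n - card I)).
      q_falling t y (card I) * hl_ratio x t I (S - I) * (\<Prod>i\<in>I. x i) * w 0 I (n - card I) \<beta>)"
  \<comment> \<open>A vector corresponds to its support together with its restriction to the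
    support, lowered by one.\<close>
  proof (rule sym, rule sum.reindex_bij_witness[where j = "\<lambda>(I, \<beta>). up I \<beta>" and
        i = "\<lambda>\<alpha>. ({i \<in> S. 0 < \<alpha> i}, \<lambda>i\<in>{i \<in> S. 0 < \<alpha> i}. \<alpha> i - 1)"])
    fix p assume p: "p \<in> (SIGMA I:{I \<in> Pow S. card I \<le> n}. compositions I (n - card I))"
    obtain I \<beta> where eq: "p = (I, \<beta>)" by (cases p)
    with p have I: "I \<subseteq> S" "card I \<le> n" and \<beta>: "\<beta> \<in> compositions I (n - card I)" by auto
    have supp: "{i \<in> S. 0 < up I \<beta> i} = I" using I by (auto simp: up_def)
    have "(\<lambda>i\<in>I. up I \<beta> i - 1) = \<beta>"
      using I \<beta> by (auto simp: up_def compositions_def PiE_iff extensional_def fun_eq_iff)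
    then show "({i \<in> S. 0 < (case p of (I, \<beta>) \<Rightarrow> up I \<beta>) i},
        \<lambda>i\<in>{i \<in> S. 0 < (case p of (I, \<beta>) \<Rightarrow> up I \<beta>) i}. (case p of (I, \<beta>) \<Rightarrow> up I \<beta>) i - 1) = p"
      by (simp add: eq supp)
    have "sum (up I \<beta>) S = (\<Sum>i\<in>S. if i \<in> I then Suc (\<beta> i) else 0)"
      by (simp add: up_def)
    also have "\<dots> = (\<Sum>i\<in>I. Suc (\<beta> i))"
      using S I by (simp add: sum.inter_restrict[symmetric] Int_absorb1)
    also have "\<dots> = n" using \<beta> I by (simp add: compositions_def sum_Suc)
    finally show "(case p of (I, \<beta>) \<Rightarrow> up I \<beta>) \<in> compositions S n"
      by (simp add: eq compositions_def up_def)
    show "w y S n (case p of (I, \<beta>) \<Rightarrow> up I \<beta>) = (case p of (I, \<beta>) \<Rightarrow>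
        q_falling t y (card I) * hl_ratio x t I (S - I) * (\<Prod>i\<in>I. x i) * w 0 I (n - card I) \<beta>)"
      using w[OF I \<beta>] by (simp add: eq)
  next
    fix \<alpha> assume \<alpha>: "\<alpha> \<in> compositions S n"
    define I where "I = {i \<in> S. 0 < \<alpha> i}"
    have "n = (\<Sum>i\<in>I. \<alpha> i)"
      using \<alpha> S unfolding compositions_def I_def by (auto intro!: sum.mono_neutral_right)
    also have "\<dots> = (\<Sum>i\<in>I. Suc (\<alpha> i - 1))" by (rule sum.cong) (auto simp: I_def)
    finally have n: "n = card I + (\<Sum>i\<in>I. \<alpha> i - 1)" by (simp add: sum_Suc)
    then show "({i \<in> S. 0 < \<alpha> i}, \<lambda>i\<in>{i \<in> S. 0 < \<alpha> i}. \<alpha> i - 1) \<in>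
        (SIGMA I:{I \<in> Pow S. card I \<le> n}. compositions I (n - card I))"
      unfolding I_def[symmetric] by (auto simp: compositions_def I_def)
    show "(case ({i \<in> S. 0 < \<alpha> i}, \<lambda>i\<in>{i \<in> S. 0 < \<alpha> i}. \<alpha> i - 1) of (I, \<beta>) \<Rightarrow> up I \<beta>) = \<alpha>"
      using \<alpha> by (auto simp: up_def compositions_def PiE_iff extensional_def fun_eq_iff)
  qed
  also have "\<dots> = (\<Sum>I | I \<in> Pow S \<and> card I \<le> n. \<Sum>\<beta>\<in>compositions I (n - card I).
      q_falling t y (card I) * hl_ratio x t I (S - I) * (\<Prod>i\<in>I. x i) * w 0 I (n - card I) \<beta>)"
    using S by (intro sum.Sigma[symmetric]) (auto intro!: finite_compositions finite_subset[OF _ S])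
  also have "\<dots> = (\<Sum>I | I \<in> Pow S \<and> card I \<le> n.
      q_falling t y (card I) * hl_ratio x t I (S - I) * (\<Prod>i\<in>I. x i) * hl_comp_sum x t 0 I (n - card I))"
    by (simp add: hl_comp_sum_def w_def sum_distrib_left)
  also have "\<dots> = (\<Sum>I\<in>Pow S. if card I \<le> n then
    q_falling t y (card I) * hl_ratio x t I (S - I) * (\<Prod>i\<in>I. x i) * hl_comp_sum x t 0 I (n - card I) else 0)"
    by (rule sum.inter_filter) (use S in simp)
  finally show ?thesis .
qed

text \<open>The case y = 0 is the expansion of the complete function h_n with coefficients
  t^(n(nu)). It is proved first, by induction on n, and then evaluates the inner sums of the column
  recursion for every y.\<close>

theorem hl_comp_sum_eq:
  fixes x :: "'i \<Rightarrow> 'k::field"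
  assumes S: "finite S" "inj_on x S" "\<And>i. i \<in> S \<Longrightarrow> x i \<noteq> 0" and t: "inj (\<lambda>k::nat. t ^ k)"
  shows "hl_comp_sum x t y S n = fps_nth (E_fps x S y * H_fps x S) n"
proof -
  have rhs: "fps_nth (E_fps x S y * H_fps x S) n = (\<Sum>I\<in>Pow S. if card I \<le> n then
      q_falling t y (card I) * hl_ratio x t I (S - I) * (\<Prod>i\<in>I. x i) * fps_nth (H_fps x I) (n - card I) else 0)"
    if "finite S" "inj_on x S" "\<And>i. i \<in> S \<Longrightarrow> x i \<noteq> 0" for S y n
    by (subst hl_subset_sum_fps[OF that t, symmetric], assumption, subst fps_sum_nth, rule sum.cong)
      (simp_all add: mult.assoc fps_X_power_mult_nth)
  have H: "hl_comp_sum x t 0 S n = fps_nth (H_fps x S) n"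
    if "finite S" "inj_on x S" "\<And>i. i \<in> S \<Longrightarrow> x i \<noteq> 0" for S n
    using that
  proof (induction n arbitrary: S rule: less_induct)
    case (less n)
    have "hl_comp_sum x t 0 I (n - card I) = fps_nth (H_fps x I) (n - card I)"
      if "I \<in> Pow S" "card I \<le> n" for I
    \<comment> \<open>For the empty support n does not decrease, so this term is computed
      directly.\<close>
    proof (cases "I = {}")
      case True
      have "compositions ({} :: 'i set) n = (if n = 0 then {\<lambda>x. undefined} else {})" for n
        by (auto simp: compositions_def)
      then show ?thesis using True
        by (simp add: hl_comp_sum_def H_fps_def E_fps_def hl_weight_def q_falling_def)
    next
      case False
      have "finite I" using that less.prems(1) by (auto intro: finite_subset)
      then have "0 < card I" using False by (simp add: card_gt_0_iff)
      then show ?thesis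
        using less that \<open>finite I\<close> by (intro less.IH) (auto intro: inj_on_subset)
    qed
    note H0 = this
    have "hl_comp_sum x t 0 S n = fps_nth (E_fps x S 0 * H_fps x S) n"
      by (subst rhs[OF less.prems], assumption, subst hl_comp_sum_support[OF less.prems(1)])
        (auto intro!: sum.cong simp: H0)
    then show ?case by (simp add: E_fps_def)
  qed
  have "hl_comp_sum x t 0 I k = fps_nth (H_fps x I) k" if "I \<subseteq> S" for I k
    using that S(1) inj_on_subset[OF S(2) that] S(3) by (intro H) (auto intro: finite_subset)
  then show ?thesis
    by (simp add: rhs[OF S] hl_comp_sum_support[OF S(1)] cong: sum.cong_simp if_cong)
qed

lemma finite_partitions: "finite {M :: nat multiset. 0 \<notin># M \<and> sum_mset M = n}"
proof (rule finite_subset)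
  show "{M :: nat multiset. 0 \<notin># M \<and> sum_mset M = n} \<subseteq> {M. M \<subseteq># (\<Sum>k\<in>{1..n}. replicate_mset n k)}"
  proof
    fix M :: "nat multiset" assume M: "M \<in> {M. 0 \<notin># M \<and> sum_mset M = n}"
    have size: "size M \<le> sum_mset M" if "0 \<notin># M" for M :: "nat multiset"
      using that by (induction M) auto
    have "count M k \<le> (\<Sum>j\<in>{1..n}. count (replicate_mset n j) k)" for k
    proof (cases "k \<in># M")
      case True
      then have "k \<in> {1..n}" using M by (auto simp: sum_mset.remove Suc_le_eq intro: Nat.gr0I)
      then have "(\<Sum>j\<in>{1..n}. count (replicate_mset n j) k) = n"
        by (simp add: sum.delta)
      moreover have "count M k \<le> n" using count_le_size[of M k] size[of M] M by simp
      ultimately show ?thesis by simp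
    qed (simp add: not_in_iff)
    then show "M \<in> {M. M \<subseteq># (\<Sum>k\<in>{1..n}. replicate_mset n k)}"
      by (simp add: subseteq_mset_def count_sum)
  qed
qed (rule finite_submultisets)

text \<open>Exponent vectors are grouped by their multiset of positive parts: the length and the
  columns are read off the multiset, and the \<open>hl_weight\<close> factors of one group add up to
  \<open>HL_sum\<close>.\<close>

lemma sum_HL_sum:
  fixes x :: "'i \<Rightarrow> 'k::field"
  assumes S: "finite S" "inj_on x S" "\<And>i. i \<in> S \<Longrightarrow> x i \<noteq> 0" and t: "inj (\<lambda>k::nat. t ^ k)"
  shows "(\<Sum>M | 0 \<notin># M \<and> sum_mset M = n. q_falling t y (size M) *
      t ^ (\<Sum>r\<in>{2..n}. size (filter_mset (\<lambda>m. r \<le> m) M) choose 2) * HL_sum x t S M) =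
    fps_nth (E_fps x S y * H_fps x S) n"
proof -
  define g where "g = (\<lambda>M. q_falling t y (size M) * t ^ (\<Sum>r\<in>{2..n}. size (filter_mset (\<lambda>m. r \<le> m) M) choose 2))"
  have "fps_nth (E_fps x S y * H_fps x S) n = (\<Sum>\<alpha>\<in>compositions S n. g (pos_parts S \<alpha>) * hl_weight x t \<alpha> S)"
    by (subst hl_comp_sum_eq[OF assms, symmetric], assumption, subst hl_comp_sum_def)
      (auto simp: g_def size_pos_parts[OF S(1)] size_filter_pos_parts[OF S(1)] intro!: sum.cong)
  also have "\<dots> = (\<Sum>M | 0 \<notin># M \<and> sum_mset M = n.
      \<Sum>\<alpha> | \<alpha> \<in> compositions S n \<and> pos_parts S \<alpha> = M. g (pos_parts S \<alpha>) * hl_weight x t \<alpha> S)"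
    by (rule sum.group[symmetric], simp add: S(1), rule finite_partitions)
      (use S(1) in \<open>auto simp: pos_parts_pos compositions_def sum_mset_pos_parts\<close>)
  also have "\<dots> = (\<Sum>M | 0 \<notin># M \<and> sum_mset M = n. g M * HL_sum x t S M)"
  proof (rule sum.cong[OF refl])
    fix M :: "nat multiset" assume M: "M \<in> {M. 0 \<notin># M \<and> sum_mset M = n}"
    have "{\<alpha>. \<alpha> \<in> compositions S n \<and> pos_parts S \<alpha> = M} = {\<alpha>. \<alpha> \<in> S \<rightarrow>\<^sub>E UNIV \<and> pos_parts S \<alpha> = M}"
      using M S(1) by (auto simp: compositions_def sum_mset_pos_parts)
    then show "(\<Sum>\<alpha> | \<alpha> \<in> compositions S n \<and> pos_parts S \<alpha> = M. g (pos_parts S \<alpha>) * hl_weight x t \<alpha> S) =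
        g M * HL_sum x t S M"
      by (simp add: HL_sum_def sum_distrib_left)
  qed
  finally show ?thesis by (simp add: g_def)
qed

section \<open>Symmetric functions as series\<close>

lemma coeff_of_mult: "coeff_of (f * g) m = (\<Sum>(a, b)\<in>{(a, b). a + b = m}. coeff_of f a * coeff_of g b)"
  by (simp add: times_mseries.rep_eq)

lemmas coeff_of_simps = zero_mseries.rep_eq one_mseries.rep_eq plus_mseries.rep_eq
  minus_mseries.rep_eq uminus_mseries.rep_eq const.rep_eq var.rep_eq complete_sym.rep_eq
  elementary_sym.rep_eq power_sum.rep_eq

lemma coeff_of_sum: "coeff_of (sum f A) m = (\<Sum>i\<in>A. coeff_of (f i) m)"
  by (induction A rule: infinite_finite_induct) (simp_all add: coeff_of_simps)

lemma coeff_of_mult_single: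
  assumes "\<And>a. coeff_of f a = (if a = c then z else 0)"
  shows "coeff_of (f * g) m = (if c \<subseteq># m then z * coeff_of g (m - c) else 0)"
proof -
  have "coeff_of (f * g) m = (\<Sum>(a, b)\<in>(if c \<subseteq># m then {(c, m - c)} else {}). coeff_of f a * coeff_of g b)"
    unfolding coeff_of_mult
    by (rule sum.mono_neutral_right[OF finite_splits]) (auto simp: assms split: if_splits)
  then show ?thesis by (simp add: assms)
qed

lemma coeff_of_const_mult [simp]: "coeff_of (const c * f) m = c * coeff_of f m"
  by (subst coeff_of_mult_single[of _ "{#}" c]) (simp_all add: coeff_of_simps)

lemma coeff_of_var_mult:
  "coeff_of (var i * f) m = (if i \<in># m then coeff_of f (m - {#i#}) else 0)"
  by (subst coeff_of_mult_single[of _ "{#i#}" 1]) (simp_all add: coeff_of_simps)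

lemma const_add: "const (a + b) = const a + const b"
  and const_mult: "const (a * b) = const a * const b"
  and const_minus: "const (- a) = - const a"
  and const_diff: "const (a - b) = const a - const b"
  by (rule mseries_eqI; simp add: coeff_of_simps)+

lemma const_0: "const 0 = 0" and const_1: "const 1 = 1"
  by (rule mseries_eqI; simp add: coeff_of_simps)+

lemma const_sum: "const (sum f A) = (\<Sum>i\<in>A. const (f i))"
  by (induction A rule: infinite_finite_induct) (simp_all add: const_0 const_add)

lemma const_power: "const (a ^ n) = const a ^ n"
  by (induction n) (simp_all add: const_1 const_mult)

lemma const_of_nat: "const (of_nat n) = of_nat n"
  by (induction n) (simp_all add: const_0 const_1 const_add)

lemma const_eq_iff [simp]: "const a = const b \<longleftrightarrow> a = b"
proof
  assume "const a = const b"
  from arg_cong[OF this, of "\<lambda>f. coeff_of f {#}"] show "a = b" by (simp add: coeff_of_simps)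
qed simp

text \<open>Setting the variables outside \<open>S\<close> to zero. This is a ring homomorphism, and
  by \<open>restr_eqI\<close> finite sets \<open>S\<close> suffice to compare series, which brings
  identities in infinitely many variables down to finite products.\<close>

lift_definition restr :: "'v set \<Rightarrow> 'v mseries \<Rightarrow> 'v mseries"
  is "\<lambda>S f m. if set_mset m \<subseteq> S then f m else 0" .

lemma restr_add: "restr S (f + g) = restr S f + restr S g"
  and restr_diff: "restr S (f - g) = restr S f - restr S g"
  and restr_minus: "restr S (- f) = - restr S f"
  and restr_const [simp]: "restr S (const c) = const c"
  and restr_0 [simp]: "restr S 0 = 0"
  and restr_1 [simp]: "restr S 1 = 1"
  by (rule mseries_eqI; simp add: coeff_of_simps restr.rep_eq)+

lemma restr_mult: "restr S (f * g) = restr S f * restr S g"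
proof (rule mseries_eqI)
  fix m
  show "coeff_of (restr S (f * g)) m = coeff_of (restr S f * restr S g) m"
  proof (cases "set_mset m \<subseteq> S")
    case True
    then show ?thesis
      by (auto simp: coeff_of_mult restr.rep_eq intro!: sum.cong)
  next
    case False
    then have "coeff_of (restr S f * restr S g) m = 0"
      unfolding coeff_of_mult by (intro sum.neutral) (auto simp: restr.rep_eq)
    then show ?thesis using False by (simp add: restr.rep_eq)
  qed
qed

lemma restr_sum: "restr S (sum f A) = (\<Sum>i\<in>A. restr S (f i))"
  by (induction A rule: infinite_finite_induct) (simp_all add: restr_add)

lemma restr_power: "restr S (f ^ n) = restr S f ^ n"
  by (induction n) (simp_all add: restr_mult)

lemma restr_eqI:
  assumes "\<And>S. finite S \<Longrightarrow> restr S f = restr S g"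
  shows "f = g"
proof (rule mseries_eqI)
  fix m
  have "coeff_of (restr (set_mset m) f) m = coeff_of (restr (set_mset m) g) m"
    by (simp add: assms)
  then show "coeff_of f m = coeff_of g m" by (simp add: restr.rep_eq)
qed

abbreviation fvar :: "nat \<Rightarrow> nat mseries fract" where
  "fvar i \<equiv> to_fract (var i)"

lemma var_nz: "var i \<noteq> 0"
proof
  assume "var i = 0"
  then have "coeff_of (var i) {#i#} = coeff_of 0 {#i#}" by simp
  then show False by (simp add: coeff_of_simps)
qed

lemma var_eq_iff [simp]: "var i = var j \<longleftrightarrow> i = j"
proof
  assume "var i = var j"
  then have "coeff_of (var i) {#i#} = coeff_of (var j) {#i#}" by simp
  then show "i = j" by (simp add: coeff_of_simps split: if_splits)
qed simp

lemma fvar_inj: "inj_on fvar S"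
  by (auto simp: inj_on_def)

lemma fvar_nz: "fvar i \<noteq> 0"
  by (simp add: var_nz)

lemma complete_sym_0 [simp]: "complete_sym 0 = 1"
  and elementary_sym_0 [simp]: "elementary_sym 0 = 1"
  by (rule mseries_eqI; simp add: coeff_of_simps)+

text \<open>The coefficients of (1 - z_i u) H(S with i) = H(S): a monomial containing z_i cancels
  against its quotient by z_i.\<close>

lemma restr_complete_sym_insert:
  assumes "i \<notin> S"
  shows "restr (insert i S) (complete_sym (Suc n)) - var i * restr (insert i S) (complete_sym n) =
    restr S (complete_sym (Suc n))"
proof (rule mseries_eqI)
  fix m
  have "i \<in># m \<Longrightarrow> set_mset (m - {#i#}) \<subseteq> insert i S \<longleftrightarrow> set_mset m \<subseteq> insert i S"
    by (metis insert_DiffM insert_subset set_mset_add_mset_insert insertI1)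
  moreover have "i \<in># m \<Longrightarrow> size (m - {#i#}) = n \<longleftrightarrow> size m = Suc n"
    by (metis insert_DiffM size_add_mset nat.inject)
  moreover have "i \<notin># m \<Longrightarrow> set_mset m \<subseteq> insert i S \<longleftrightarrow> set_mset m \<subseteq> S" by auto
  moreover have "i \<in># m \<Longrightarrow> \<not> set_mset m \<subseteq> S" using assms by auto
  ultimately show "coeff_of (restr (insert i S) (complete_sym (Suc n)) -
      var i * restr (insert i S) (complete_sym n)) m = coeff_of (restr S (complete_sym (Suc n))) m"
    by (simp add: coeff_of_simps restr.rep_eq coeff_of_var_mult)
qed

lemma restr_elementary_sym_insert:
  assumes "i \<notin> S"
  shows "restr (insert i S) (elementary_sym (Suc n)) =
    restr S (elementary_sym (Suc n)) + var i * restr S (elementary_sym n)"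
proof (rule mseries_eqI)
  fix m
  have "coeff_of (restr (insert i S) (elementary_sym (Suc n))) m =
      coeff_of (var i * restr S (elementary_sym n)) m" if i: "i \<in># m"
  proof -
    obtain m' where m: "m = add_mset i m'" using i by (metis insert_DiffM)
    have "set_mset m \<subseteq> insert i S \<and> (\<forall>k. count m k \<le> 1) \<longleftrightarrow> set_mset m' \<subseteq> S \<and> (\<forall>k. count m' k \<le> 1)"
    proof
      assume l: "set_mset m \<subseteq> insert i S \<and> (\<forall>k. count m k \<le> 1)"
      then have "count m i \<le> 1" by blast
      then have "i \<notin># m'" by (simp add: m not_in_iff)
      moreover have "count m' k \<le> 1" for k
        using l[THEN conjunct2, rule_format, of k] by (simp add: m split: if_splits)
      ultimately show "set_mset m' \<subseteq> S \<and> (\<forall>k. count m' k \<le> 1)" using l by (auto simp: m)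
    next
      assume r: "set_mset m' \<subseteq> S \<and> (\<forall>k. count m' k \<le> 1)"
      then have "i \<notin># m'" using assms by auto
      then show "set_mset m \<subseteq> insert i S \<and> (\<forall>k. count m k \<le> 1)"
        using r by (auto simp: m not_in_iff)
    qed
    moreover have "coeff_of (restr (insert i S) (elementary_sym (Suc n))) m =
        (if (set_mset m \<subseteq> insert i S \<and> (\<forall>k. count m k \<le> 1)) \<and> size m = Suc n then 1 else 0)"
      by (simp add: coeff_of_simps restr.rep_eq)
    moreover have "coeff_of (var i * restr S (elementary_sym n)) m =
        (if (set_mset m' \<subseteq> S \<and> (\<forall>k. count m' k \<le> 1)) \<and> size m' = n then 1 else 0)"
      by (simp add: coeff_of_simps restr.rep_eq coeff_of_var_mult m)
    moreover have "size m = Suc n \<longleftrightarrow> size m' = n" by (simp add: m)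
    ultimately show ?thesis by (simp only:)
  qed
  moreover have "i \<notin># m \<Longrightarrow> set_mset m \<subseteq> insert i S \<longleftrightarrow> set_mset m \<subseteq> S" by auto
  moreover have "i \<in># m \<Longrightarrow> \<not> set_mset m \<subseteq> S" using assms by auto
  ultimately show "coeff_of (restr (insert i S) (elementary_sym (Suc n))) m =
    coeff_of (restr S (elementary_sym (Suc n)) + var i * restr S (elementary_sym n)) m"
    by (cases "i \<in># m") (simp_all add: coeff_of_simps restr.rep_eq coeff_of_var_mult)
qed

lemma E_fps_fvar_nth:
  "finite S \<Longrightarrow> fps_nth (E_fps fvar S y) n = (- y) ^ n * to_fract (restr S (elementary_sym n))"
proof (induction S arbitrary: n rule: finite_induct)
  case empty
  have "restr {} (elementary_sym n) = (if n = 0 then 1 else 0)"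
    by (rule mseries_eqI) (auto simp: coeff_of_simps restr.rep_eq)
  then show ?case by (simp add: E_fps_def)
next
  case (insert i S)
  have "E_fps fvar (insert i S) y = E_fps fvar S y - fps_X * (fps_const (y * fvar i) * E_fps fvar S y)"
    using insert by (simp add: E_fps_def algebra_simps)
  note eq = this
  show ?case
    unfolding eq using insert
    by (cases n) (simp_all add: restr_elementary_sym_insert to_fract_add to_fract_mult algebra_simps)
qed

lemma H_fps_fvar_nth:
  "finite S \<Longrightarrow> fps_nth (H_fps fvar S) n = to_fract (restr S (complete_sym n))"
proof (induction S arbitrary: n rule: finite_induct)
  case empty
  have "restr {} (complete_sym n) = (if n = 0 then 1 else 0)"
    by (rule mseries_eqI) (auto simp: coeff_of_simps restr.rep_eq)
  then show ?case by (simp add: H_fps_def E_fps_def)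
next
  case (insert i S)
  define h where "h = Abs_fps (\<lambda>n. to_fract (restr (insert i S) (complete_sym n)))"
  have "(1 - fps_const (fvar i) * fps_X) * h = H_fps fvar S"
  proof (rule fps_ext)
    fix n
    have "((1 - fps_const (fvar i) * fps_X) * h) $ n = (h - fps_const (fvar i) * (fps_X * h)) $ n"
      by (simp add: algebra_simps)
    also have "\<dots> = H_fps fvar S $ n"
      using insert(2)
      by (cases n) (simp_all add: h_def insert.IH restr_complete_sym_insert[symmetric] to_fract_diff to_fract_mult)
    finally show "((1 - fps_const (fvar i) * fps_X) * h) $ n = H_fps fvar S $ n" .
  qed
  then have "E_fps fvar (insert i S) 1 * h = E_fps fvar S 1 * H_fps fvar S"
    using insert(1,2) by (simp add: E_fps_def ac_simps)
  then have "E_fps fvar (insert i S) 1 * h = 1" by (simp add: E_H_fps)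
  then have "(E_fps fvar (insert i S) 1 * H_fps fvar (insert i S)) * h = H_fps fvar (insert i S)"
    by (simp only: mult.commute[of "E_fps fvar (insert i S) 1"] mult.assoc mult_1_right)
  then have "h = H_fps fvar (insert i S)" by (simp add: E_H_fps)
  then show ?case by (metis h_def fps_nth_Abs_fps)
qed

lemma to_fract_sum: "to_fract (sum f A) = (\<Sum>i\<in>A. to_fract (f i))"
  by (induction A rule: infinite_finite_induct) simp_all

lemma to_fract_power: "to_fract (a ^ n) = to_fract a ^ n"
  by (induction n) simp_all

text \<open>The \<open>n\<close>-th coefficient of \<open>\<Prod>(1 - y z\<^sub>i u) / (1 - z\<^sub>i u)\<close>.\<close>

definition EH_sym :: "complex \<Rightarrow> nat \<Rightarrow> nat mseries" where
  "EH_sym y n = (\<Sum>i\<le>n. const ((- y) ^ i) * elementary_sym i * complete_sym (n - i))"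

lemma E_H_fps_fvar_nth:
  assumes "finite S"
  shows "fps_nth (E_fps fvar S (to_fract (const y)) * H_fps fvar S) n = to_fract (restr S (EH_sym y n))"
  using assms
  by (simp add: fps_mult_nth EH_sym_def E_fps_fvar_nth H_fps_fvar_nth restr_sum restr_mult to_fract_sum
      const_power const_minus to_fract_power restr_power restr_minus atLeast0AtMost)

text \<open>At y = 1 the product of the E and H series is 1.\<close>

lemma sum_elementary_complete:
  assumes "0 < n"
  shows "(\<Sum>i\<le>n. (- 1) ^ i * elementary_sym i * complete_sym (n - i)) = 0"
proof -
  have "EH_sym 1 n = 0"
  proof (rule restr_eqI)
    fix S :: "nat set" assume "finite S"
    then have "to_fract (restr S (EH_sym 1 n)) = 0"
      using assms by (simp add: E_H_fps_fvar_nth[symmetric] const_1 E_H_fps)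
    then show "restr S (EH_sym 1 n) = restr S 0" by simp
  qed
  then show ?thesis by (simp add: EH_sym_def const_power const_minus const_1)
qed

text \<open>Coefficientwise counting: for a monomial of degree n the right side counts the pairs of
  an i >= 1 and a variable of multiplicity at least i, and their number is the sum of the
  multiplicities.\<close>

lemma newton_complete:
  "of_nat n * complete_sym n = (\<Sum>i\<in>{1..n}. power_sum i * complete_sym (n - i))"
proof (rule mseries_eqI)
  fix m :: "nat multiset"
  have *: "coeff_of (power_sum i * complete_sym (n - i)) m =
      (if size m = n then of_nat (card {j. replicate_mset i j \<subseteq># m}) else 0)" if i: "i \<in> {1..n}" for i
  proof -
    let ?A = "{(a, b). a + b = m}" and ?R = "{j. replicate_mset i j \<subseteq># m}"
    have fin: "finite ?R"
      by (rule finite_subset[of _ "set_mset m"])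
        (use i in \<open>auto dest!: set_mset_mono\<close>)
    have "coeff_of (power_sum i * complete_sym (n - i)) m =
        (\<Sum>(a, b)\<in>?A. if (\<exists>j. a = replicate_mset i j) \<and> size b = n - i then 1 else 0)"
      unfolding coeff_of_mult by (rule sum.cong) (auto simp: coeff_of_simps)
    also have "\<dots> = of_nat (card {(a, b). a + b = m \<and> (\<exists>j. a = replicate_mset i j) \<and> size b = n - i})"
    proof -
      have "{(a, b). a + b = m \<and> (\<exists>j. a = replicate_mset i j) \<and> size b = n - i} =
          ?A \<inter> {p. (\<exists>j. fst p = replicate_mset i j) \<and> size (snd p) = n - i}" by auto
      then show ?thesis using finite_splits[of m] by (simp add: sum.If_cases case_prod_beta)
    qed
    also have "{(a, b). a + b = m \<and> (\<exists>j. a = replicate_mset i j) \<and> size b = n - i} =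
        (if size m = n then (\<lambda>j. (replicate_mset i j, m - replicate_mset i j)) ` ?R else {})"
      (is "?L = ?L'")
    proof (intro equalityI subsetI)
      fix p assume "p \<in> ?L"
      then obtain j b where p: "p = (replicate_mset i j, b)" "replicate_mset i j + b = m" "size b = n - i" by auto
      have "size m = n" using p(2,3) i by (metis atLeastAtMost_iff le_add_diff_inverse size_replicate_mset size_union)
      moreover have "j \<in> ?R" "b = m - replicate_mset i j" using p(2) by auto
      ultimately show "p \<in> ?L'" using p(1) by simp
    next
      fix p assume "p \<in> ?L'"
      then obtain j where n: "size m = n" and j: "replicate_mset i j \<subseteq># m"
        and p: "p = (replicate_mset i j, m - replicate_mset i j)" by (auto split: if_splits)
      have "replicate_mset i j + (m - replicate_mset i j) = m" using j by simp
      moreover have "size (m - replicate_mset i j) = n - i" using j n by (simp add: size_Diff_submset)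
      ultimately show "p \<in> ?L" using p by blast
    qed
    also have "of_nat (card \<dots>) = (if size m = n then of_nat (card ?R) else 0)"
    proof -
      have "inj_on (\<lambda>j. (replicate_mset i j, m - replicate_mset i j)) ?R"
      proof (rule inj_onI)
        fix j j' assume "(replicate_mset i j, m - replicate_mset i j) = (replicate_mset i j', m - replicate_mset i j')"
        then have "set_mset (replicate_mset i j) = set_mset (replicate_mset i j')" by simp
        then show "j = j'" using i by (simp split: if_splits)
      qed
      then show ?thesis by (simp add: card_image)
    qed
    finally show ?thesis .
  qed
  show "coeff_of (of_nat n * complete_sym n) m = coeff_of (\<Sum>i\<in>{1..n}. power_sum i * complete_sym (n - i)) m"
  proof (cases "size m = n")
    case True
    have card: "card {j. replicate_mset i j \<subseteq># m} = card {j \<in> set_mset m. i \<le> count m j}" if "i \<in> {1..n}" for i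
      using that by (intro arg_cong[of _ _ card])
        (auto simp: subseteq_mset_def count_greater_zero_iff[symmetric] simp del: count_greater_zero_iff split: if_splits)
    have "(\<Sum>i\<in>{1..n}. card {j \<in> set_mset m. i \<le> count m j}) = (\<Sum>j\<in>set_mset m. card {i \<in> {1..n}. i \<le> count m j})"
      unfolding card_eq_sum by (rule sum.swap_restrict) auto
    also have "\<dots> = (\<Sum>j\<in>set_mset m. count m j)"
    proof (rule sum.cong[OF refl])
      fix j
      have "count m j \<le> n" using count_le_size[of m j] True by simp
      then have "{i \<in> {1..n}. i \<le> count m j} = {1..count m j}" by auto
      then show "card {i \<in> {1..n}. i \<le> count m j} = count m j" by simp
    qed
    also have "\<dots> = n" using True by (simp add: size_multiset_overloaded_eq)
    finally show ?thesis using True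
      by (simp add: coeff_of_sum * card coeff_of_simps flip: const_of_nat of_nat_sum)
  next
    case False
    then show ?thesis by (simp add: coeff_of_sum * coeff_of_simps flip: const_of_nat)
  qed
qed

text \<open>For the generating series, \<open>newton_complete\<close> says H' = P H, and E H = 1
  then forces E' = - P E.\<close>

lemma newton_elementary:
  "of_nat n * elementary_sym n = (\<Sum>i\<in>{1..n}. (- 1) ^ (i - 1) * power_sum i * elementary_sym (n - i))"
proof (cases n)
  case (Suc m)
  define H where "H = Abs_fps complete_sym"
  define E where "E = Abs_fps (\<lambda>n. (- 1) ^ n * elementary_sym n)"
  define P where "P = Abs_fps (\<lambda>n. power_sum (Suc n))"
  have EH: "E * H = 1"
  proof (rule fps_ext)
    fix n
    show "(E * H) $ n = 1 $ n"
      using sum_elementary_complete[of n]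
      by (cases "n = 0") (simp_all add: fps_mult_nth E_def H_def atLeast0AtMost)
  qed
  have "fps_deriv H = P * H"
  proof (rule fps_ext)
    fix n
    have "fps_deriv H $ n = of_nat (Suc n) * complete_sym (Suc n)" by (simp add: H_def)
    also have "\<dots> = (\<Sum>i\<in>{0..n}. power_sum (Suc i) * complete_sym (n - i))"
      unfolding newton_complete
      by (rule sum.reindex_bij_witness[of _ Suc "\<lambda>i. i - 1"]) auto
    also have "\<dots> = (P * H) $ n" by (simp add: fps_mult_nth P_def H_def)
    finally show "fps_deriv H $ n = (P * H) $ n" .
  qed
  moreover have "fps_deriv E * H + E * fps_deriv H = 0"
    using arg_cong[OF EH, of fps_deriv] by (simp add: add.commute)
  ultimately have "(fps_deriv E + P * E) * H = 0" by (simp add: algebra_simps)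
  then have "(fps_deriv E + P * E) * (E * H) = 0" by (simp add: mult.left_commute[of _ E])
  then have "fps_deriv E + P * E = 0" by (simp add: EH)
  then have "(fps_deriv E + P * E) $ m = 0" by simp
  then have "of_nat (Suc m) * ((- 1) ^ Suc m * elementary_sym (Suc m)) +
      (\<Sum>i=0..m. power_sum (Suc i) * ((- 1) ^ (m - i) * elementary_sym (m - i))) = 0"
    by (simp add: E_def P_def fps_mult_nth)
  then have X: "(\<Sum>i=0..m. power_sum (Suc i) * ((- 1) ^ (m - i) * elementary_sym (m - i))) =
      - (of_nat (Suc m) * ((- 1) ^ Suc m * elementary_sym (Suc m)))"
    by (simp only: add_eq_0_iff)
  have sign: "(- 1) ^ m * (y * ((- 1) ^ (m - i) * x)) = (- 1) ^ i * y * x" if "i \<le> m" for i and x y :: "nat mseries"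
  proof -
    have "(- 1 :: nat mseries) ^ m = (- 1) ^ i * (- 1) ^ (m - i)" using that by (simp flip: power_add)
    then have "(- 1) ^ m * (y * ((- 1) ^ (m - i) * x)) = (- 1) ^ i * ((- 1) ^ (m - i) * ((- 1) ^ (m - i) * (y * x)))"
      by (simp only: ac_simps)
    then show ?thesis by (simp only: left_minus_one_mult_self mult.assoc)
  qed
  have "of_nat (Suc m) * elementary_sym (Suc m) =
      (- 1) ^ m * - (of_nat (Suc m) * ((- 1) ^ Suc m * elementary_sym (Suc m)))"
    by (simp add: mult.left_commute[of "(- 1) ^ m" "1 + of_nat m"])
  also have "\<dots> = (\<Sum>i=0..m. (- 1) ^ i * power_sum (Suc i) * elementary_sym (m - i))"
    unfolding X[symmetric] sum_distrib_left by (rule sum.cong) (simp_all add: sign)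
  also have "\<dots> = (\<Sum>i\<in>{1..n}. (- 1) ^ (i - 1) * power_sum i * elementary_sym (n - i))"
    by (rule sum.reindex_bij_witness[of _ "\<lambda>i. i - 1" Suc]) (auto simp: Suc)
  finally show ?thesis by (simp only: Suc)
qed simp

text \<open>The monomial substitutions used here are injective on monomials, so no coefficients are merged.\<close>

abbreviation subst_mset :: "('v \<Rightarrow> 'w multiset) \<Rightarrow> 'v multiset \<Rightarrow> 'w multiset" where
  "subst_mset \<sigma> m \<equiv> (\<Sum>v\<in>#m. \<sigma> v)"

lemma coeff_of_monom_subst:
  assumes "inj (subst_mset \<sigma>)"
  shows "coeff_of (monom_subst \<sigma> f) (subst_mset \<sigma> m) = coeff_of f m"
proof -
  have "{m'. subst_mset \<sigma> m' = subst_mset \<sigma> m} = {m}" using assms by (auto dest: injD)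
  then show ?thesis by (simp add: monom_subst.rep_eq)
qed

lemma coeff_of_monom_subst_notin:
  assumes "M \<notin> range (subst_mset \<sigma>)"
  shows "coeff_of (monom_subst \<sigma> f) M = 0"
proof -
  have "{m'. subst_mset \<sigma> m' = M} = {}" using assms by auto
  then show ?thesis by (simp add: monom_subst.rep_eq)
qed

lemma monom_subst_eqI:
  assumes inj: "inj (subst_mset \<sigma>)"
    and "\<And>m. coeff_of g (subst_mset \<sigma> m) = coeff_of f m"
    and "\<And>M. M \<notin> range (subst_mset \<sigma>) \<Longrightarrow> coeff_of g M = 0"
  shows "monom_subst \<sigma> f = g"
proof (rule mseries_eqI)
  fix M
  show "coeff_of (monom_subst \<sigma> f) M = coeff_of g M"
    using assms by (cases "M \<in> range (subst_mset \<sigma>)")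
      (auto simp: coeff_of_monom_subst[OF inj] coeff_of_monom_subst_notin)
qed

lemma monom_subst_add:
  assumes inj: "inj (subst_mset \<sigma>)"
  shows "monom_subst \<sigma> (f + g) = monom_subst \<sigma> f + monom_subst \<sigma> g"
  by (rule monom_subst_eqI[OF inj])
    (simp_all add: coeff_of_simps coeff_of_monom_subst[OF inj] coeff_of_monom_subst_notin)

lemma monom_subst_const:
  assumes inj: "inj (subst_mset \<sigma>)"
  shows "monom_subst \<sigma> (const c) = const c"
proof (rule monom_subst_eqI[OF inj])
  fix m
  have "subst_mset \<sigma> m = {#} \<longleftrightarrow> m = {#}"
    using injD[OF inj, of m "{#}"] by auto
  then show "coeff_of (const c) (subst_mset \<sigma> m) = coeff_of (const c) m"
    by (simp add: coeff_of_simps)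
next
  fix M assume "M \<notin> range (subst_mset \<sigma>)"
  then have "M \<noteq> {#}" using rangeI[of "subst_mset \<sigma>" "{#}"] by auto
  then show "coeff_of (const c) M = 0" by (simp add: coeff_of_simps)
qed

lemma monom_subst_mult:
  assumes inj: "inj (subst_mset \<sigma>)"
  shows "monom_subst \<sigma> (f * g) = monom_subst \<sigma> f * monom_subst \<sigma> g"
proof (rule monom_subst_eqI[OF inj])
  let ?p = "\<lambda>(a, b). (subst_mset \<sigma> a, subst_mset \<sigma> b)"
  let ?F = "\<lambda>(A, B). coeff_of (monom_subst \<sigma> f) A * coeff_of (monom_subst \<sigma> g) B"
  fix m
  have "coeff_of (monom_subst \<sigma> f * monom_subst \<sigma> g) (subst_mset \<sigma> m) =
      sum ?F (?p ` {(a, b). a + b = m})"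
    unfolding coeff_of_mult
  proof (rule sum.mono_neutral_right[OF finite_splits])
    show "\<forall>p\<in>{(a, b). a + b = subst_mset \<sigma> m} - ?p ` {(a, b). a + b = m}. ?F p = 0"
    proof
      fix p assume p: "p \<in> {(a, b). a + b = subst_mset \<sigma> m} - ?p ` {(a, b). a + b = m}"
      obtain A B where AB: "p = (A, B)" by (cases p)
      have "A \<notin> range (subst_mset \<sigma>) \<or> B \<notin> range (subst_mset \<sigma>)"
      proof (rule ccontr)
        assume "\<not> ?thesis"
        then obtain a b where ab: "A = subst_mset \<sigma> a" "B = subst_mset \<sigma> b" by blast
        then have "subst_mset \<sigma> (a + b) = subst_mset \<sigma> m" using p AB by simp
        then have "a + b = m" by (rule injD[OF inj])
        then show False using p AB ab by (auto simp: image_iff)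
      qed
      then show "?F p = 0" by (auto simp: AB coeff_of_monom_subst_notin)
    qed
  qed auto
  also have "\<dots> = coeff_of (f * g) m"
    unfolding coeff_of_mult
    by (subst sum.reindex)
      (auto simp: inj_on_def coeff_of_monom_subst[OF inj] dest: injD[OF inj] intro!: sum.cong)
  finally show "coeff_of (monom_subst \<sigma> f * monom_subst \<sigma> g) (subst_mset \<sigma> m) = coeff_of (f * g) m" .
next
  fix M assume M: "M \<notin> range (subst_mset \<sigma>)"
  have "(case p of (A, B) \<Rightarrow> coeff_of (monom_subst \<sigma> f) A * coeff_of (monom_subst \<sigma> g) B) = 0"
    if pM: "p \<in> {(A, B). A + B = M}" for p
  proof -
    obtain A B where p: "p = (A, B)" "A + B = M" using pM by auto
    have "A \<notin> range (subst_mset \<sigma>) \<or> B \<notin> range (subst_mset \<sigma>)"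
    proof (rule ccontr)
      assume "\<not> ?thesis"
      then obtain a b where "A = subst_mset \<sigma> a" "B = subst_mset \<sigma> b" by blast
      then have "M = subst_mset \<sigma> (a + b)" using p(2) by simp
      then show False using M by blast
    qed
    then show ?thesis by (auto simp: p coeff_of_monom_subst_notin)
  qed
  then show "coeff_of (monom_subst \<sigma> f * monom_subst \<sigma> g) M = 0"
    unfolding coeff_of_mult by (intro sum.neutral) blast
qed

lemma subst_mset_single: "subst_mset (\<lambda>i. {#z i#}) m = image_mset z m"
  by (induction m) auto

lemma subst_mset_replicate: "subst_mset (\<lambda>i. replicate_mset b i) m = repeat_mset b m"
  by (induction m) (auto intro!: multiset_eqI)

lemma inj_subst_mset_single: "inj z \<Longrightarrow> inj (subst_mset (\<lambda>i. {#z i#}))"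
  unfolding subst_mset_single by (auto intro!: injI dest: multiset.inj_map_strong[rotated] injD)

lemma inj_subst_mset_replicate: "0 < b \<Longrightarrow> inj (subst_mset (\<lambda>i. replicate_mset b (Y i)))"
  unfolding Y_def subst_mset_replicate by (metis injI less_irrefl repeat_mset_cancel1)

text \<open>\<open>calg_hom\<close> constrains a map only on its domain, so each use requires
  membership of the arguments; this predicate supplies the closure rules.\<close>

definition subalg :: "'v mseries set \<Rightarrow> bool" where
  "subalg A \<longleftrightarrow> (\<forall>c. const c \<in> A) \<and> (\<forall>f\<in>A. \<forall>g\<in>A. f + g \<in> A \<and> f * g \<in> A)"

lemma subalgD:
  assumes "subalg A"
  shows "const c \<in> A" "f \<in> A \<Longrightarrow> g \<in> A \<Longrightarrow> f + g \<in> A" "f \<in> A \<Longrightarrow> g \<in> A \<Longrightarrow> f * g \<in> A"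
  using assms by (auto simp: subalg_def)

lemma subalg_sum:
  assumes "subalg A" "\<And>i. i \<in> I \<Longrightarrow> f i \<in> A"
  shows "sum f I \<in> A"
  using assms(2) subalgD(1)[OF assms(1), of 0]
  by (induction I rule: infinite_finite_induct) (auto simp: const_0 intro: subalgD[OF assms(1)])

lemma subalg_subalgebra: "subalg (subalgebra S)"
  by (auto simp: subalg_def intro: subalgebra.intros)

lemma calg_homD:
  assumes "calg_hom A B h"
  shows "f \<in> A \<Longrightarrow> h f \<in> B" "h (const c) = const c"
    "f \<in> A \<Longrightarrow> g \<in> A \<Longrightarrow> h (f + g) = h f + h g" "f \<in> A \<Longrightarrow> g \<in> A \<Longrightarrow> h (f * g) = h f * h g"
  using assms by (auto simp: calg_hom_def)

lemma calg_hom_sum: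
  assumes A: "subalg A" and h: "calg_hom A B h" and f: "\<And>i. i \<in> I \<Longrightarrow> f i \<in> A"
  shows "h (sum f I) = (\<Sum>i\<in>I. h (f i))"
  using f
proof (induction I rule: infinite_finite_induct)
  case (insert i I)
  then have "sum f I \<in> A" "f i \<in> A" using subalg_sum[OF A, of I f] by auto
  then show ?case using insert calg_homD(3)[OF h] by simp
qed (use calg_homD(2)[OF h, of 0] in \<open>simp_all add: const_0\<close>)

lemma calg_hom_const_mult:
  assumes A: "subalg A" and h: "calg_hom A B h" and f: "f \<in> A"
  shows "h (const c * f) = const c * h f"
  using calg_homD(2,4)[OF h] subalgD(1)[OF A] f by metis

lemma subalg_Sym: "subalg Sym"
  unfolding subalg_def
proof (intro conjI allI ballI)
  fix c show "const c \<in> Sym"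
    by (auto simp: Sym_def coeff_of_simps intro!: exI[of _ 0])
next
  fix f g assume fg: "f \<in> Sym" "g \<in> Sym"
  obtain D D' where D: "\<And>m. D < size m \<Longrightarrow> coeff_of f m = 0" "\<And>m. D' < size m \<Longrightarrow> coeff_of g m = 0"
    using fg by (auto simp: Sym_def)
  have inv: "coeff_of f (image_mset \<pi> m) = coeff_of f m" "coeff_of g (image_mset \<pi> m) = coeff_of g m"
    if "bij \<pi>" for \<pi> m using fg that by (auto simp: Sym_def)
  show "f + g \<in> Sym"
    using D inv by (auto simp: Sym_def coeff_of_simps intro!: exI[of _ "D + D'"])
  have "coeff_of (f * g) m = 0" if "D + D' < size m" for m
    unfolding coeff_of_mult
  proof (intro sum.neutral ballI)
    fix p assume "p \<in> {(a, b). a + b = m}"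
    then obtain a b where p: "p = (a, b)" "a + b = m" by auto
    then have "D < size a \<or> D' < size b" using that by auto
    then show "(case p of (a, b) \<Rightarrow> coeff_of f a * coeff_of g b) = 0" using D by (auto simp: p)
  qed
  moreover have "coeff_of (f * g) (image_mset \<pi> m) = coeff_of (f * g) m" if \<pi>: "bij \<pi>" for \<pi> m
  proof -
    have 1: "image_mset (inv_into UNIV \<pi>) (image_mset \<pi> a) = a" for a
      using bij_is_inj[OF \<pi>] by (simp add: multiset.map_comp)
    have 2: "image_mset \<pi> (image_mset (inv_into UNIV \<pi>) a) = a" for a
      using bij_is_surj[OF \<pi>] by (simp add: multiset.map_comp surj_iff)
    have 3: "coeff_of f (image_mset (inv_into UNIV \<pi>) a) = coeff_of f a"
      "coeff_of g (image_mset (inv_into UNIV \<pi>) a) = coeff_of g a" for a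
      using inv[OF \<pi>, of "image_mset (inv_into UNIV \<pi>) a"] by (simp_all only: 2)
    show ?thesis
      unfolding coeff_of_mult
      by (rule sum.reindex_bij_witness[where i = "\<lambda>(a, b). (image_mset \<pi> a, image_mset \<pi> b)"
            and j = "\<lambda>(a, b). (image_mset (inv_into UNIV \<pi>) a, image_mset (inv_into UNIV \<pi>) b)"])
        (auto simp: 1 2 3 simp flip: image_mset_union)
  qed
  ultimately show "f * g \<in> Sym" by (auto simp: Sym_def)
qed

lemma complete_sym_Sym: "complete_sym r \<in> Sym"
  by (auto simp: Sym_def coeff_of_simps intro!: exI[of _ r])

lemma elementary_sym_Sym: "elementary_sym r \<in> Sym"
proof -
  have "(\<forall>i. count (image_mset \<pi> m) i \<le> 1) \<longleftrightarrow> (\<forall>i. count m i \<le> 1)" if \<pi>: "bij \<pi>" for \<pi> :: "nat \<Rightarrow> nat" and m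
  proof -
    have "count (image_mset \<pi> m) (\<pi> i) = count m i" for i
      by (induction m) (auto dest: injD[OF bij_is_inj[OF \<pi>]])
    then show ?thesis using bij_is_surj[OF \<pi>] by (metis surjD)
  qed
  then show ?thesis
    by (auto simp: Sym_def coeff_of_simps intro!: exI[of _ r])
qed

lemma power_sum_Sym: "power_sum r \<in> Sym"
proof -
  have "(\<exists>i. image_mset \<pi> m = replicate_mset r i) \<longleftrightarrow> (\<exists>i. m = replicate_mset r i)" if \<pi>: "bij \<pi>" for \<pi> :: "nat \<Rightarrow> nat" and m
  proof
    assume "\<exists>i. image_mset \<pi> m = replicate_mset r i"
    then obtain i where "image_mset (inv_into UNIV \<pi>) (image_mset \<pi> m) = image_mset (inv_into UNIV \<pi>) (replicate_mset r i)" by auto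
    then show "\<exists>i. m = replicate_mset r i"
      using bij_is_inj[OF \<pi>] by (auto simp: multiset.map_comp)
  qed auto
  then show ?thesis
    by (auto simp: Sym_def coeff_of_simps intro!: exI[of _ r])
qed

lemma EH_sym_Sym: "EH_sym y n \<in> Sym"
  unfolding EH_sym_def
  by (intro subalg_sum[OF subalg_Sym] subalgD[OF subalg_Sym] complete_sym_Sym elementary_sym_Sym)

context
  fixes z :: "nat \<Rightarrow> 'v"
  assumes z: "inj z"
begin

lemma in_vars_add: "in_vars z (f + g) = in_vars z f + in_vars z g"
  and in_vars_mult: "in_vars z (f * g) = in_vars z f * in_vars z g"
  and in_vars_const: "in_vars z (const c) = const c"
  unfolding in_vars_def
  by (rule monom_subst_add monom_subst_mult monom_subst_const, rule inj_subst_mset_single[OF z])+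

lemma in_vars_sum: "in_vars z (sum f A) = (\<Sum>i\<in>A. in_vars z (f i))"
  using in_vars_const[of 0]
  by (induction A rule: infinite_finite_induct) (simp_all add: in_vars_add const_0)

end

section \<open>Hall-Littlewood functions as limits\<close>

text \<open>Polynomials in the complete and elementary functions. For these, deleting a variable has
  an expansion whose form is the same for all \<open>S\<close>.\<close>

abbreviation Sym_alg :: "nat mseries set" where
  "Sym_alg \<equiv> subalgebra (range complete_sym \<union> range elementary_sym)"

lemma complete_sym_alg: "complete_sym n \<in> Sym_alg"
  and elementary_sym_alg: "elementary_sym n \<in> Sym_alg"
  by (auto intro: subalgebra.incl)

lemma EH_sym_alg: "EH_sym y n \<in> Sym_alg"
  unfolding EH_sym_def
  by (intro subalg_sum[OF subalg_subalgebra] subalgD[OF subalg_subalgebra] complete_sym_alg elementary_sym_alg)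

text \<open>Polynomials in the variable \<open>i\<close> whose coefficients are symmetric in all variables of \<open>S\<close>;
  the coefficients do not depend on \<open>S\<close>.\<close>

inductive expandable :: "(nat set \<Rightarrow> nat \<Rightarrow> nat mseries) \<Rightarrow> bool" where
  sym: "f \<in> Sym_alg \<Longrightarrow> expandable (\<lambda>S i. restr S f)"
| add: "expandable G \<Longrightarrow> expandable H \<Longrightarrow> expandable (\<lambda>S i. G S i + H S i)"
| var: "expandable G \<Longrightarrow> expandable (\<lambda>S i. var i * G S i)"

lemma expandable_mult:
  assumes "expandable G" "expandable H"
  shows "expandable (\<lambda>S i. G S i * H S i)"
  using assms(1)
proof induction
  case (sym f)
  show ?case
    using assms(2)
  proof induction
    case (sym g)
    then show ?case using expandable.sym[of "f * g"] \<open>f \<in> Sym_alg\<close>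
      by (simp add: restr_mult subalgebra.mult)
  next
    case (add G H)
    then show ?case using expandable.add by (simp add: distrib_left)
  next
    case (var G)
    then show ?case using expandable.var by (simp add: mult.left_commute)
  qed
next
  case (add G H)
  then show ?case using expandable.add by (simp add: distrib_right)
next
  case (var G)
  then show ?case using expandable.var by (simp add: mult.assoc)
qed

lemma expandable_minus_var:
  assumes "expandable G" "expandable H"
  shows "expandable (\<lambda>S i. G S i - var i * H S i)"
proof -
  have "expandable (\<lambda>S i. restr S (const (- 1)) * (var i * H S i))"
    by (intro expandable_mult expandable.var expandable.sym subalgebra.const assms)
  with assms(1) have "expandable (\<lambda>S i. G S i + restr S (const (- 1)) * (var i * H S i))"
    by (rule expandable.add)
  then show ?thesis by (simp add: const_minus const_1 restr_minus)
qed

text \<open>On generators: h_n without z_i is h_n - z_i h_(n-1), and e_n without z_i is found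
  recursively by solving e_n(S) = e_n(S - {i}) + z_i e_(n-1)(S - {i}). Expansions can be added and
  multiplied.\<close>

lemma expandable_restr_remove:
  assumes "f \<in> Sym_alg"
  shows "\<exists>G. expandable G \<and> (\<forall>S. \<forall>i\<in>S. restr (S - {i}) f = G S i)"
  using assms
proof induction
  case (incl f)
  have const: "\<exists>G. expandable G \<and> (\<forall>S. \<forall>i\<in>S. restr (S - {i}) 1 = G S i)"
    using expandable.sym[of 1] complete_sym_alg[of 0] by (intro exI[of _ "\<lambda>S i. restr S 1"]) simp
  have "\<exists>G. expandable G \<and> (\<forall>S. \<forall>i\<in>S. restr (S - {i}) (complete_sym n) = G S i)" for n
  proof (cases n)
    case (Suc k)
    have "restr (S - {i}) (complete_sym n) = restr S (complete_sym n) - var i * restr S (complete_sym k)"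
      if "i \<in> S" for S i
      using restr_complete_sym_insert[of i "S - {i}" k] that by (simp add: Suc insert_absorb)
    then show ?thesis
      using expandable_minus_var[OF expandable.sym[OF complete_sym_alg[of n]] expandable.sym[OF complete_sym_alg[of k]]]
      by blast
  qed (use const in simp)
  moreover have "\<exists>G. expandable G \<and> (\<forall>S. \<forall>i\<in>S. restr (S - {i}) (elementary_sym n) = G S i)" for n
  proof (induction n)
    case (Suc k)
    then obtain G where G: "expandable G" "\<forall>S. \<forall>i\<in>S. restr (S - {i}) (elementary_sym k) = G S i"
      by (elim exE conjE)
    have "restr (S - {i}) (elementary_sym (Suc k)) = restr S (elementary_sym (Suc k)) - var i * G S i"
      if "i \<in> S" for S i
      using restr_elementary_sym_insert[of i "S - {i}" k] that G(2) by (simp add: insert_absorb)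
    then show ?case
      using expandable_minus_var[OF expandable.sym[OF elementary_sym_alg[of "Suc k"]] G(1)] by blast
  qed (use const in simp)
  ultimately show ?case using incl by blast
next
  case (const c)
  then show ?case using expandable.sym[OF subalgebra.const[of c]]
    by (intro exI[of _ "\<lambda>S i. restr S (const c)"]) simp
next
  case (add f g)
  from add.IH(1) obtain G where "expandable G" "\<forall>S. \<forall>i\<in>S. restr (S - {i}) f = G S i"
    by (elim exE conjE)
  moreover from add.IH(2) obtain H where "expandable H" "\<forall>S. \<forall>i\<in>S. restr (S - {i}) g = H S i"
    by (elim exE conjE)
  ultimately show ?case by (intro exI[of _ "\<lambda>S i. G S i + H S i"]) (simp add: restr_add expandable.add)
next
  case (mult f g)
  from mult.IH(1) obtain G where "expandable G" "\<forall>S. \<forall>i\<in>S. restr (S - {i}) f = G S i"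
    by (elim exE conjE)
  moreover from mult.IH(2) obtain H where "expandable H" "\<forall>S. \<forall>i\<in>S. restr (S - {i}) g = H S i"
    by (elim exE conjE)
  ultimately show ?case by (intro exI[of _ "\<lambda>S i. G S i * H S i"]) (simp add: restr_mult expandable_mult)
qed

abbreviation fconst :: "complex \<Rightarrow> nat mseries fract" where
  "fconst c \<equiv> to_fract (const c)"

lemma fconst_simps: "fconst (a * b) = fconst a * fconst b" "fconst (a ^ k) = fconst a ^ k"
  "fconst (a - b) = fconst a - fconst b" "fconst 1 = 1" "fconst 0 = 0"
  by (simp_all add: const_mult const_power const_diff const_1 const_0 to_fract_power)

lemma fconst_eq_iff: "fconst a = fconst b \<longleftrightarrow> a = b"
  by simp

lemma inj_fconst_power: "inj (\<lambda>k::nat. t ^ k) \<Longrightarrow> inj (\<lambda>k::nat. fconst t ^ k)"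
  by (auto simp: inj_def fconst_simps(2)[symmetric])

lemma mult_eq_1_solve: "b * a = 1 \<Longrightarrow> a * s = c \<Longrightarrow> s = b * (c :: 'k::comm_monoid_mult)"
  by (auto simp: mult.assoc[symmetric])

text \<open>Symmetric coefficients leave the sum and powers of z_i raise m, so only the sums of
  z_i^m times a ratio remain, equal to \<open>EH_sym t m\<close> divided by 1 - t. Positivity of m
  matters: for m = 0 the sum is determined by \<open>card S\<close> and is not the truncation of one
  fixed series.\<close>

lemma expandable_hl_sum:
  assumes "expandable G" "t \<noteq> 1" "0 < m"
  shows "\<exists>F\<in>Sym_alg. \<forall>S. finite S \<longrightarrow>
    (\<Sum>i\<in>S. fvar i ^ m * hl_ratio fvar (fconst t) {i} (S - {i}) * to_fract (G S i)) = to_fract (restr S F)"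
  using assms(1,3)
proof (induction arbitrary: m)
  case (sym f)
  have "1 - fconst t \<noteq> 0" using assms(2) fconst_eq_iff[of 1 t] by (simp add: const_1)
  have "(\<Sum>i\<in>S. fvar i ^ m * hl_ratio fvar (fconst t) {i} (S - {i}) * to_fract (restr S f)) =
      to_fract (restr S (const (1 / (1 - t)) * (EH_sym t m * f)))" if S: "finite S" for S
  proof -
    have "(1 - fconst t) * (\<Sum>i\<in>S. fvar i ^ m * hl_ratio fvar (fconst t) {i} (S - {i})) = to_fract (restr S (EH_sym t m))"
      using hl_ratio_power_sum[OF S fvar_inj fvar_nz sym(2), of "fconst t"] E_H_fps_fvar_nth[OF S, of t m] by simp
    moreover have "fconst (1 / (1 - t)) * (1 - fconst t) = 1"
      using fconst_simps(1)[of "1 / (1 - t)" "1 - t"] assms(2) by (simp add: fconst_simps const_1)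
    ultimately have "(\<Sum>i\<in>S. fvar i ^ m * hl_ratio fvar (fconst t) {i} (S - {i})) =
        fconst (1 / (1 - t)) * to_fract (restr S (EH_sym t m))"
      by (rule mult_eq_1_solve[rotated])
    then show ?thesis
      unfolding sum_distrib_right[symmetric] by (simp add: restr_mult mult.assoc)
  qed
  then show ?case
    using sym(1) EH_sym_alg subalgebra.const subalgebra.mult by meson
next
  case (add G H)
  from add.IH(1)[OF add.prems] obtain F where "F \<in> Sym_alg"
    "\<forall>S. finite S \<longrightarrow> (\<Sum>i\<in>S. fvar i ^ m * hl_ratio fvar (fconst t) {i} (S - {i}) * to_fract (G S i)) = to_fract (restr S F)"
    by (elim bexE)
  moreover from add.IH(2)[OF add.prems] obtain F' where "F' \<in> Sym_alg"
    "\<forall>S. finite S \<longrightarrow> (\<Sum>i\<in>S. fvar i ^ m * hl_ratio fvar (fconst t) {i} (S - {i}) * to_fract (H S i)) = to_fract (restr S F')"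
    by (elim bexE)
  ultimately show ?case
    by (intro bexI[of _ "F + F'"]) (simp_all add: distrib_left sum.distrib restr_add subalgebra.add)
next
  case (var G)
  then show ?case using var.IH[of "Suc m"] by (simp add: ac_simps)
qed

text \<open>Polynomiality and stability together: a single series \<open>F\<close> truncates to the
  finite sum for every \<open>S\<close>. The largest part is removed by
  \<open>HL_sum_remove_max\<close>, the truncation at \<open>S - {i}\<close> is expanded in z_i, and
  distinct powers of t allow division by 1 - t^mult.\<close>

lemma HL_sum_sym:
  assumes t: "inj (\<lambda>k::nat. t ^ k)" and M: "0 \<notin># M"
  shows "\<exists>F\<in>Sym_alg. \<forall>S. finite S \<longrightarrow> HL_sum fvar (fconst t) S M = to_fract (restr S F)"
  using M
proof (induction "size M" arbitrary: M rule: less_induct)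
  case less
  show ?case
  proof (cases "M = {#}")
    case True
    then show ?thesis using complete_sym_alg[of 0] by (intro bexI[of _ 1]) (simp_all add: HL_sum_empty)
  next
    case False
    define m where "m = Max_mset M"
    have m: "m \<in># M" "\<And>k. k \<in># M \<Longrightarrow> k \<le> m" using False by (simp_all add: m_def)
    have m0: "0 < m" using m(1) less.prems by (metis gr0I)
    have t1: "t \<noteq> 1" using injD[OF t, of 1 0] by auto
    have tc: "t ^ count M m \<noteq> 1" using injD[OF t, of "count M m" 0] m(1) by (metis not_in_iff power_0)
    have "size (M - {#m#}) < size M" "0 \<notin># M - {#m#}"
      using m(1) less.prems by (auto simp: size_Diff1_less dest: in_diffD)
    from less.hyps[OF this] obtain F where F: "F \<in> Sym_alg"
      "\<And>S. finite S \<Longrightarrow> HL_sum fvar (fconst t) S (M - {#m#}) = to_fract (restr S F)" by blast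
    from expandable_restr_remove[OF F(1)]
    obtain G where G: "expandable G" "\<forall>S. \<forall>i\<in>S. restr (S - {i}) F = G S i"
      by (elim exE conjE)
    obtain F' where F': "F' \<in> Sym_alg" "\<And>S. finite S \<Longrightarrow>
      (\<Sum>i\<in>S. fvar i ^ m * hl_ratio fvar (fconst t) {i} (S - {i}) * to_fract (G S i)) = to_fract (restr S F')"
      using expandable_hl_sum[OF G(1) t1 m0] by blast
    have "HL_sum fvar (fconst t) S M = to_fract (restr S (const ((1 - t) / (1 - t ^ count M m)) * F'))"
      if S: "finite S" for S
    proof -
      have "(\<Sum>i\<in>S. fvar i ^ m * hl_ratio fvar (fconst t) {i} (S - {i}) * HL_sum fvar (fconst t) (S - {i}) (M - {#m#})) =
          to_fract (restr S F')"
        unfolding F'(2)[OF S, symmetric] using S by (intro sum.cong) (simp_all add: F(2) G(2))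
      then have 1: "(1 - fconst t) * to_fract (restr S F') = (1 - fconst t ^ count M m) * HL_sum fvar (fconst t) S M"
        using HL_sum_remove_max[OF S fvar_inj fvar_nz m m0, of "fconst t"] by simp
      have 2: "fconst ((1 - t) / (1 - t ^ count M m)) * (1 - fconst t ^ count M m) = 1 - fconst t"
        using fconst_simps(1)[of "(1 - t) / (1 - t ^ count M m)" "1 - t ^ count M m"] tc
        by (simp add: fconst_simps)
      have "(1 - fconst t ^ count M m) * HL_sum fvar (fconst t) S M =
          (1 - fconst t ^ count M m) * (fconst ((1 - t) / (1 - t ^ count M m)) * to_fract (restr S F'))"
        unfolding 1[symmetric] 2[symmetric] by (simp only: ac_simps)
      moreover have "1 - fconst t ^ count M m \<noteq> 0"
        using tc fconst_eq_iff[of 1 "t ^ count M m"] by (simp add: fconst_simps)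
      ultimately have "HL_sum fvar (fconst t) S M = fconst ((1 - t) / (1 - t ^ count M m)) * to_fract (restr S F')"
        by (simp only: mult_cancel_left) simp
      then show ?thesis by (simp add: restr_mult)
    qed
    then show ?thesis using F'(1) subalgebra.const subalgebra.mult by meson
  qed
qed

section \<open>From coset sums to exponent vectors, and the limit\<close>

definition parts_mset :: "(nat \<Rightarrow> nat) \<Rightarrow> nat multiset" where
  "parts_mset \<nu> = image_mset \<nu> (mset_set {i. \<nu> i \<noteq> 0})"

text \<open>The summand factors through \<open>a\<close>, so each class has a single value and the
  classes correspond to the values of \<open>a\<close>.\<close>

lemma sum_quotient_kernel:
  fixes a :: "'w \<Rightarrow> 'b" and h :: "'b \<Rightarrow> 'c::comm_monoid_add"
  shows "(\<Sum>C\<in>P // {(w, w'). w \<in> P \<and> w' \<in> P \<and> a w = a w'}. the_elem ((\<lambda>w. h (a w)) ` C)) = sum h (a ` P)"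
proof (rule sum.reindex_bij_witness[where i = "\<lambda>\<alpha>. {w \<in> P. a w = \<alpha>}" and j = "\<lambda>C. the_elem (a ` C)"])
  let ?r = "{(w, w'). w \<in> P \<and> w' \<in> P \<and> a w = a w'}"
  fix C assume "C \<in> P // ?r"
  then obtain w where w: "w \<in> P" and "C = ?r `` {w}" by (rule quotientE)
  then have C: "C = {w' \<in> P. a w' = a w}" by auto
  have "a ` C = {a w}" using w C by auto
  moreover have "(\<lambda>w. h (a w)) ` C = {h (a w)}" using w C by auto
  ultimately show "{w \<in> P. a w = the_elem (a ` C)} = C" "the_elem (a ` C) \<in> a ` P"
    "h (the_elem (a ` C)) = the_elem ((\<lambda>w. h (a w)) ` C)" using w C by auto
next
  let ?r = "{(w, w'). w \<in> P \<and> w' \<in> P \<and> a w = a w'}"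
  fix \<alpha> assume "\<alpha> \<in> a ` P"
  then obtain w where w: "w \<in> P" "\<alpha> = a w" by auto
  have "a ` {w \<in> P. a w = \<alpha>} = {\<alpha>}" using w by auto
  then show "the_elem (a ` {w \<in> P. a w = \<alpha>}) = \<alpha>" by simp
  have "{w \<in> P. a w = \<alpha>} = ?r `` {w}" using w by auto
  then show "{w \<in> P. a w = \<alpha>} \<in> P // ?r" using quotientI[OF w(1), of ?r] by (simp only:)
qed

lemma HL_term_eq:
  assumes w: "w \<in> perms N"
  shows "HL_term N \<nu> t w = hl_weight fvar (fconst t) (\<lambda>j\<in>{..<N}. \<nu> (inv_into UNIV w j)) {..<N}"
proof -
  let ?\<alpha> = "\<lambda>j\<in>{..<N}. \<nu> (inv_into UNIV w j)"
  have p: "w permutes {..<N}" using w by (simp add: perms_def)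
  then have bij: "bij_betw w {..<N} {..<N}" by (rule permutes_imp_bij)
  have \<alpha>: "?\<alpha> (w i) = \<nu> i" if "i < N" for i
    using that p by (simp add: permutes_inverses permutes_in_image[of w "{..<N}", simplified])
  have "hl_weight fvar (fconst t) ?\<alpha> {..<N} =
      (\<Prod>i<N. fvar (w i) ^ \<nu> i * hl_ratio fvar (fconst t) {w i} {j \<in> {..<N}. ?\<alpha> j < \<nu> i})"
    unfolding hl_weight_def
    by (subst prod.reindex_bij_betw[OF bij, symmetric]) (rule prod.cong, auto simp: \<alpha> simp del: restrict_apply)
  also have "\<dots> = (\<Prod>i<N. fvar (w i) ^ \<nu> i * (\<Prod>j | j < N \<and> \<nu> j < \<nu> i.
      (fvar (w i) - fconst t * fvar (w j)) / (fvar (w i) - fvar (w j))))"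
  proof (rule prod.cong[OF refl])
    fix i assume "i \<in> {..<N}"
    have "{j \<in> {..<N}. ?\<alpha> j < \<nu> i} = w ` {j. j < N \<and> \<nu> j < \<nu> i}"
    proof (intro equalityI subsetI)
      fix j assume j: "j \<in> {j \<in> {..<N}. ?\<alpha> j < \<nu> i}"
      then obtain k where k: "k < N" "j = w k" using bij by (auto simp: bij_betw_def)
      then show "j \<in> w ` {j. j < N \<and> \<nu> j < \<nu> i}" using j \<alpha> by auto
    next
      fix j assume "j \<in> w ` {j. j < N \<and> \<nu> j < \<nu> i}"
      then show "j \<in> {j \<in> {..<N}. ?\<alpha> j < \<nu> i}"
        using bij by (auto simp: \<alpha> bij_betw_def simp del: restrict_apply)
    qed
    moreover have "inj_on w {j. j < N \<and> \<nu> j < \<nu> i}"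
      using permutes_inj[OF p] by (rule inj_on_subset) simp
    ultimately show "fvar (w i) ^ \<nu> i * hl_ratio fvar (fconst t) {w i} {j \<in> {..<N}. ?\<alpha> j < \<nu> i} =
        fvar (w i) ^ \<nu> i * (\<Prod>j | j < N \<and> \<nu> j < \<nu> i.
          (fvar (w i) - fconst t * fvar (w j)) / (fvar (w i) - fvar (w j)))"
      by (simp add: hl_ratio_def prod.reindex)
  qed
  also have "\<dots> = (\<Prod>i<N. fvar (w i) ^ \<nu> i) * (\<Prod>(i, j)\<in>(SIGMA i:{..<N}. {j. j < N \<and> \<nu> j < \<nu> i}).
      (fvar (w i) - fconst t * fvar (w j)) / (fvar (w i) - fvar (w j)))"
    by (simp add: prod.distrib prod.Sigma)
  also have "(SIGMA i:{..<N}. {j. j < N \<and> \<nu> j < \<nu> i}) = {(i, j). i < N \<and> j < N \<and> \<nu> j < \<nu> i}" by auto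
  finally have e: "hl_weight fvar (fconst t) ?\<alpha> {..<N} = (\<Prod>i<N. fvar (w i) ^ \<nu> i) *
      (\<Prod>(i, j)\<in>{(i, j). i < N \<and> j < N \<and> \<nu> j < \<nu> i}.
        (fvar (w i) - fconst t * fvar (w j)) / (fvar (w i) - fvar (w j)))" .
  show ?thesis unfolding e HL_term_def by simp
qed

text \<open>Two permutations lie in the same left coset of the stabilizer exactly when they
  rearrange \<open>\<nu>\<close> into the same exponent vector, so \<open>coset_rel\<close> is the
  kernel of the map \<open>a\<close> below.\<close>

lemma HL_term_sum:
  assumes N: "\<And>i. N \<le> i \<Longrightarrow> \<nu> i = 0"
  shows "(\<Sum>C\<in>perms N // coset_rel N \<nu>. the_elem (HL_term N \<nu> t ` C)) =
    HL_sum fvar (fconst t) {..<N} (parts_mset \<nu>)"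
proof -
  define a where "a = (\<lambda>w. \<lambda>j\<in>{..<N}. \<nu> (inv_into UNIV w j))"
  have parts: "parts_mset \<nu> = pos_parts {..<N} \<nu>"
  proof -
    have "i < N" if "\<nu> i \<noteq> 0" for i using N[of i] that by (cases "i < N") auto
    then have "{i. \<nu> i \<noteq> 0} = {i \<in> {..<N}. 0 < \<nu> i}" by auto
    then show ?thesis by (simp add: parts_mset_def pos_parts_def filter_mset_image_mset)
  qed
  have rel: "coset_rel N \<nu> = {(w, w'). w \<in> perms N \<and> w' \<in> perms N \<and> a w = a w'}"
  proof -
    have "(\<forall>i<N. \<nu> ((inv_into UNIV w \<circ> w') i) = \<nu> i) \<longleftrightarrow> a w = a w'" if "w \<in> perms N" "w' \<in> perms N" for w w'
    proof -
      have p: "w' permutes {..<N}" using that by (simp add: perms_def)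
      have "a w = a w' \<longleftrightarrow> (\<forall>j\<in>{..<N}. \<nu> (inv_into UNIV w j) = \<nu> (inv_into UNIV w' j))"
        by (auto simp: a_def fun_eq_iff)
      also have "\<dots> \<longleftrightarrow> (\<forall>i\<in>{..<N}. \<nu> (inv_into UNIV w (w' i)) = \<nu> (inv_into UNIV w' (w' i)))"
        by (subst permutes_image[OF p, symmetric]) simp
      finally show ?thesis using p by (auto simp: permutes_inverses)
    qed
    then show ?thesis by (auto simp: coset_rel_def)
  qed
  have "a ` perms N = {\<alpha>. \<alpha> \<in> {..<N} \<rightarrow>\<^sub>E UNIV \<and> pos_parts {..<N} \<alpha> = parts_mset \<nu>}"
  proof (intro equalityI subsetI)
    fix \<alpha> assume "\<alpha> \<in> a ` perms N"
    then obtain w where w: "w permutes {..<N}" and \<alpha>: "\<alpha> = a w" by (auto simp: perms_def)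
    have "image_mset \<alpha> (mset_set {..<N}) = image_mset (\<lambda>j. \<nu> (inv_into UNIV w j)) (mset_set {..<N})"
      by (auto simp: \<alpha> a_def intro!: image_mset_cong)
    also have "\<dots> = image_mset \<nu> (image_mset (inv_into UNIV w) (mset_set {..<N}))"
      by (simp add: multiset.map_comp comp_def)
    also have "\<dots> = image_mset \<nu> (mset_set {..<N})"
      using permutes_inv[OF w] by (simp add: permutes_image_mset)
    finally show "\<alpha> \<in> {\<alpha>. \<alpha> \<in> {..<N} \<rightarrow>\<^sub>E UNIV \<and> pos_parts {..<N} \<alpha> = parts_mset \<nu>}"
      unfolding parts by (auto simp: pos_parts_def \<alpha> a_def)
  next
    fix \<alpha> assume \<alpha>: "\<alpha> \<in> {\<alpha>. \<alpha> \<in> {..<N} \<rightarrow>\<^sub>E UNIV \<and> pos_parts {..<N} \<alpha> = parts_mset \<nu>}"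
    \<comment> \<open>Both multisets have N elements, so equal positive parts force equally many
      zeros; a permutation matching the two vectors then exists.\<close>
    have "image_mset \<nu> (mset_set {..<N}) = image_mset \<alpha> (mset_set {..<N})" (is "?A = ?B")
    proof -
      have pos: "filter_mset (\<lambda>m. 0 < m) ?A = filter_mset (\<lambda>m. 0 < m) ?B"
        using \<alpha> by (simp add: parts pos_parts_def)
      have split: "Z = filter_mset (\<lambda>m. 0 < m) Z + replicate_mset (size Z - size (filter_mset (\<lambda>m. 0 < m) Z)) 0"
        for Z :: "nat multiset"
        by (induction Z) (auto simp: Suc_diff_le size_filter_mset_lesseq)
      have "?A = filter_mset (\<lambda>m. 0 < m) ?B + replicate_mset (size ?B - size (filter_mset (\<lambda>m. 0 < m) ?B)) 0"
        using split[of ?A] by (simp only: pos size_image_mset)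
      also have "\<dots> = ?B" by (rule split[symmetric])
      finally show ?thesis .
    qed
    then obtain p where p: "p permutes {..<N}" "\<forall>x\<in>{..<N}. \<nu> x = \<alpha> (p x)"
      by (rule image_mset_eq_implies_permutes[OF finite_lessThan])
    have "\<alpha> = a p"
    proof
      fix j
      show "\<alpha> j = a p j"
      proof (cases "j < N")
        case True
        then have "inv_into UNIV p j \<in> {..<N}" using permutes_in_image[OF permutes_inv[OF p(1)]] by simp
        from p(2)[THEN bspec, OF this] show ?thesis using True p(1) by (simp add: a_def permutes_inverses)
      qed (use \<alpha> in \<open>auto simp: a_def PiE_iff extensional_def\<close>)
    qed
    then show "\<alpha> \<in> a ` perms N" using p(1) by (auto simp: perms_def)
  qed
  then have "HL_sum fvar (fconst t) {..<N} (parts_mset \<nu>) =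
      (\<Sum>\<alpha>\<in>a ` perms N. hl_weight fvar (fconst t) \<alpha> {..<N})"
    by (simp add: HL_sum_def)
  also have "\<dots> = (\<Sum>C\<in>perms N // coset_rel N \<nu>. the_elem ((\<lambda>w. hl_weight fvar (fconst t) (a w) {..<N}) ` C))"
    unfolding rel by (rule sum_quotient_kernel[symmetric])
  also have "\<dots> = (\<Sum>C\<in>perms N // coset_rel N \<nu>. the_elem (HL_term N \<nu> t ` C))"
  proof (rule sum.cong[OF refl])
    fix C assume "C \<in> perms N // coset_rel N \<nu>"
    then have "C \<subseteq> perms N" unfolding rel by (auto elim!: quotientE)
    then have "HL_term N \<nu> t ` C = (\<lambda>w. hl_weight fvar (fconst t) (a w) {..<N}) ` C"
      unfolding a_def by (intro image_cong refl HL_term_eq) blast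
    then show "the_elem ((\<lambda>w. hl_weight fvar (fconst t) (a w) {..<N}) ` C) = the_elem (HL_term N \<nu> t ` C)"
      by simp
  qed
  finally show ?thesis by simp
qed

text \<open>Once N is past the length of \<open>\<nu>\<close>, \<open>HL_finite N \<nu> t\<close> is
  the truncation to N variables of the series from \<open>HL_sum_sym\<close>; injectivity of
  \<open>to_fract\<close> resolves the description operator. Each coefficient is then eventually
  constant in N, so the limit is that series.\<close>

theorem HL_restr:
  assumes t: "inj (\<lambda>k::nat. t ^ k)" and \<nu>: "is_partition \<nu>"
  shows "finite S \<Longrightarrow> to_fract (restr S (HL \<nu> t)) = HL_sum fvar (fconst t) S (parts_mset \<nu>)"
proof -
  have fin: "finite {i. \<nu> i \<noteq> 0}" using \<nu> by (simp add: is_partition_def)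
  then obtain N0 where N0: "\<And>i. N0 \<le> i \<Longrightarrow> \<nu> i = 0"
    by (metis (mono_tags, lifting) finite_nat_set_iff_bounded mem_Collect_eq not_le)
  have "0 \<notin># parts_mset \<nu>" using fin by (auto simp: parts_mset_def)
  from HL_sum_sym[OF t this] obtain F where
    F: "\<And>S. finite S \<Longrightarrow> HL_sum fvar (fconst t) S (parts_mset \<nu>) = to_fract (restr S F)" by blast
  have HLN: "HL_finite N \<nu> t = restr {..<N} F" if "N0 \<le> N" for N
    unfolding HL_finite_def using that
    by (subst HL_term_sum) (auto intro: N0 simp: F)
  have "HL \<nu> t = F"
  proof (rule mseries_eqI)
    fix m
    have "\<forall>\<^sub>F N in sequentially. coeff_of (HL_finite N \<nu> t) m = coeff_of F m"
    proof (rule eventually_sequentiallyI)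
      fix N assume N: "max N0 (Suc (Max (insert 0 (set_mset m)))) \<le> N"
      have "i < N" if "i \<in># m" for i
      proof -
        have "i \<le> Max (insert 0 (set_mset m))" using that by (intro Max_ge) auto
        then show ?thesis using N by linarith
      qed
      then show "coeff_of (HL_finite N \<nu> t) m = coeff_of F m"
        using N by (auto simp: HLN restr.rep_eq)
    qed
    then have "(\<lambda>N. coeff_of (HL_finite N \<nu> t) m) \<longlonglongrightarrow> coeff_of F m"
      by (rule tendsto_eventually)
    then show "coeff_of (HL \<nu> t) m = coeff_of F m"
      by (simp add: HL_def Series_inverse limI)
  qed
  then show "finite S \<Longrightarrow> to_fract (restr S (HL \<nu> t)) = HL_sum fvar (fconst t) S (parts_mset \<nu>)"
    by (simp add: F)
qed

section \<open>Summation over partitions\<close>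

definition partitions_of :: "nat \<Rightarrow> (nat \<Rightarrow> nat) set" where
  "partitions_of n = {\<nu>. is_partition \<nu> \<and> part_size \<nu> = n}"

definition part_len :: "(nat \<Rightarrow> nat) \<Rightarrow> nat" where
  "part_len \<nu> = card {i. \<nu> i \<noteq> 0}"

lemma partition_level_finite: "is_partition \<nu> \<Longrightarrow> 0 < r \<Longrightarrow> finite {i. r \<le> \<nu> i}"
  unfolding is_partition_def by (rule finite_subset[of _ "{i. \<nu> i \<noteq> 0}"]) auto

lemma partition_level:
  assumes \<nu>: "is_partition \<nu>" and r: "0 < r"
  shows "{i. r \<le> \<nu> i} = {..<card {i. r \<le> \<nu> i}}"
proof -
  let ?A = "{i. r \<le> \<nu> i}"
  have fin: "finite ?A" by (rule partition_level_finite[OF assms])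
  have down: "j \<in> ?A" if "i \<in> ?A" "j \<le> i" for i j
    using \<nu> that by (auto simp: is_partition_def antimono_def intro: order_trans)
  have "\<exists>k. \<forall>i. i \<in> ?A \<longleftrightarrow> i < k"
  proof -
    obtain k where k: "k \<notin> ?A" using fin by (metis ex_new_if_finite infinite_UNIV_nat)
    define k0 where "k0 = (LEAST k. k \<notin> ?A)"
    have "k0 \<notin> ?A" unfolding k0_def using k by (rule LeastI)
    moreover have "i \<in> ?A" if "i < k0" for i using that not_less_Least unfolding k0_def by blast
    ultimately have "i \<in> ?A \<longleftrightarrow> i < k0" for i using down[of i k0] by (cases "i < k0") auto
    then show ?thesis by blast
  qed
  then obtain k where "\<forall>i. i \<in> ?A \<longleftrightarrow> i < k" by (elim exE)
  then have A: "?A = {..<k}" by auto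
  show ?thesis by (simp only: A card_lessThan)
qed

text \<open>The numbers compared are the parts of the conjugate partitions.\<close>

lemma partition_eqI:
  assumes "is_partition \<nu>" "is_partition \<nu>'"
    and "\<And>r. 0 < r \<Longrightarrow> card {i. r \<le> \<nu> i} = card {i. r \<le> \<nu>' i}"
  shows "\<nu> = \<nu>'"
proof
  fix i
  have "r \<le> \<nu> i \<longleftrightarrow> r \<le> \<nu>' i" if "0 < r" for r
  proof -
    have "{i. r \<le> \<nu> i} = {..<card {i. r \<le> \<nu>' i}}"
      unfolding assms(3)[OF that, symmetric] by (rule partition_level[OF assms(1) that])
    also have "\<dots> = {i. r \<le> \<nu>' i}" by (rule partition_level[OF assms(2) that, symmetric])
    finally show ?thesis by blast
  qed
  from this[of "\<nu> i"] this[of "\<nu>' i"] show "\<nu> i = \<nu>' i"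
    by (cases "\<nu> i = 0"; cases "\<nu>' i = 0") auto
qed

lemma size_filter_parts_mset:
  assumes "is_partition \<nu>" "0 < r"
  shows "size (filter_mset (\<lambda>m. r \<le> m) (parts_mset \<nu>)) = card {i. r \<le> \<nu> i}"
proof -
  have "{i \<in> {i. \<nu> i \<noteq> 0}. r \<le> \<nu> i} = {i. r \<le> \<nu> i}" using assms(2) by auto
  then show ?thesis
    using assms by (simp add: parts_mset_def filter_mset_image_mset filter_mset_mset_set is_partition_def)
qed

text \<open>Injectivity is read off the column lengths; for surjectivity the parts are sorted
  decreasingly and padded by zeros.\<close>

lemma bij_betw_parts_mset:
  "bij_betw parts_mset (partitions_of n) {M. 0 \<notin># M \<and> sum_mset M = n}"
  unfolding bij_betw_def
proof
  show "inj_on parts_mset (partitions_of n)"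
  proof (rule inj_onI)
    fix \<nu> \<nu>' assume \<nu>: "\<nu> \<in> partitions_of n" "\<nu>' \<in> partitions_of n" "parts_mset \<nu> = parts_mset \<nu>'"
    show "\<nu> = \<nu>'"
      using \<nu> by (intro partition_eqI) (auto simp: partitions_of_def simp flip: size_filter_parts_mset)
  qed
  show "parts_mset ` partitions_of n = {M. 0 \<notin># M \<and> sum_mset M = n}"
  proof (intro equalityI subsetI)
    fix M assume "M \<in> parts_mset ` partitions_of n"
    then show "M \<in> {M. 0 \<notin># M \<and> sum_mset M = n}"
      by (auto simp: partitions_of_def parts_mset_def part_size_def is_partition_def sum_unfold_sum_mset)
  next
    fix M :: "nat multiset" assume M: "M \<in> {M. 0 \<notin># M \<and> sum_mset M = n}"
    define L where "L = rev (sorted_list_of_multiset M)"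
    have L: "mset L = M" by (simp add: L_def)
    define \<nu> where "\<nu> = (\<lambda>i. if i < length L then L ! i else 0)"
    have pos: "L ! i \<noteq> 0" if "i < length L" for i
      using that M L nth_mem_mset[of i L] by (metis mem_Collect_eq)
    have supp: "{i. \<nu> i \<noteq> 0} = {..<length L}" using pos by (auto simp: \<nu>_def)
    have "antimono \<nu>"
    proof (rule antimonoI)
      fix i j :: nat assume "i \<le> j"
      moreover have "sorted (rev L)" by (simp add: L_def)
      ultimately show "\<nu> j \<le> \<nu> i" by (auto simp: \<nu>_def sorted_rev_nth_mono)
    qed
    then have part: "is_partition \<nu>" unfolding is_partition_def supp by simp
    have "parts_mset \<nu> = image_mset (\<lambda>i. L ! i) (mset_set {..<length L})"
      unfolding parts_mset_def supp by (rule image_mset_cong) (auto simp: \<nu>_def)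
    also have "\<dots> = mset (map (\<lambda>i. L ! i) [0..<length L])"
      by (simp flip: mset_set_upto_eq_mset_upto atLeast0LessThan)
    finally have "parts_mset \<nu> = M" by (simp add: map_nth L)
    moreover have "part_size \<nu> = sum_mset (parts_mset \<nu>)"
      by (simp add: part_size_def parts_mset_def sum_unfold_sum_mset)
    ultimately show "M \<in> parts_mset ` partitions_of n"
      using M part by (auto simp: partitions_of_def intro!: image_eqI[of _ _ \<nu>])
  qed
qed

lemma finite_partitions_of: "finite (partitions_of n)"
  using bij_betw_finite[OF bij_betw_parts_mset] finite_partitions by blast

lemma sum_lessThan_choose: "(\<Sum>i<c. i) = (c choose 2)"
proof (induction c)
  case (Suc c)
  have "Suc c choose 2 = (c choose 2) + c" by (simp add: numeral_2_eq_2)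
  then show ?case using Suc by simp
qed (simp add: numeral_2_eq_2)

lemma partition_le_size:
  assumes "\<nu> \<in> partitions_of n"
  shows "\<nu> i \<le> n"
proof (cases "\<nu> i = 0")
  case False
  then have "\<nu> i \<le> sum \<nu> {i. \<nu> i \<noteq> 0}"
    using assms by (intro member_le_sum) (auto simp: partitions_of_def is_partition_def)
  then show ?thesis using assms by (simp add: partitions_of_def part_size_def)
qed simp

text \<open>In a column of length c the occupied rows are 0, ..., c - 1, and these indices add up to
  c choose 2.\<close>

lemma part_n_eq:
  assumes \<nu>: "\<nu> \<in> partitions_of n"
  shows "part_n \<nu> = (\<Sum>r\<in>{1..n}. card {i. r \<le> \<nu> i} choose 2)"
proof -
  let ?A = "{i. \<nu> i \<noteq> 0}"
  have part: "is_partition \<nu>" and fin: "finite ?A"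
    using \<nu> by (auto simp: partitions_of_def is_partition_def)
  have "part_n \<nu> = (\<Sum>i\<in>?A. \<Sum>r | r \<in> {1..n} \<and> r \<le> \<nu> i. i)"
    unfolding part_n_def
  proof (rule sum.cong[OF refl])
    fix i assume "i \<in> ?A"
    have "{r \<in> {1..n}. r \<le> \<nu> i} = {1..\<nu> i}" using partition_le_size[OF \<nu>, of i] by auto
    then show "i * \<nu> i = (\<Sum>r | r \<in> {1..n} \<and> r \<le> \<nu> i. i)" by simp
  qed
  also have "\<dots> = (\<Sum>r\<in>{1..n}. \<Sum>i | i \<in> ?A \<and> r \<le> \<nu> i. i)"
    by (rule sum.swap_restrict[OF fin]) simp
  also have "\<dots> = (\<Sum>r\<in>{1..n}. card {i. r \<le> \<nu> i} choose 2)"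
  proof (rule sum.cong[OF refl])
    fix r assume r: "r \<in> {1..n}"
    then have "{i. i \<in> ?A \<and> r \<le> \<nu> i} = {i. r \<le> \<nu> i}" by auto
    also have "\<dots> = {..<card {i. r \<le> \<nu> i}}" using partition_level[OF part] r by simp
    finally show "(\<Sum>i | i \<in> ?A \<and> r \<le> \<nu> i. i) = (card {i. r \<le> \<nu> i} choose 2)"
      by (simp only: sum_lessThan_choose)
  qed
  finally show ?thesis .
qed

context
  fixes q :: nat
  assumes q: "2 \<le> q"
begin

lemma inj_inverse_power: "inj (\<lambda>k::nat. (1 / of_nat q :: complex) ^ k)"
proof (rule injI)
  fix a b :: nat assume "(1 / of_nat q :: complex) ^ a = (1 / of_nat q) ^ b"
  then have "(of_nat (q ^ a) :: complex) = of_nat (q ^ b)"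
    using q by (simp add: power_one_over field_simps)
  then have "q ^ a = q ^ b" by (simp only: of_nat_eq_iff)
  then show "a = b" using q by (simp add: power_inject_exp)
qed

text \<open>This is \<open>sum_HL_sum\<close> at t = 1/q and y = q. Since t^j - q = t^j (1 -
  q^(j+1)), \<open>q_falling\<close> yields both the product over the length and the power of t
  belonging to the first column, which completes the exponent to \<open>part_n\<close>. The case n =
  0 is separate because the column r = 1 has to lie in the range {1..n}.\<close>

lemma sum_HL_tilde:
  "(\<Sum>\<nu>\<in>partitions_of n. const (\<Prod>j<part_len \<nu>. 1 - of_nat q ^ Suc j) * HL_tilde \<nu> q) = EH_sym (of_nat q) n"
proof (cases "n = 0")
  case True
  have "partitions_of 0 = {\<lambda>i. 0}"
    by (auto simp: partitions_of_def part_size_def is_partition_def antimono_def fun_eq_iff)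
  moreover have "HL_tilde (\<lambda>i. 0) q = 1"
  proof -
    have "HL (\<lambda>i. 0) (1 / of_nat q) = 1"
    proof (rule restr_eqI)
      fix S :: "nat set" assume S: "finite S"
      have "to_fract (restr S (HL (\<lambda>i. 0) (1 / of_nat q))) = 1"
        using HL_restr[OF inj_inverse_power _ S, of "\<lambda>i. 0"] S
        by (simp add: is_partition_def antimono_def parts_mset_def HL_sum_empty)
      then show "restr S (HL (\<lambda>i. 0) (1 / of_nat q)) = restr S 1"
        using to_fract_eq_iff[of "restr S (HL (\<lambda>i. 0) (1 / of_nat q))" 1] by simp
    qed
    then show ?thesis by (simp add: HL_tilde_def part_n_def const_1)
  qed
  ultimately show ?thesis using True by (simp add: part_len_def EH_sym_def const_1)
next
  case n: False
  let ?t = "1 / of_nat q :: complex"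
  have coeff: "(\<Prod>j<part_len \<nu>. 1 - of_nat q ^ Suc j) * (1 / of_nat q ^ part_n \<nu>) =
      q_falling ?t (of_nat q) (size (parts_mset \<nu>)) *
      ?t ^ (\<Sum>r\<in>{2..n}. size (filter_mset (\<lambda>m. r \<le> m) (parts_mset \<nu>)) choose 2)"
    if \<nu>: "\<nu> \<in> partitions_of n" for \<nu>
  proof -
    have part: "is_partition \<nu>" using \<nu> by (simp add: partitions_of_def)
    have "{1..n} = insert 1 {2..n}" using n by auto
    moreover have "{i. 1 \<le> \<nu> i} = {i. \<nu> i \<noteq> 0}" by auto
    ultimately have "part_n \<nu> = (part_len \<nu> choose 2) +
        (\<Sum>r\<in>{2..n}. size (filter_mset (\<lambda>m. r \<le> m) (parts_mset \<nu>)) choose 2)"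
      unfolding part_n_eq[OF \<nu>] part_len_def
      by (simp add: size_filter_parts_mset[OF part] cong: sum.cong_simp)
    moreover have "size (parts_mset \<nu>) = part_len \<nu>" by (simp add: parts_mset_def part_len_def)
    moreover have "q_falling ?t (of_nat q) r = ?t ^ (r choose 2) * (\<Prod>j<r. 1 - of_nat q ^ Suc j)" for r
    proof -
      have "?t ^ j - of_nat q = ?t ^ j * (1 - of_nat q ^ Suc j)" for j
        using q by (simp add: field_simps power_one_over)
      then have "q_falling ?t (of_nat q) r = (\<Prod>j<r. ?t ^ j) * (\<Prod>j<r. 1 - of_nat q ^ Suc j)"
        unfolding q_falling_def by (simp only: prod.distrib)
      then show ?thesis by (simp only: power_sum[symmetric] sum_lessThan_choose)
    qed
    ultimately show ?thesis by (simp add: power_add power_one_over)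
  qed
  show ?thesis
  proof (rule restr_eqI)
    fix S :: "nat set" assume S: "finite S"
    have "to_fract (restr S (\<Sum>\<nu>\<in>partitions_of n. const (\<Prod>j<part_len \<nu>. 1 - of_nat q ^ Suc j) * HL_tilde \<nu> q)) =
        (\<Sum>\<nu>\<in>partitions_of n. fconst ((\<Prod>j<part_len \<nu>. 1 - of_nat q ^ Suc j) * (1 / of_nat q ^ part_n \<nu>)) *
          HL_sum fvar (fconst ?t) S (parts_mset \<nu>))"
      unfolding restr_sum to_fract_sum
    proof (rule sum.cong[OF refl])
      fix \<nu> assume "\<nu> \<in> partitions_of n"
      then have "HL_sum fvar (fconst ?t) S (parts_mset \<nu>) = to_fract (restr S (HL \<nu> ?t))"
        using HL_restr[OF inj_inverse_power _ S] by (simp add: partitions_of_def)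
      then show "to_fract (restr S (const (\<Prod>j<part_len \<nu>. 1 - of_nat q ^ Suc j) * HL_tilde \<nu> q)) =
          fconst ((\<Prod>j<part_len \<nu>. 1 - of_nat q ^ Suc j) * (1 / of_nat q ^ part_n \<nu>)) *
          HL_sum fvar (fconst ?t) S (parts_mset \<nu>)"
        by (simp only: HL_tilde_def restr_mult restr_const to_fract_mult fconst_simps(1) mult.assoc)
    qed
    also have "\<dots> = (\<Sum>\<nu>\<in>partitions_of n. q_falling (fconst ?t) (fconst (of_nat q)) (size (parts_mset \<nu>)) *
        fconst ?t ^ (\<Sum>r\<in>{2..n}. size (filter_mset (\<lambda>m. r \<le> m) (parts_mset \<nu>)) choose 2) *
        HL_sum fvar (fconst ?t) S (parts_mset \<nu>))"
    proof (rule sum.cong[OF refl])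
      fix \<nu> assume "\<nu> \<in> partitions_of n"
      have "fconst (q_falling a b r) = q_falling (fconst a) (fconst b) r" for a b r
      proof -
        have "fconst (prod f {..<r}) = (\<Prod>j<r. fconst (f j))" for f :: "nat \<Rightarrow> complex" and r
          by (induction r) (simp_all only: prod.lessThan_Suc fconst_simps lessThan_0 prod.empty)
        then show ?thesis by (simp only: q_falling_def fconst_simps)
      qed
      then show "fconst ((\<Prod>j<part_len \<nu>. 1 - of_nat q ^ Suc j) * (1 / of_nat q ^ part_n \<nu>)) *
          HL_sum fvar (fconst ?t) S (parts_mset \<nu>) =
          q_falling (fconst ?t) (fconst (of_nat q)) (size (parts_mset \<nu>)) *
          fconst ?t ^ (\<Sum>r\<in>{2..n}. size (filter_mset (\<lambda>m. r \<le> m) (parts_mset \<nu>)) choose 2) *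
          HL_sum fvar (fconst ?t) S (parts_mset \<nu>)"
        by (simp only: coeff[OF \<open>\<nu> \<in> partitions_of n\<close>] fconst_simps)
    qed
    also have "\<dots> = (\<Sum>M | 0 \<notin># M \<and> sum_mset M = n. q_falling (fconst ?t) (fconst (of_nat q)) (size M) *
        fconst ?t ^ (\<Sum>r\<in>{2..n}. size (filter_mset (\<lambda>m. r \<le> m) M) choose 2) *
        HL_sum fvar (fconst ?t) S M)"
      by (rule sum.reindex_bij_betw[OF bij_betw_parts_mset])
    also have "\<dots> = to_fract (restr S (EH_sym (of_nat q) n))"
      using sum_HL_sum[OF S fvar_inj fvar_nz inj_fconst_power[OF inj_inverse_power], of "fconst (of_nat q)" n]
        E_H_fps_fvar_nth[OF S, of "of_nat q" n] by simp
    finally show "restr S (\<Sum>\<nu>\<in>partitions_of n. const (\<Prod>j<part_len \<nu>. 1 - of_nat q ^ Suc j) * HL_tilde \<nu> q) =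
        restr S (EH_sym (of_nat q) n)" by (simp only: to_fract_eq_iff)
  qed
qed

lemma HL_tilde_one_row:
  assumes n: "0 < n"
  shows "const (1 - 1 / of_nat q) * HL_tilde (one_row n) q = EH_sym (1 / of_nat q) n"
proof -
  let ?t = "1 / of_nat q :: complex"
  have part: "is_partition (one_row n)"
    by (auto simp: is_partition_def one_row_def antimono_def)
  have supp: "{i. one_row n i \<noteq> 0} = {0}" using n by (auto simp: one_row_def)
  have parts: "parts_mset (one_row n) = {#n#}" unfolding parts_mset_def supp by (simp add: one_row_def)
  have "part_n (one_row n) = 0" unfolding part_n_def supp by simp
  then have tilde: "HL_tilde (one_row n) q = HL (one_row n) ?t" by (simp add: HL_tilde_def const_1)
  show ?thesis
  proof (rule restr_eqI)
    fix S :: "nat set" assume S: "finite S"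
    have "?t \<noteq> 1" using q by simp
    then have "fconst ?t \<noteq> 1" using fconst_eq_iff[of ?t 1] by (simp add: const_1)
    then have "(1 - fconst ?t) * to_fract (restr S (HL (one_row n) ?t)) = to_fract (restr S (EH_sym ?t n))"
      using HL_sum_one_row[OF S fvar_inj fvar_nz n, of "fconst ?t"] HL_restr[OF inj_inverse_power part S]
        E_H_fps_fvar_nth[OF S, of ?t n] by (simp add: parts)
    then have "to_fract (restr S (const (1 - ?t) * HL_tilde (one_row n) q)) = to_fract (restr S (EH_sym ?t n))"
      by (simp only: tilde restr_mult restr_const to_fract_mult fconst_simps)
    then show "restr S (const (1 - ?t) * HL_tilde (one_row n) q) = restr S (EH_sym ?t n)"
      by (simp only: to_fract_eq_iff)
  qed
qed

end

section \<open>Characters of $M_n$\<close>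

text \<open>The subgroup conditions on \<open>H\<close> are bundled with the character, because the
  domain grows in the extension argument.\<close>

definition mult_char :: "'k::field set \<Rightarrow> ('k \<Rightarrow> complex) \<Rightarrow> bool" where
  "mult_char H \<chi> \<longleftrightarrow> 1 \<in> H \<and> (\<forall>x\<in>H. x \<noteq> 0 \<and> inverse x \<in> H \<and> \<chi> x \<noteq> 0) \<and>
     (\<forall>x\<in>H. \<forall>y\<in>H. x * y \<in> H \<and> \<chi> (x * y) = \<chi> x * \<chi> y)"

lemma mult_charD:
  assumes "mult_char H \<chi>"
  shows "1 \<in> H" "x \<in> H \<Longrightarrow> x \<noteq> 0" "x \<in> H \<Longrightarrow> inverse x \<in> H" "x \<in> H \<Longrightarrow> \<chi> x \<noteq> 0"
    "x \<in> H \<Longrightarrow> y \<in> H \<Longrightarrow> x * y \<in> H" "x \<in> H \<Longrightarrow> y \<in> H \<Longrightarrow> \<chi> (x * y) = \<chi> x * \<chi> y"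
  using assms by (auto simp: mult_char_def)

lemma mult_char_1: "mult_char H \<chi> \<Longrightarrow> \<chi> 1 = 1"
  using mult_charD(1)[of H \<chi>] mult_charD(4)[of H \<chi> 1] mult_charD(6)[of H \<chi> 1 1] by simp

lemma mult_char_power:
  assumes "mult_char H \<chi>" "x \<in> H"
  shows "x ^ k \<in> H \<and> \<chi> (x ^ k) = \<chi> x ^ k"
  using assms mult_charD[OF assms(1)] mult_char_1[OF assms(1)] by (induction k) auto

text \<open>\<open>m\<close> is the order of \<open>g\<close> modulo \<open>H\<close>. A relation h
  g^k = h' g^k' forces m to divide the difference of the exponents, so the only condition on the new
  value \<open>\<alpha>\<close> concerns its m-th power.\<close>

lemma mult_char_extend:
  assumes \<chi>: "mult_char H \<chi>" and g: "g \<noteq> 0" and m: "0 < m" "g ^ m \<in> H"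
    and min: "\<And>k. 0 < k \<Longrightarrow> k < m \<Longrightarrow> g ^ k \<notin> H" and \<alpha>: "\<alpha> ^ m = \<chi> (g ^ m)"
  shows "\<exists>\<chi>'. mult_char {h * g ^ k | h k. h \<in> H} \<chi>' \<and> (\<forall>h\<in>H. \<chi>' h = \<chi> h) \<and> \<chi>' g = \<alpha>"
proof -
  note D = mult_charD[OF \<chi>]
  let ?H' = "{h * g ^ k | h k. h \<in> H}"
  have \<alpha>0: "\<alpha> \<noteq> 0" using \<alpha> D(4)[OF m(2)] zero_power[OF m(1)] by metis
  have pow: "m dvd k \<and> \<chi> (g ^ k) = \<alpha> ^ k" if k: "g ^ k \<in> H" for k
  proof -
    define a where "a = g ^ m"
    have a: "a ^ (k div m) \<in> H" "\<chi> (a ^ (k div m)) = \<chi> a ^ (k div m)"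
      using mult_char_power[OF \<chi>, of a] m(2) by (simp_all add: a_def)
    have gk: "g ^ k = a ^ (k div m) * g ^ (k mod m)"
      by (simp add: a_def flip: power_mult power_add)
    have "inverse (a ^ (k div m)) * g ^ k = g ^ (k mod m)"
      unfolding gk using g by (simp add: a_def)
    then have "g ^ (k mod m) \<in> H" using D(5)[OF D(3)[OF a(1)] k] by simp
    then have 0: "k mod m = 0" using min[of "k mod m"] m(1) by (cases "k mod m = 0") auto
    then have "\<chi> (g ^ k) = (\<alpha> ^ m) ^ (k div m)" using gk a(2) by (simp add: \<alpha> a_def)
    also have "\<dots> = \<alpha> ^ k" using mult_div_mod_eq[of m k] 0 by (simp flip: power_mult)
    finally show ?thesis using 0 by auto
  qed
  have wd: "\<chi> h * \<alpha> ^ k = \<chi> h' * \<alpha> ^ k'" if eq: "h * g ^ k = h' * g ^ k'" and h: "h \<in> H" "h' \<in> H" for h h' k k'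
  proof -
    have *: "\<chi> h * \<alpha> ^ k = \<chi> h' * \<alpha> ^ k'" if eq: "h * g ^ k = h' * g ^ k'" and h: "h \<in> H" "h' \<in> H" and le: "k \<le> k'" for h h' k k'
    proof -
      have "g ^ k' = g ^ k * g ^ (k' - k)" using le by (simp flip: power_add)
      then have "h * g ^ k = (h' * g ^ (k' - k)) * g ^ k" using eq by simp
      then have hh: "h = h' * g ^ (k' - k)" using g by simp
      then have "inverse h' * h = g ^ (k' - k)" using D(2)[OF h(2)] by simp
      then have gH: "g ^ (k' - k) \<in> H" using D(5)[OF D(3)[OF h(2)] h(1)] by simp
      have "\<chi> h = \<chi> h' * \<alpha> ^ (k' - k)" using D(6)[OF h(2) gH] pow[OF gH] by (simp add: hh)
      moreover have "\<alpha> ^ k' = \<alpha> ^ (k' - k) * \<alpha> ^ k" using le by (simp flip: power_add)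
      ultimately show ?thesis by simp
    qed
    show ?thesis
    proof (cases "k \<le> k'")
      case True
      then show ?thesis by (rule *[OF eq h])
    next
      case False
      then show ?thesis using *[OF eq[symmetric] h(2,1)] by simp
    qed
  qed
  \<comment> \<open>Any representation h g^k may be chosen, by the independence \<open>wd\<close>
    just shown.\<close>
  define \<chi>' where "\<chi>' = (\<lambda>w. let p = SOME p. fst p \<in> H \<and> w = fst p * g ^ snd p in \<chi> (fst p) * \<alpha> ^ snd p)"
  have \<chi>': "\<chi>' (h * g ^ k) = \<chi> h * \<alpha> ^ k" if h: "h \<in> H" for h k
  proof -
    define p where "p = (SOME p. fst p \<in> H \<and> h * g ^ k = fst p * g ^ snd p)"
    have "fst p \<in> H \<and> h * g ^ k = fst p * g ^ snd p"
      unfolding p_def by (rule someI[of _ "(h, k)"]) (use h in simp)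
    then have "\<chi> (fst p) * \<alpha> ^ snd p = \<chi> h * \<alpha> ^ k" using wd[of "fst p" "snd p" h k] h by simp
    then show ?thesis by (simp add: \<chi>'_def Let_def p_def)
  qed
  have "mult_char ?H' \<chi>'"
    unfolding mult_char_def
  proof (intro conjI ballI)
    show "1 \<in> ?H'" using D(1) by (intro CollectI exI[of _ 1] exI[of _ 0]) simp
  next
    fix x assume "x \<in> ?H'"
    then obtain h k where h: "h \<in> H" "x = h * g ^ k" by auto
    show "x \<noteq> 0" using D(2)[OF h(1)] g by (simp add: h)
    show "\<chi>' x \<noteq> 0" using D(4)[OF h(1)] \<alpha>0 by (simp add: h \<chi>')
    \<comment> \<open>The inverse of g^k is written as the inverse of (g^m)^k times g^((m-1) k), so
      that g occurs with a natural exponent.\<close>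
    have "g ^ (m * k) = g ^ ((m - 1) * k) * g ^ k"
      using m(1) by (simp add: algebra_simps flip: power_add)
    then have "inverse x = (inverse h * inverse ((g ^ m) ^ k)) * g ^ ((m - 1) * k)"
      using g D(2)[OF h(1)] by (simp add: h field_simps flip: power_mult)
    moreover have "inverse h * inverse ((g ^ m) ^ k) \<in> H"
      using mult_char_power[OF \<chi> m(2), of k] h(1) by (intro D) auto
    ultimately show "inverse x \<in> ?H'" by blast
  next
    fix x y assume "x \<in> ?H'" "y \<in> ?H'"
    then obtain h k h' k' where h: "h \<in> H" "x = h * g ^ k" "h' \<in> H" "y = h' * g ^ k'" by auto
    have xy: "x * y = (h * h') * g ^ (k + k')" by (simp add: h power_add)
    show "x * y \<in> ?H'" using D(5)[OF h(1,3)] xy by blast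
    show "\<chi>' (x * y) = \<chi>' x * \<chi>' y"
      unfolding xy \<chi>'[OF D(5)[OF h(1,3)]]
      by (simp add: h(2,4) \<chi>'[OF h(1)] \<chi>'[OF h(3)] D(6)[OF h(1,3)] power_add)
  qed
  moreover have "\<forall>h\<in>H. \<chi>' h = \<chi> h" using \<chi>'[of _ 0] by simp
  moreover have "\<chi>' g = \<alpha>" using \<chi>'[OF D(1), of 1] mult_char_1[OF \<chi>] by simp
  ultimately show ?thesis by blast
qed

text \<open>To the trivial subgroup \<open>z\<close> is adjoined with a primitive root of unity as
  its value, which is not 1 because the relative order exceeds 1. A maximal subgroup carrying a
  character with value other than 1 at \<open>z\<close> must then be all of \<open>G\<close>, by one
  more extension.\<close>

lemma mult_char_separates:
  assumes fin: "finite G" and one: "1 \<in> G" and nz: "\<And>x. x \<in> G \<Longrightarrow> x \<noteq> 0"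
    and mult: "\<And>x y. x \<in> G \<Longrightarrow> y \<in> G \<Longrightarrow> x * y \<in> G"
    and ord: "\<And>x. x \<in> G \<Longrightarrow> x ^ M = 1" "0 < M" and z: "z \<in> G" "z \<noteq> 1"
  shows "\<exists>\<chi>. mult_char G \<chi> \<and> \<chi> z \<noteq> 1"
proof -
  have power: "x ^ k \<in> G" if "x \<in> G" for x k using that by (induction k) (auto intro: one mult)
  have extend: "\<exists>H' \<chi>'. mult_char H' \<chi>' \<and> H \<subseteq> H' \<and> g \<in> H' \<and> H' \<subseteq> G \<and> (\<forall>h\<in>H. \<chi>' h = \<chi> h) \<and> (H = {1} \<longrightarrow> \<chi>' g \<noteq> 1)"
    if \<chi>: "mult_char H \<chi>" and H: "H \<subseteq> G" and g: "g \<in> G" "g \<notin> H" for H \<chi> g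
  proof -
    define m where "m = (LEAST m. 0 < m \<and> g ^ m \<in> H)"
    have "0 < M \<and> g ^ M \<in> H" using ord g mult_charD(1)[OF \<chi>] by simp
    then have m: "0 < m \<and> g ^ m \<in> H" unfolding m_def by (rule LeastI)
    have min: "g ^ k \<notin> H" if "0 < k" "k < m" for k
      using that not_less_Least[of k "\<lambda>m. 0 < m \<and> g ^ m \<in> H"] by (auto simp: m_def)
    have m1: "1 < m" using m g(2) by (cases "m = 1") auto
    obtain \<alpha> where \<alpha>: "\<alpha> ^ m = \<chi> (g ^ m)" "H = {1} \<longrightarrow> \<alpha> \<noteq> 1"
    proof (cases "H = {1}")
      case True
      then have "\<chi> (g ^ m) = 1" using m mult_char_1[OF \<chi>] by simp
      moreover have "cis (2 * pi / real m) ^ m = 1"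
        using m by (simp add: DeMoivre)
      moreover have "cis (2 * pi / real m) \<noteq> 1"
      proof
        assume "cis (2 * pi / real m) = 1"
        then have "cos (2 * pi / real m) = 1" by (simp add: complex_eq_iff)
        then obtain k :: int where "2 * pi / real m = real_of_int k * (2 * pi)"
          by (auto simp: cos_one_2pi_int)
        then have "1 = real_of_int k * real m" using m by (simp add: field_simps)
        then have "1 = k * int m" by (metis of_int_1 of_int_eq_iff of_int_mult of_int_of_nat_eq)
        then have "int m dvd 1" by (metis dvd_triv_right)
        then show False using m1 by simp
      qed
      ultimately show thesis using that[of "cis (2 * pi / real m)"] by simp
    next
      case False
      then show thesis using that nth_root_exists[of m "\<chi> (g ^ m)"] m by auto
    qed
    obtain \<chi>' where \<chi>': "mult_char {h * g ^ k | h k. h \<in> H} \<chi>'" "\<forall>h\<in>H. \<chi>' h = \<chi> h" "\<chi>' g = \<alpha>"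
      using mult_char_extend[OF \<chi> nz[OF g(1)] _ _ min \<alpha>(1)] m by blast
    have "H \<subseteq> {h * g ^ k | h k. h \<in> H}" by (auto intro: exI[of _ 0] simp: exI[of _ 0])
         (metis mult.right_neutral power_0)
    moreover have "g \<in> {h * g ^ k | h k. h \<in> H}"
      using mult_charD(1)[OF \<chi>] by (auto intro!: exI[of _ 1])
    moreover have "{h * g ^ k | h k. h \<in> H} \<subseteq> G" using H g power mult by blast
    ultimately show ?thesis using \<chi>' \<alpha>(2) by blast
  qed
  define F where "F = {H. H \<subseteq> G \<and> (\<exists>\<chi>. mult_char H \<chi> \<and> z \<in> H \<and> \<chi> z \<noteq> 1)}"
  have "mult_char {1} (\<lambda>_. 1)" by (simp add: mult_char_def)
  from extend[OF this _ z(1)] have "F \<noteq> {}"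
    using one z(2) by (auto simp: F_def)
  moreover have "finite F" by (rule finite_subset[of _ "Pow G"]) (use fin in \<open>auto simp: F_def\<close>)
  ultimately obtain H where H: "H \<in> F" "\<And>H'. H' \<in> F \<Longrightarrow> H \<subseteq> H' \<Longrightarrow> H' = H"
    using finite_has_maximal[of F] by blast
  then obtain \<chi> where \<chi>: "H \<subseteq> G" "mult_char H \<chi>" "z \<in> H" "\<chi> z \<noteq> 1" by (auto simp: F_def)
  have "H = G"
  proof (rule ccontr)
    assume "H \<noteq> G"
    then obtain g where g: "g \<in> G" "g \<notin> H" using \<chi>(1) by blast
    from extend[OF \<chi>(2,1) g] obtain H' \<chi>' where
      H': "mult_char H' \<chi>'" "H \<subseteq> H'" "g \<in> H'" "H' \<subseteq> G" "\<forall>h\<in>H. \<chi>' h = \<chi> h" by blast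
    have "H' \<in> F" using H' \<chi> by (auto simp: F_def)
    then show False using H(2) H' g by blast
  qed
  then show ?thesis using \<chi> by blast
qed

lemma card_funpow_orbit:
  assumes "(f ^^ n) x = x" "0 < n"
  shows "card (range (\<lambda>k. (f ^^ k) x)) dvd n \<and> 0 < card (range (\<lambda>k. (f ^^ k) x))"
proof -
  define p where "p = (LEAST p. 0 < p \<and> (f ^^ p) x = x)"
  have "0 < n \<and> (f ^^ n) x = x" using assms by simp
  then have p: "0 < p \<and> (f ^^ p) x = x" unfolding p_def by (rule LeastI)
  have min: "p \<le> k" if "0 < k" "(f ^^ k) x = x" for k
    unfolding p_def by (rule Least_le) (use that in simp)
  have "range (\<lambda>k. (f ^^ k) x) = (\<lambda>k. (f ^^ k) x) ` {..<p}"
  proof (intro equalityI subsetI)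
    fix y assume "y \<in> range (\<lambda>k. (f ^^ k) x)"
    then obtain k where "y = (f ^^ k) x" by auto
    then have "y = (f ^^ (k mod p)) x" using funpow_mod_eq[of p f x k] p by simp
    then show "y \<in> (\<lambda>k. (f ^^ k) x) ` {..<p}" using p by auto
  qed auto
  moreover have "inj_on (\<lambda>k. (f ^^ k) x) {..<p}"
  proof (rule linorder_inj_onI)
    fix i j assume ij: "i < j" "i \<in> {..<p}" "j \<in> {..<p}"
    show "(f ^^ i) x \<noteq> (f ^^ j) x"
    proof
      assume "(f ^^ i) x = (f ^^ j) x"
      then have "(f ^^ (p - j)) ((f ^^ i) x) = (f ^^ (p - j)) ((f ^^ j) x)" by simp
      then have "(f ^^ (p - j + i)) x = (f ^^ (p - j + j)) x" by (simp only: funpow_add comp_def)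
      then have "(f ^^ (p - j + i)) x = x" using ij p by simp
      then show False using min[of "p - j + i"] ij by simp
    qed
  qed auto
  moreover have "p dvd n"
  proof -
    have "(f ^^ (n mod p)) x = x" using funpow_mod_eq[of p f x n] p assms by simp
    moreover have "n mod p < p" using p by simp
    ultimately have "n mod p = 0" using min[of "n mod p"] by (cases "n mod p = 0") auto
    then show ?thesis by auto
  qed
  ultimately show ?thesis using p by (simp add: card_image)
qed


section \<open>The groups M_n, their norms and the Frobenius orbits of characters\<close>

context
  fixes q :: nat and dummy :: "'a::{field,finite} itself"
  assumes q_def: "q = CARD('a)"
begin

abbreviation M_grp :: "nat \<Rightarrow> 'a alg_closure set" where "M_grp \<equiv> Mgrp"

lemma card_field_ge_2: "2 \<le> q"
  unfolding q_def using card_mono[of "UNIV :: 'a set" "{0, 1}"] by simp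

lemma Mgrp_iff: "z \<in> M_grp n \<longleftrightarrow> z \<noteq> 0 \<and> z ^ (q ^ n - 1) = 1"
proof -
  have "0 < q ^ n" using card_field_ge_2 by simp
  then have "z ^ q ^ n = z * z ^ (q ^ n - 1)" by (metis Suc_diff_1 power_Suc)
  then show ?thesis by (auto simp: Mgrp_def q_def[symmetric])
qed

lemma power_q_gt_1: "0 < n \<Longrightarrow> 1 < q ^ n"
  using card_field_ge_2 by (intro one_less_power) auto

lemma Mgrp_simps: "1 \<in> M_grp n" "x \<in> M_grp n \<Longrightarrow> y \<in> M_grp n \<Longrightarrow> x * y \<in> M_grp n"
  by (simp_all add: Mgrp_iff power_mult_distrib)

lemma finite_Mgrp:
  assumes "0 < n"
  shows "finite (M_grp n)"
proof -
  let ?p = "monom 1 (q ^ n - 1) - 1 :: 'a alg_closure poly"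
  have "coeff ?p (q ^ n - 1) = 1" using power_q_gt_1[OF assms] by (simp add: coeff_eq_0)
  then have "?p \<noteq> 0" by (metis coeff_0 zero_neq_one)
  then have "finite {z. poly ?p z = 0}" by (rule poly_roots_finite)
  then show ?thesis by (rule rev_finite_subset) (auto simp: Mgrp_iff poly_monom)
qed

text \<open>The norm is the power map with exponent (q^n - 1)/(q^m - 1);
  \<open>norm_exp_mult\<close> states this value without division.\<close>

definition norm_exp :: "nat \<Rightarrow> nat \<Rightarrow> nat" where
  "norm_exp m n = (\<Sum>i<n div m. q ^ (m * i))"

lemma Mnorm_eq: "Mnorm m n (z :: 'a alg_closure) = z ^ norm_exp m n"
  unfolding Mnorm_def norm_exp_def q_def[symmetric] by (simp add: power_sum)

lemma norm_exp_mult: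
  assumes "m dvd n"
  shows "norm_exp m n * (q ^ m - 1) = q ^ n - 1"
proof -
  have "(x - 1) * (\<Sum>i<k. x ^ i) = x ^ k - 1" if "0 < x" for x k :: nat
  proof (induction k)
    case (Suc k)
    have "(x - 1) * (\<Sum>i<Suc k. x ^ i) = x ^ k - 1 + (x - 1) * x ^ k" using Suc by (simp add: distrib_left)
    also have "\<dots> = x ^ Suc k - 1" using that by (simp add: diff_mult_distrib)
    finally show ?case .
  qed simp
  from this[of "q ^ m" "n div m"] show ?thesis
    using card_field_ge_2 assms by (simp add: norm_exp_def mult.commute flip: power_mult)
qed

lemma norm_exp_pos:
  assumes "m dvd n" "0 < n"
  shows "0 < norm_exp m n"
  using norm_exp_mult[OF assms(1)] power_q_gt_1[OF assms(2)] by (cases "norm_exp m n = 0") auto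

lemma Mnorm_in: "m dvd n \<Longrightarrow> z \<in> M_grp n \<Longrightarrow> Mnorm m n z \<in> M_grp m"
  using norm_exp_mult[of m n] by (simp add: Mnorm_eq Mgrp_iff flip: power_mult)

text \<open>A root of the power equation exists in the algebraic closure, and it lies in M_n
  automatically: raising it to the power q^n - 1 amounts to raising \<open>w\<close> to the power
  q^m - 1.\<close>

lemma Mnorm_surj:
  assumes "m dvd n" "0 < n" "w \<in> M_grp m"
  obtains z where "z \<in> M_grp n" "Mnorm m n z = w"
proof -
  obtain z where z: "z ^ norm_exp m n = w" using nth_root_exists[OF norm_exp_pos[OF assms(1,2)]] by blast
  have "z \<noteq> 0" using z assms(3) norm_exp_pos[OF assms(1,2)] by (auto simp: Mgrp_iff zero_power)
  moreover have "z ^ (q ^ n - 1) = 1"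
    unfolding norm_exp_mult[OF assms(1), symmetric] power_mult z using assms(3) by (simp add: Mgrp_iff)
  ultimately show thesis using that[of z] z by (simp add: Mgrp_iff Mnorm_eq)
qed

abbreviation M_hat :: "nat \<Rightarrow> ('a alg_closure \<Rightarrow> complex) set" where "M_hat \<equiv> Mhat"

lemma Mhat_mult_char: "\<xi> \<in> M_hat n \<Longrightarrow> mult_char (M_grp n) \<xi>"
  using Mgrp_simps by (auto simp: Mhat_def mult_char_def Mgrp_iff power_inverse)

lemma Mhat_power: "\<xi> \<in> M_hat n \<Longrightarrow> z \<in> M_grp n \<Longrightarrow> \<xi> (z ^ k) = \<xi> z ^ k"
  using mult_char_power[OF Mhat_mult_char] by blast

lemma Mhat_eqI:
  assumes "\<xi> \<in> M_hat n" "\<xi>' \<in> M_hat n" "\<And>z. z \<in> M_grp n \<Longrightarrow> \<xi> z = \<xi>' z"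
  shows "\<xi> = \<xi>'"
proof
  fix z show "\<xi> z = \<xi>' z" using assms by (cases "z \<in> M_grp n") (auto simp: Mhat_def)
qed

definition char_class :: "nat \<Rightarrow> ('a alg_closure \<Rightarrow> complex) \<Rightarrow> 'a level_char set" where
  "char_class n \<xi> = char_rel `` {(n, \<xi>)}"

lemma char_class_self:
  assumes "0 < n" "\<xi> \<in> M_hat n"
  shows "(n, \<xi>) \<in> char_class n \<xi>"
  using assms by (auto simp: char_class_def char_rel_def)

lemma char_class_in_union: "0 < n \<Longrightarrow> \<xi> \<in> M_hat n \<Longrightarrow> char_class n \<xi> \<in> char_union"
  unfolding char_union_def char_class_def by (intro quotientI) auto

text \<open>Norms are surjective, so characters of the same level that agree after embedding into a
  higher level are equal.\<close>

lemma char_val_char_class: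
  assumes "0 < n" "\<xi> \<in> M_hat n"
  shows "char_val (char_class n \<xi>) n = \<xi>"
  unfolding char_val_def
proof (rule the_equality)
  show "(n, \<xi>) \<in> char_class n \<xi>" by (rule char_class_self[OF assms])
  fix \<xi>' assume "(n, \<xi>') \<in> char_class n \<xi>"
  then obtain N where N: "\<xi>' \<in> M_hat n" "0 < N" "n dvd N" "Mhat_embed n N \<xi> = Mhat_embed n N \<xi>'"
    by (auto simp: char_class_def char_rel_def)
  show "\<xi>' = \<xi>"
  proof (rule Mhat_eqI[OF N(1) assms(2)])
    fix w assume "w \<in> M_grp n"
    then obtain z where "z \<in> M_grp N" "Mnorm n N z = w" using Mnorm_surj[OF N(3,2)] by blast
    then show "\<xi>' w = \<xi> w" using fun_cong[OF N(4), of z] by (simp add: Mhat_embed_def)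
  qed
qed

lemma char_frob_funpow: "(char_frob ^^ k) \<Xi> = (\<lambda>(n, \<xi>). (n, \<lambda>z. \<xi> z ^ (q ^ k))) ` (\<Xi> :: 'a level_char set)"
proof (induction k)
  case (Suc k)
  have "(\<lambda>(n, \<xi>). (n, \<lambda>z. \<xi> z ^ q)) ((\<lambda>(n, \<xi>). (n, \<lambda>z. \<xi> z ^ (q ^ k))) p) =
      (\<lambda>(n, \<xi>). (n, \<lambda>z. \<xi> z ^ (q ^ Suc k))) (p :: 'a level_char)" for p
    by (cases p) (simp add: mult.commute flip: power_mult)
  then show ?case
    unfolding funpow.simps comp_def Suc char_frob_def[of "_ ` _"] q_def[symmetric] image_image by simp
qed simp

text \<open>At level n, raising values to the power q^n means evaluating at z^(q^n) = z. Values of a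
  representative at another level are values of \<open>\<xi>\<close>, through a common level and
  surjectivity of the norm. Consequently the orbit size divides n.\<close>

lemma char_frob_char_class:
  assumes n: "0 < n" and \<xi>: "\<xi> \<in> M_hat n"
  shows "(char_frob ^^ n) (char_class n \<xi>) = char_class n \<xi>"
proof -
  have "(\<lambda>(n, \<xi>). (n, \<lambda>z. \<xi> z ^ (q ^ k))) p = p" if "p \<in> char_class n \<xi>" "k = n" for p k
  proof -
    obtain m \<xi>' where p: "p = (m, \<xi>')" by (cases p)
    with that obtain N where N: "\<xi>' \<in> M_hat m" "0 < N" "n dvd N" "m dvd N"
      "Mhat_embed n N \<xi> = Mhat_embed m N \<xi>'"
      by (auto simp: char_class_def char_rel_def)
    have "\<xi>' w ^ (q ^ n) = \<xi>' w" for w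
    proof (cases "w \<in> M_grp m")
      case True
      then obtain z where z: "z \<in> M_grp N" "Mnorm m N z = w" using Mnorm_surj[OF N(4,2)] by blast
      then have eq: "\<xi>' w = \<xi> (Mnorm n N z)" using fun_cong[OF N(5), of z] by (simp add: Mhat_embed_def)
      have y: "Mnorm n N z \<in> M_grp n" by (rule Mnorm_in[OF N(3) z(1)])
      then have "Mnorm n N z ^ (q ^ n) = Mnorm n N z" by (simp add: Mgrp_def q_def)
      then show ?thesis using Mhat_power[OF \<xi> y, of "q ^ n"] by (simp add: eq)
    next
      case False
      then have "\<xi>' w = 0" using N(1) by (auto simp: Mhat_def)
      then show ?thesis using card_field_ge_2 by simp
    qed
    then show ?thesis using that by (simp add: p)
  qed
  then show ?thesis unfolding char_frob_funpow by (auto simp: image_iff intro!: bexI)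
qed

definition char_orbit :: "nat \<Rightarrow> ('a alg_closure \<Rightarrow> complex) \<Rightarrow> 'a level_char set set" where
  "char_orbit n \<xi> = range (\<lambda>k. (char_frob ^^ k) (char_class n \<xi>))"

lemma char_orbit:
  assumes "0 < n" "\<xi> \<in> M_hat n"
  shows "char_orbit n \<xi> \<in> Theta" "char_class n \<xi> \<in> char_orbit n \<xi>"
    "card (char_orbit n \<xi>) dvd n" "0 < card (char_orbit n \<xi>)"
proof -
  show "char_orbit n \<xi> \<in> Theta"
    using char_class_in_union[OF assms] by (auto simp: Theta_def char_orbit_def)
  show "char_class n \<xi> \<in> char_orbit n \<xi>" unfolding char_orbit_def by (rule image_eqI[of _ _ 0]) auto
  show "card (char_orbit n \<xi>) dvd n" "0 < card (char_orbit n \<xi>)"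
    using card_funpow_orbit[OF char_frob_char_class[OF assms] assms(1)] by (simp_all add: char_orbit_def)
qed

lemma finite_Mhat:
  assumes n: "0 < n"
  shows "finite (M_hat n)"
proof (rule finite_subset)
  let ?R = "{c :: complex. c ^ (q ^ n - 1) = 1}"
  have fin: "finite ?R" using finite_roots_unity[of "q ^ n - 1", where 'a = complex] power_q_gt_1[OF n] by simp
  show "finite {f. \<forall>x. (x \<in> M_grp n \<longrightarrow> f x \<in> ?R) \<and> (x \<notin> M_grp n \<longrightarrow> f x = 0)}"
    by (rule finite_set_of_finite_funs[OF finite_Mgrp[OF n] fin])
  show "M_hat n \<subseteq> {f. \<forall>x. (x \<in> M_grp n \<longrightarrow> f x \<in> ?R) \<and> (x \<notin> M_grp n \<longrightarrow> f x = 0)}"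
  proof (intro subsetI CollectI allI conjI impI)
    fix \<xi> x assume \<xi>: "\<xi> \<in> M_hat n"
    show "\<xi> x = 0" if "x \<notin> M_grp n" using that \<xi> by (auto simp: Mhat_def)
    show "\<xi> x ^ (q ^ n - 1) = 1" if "x \<in> M_grp n"
      using Mhat_power[OF \<xi> that, of "q ^ n - 1"] that mult_char_1[OF Mhat_mult_char[OF \<xi>]]
      by (simp add: Mgrp_iff)
  qed
qed

text \<open>Multiplication by a character whose value at \<open>z\<close> is not 1 permutes the
  characters and rescales the sum.\<close>

lemma Mhat_orthogonal:
  assumes n: "0 < n" and z: "z \<in> M_grp n"
  shows "(\<Sum>\<xi>\<in>M_hat n. \<xi> z) = (if z = 1 then of_nat (card (M_hat n)) else 0)"
proof (cases "z = 1")
  case True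
  then have "(\<Sum>\<xi>\<in>M_hat n. \<xi> z) = (\<Sum>\<xi>\<in>M_hat n. 1)"
    by (intro sum.cong) (simp_all add: mult_char_1[OF Mhat_mult_char])
  then show ?thesis using True by simp
next
  case False
  obtain \<chi> where \<chi>: "mult_char (M_grp n) \<chi>" "\<chi> z \<noteq> 1"
    using mult_char_separates[OF finite_Mgrp[OF n] Mgrp_simps(1), where M = "q ^ n - 1" and z = z]
      Mgrp_simps(2) power_q_gt_1[OF n] z False by (auto simp: Mgrp_iff)
  define mul where "mul = (\<lambda>\<chi> \<xi> x. if x \<in> M_grp n then \<chi> x * \<xi> x else (0 :: complex))"
  note D = mult_charD[OF \<chi>(1)]
  have mul: "mul \<chi> \<xi> \<in> M_hat n" "mul (\<lambda>x. inverse (\<chi> x)) \<xi> \<in> M_hat n" if "\<xi> \<in> M_hat n" for \<xi>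
    using that D(4,6) Mgrp_simps(2) by (auto simp: Mhat_def mul_def)
  have inv: "mul (\<lambda>x. inverse (\<chi> x)) (mul \<chi> \<xi>) = \<xi>" "mul \<chi> (mul (\<lambda>x. inverse (\<chi> x)) \<xi>) = \<xi>"
    if "\<xi> \<in> M_hat n" for \<xi>
    using that D(4) by (auto simp: mul_def fun_eq_iff Mhat_def)
  have "(\<Sum>\<xi>\<in>M_hat n. \<xi> z) = (\<Sum>\<xi>\<in>M_hat n. mul \<chi> \<xi> z)"
    by (rule sum.reindex_bij_witness[where i = "mul \<chi>" and j = "mul (\<lambda>x. inverse (\<chi> x))"])
      (simp_all add: mul inv)
  also have "\<dots> = \<chi> z * (\<Sum>\<xi>\<in>M_hat n. \<xi> z)" using z by (simp add: mul_def sum_distrib_left)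
  finally have "(1 - \<chi> z) * (\<Sum>\<xi>\<in>M_hat n. \<xi> z) = 0" by (simp add: algebra_simps)
  then show ?thesis using \<chi>(2) False by simp
qed

text \<open>The number of characters is never computed; it enters as a common factor that has to be
  cancelled.\<close>

lemma card_Mhat_pos:
  assumes n: "0 < n"
  shows "0 < card (M_hat n)"
proof -
  have "(\<lambda>x. if x \<in> M_grp n then 1 else 0) \<in> M_hat n" using Mgrp_simps(2) by (auto simp: Mhat_def)
  then show ?thesis using finite_Mhat[OF n] by (auto simp: card_gt_0_iff)
qed

lemma x_minus_1_Phi: "(x_minus_1 :: 'a poly) \<in> Phi"
  by (simp add: Phi_def irreducible_linear_field_poly)

lemma orbit_poly_1: "orbit_poly (1 :: 'a alg_closure) = x_minus_1"
  unfolding orbit_poly_def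
proof (rule the_equality)
  show "(x_minus_1 :: 'a poly) \<in> Phi \<and> poly (map_poly to_ac x_minus_1) 1 = 0"
    using x_minus_1_Phi by (simp add: map_poly_pCons)
  fix f :: "'a poly" assume f: "f \<in> Phi \<and> poly (map_poly to_ac f) 1 = 0"
  have "poly (map_poly to_ac f) (to_ac x) = to_ac (poly f x)" for x :: 'a
    by (induction f) (simp_all add: map_poly_pCons)
  from this[of 1] have "poly f 1 = 0" using f by simp
  then have "x_minus_1 dvd f" by (simp add: poly_eq_0_iff_dvd)
  then obtain g where g: "f = x_minus_1 * g" by (elim dvdE)
  have "irreducible f" "lead_coeff f = 1" using f by (auto simp: Phi_def)
  then have "is_unit (x_minus_1 :: 'a poly) \<or> is_unit g" using g irreducibleD by blast
  moreover have "\<not> is_unit (x_minus_1 :: 'a poly)" by (simp add: is_unit_iff_degree)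
  ultimately obtain c where c: "g = [:c:]" using is_unit_polyE by blast
  have "lead_coeff f = c" unfolding g c by simp
  then show "f = x_minus_1" using \<open>lead_coeff f = 1\<close> by (simp add: g c)
qed

end

section \<open>The maps $\rho$ and $\omega$\<close>

lemma newton_power_sum:
  assumes "0 < k"
  shows "power_sum k = const (of_nat k) * complete_sym k +
    (\<Sum>i\<in>{1..<k}. const (- 1) * (power_sum i * complete_sym (k - i)))"
proof -
  have "{1..k} = insert k {1..<k}" using assms by auto
  then have "of_nat k * complete_sym k = power_sum k + (\<Sum>i\<in>{1..<k}. power_sum i * complete_sym (k - i))"
    unfolding newton_complete by simp
  then show ?thesis by (simp add: const_of_nat const_minus const_1 sum_negf)
qed

lemmas Sym_intros = complete_sym_Sym elementary_sym_Sym power_sum_Sym subalgD[OF subalg_Sym] subalg_sum[OF subalg_Sym]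

lemma const_of_nat_cancel:
  assumes "0 < n" "of_nat n * f = of_nat n * (g :: 'v mseries)"
  shows "f = g"
proof -
  have "const (1 / of_nat n) * (of_nat n * f) = f" for f :: "'v mseries"
    using assms(1) by (simp add: mult.assoc[symmetric] const_of_nat[symmetric] const_mult[symmetric] const_1)
  then show ?thesis using assms(2) by metis
qed

context
  fixes \<theta> :: "nat mseries \<Rightarrow> 'v mseries" and B
  assumes \<theta>: "calg_hom Sym B \<theta>"
begin

lemma sym_hom: "f \<in> Sym \<Longrightarrow> g \<in> Sym \<Longrightarrow> \<theta> (f + g) = \<theta> f + \<theta> g"
  "f \<in> Sym \<Longrightarrow> g \<in> Sym \<Longrightarrow> \<theta> (f * g) = \<theta> f * \<theta> g" "\<theta> (const c) = const c"
  using calg_homD[OF \<theta>] by auto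

lemma sym_hom_const_mult: "f \<in> Sym \<Longrightarrow> \<theta> (const c * f) = const c * \<theta> f"
  using sym_hom(2,3) subalgD(1)[OF subalg_Sym] by metis

lemma sym_hom_sum: "(\<And>i. i \<in> I \<Longrightarrow> f i \<in> Sym) \<Longrightarrow> \<theta> (sum f I) = (\<Sum>i\<in>I. \<theta> (f i))"
  by (rule calg_hom_sum[OF subalg_Sym \<theta>])

lemma sym_hom_1: "\<theta> 1 = 1"
  using sym_hom(3)[of 1] by (simp add: const_1)

lemma sym_hom_EH_sym:
  "\<theta> (EH_sym y n) = (\<Sum>i\<le>n. const ((- y) ^ i) * \<theta> (elementary_sym i) * \<theta> (complete_sym (n - i)))"
  by (simp add: EH_sym_def sym_hom_sum sym_hom(2,3) Sym_intros)

lemma sym_hom_newton_power_sum: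
  assumes "0 < k"
  shows "\<theta> (power_sum k) = const (of_nat k) * \<theta> (complete_sym k) +
    (\<Sum>i\<in>{1..<k}. const (- 1) * (\<theta> (power_sum i) * \<theta> (complete_sym (k - i))))"
  by (subst newton_power_sum[OF assms])
    (simp add: sym_hom_sum sym_hom Sym_intros)

end

text \<open>Newton's identities determine the images of the power sums from those of the complete
  functions.\<close>

lemma sym_hom_power_sum_unique:
  assumes "calg_hom Sym B \<theta>" "calg_hom Sym B' \<theta>'"
    and h: "\<And>a. \<theta> (complete_sym a) = \<theta>' (complete_sym a)"
  shows "0 < k \<Longrightarrow> \<theta> (power_sum k) = \<theta>' (power_sum k)"
proof (induction k rule: less_induct)
  case (less k)
  show ?case
    by (subst sym_hom_newton_power_sum[OF assms(1) less.prems],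
        subst sym_hom_newton_power_sum[OF assms(2) less.prems])
      (auto simp: h less.IH intro!: sum.cong)
qed

text \<open>The Newton recursion for h_n, with each p_k replaced by (-1)^(k-1) p_k, is the recursion
  for e_n, and conversely.\<close>

lemma sym_hom_dual:
  assumes \<theta>: "calg_hom Sym B \<theta>"
    and p: "\<And>k. 0 < k \<Longrightarrow> \<theta> (power_sum k) = (- 1) ^ (k - 1) * power_sum k"
  shows "\<theta> (complete_sym n) = elementary_sym n" "\<theta> (elementary_sym n) = complete_sym n"
proof -
  show "\<theta> (complete_sym n) = elementary_sym n"
  proof (induction n rule: less_induct)
    case (less n)
    show ?case
    proof (cases "n = 0")
      case False
      have "of_nat n * \<theta> (complete_sym n) = \<theta> (const (of_nat n) * complete_sym n)"
        unfolding const_of_nat[symmetric] by (rule sym_hom_const_mult[OF \<theta> complete_sym_Sym, symmetric])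
      also have "\<dots> = (\<Sum>i\<in>{1..n}. \<theta> (power_sum i) * \<theta> (complete_sym (n - i)))"
        by (simp add: const_of_nat newton_complete sym_hom_sum[OF \<theta>] sym_hom[OF \<theta>] Sym_intros)
      also have "\<dots> = of_nat n * elementary_sym n"
        unfolding newton_elementary using less by (intro sum.cong) (auto simp: p)
      finally show ?thesis using False const_of_nat_cancel by blast
    qed (use sym_hom_1[OF \<theta>] in simp)
  qed
  show "\<theta> (elementary_sym n) = complete_sym n"
  proof (induction n rule: less_induct)
    case (less n)
    show ?case
    proof (cases "n = 0")
      case False
      have sgn: "(- 1) ^ k = const ((- 1) ^ k)" for k by (simp add: const_power const_minus const_1)
      have "of_nat n * \<theta> (elementary_sym n) = \<theta> (const (of_nat n) * elementary_sym n)"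
        unfolding const_of_nat[symmetric] by (rule sym_hom_const_mult[OF \<theta> elementary_sym_Sym, symmetric])
      also have "\<dots> = (\<Sum>i\<in>{1..n}. (- 1) ^ (i - 1) * \<theta> (power_sum i) * \<theta> (elementary_sym (n - i)))"
        by (simp add: const_of_nat newton_elementary sym_hom_sum[OF \<theta>] sym_hom[OF \<theta>] Sym_intros sgn)
      also have "\<dots> = of_nat n * complete_sym n"
        unfolding newton_complete using less by (intro sum.cong) (auto simp: p)
      finally show ?thesis using False const_of_nat_cancel by blast
    qed (use sym_hom_1[OF \<theta>] in simp)
  qed
qed

lemma sum_complete_elementary:
  assumes "0 < n"
  shows "(\<Sum>i\<le>n. const ((- 1) ^ i) * (complete_sym i * elementary_sym (n - i))) = 0"
proof -
  have sgn: "(- 1 :: nat mseries) ^ k = const ((- 1) ^ k)" for k by (simp add: const_power const_minus const_1)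
  have "(\<Sum>i\<le>n. const ((- 1) ^ i) * (complete_sym i * elementary_sym (n - i))) =
      (\<Sum>i\<le>n. const ((- 1) ^ (n - i)) * (complete_sym (n - i) * elementary_sym i))"
    by (rule sum.reindex_bij_witness[of _ "\<lambda>i. n - i" "\<lambda>i. n - i"]) auto
  also have "\<dots> = (\<Sum>i\<le>n. const ((- 1) ^ n) * ((- 1) ^ i * elementary_sym i * complete_sym (n - i)))"
  proof (rule sum.cong[OF refl])
    fix i assume "i \<in> {..n}"
    then have "(- 1 :: complex) ^ (n - i) = (- 1) ^ n * (- 1) ^ i"
      by (simp add: minus_one_power_iff)
    then show "const ((- 1) ^ (n - i)) * (complete_sym (n - i) * elementary_sym i) =
        const ((- 1) ^ n) * ((- 1) ^ i * elementary_sym i * complete_sym (n - i))"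
      by (simp only: const_mult sgn ac_simps)
  qed
  also have "\<dots> = 0" using sum_elementary_complete[OF assms] by (simp flip: sum_distrib_left)
  finally show ?thesis .
qed

text \<open>The defining property fixes the images of the e_r. Those of the h_n follow recursively,
  because the alternating relation between the two families is symmetric in e and h.\<close>

lemma omega_complete:
  assumes z: "inj z" and \<omega>: "is_omega z \<omega>"
  shows "calg_hom Sym (Sym_in z) (\<lambda>f. \<omega> (in_vars z f))"
    "\<omega> (in_vars z (elementary_sym n)) = in_vars z (complete_sym n)"
    "\<omega> (in_vars z (complete_sym n)) = in_vars z (elementary_sym n)"
proof -
  have hom: "calg_hom (Sym_in z) (Sym_in z) \<omega>" and e: "\<And>r. \<omega> (in_vars z (elementary_sym r)) = in_vars z (complete_sym r)"
    using \<omega> by (auto simp: is_omega_def)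
  show \<theta>: "calg_hom Sym (Sym_in z) (\<lambda>f. \<omega> (in_vars z f))"
    using calg_homD[OF hom]
    by (auto simp: calg_hom_def Sym_in_def in_vars_add[OF z] in_vars_mult[OF z] in_vars_const[OF z])
  show "\<omega> (in_vars z (elementary_sym n)) = in_vars z (complete_sym n)" by (rule e)
  have one: "in_vars z 1 = 1" using in_vars_const[OF z, of 1] by (simp add: const_1)
  show "\<omega> (in_vars z (complete_sym n)) = in_vars z (elementary_sym n)"
  proof (induction n rule: less_induct)
    case (less n)
    show ?case
    proof (cases "n = 0")
      case True
      then show ?thesis using sym_hom_1[OF \<theta>] one by simp
    next
      case False
      define G where "G = (\<Sum>i\<in>{1..n}. const ((- 1) ^ i) * (in_vars z (complete_sym i) * in_vars z (elementary_sym (n - i))))"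
      have ins: "{..n} = insert 0 {1..n}" by auto
      have "0 = \<omega> (in_vars z (\<Sum>i\<le>n. const ((- 1) ^ i) * (elementary_sym i * complete_sym (n - i))))"
        using sum_elementary_complete[of n] False sym_hom(3)[OF \<theta>, of 0]
        by (simp add: const_power const_minus const_1 const_0 mult.assoc)
      also have "\<dots> = (\<Sum>i\<le>n. const ((- 1) ^ i) * (in_vars z (complete_sym i) * \<omega> (in_vars z (complete_sym (n - i)))))"
        by (simp add: sym_hom_sum[OF \<theta>] sym_hom[OF \<theta>] Sym_intros e)
      also have "\<dots> = \<omega> (in_vars z (complete_sym n)) + G"
        using less by (simp add: ins G_def const_1 one)
      finally have 1: "\<omega> (in_vars z (complete_sym n)) + G = 0" by simp
      have "0 = in_vars z (\<Sum>i\<le>n. const ((- 1) ^ i) * (complete_sym i * elementary_sym (n - i)))"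
        using sum_complete_elementary[of n] False in_vars_const[OF z, of 0] by (simp add: const_0)
      also have "\<dots> = in_vars z (elementary_sym n) + G"
        by (simp add: in_vars_add[OF z] in_vars_sum[OF z] in_vars_mult[OF z] in_vars_const[OF z]
            ins G_def const_1 one)
      finally show ?thesis using 1 by (metis add_right_cancel)
    qed
  qed
qed

lemma inj_alphabet: "inj (alphabet s)"
  by (auto simp: inj_def alphabet_def)

lemma inj_Y: "inj Y"
  by (auto simp: inj_def Y_def)

lemma in_vars_Y: "in_vars Y f = f"
  unfolding in_vars_def
  by (rule monom_subst_eqI[OF inj_subst_mset_single[OF inj_Y]]) (auto simp: subst_mset_single Y_def)

lemma Sym_tensor_in_vars: "s \<in> I \<Longrightarrow> f \<in> Sym \<Longrightarrow> in_vars (alphabet s) f \<in> Sym_tensor I"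
  unfolding Sym_tensor_def by (rule subalgebra.incl) (auto simp: Sym_in_def)

lemma subalg_Sym_tensor: "subalg (Sym_tensor I)"
  unfolding Sym_tensor_def by (rule subalg_subalgebra)

lemma calg_hom_in_vars:
  assumes h: "calg_hom (Sym_tensor I) B h" and s: "s \<in> I"
  shows "calg_hom Sym B (\<lambda>f. h (in_vars (alphabet s) f))"
  using calg_homD[OF h] Sym_tensor_in_vars[OF s]
  by (auto simp: calg_hom_def in_vars_add[OF inj_alphabet] in_vars_mult[OF inj_alphabet] in_vars_const[OF inj_alphabet])

lemma calg_hom_comp:
  assumes "calg_hom A B h" "calg_hom B C k"
  shows "calg_hom A C (\<lambda>f. k (h f))"
  using calg_homD[OF assms(1)] calg_homD[OF assms(2)] by (auto simp: calg_hom_def)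

lemma plethysm_p_power_sum:
  assumes b: "0 < b" and k: "0 < k"
  shows "plethysm_p b (power_sum k) = power_sum (k * b)"
  unfolding plethysm_p_def
proof (rule monom_subst_eqI[OF inj_subst_mset_replicate[OF b]])
  have rep: "repeat_mset b (replicate_mset k i) = replicate_mset (k * b) i" for i
    by (rule multiset_eqI) simp
  show "coeff_of (power_sum (k * b)) (\<Sum>v\<in>#m. replicate_mset b (Y v)) = coeff_of (power_sum k) m" for m
  proof -
    have "repeat_mset b m = replicate_mset (k * b) i \<longleftrightarrow> m = replicate_mset k i" for i
      using b by (simp add: rep[symmetric] repeat_mset_cancel1)
    then show ?thesis by (simp add: coeff_of_simps Y_def subst_mset_replicate)
  qed
  show "coeff_of (power_sum (k * b)) M = 0" if M: "M \<notin> range (subst_mset (\<lambda>i. replicate_mset b (Y i)))" for M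
  proof -
    have "M \<noteq> replicate_mset (k * b) i" for i
      using M unfolding Y_def subst_mset_replicate rep[symmetric] by auto
    then show ?thesis by (simp add: coeff_of_simps)
  qed
qed

lemma calg_hom_plethysm_p:
  assumes "0 < b"
  shows "calg_hom Sym UNIV (plethysm_p b)"
  unfolding calg_hom_def plethysm_p_def
  using monom_subst_add monom_subst_mult monom_subst_const inj_subst_mset_replicate[OF assms] by auto

text \<open>Sum the defining relation of \<open>\<iota>\<close> over all characters of $M_n$: on the \<open>X\<close> side only
  $z = 1$ survives, and on the \<open>Y\<close> side \<open>\<rho>\<close> sends every summand to $p_n(Y)$.\<close>

lemma rho_power_sum:
  fixes \<iota> :: "(nat \<times> 'a::{field,finite} level_char set set) mseries \<Rightarrow> (nat \<times> 'a poly) mseries"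
  assumes \<iota>: "is_identification \<iota>" and \<rho>: "is_rho \<iota> \<rho>" and n: "0 < n"
  shows "\<rho> (in_vars (alphabet x_minus_1) (power_sum n)) = (- 1) ^ (n - 1) * power_sum n"
proof -
  note q = refl[of "CARD('a)"]
  let ?M = "Mhat n :: ('a alg_closure \<Rightarrow> complex) set"
  define Orb where "Orb = (\<lambda>\<xi> :: 'a alg_closure \<Rightarrow> complex. char_orbit n \<xi>)"
  \<comment> \<open>The index gives every summand total degree n when the variables of an orbit have
    degree the orbit size, which divides n by \<open>char_orbit\<close>.\<close>
  define p where "p = (\<lambda>\<xi>. in_vars (alphabet (Orb \<xi>)) (power_sum (n div card (Orb \<xi>))))"
  define W where "W = (\<lambda>z :: 'a alg_closure. in_vars (alphabet (orbit_poly z)) (power_sum (n div degree (orbit_poly z))))"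
  have \<iota>hom: "calg_hom (Sym_tensor Theta) (Sym_tensor Phi) \<iota>"
    and \<iota>p: "\<And>\<phi> \<Xi> k. \<phi> \<in> Theta \<Longrightarrow> \<Xi> \<in> \<phi> \<Longrightarrow> 0 < k \<Longrightarrow>
        \<iota> (in_vars (alphabet \<phi>) (power_sum k)) = const ((- 1) ^ (k * card \<phi> - 1)) *
          (\<Sum>z\<in>Mgrp (k * card \<phi>). const (char_val \<Xi> (k * card \<phi>) z) *
             in_vars (alphabet (orbit_poly z)) (power_sum (k * card \<phi> div degree (orbit_poly z))))"
    using \<iota> by (auto simp: is_identification_def)
  have \<rho>hom: "calg_hom (Sym_tensor Phi) (Sym_in Y) \<rho>"
    and \<rho>h: "\<And>\<phi> a. \<phi> \<in> Theta \<Longrightarrow> \<rho> (\<iota> (in_vars (alphabet \<phi>) (complete_sym a))) = plethysm_p (card \<phi>) (complete_sym a)"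
    using \<rho> by (auto simp: is_rho_def)
  note orb = char_orbit[OF q n]
  have k: "0 < n div card (Orb \<xi>)" "n div card (Orb \<xi>) * card (Orb \<xi>) = n" if "\<xi> \<in> ?M" for \<xi>
    using orb(3,4)[OF that] n unfolding Orb_def by (simp_all add: div_greater_zero_iff dvd_imp_le)
  have \<iota>p': "\<iota> (p \<xi>) = const ((- 1) ^ (n - 1)) * (\<Sum>z\<in>Mgrp n. const (\<xi> z) * W z)" if \<xi>: "\<xi> \<in> ?M" for \<xi>
    using \<iota>p[OF orb(1,2)[OF \<xi>] k(1)[OF \<xi>, unfolded Orb_def]] k(2)[OF \<xi>] char_val_char_class[OF q n \<xi>]
    by (simp add: p_def W_def Orb_def)
  have pT: "p \<xi> \<in> Sym_tensor Theta" if "\<xi> \<in> ?M" for \<xi>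
    unfolding p_def Orb_def by (rule Sym_tensor_in_vars[OF orb(1)[OF that] power_sum_Sym])
  have \<rho>p: "\<rho> (\<iota> (p \<xi>)) = power_sum n" if \<xi>: "\<xi> \<in> ?M" for \<xi>
  proof -
    have hom: "calg_hom Sym (Sym_in Y) (\<lambda>f. \<rho> (\<iota> (in_vars (alphabet (Orb \<xi>)) f)))"
      unfolding Orb_def by (rule calg_hom_in_vars[OF calg_hom_comp[OF \<iota>hom \<rho>hom] orb(1)[OF \<xi>]])
    have pos: "0 < card (Orb \<xi>)" using orb(4)[OF \<xi>] by (simp add: Orb_def)
    \<comment> \<open>The composite of \<open>\<iota>\<close> and \<open>\<rho>\<close> on this
      alphabet and the plethysm are two homomorphisms on \<open>Sym\<close> with equal values on
      complete functions, hence also on power sums.\<close>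
    have "\<rho> (\<iota> (p \<xi>)) = plethysm_p (card (Orb \<xi>)) (power_sum (n div card (Orb \<xi>)))"
      unfolding p_def using sym_hom_power_sum_unique[OF hom calg_hom_plethysm_p[OF pos] _ k(1)[OF \<xi>]]
        \<rho>h[OF orb(1)[OF \<xi>]] by (simp add: Orb_def)
    then show ?thesis using plethysm_p_power_sum[OF pos k(1)[OF \<xi>]] k(2)[OF \<xi>] by simp
  qed
  have W1: "W 1 = in_vars (alphabet x_minus_1) (power_sum n)"
    by (simp add: W_def orbit_poly_1[OF q])
  have W1T: "W 1 \<in> Sym_tensor Phi"
    unfolding W1 by (rule Sym_tensor_in_vars[OF x_minus_1_Phi[OF q] power_sum_Sym])
  have "(\<Sum>\<xi>\<in>?M. \<iota> (p \<xi>)) = const ((- 1) ^ (n - 1)) * (\<Sum>z\<in>Mgrp n. (\<Sum>\<xi>\<in>?M. const (\<xi> z)) * W z)"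
    by (simp add: \<iota>p' sum_distrib_right sum.swap[of _ ?M] flip: sum_distrib_left)
  also have "(\<Sum>z\<in>Mgrp n. (\<Sum>\<xi>\<in>?M. const (\<xi> z)) * W z) =
      (\<Sum>z\<in>Mgrp n. if z = (1 :: 'a alg_closure) then const (of_nat (card ?M)) * W 1 else 0)"
  proof (rule sum.cong[OF refl])
    fix z :: "'a alg_closure" assume "z \<in> Mgrp n"
    from Mhat_orthogonal[OF q n this] show "(\<Sum>\<xi>\<in>?M. const (\<xi> z)) * W z = (if z = 1 then const (of_nat (card ?M)) * W 1 else 0)"
      by (simp add: const_sum[symmetric] const_0)
  qed
  also have "\<dots> = const (of_nat (card ?M)) * W 1"
    using finite_Mgrp[OF q n] Mgrp_simps(1)[OF q] by simp
  finally have eq: "(\<Sum>\<xi>\<in>?M. \<iota> (p \<xi>)) = const ((- 1) ^ (n - 1) * of_nat (card ?M)) * W 1"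
    by (simp add: const_mult mult.assoc)
  have "of_nat (card ?M) * power_sum n = (\<Sum>\<xi>\<in>?M. \<rho> (\<iota> (p \<xi>)))"
    by (simp add: \<rho>p)
  also have "\<dots> = \<rho> (\<Sum>\<xi>\<in>?M. \<iota> (p \<xi>))"
    using pT calg_homD(1)[OF \<iota>hom] by (intro calg_hom_sum[OF subalg_Sym_tensor \<rho>hom, symmetric]) auto
  also have "\<dots> = const ((- 1) ^ (n - 1) * of_nat (card ?M)) * \<rho> (W 1)"
    unfolding eq by (rule calg_hom_const_mult[OF subalg_Sym_tensor \<rho>hom W1T])
  also have "\<dots> = of_nat (card ?M) * ((- 1) ^ (n - 1) * \<rho> (W 1))"
    by (simp add: const_mult const_power const_minus const_1 const_of_nat)
  finally have "power_sum n = (- 1) ^ (n - 1) * \<rho> (W 1)"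
    using const_of_nat_cancel card_Mhat_pos[OF q n] by blast
  from arg_cong[OF this, of "\<lambda>f. (- 1) ^ (n - 1) * f"] show ?thesis by (simp add: W1)
qed

lemma rho_dual:
  fixes \<iota> :: "(nat \<times> 'a::{field,finite} level_char set set) mseries \<Rightarrow> (nat \<times> 'a poly) mseries"
  assumes "is_identification \<iota>" "is_rho \<iota> \<rho>"
  shows "calg_hom Sym (Sym_in Y) (\<lambda>f. \<rho> (in_vars (alphabet x_minus_1) f))"
    "\<rho> (in_vars (alphabet x_minus_1) (complete_sym n)) = elementary_sym n"
    "\<rho> (in_vars (alphabet x_minus_1) (elementary_sym n)) = complete_sym n"
proof -
  have "calg_hom (Sym_tensor Phi) (Sym_in Y) \<rho>" using assms(2) by (simp add: is_rho_def)
  then show hom: "calg_hom Sym (Sym_in Y) (\<lambda>f. \<rho> (in_vars (alphabet x_minus_1) f))"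
    by (rule calg_hom_in_vars) (rule x_minus_1_Phi[OF refl])
  show "\<rho> (in_vars (alphabet x_minus_1) (complete_sym n)) = elementary_sym n"
    "\<rho> (in_vars (alphabet x_minus_1) (elementary_sym n)) = complete_sym n"
    using sym_hom_dual[OF hom] rho_power_sum[OF assms] by blast+
qed

text \<open>\<open>EH_sym\<close> is a polynomial in the e_i and h_j; \<open>\<rho>\<close> on the
  alphabet of x - 1 and then \<open>\<omega>\<^sub>Y\<close> exchange these families, and the last
  map only renames variables.\<close>

lemma change_vars_omega_rho:
  fixes \<iota> :: "(nat \<times> 'a::{field,finite} level_char set set) mseries \<Rightarrow> (nat \<times> 'a poly) mseries"
  assumes "is_identification \<iota>" "is_rho \<iota> \<rho>" "is_omega Y \<omega>\<^sub>Y"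
  shows "change_vars (\<omega>\<^sub>Y (\<rho> (in_vars (alphabet x_minus_1) (const c * EH_sym y n)))) =
    in_vars (alphabet (x_minus_1 :: 'a poly)) (const c * EH_sym y n)"
proof -
  note rho = rho_dual[OF assms(1,2)] and om = omega_complete[OF inj_Y assms(3), unfolded in_vars_Y]
  have "\<rho> (in_vars (alphabet x_minus_1) (const c * EH_sym y n)) =
      const c * (\<Sum>i\<le>n. const ((- y) ^ i) * complete_sym i * elementary_sym (n - i))"
    by (simp add: sym_hom[OF rho(1)] sym_hom_EH_sym[OF rho(1)] rho(2,3) Sym_intros EH_sym_Sym)
  then have "\<omega>\<^sub>Y (\<rho> (in_vars (alphabet x_minus_1) (const c * EH_sym y n))) = const c * EH_sym y n"
    by (simp add: sym_hom[OF om(1)] sym_hom_sum[OF om(1)] om(2,3) Sym_intros EH_sym_def)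
  then show ?thesis by (simp add: change_vars_def in_vars_def)
qed

text \<open>The constant is q^n (1 - 1/q): the factor 1 - 1/q cancels the normalisation in
  \<open>HL_tilde_one_row\<close>, and q^n compensates the reversal of the sum after
  \<open>\<omega>\<close> has exchanged e and h, since q^n (- 1/q)^(n-i) = (-1)^n (- q)^i.\<close>

lemma omega_HL_tilde_one_row:
  fixes q :: nat
  assumes z: "inj z" and \<omega>: "is_omega z \<omega>" and q: "2 \<le> q" and n: "0 < n"
  shows "const (of_nat (q ^ (n - 1) * (q - 1))) * \<omega> (in_vars z (HL_tilde (one_row n) q)) =
    in_vars z (const ((- 1) ^ n) * EH_sym (of_nat q) n)"
proof -
  let ?t = "1 / of_nat q :: complex"
  note om = omega_complete[OF z \<omega>]
  have t1: "1 - ?t \<noteq> 0" using q by simp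
  have row: "HL_tilde (one_row n) q = const (1 / (1 - ?t)) * EH_sym ?t n"
  proof -
    have "1 / (1 - ?t) * (1 - ?t) = 1" using t1 by simp
    then show ?thesis
      unfolding HL_tilde_one_row[OF q n, symmetric] mult.assoc[symmetric] const_mult[symmetric]
      by (simp only: const_1 mult_1_left)
  qed
  have "complex_of_nat (q ^ (n - 1) * (q - 1)) = of_nat q ^ n * (1 - ?t)"
    using q n by (cases n) (simp_all add: of_nat_diff field_simps)
  then have "const (of_nat (q ^ (n - 1) * (q - 1))) * \<omega> (in_vars z (HL_tilde (one_row n) q)) =
      const (of_nat q ^ n * (1 - ?t)) * (const (1 / (1 - ?t)) * \<omega> (in_vars z (EH_sym ?t n)))"
    unfolding row by (simp add: sym_hom[OF om(1)] Sym_intros EH_sym_Sym)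
  also have "\<dots> = const (of_nat q ^ n) * \<omega> (in_vars z (EH_sym ?t n))"
  proof -
    have "of_nat q ^ n * (1 - ?t) * (1 / (1 - ?t)) = of_nat q ^ n" using t1 by simp
    then show ?thesis unfolding mult.assoc[symmetric] const_mult[symmetric] by (simp only:)
  qed
  also have "\<omega> (in_vars z (EH_sym ?t n)) =
      (\<Sum>i\<le>n. const ((- ?t) ^ i) * in_vars z (complete_sym i) * in_vars z (elementary_sym (n - i)))"
    by (simp add: sym_hom_EH_sym[OF om(1)] om(2,3))
  also have "const (of_nat q ^ n) * \<dots> =
      (\<Sum>i\<le>n. const (of_nat q ^ n * (- ?t) ^ i) * (in_vars z (complete_sym i) * in_vars z (elementary_sym (n - i))))"
    by (simp add: sum_distrib_left const_mult mult.assoc)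
  also have "\<dots> = (\<Sum>i\<le>n. const (of_nat q ^ n * (- ?t) ^ (n - i)) * (in_vars z (complete_sym (n - i)) * in_vars z (elementary_sym i)))"
    by (rule sum.reindex_bij_witness[of _ "\<lambda>i. n - i" "\<lambda>i. n - i"]) auto
  also have "\<dots> = (\<Sum>i\<le>n. const ((- 1) ^ n * (- of_nat q) ^ i) * (in_vars z (elementary_sym i) * in_vars z (complete_sym (n - i))))"
  proof (rule sum.cong[OF refl])
    fix i assume "i \<in> {..n}"
    then have i: "n = (n - i) + i" by simp
    have "of_nat q ^ n * (- ?t) ^ (n - i) = (- 1) ^ (n - i) * (of_nat q * ?t) ^ (n - i) * of_nat q ^ i"
    proof -
      have "(of_nat q :: complex) ^ n = of_nat q ^ (n - i) * of_nat q ^ i"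
        using i by (metis power_add)
      moreover have "(- ?t) ^ (n - i) = (- 1) ^ (n - i) * ?t ^ (n - i)" by (rule power_minus)
      ultimately show ?thesis by (simp only: power_mult_distrib ac_simps)
    qed
    also have "\<dots> = (- 1) ^ (n - i) * of_nat q ^ i" using q by simp
    also have "\<dots> = (- 1) ^ n * (- of_nat q) ^ i"
      using \<open>i \<in> {..n}\<close> unfolding power_minus[of "of_nat q" i] by (simp add: minus_one_power_iff)
    finally show "const (of_nat q ^ n * (- ?t) ^ (n - i)) * (in_vars z (complete_sym (n - i)) * in_vars z (elementary_sym i)) =
        const ((- 1) ^ n * (- of_nat q) ^ i) * (in_vars z (elementary_sym i) * in_vars z (complete_sym (n - i)))"
      by (simp only: mult.commute)
  qed
  also have "\<dots> = in_vars z (const ((- 1) ^ n) * EH_sym (of_nat q) n)"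
    by (simp add: EH_sym_def in_vars_mult[OF z] in_vars_sum[OF z] in_vars_const[OF z] const_mult sum_distrib_left mult.assoc)
  finally show ?thesis .
qed

section \<open>Chains of subspaces adapted to a nilpotent map\<close>

unbundle no fps_syntax

definition vsub :: "nat \<Rightarrow> 'a::field vec set \<Rightarrow> bool" where
  "vsub n W \<longleftrightarrow> W \<subseteq> carrier_vec n \<and> 0\<^sub>v n \<in> W \<and> (\<forall>v\<in>W. \<forall>w\<in>W. v + w \<in> W) \<and> (\<forall>a. \<forall>v\<in>W. a \<cdot>\<^sub>v v \<in> W)"

lemma vsubD:
  assumes "vsub n W"
  shows "v \<in> W \<Longrightarrow> v \<in> carrier_vec n" "0\<^sub>v n \<in> W" "v \<in> W \<Longrightarrow> w \<in> W \<Longrightarrow> v + w \<in> W" "v \<in> W \<Longrightarrow> a \<cdot>\<^sub>v v \<in> W"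
    "v \<in> W \<Longrightarrow> w \<in> W \<Longrightarrow> v - w \<in> W"
proof -
  show *: "v \<in> W \<Longrightarrow> v \<in> carrier_vec n" "0\<^sub>v n \<in> W" "v \<in> W \<Longrightarrow> w \<in> W \<Longrightarrow> v + w \<in> W" "v \<in> W \<Longrightarrow> a \<cdot>\<^sub>v v \<in> W" for v w a
    using assms by (auto simp: vsub_def)
  assume "v \<in> W" "w \<in> W"
  then have "v + (- 1) \<cdot>\<^sub>v w \<in> W" using * by blast
  moreover have "v + (- 1) \<cdot>\<^sub>v w = v - w"
    using *(1)[OF \<open>v \<in> W\<close>] *(1)[OF \<open>w \<in> W\<close>] by (intro eq_vecI) auto
  ultimately show "v - w \<in> W" by simp
qed

text \<open>Lists are read with the newest vector at the head, so the tails span the smaller members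
  of a flag.\<close>

fun span_list :: "nat \<Rightarrow> 'a::field vec list \<Rightarrow> 'a vec set" where
  "span_list n [] = {0\<^sub>v n}"
| "span_list n (w # ws) = {u + a \<cdot>\<^sub>v w | u a. u \<in> span_list n ws}"

lemma vsub_span_list: "set ws \<subseteq> carrier_vec n \<Longrightarrow> vsub n (span_list n ws)"
proof (induction ws)
  case (Cons w ws)
  then have U: "vsub n (span_list n ws)" and w: "w \<in> carrier_vec n" by auto
  note D = vsubD[OF U]
  show ?case
    unfolding vsub_def
  proof (intro conjI ballI allI subsetI)
    fix v assume "v \<in> span_list n (w # ws)"
    then show "v \<in> carrier_vec n" using w D(1) by auto
  next
    have "0\<^sub>v n + 0 \<cdot>\<^sub>v w = 0\<^sub>v n" using w by (intro eq_vecI) auto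
    then show "0\<^sub>v n \<in> span_list n (w # ws)" unfolding span_list.simps
      by (intro CollectI exI[of _ "0\<^sub>v n"] exI[of _ 0]) (use D(2) in simp)
  next
    fix v v' assume "v \<in> span_list n (w # ws)" "v' \<in> span_list n (w # ws)"
    then obtain u a u' a' where u: "u \<in> span_list n ws" "v = u + a \<cdot>\<^sub>v w" "u' \<in> span_list n ws" "v' = u' + a' \<cdot>\<^sub>v w"
      by auto
    have "v + v' = (u + u') + (a + a') \<cdot>\<^sub>v w"
      using w D(1)[OF u(1)] D(1)[OF u(3)] by (intro eq_vecI) (auto simp: u algebra_simps)
    then show "v + v' \<in> span_list n (w # ws)" using D(3)[OF u(1,3)] by auto
  next
    fix b v assume "v \<in> span_list n (w # ws)"
    then obtain u a where u: "u \<in> span_list n ws" "v = u + a \<cdot>\<^sub>v w" by auto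
    have "b \<cdot>\<^sub>v v = (b \<cdot>\<^sub>v u) + (b * a) \<cdot>\<^sub>v w"
      using w D(1)[OF u(1)] by (intro eq_vecI) (auto simp: u algebra_simps)
    then show "b \<cdot>\<^sub>v v \<in> span_list n (w # ws)" using D(4)[OF u(1)] by auto
  qed
qed (auto simp: vsub_def)

lemma span_list_Cons_unique:
  assumes U: "vsub n U" and w: "w \<in> carrier_vec n" "w \<notin> U"
    and u: "u \<in> U" "u' \<in> U" and eq: "u + a \<cdot>\<^sub>v w = u' + a' \<cdot>\<^sub>v w"
  shows "a = a'" "u = u'"
proof -
  note D = vsubD[OF U]
  show a: "a = a'"
  proof (rule ccontr)
    assume "a \<noteq> a'"
    have "w = inverse (a - a') \<cdot>\<^sub>v (u' - u)"
    proof (rule eq_vecI)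
      fix i assume "i < dim_vec (inverse (a - a') \<cdot>\<^sub>v (u' - u))"
      then have i: "i < n" using D(1)[OF u(1)] by simp
      have "u $ i + a * w $ i = u' $ i + a' * w $ i"
        using arg_cong[OF eq, of "\<lambda>v. vec_index v i"] i w(1) D(1)[OF u(1)] D(1)[OF u(2)] by simp
      then have "(a - a') * w $ i = u' $ i - u $ i" by (simp add: algebra_simps)
      then show "w $ i = (inverse (a - a') \<cdot>\<^sub>v (u' - u)) $ i"
        using i w(1) D(1)[OF u(1)] D(1)[OF u(2)] \<open>a \<noteq> a'\<close> by (simp add: field_simps)
    qed (use w(1) D(1)[OF u(1)] in auto)
    then have "w \<in> U" using D(4)[OF D(5)[OF u(2,1)]] by simp
    then show False using w(2) by simp
  qed
  show "u = u'"
  proof (rule eq_vecI)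
    fix i assume "i < dim_vec u'"
    then have i: "i < n" using D(1)[OF u(2)] by simp
    then show "u $ i = u' $ i"
      using arg_cong[OF eq, of "\<lambda>v. vec_index v i"] i w(1) D(1)[OF u(1)] D(1)[OF u(2)] a by simp
  qed (use D(1)[OF u(1)] D(1)[OF u(2)] in auto)
qed

lemma finite_carrier_vec [simp]: "finite (carrier_vec n :: 'a::finite vec set)"
proof (rule finite_subset)
  show "(carrier_vec n :: 'a vec set) \<subseteq> vec_of_list ` {xs. set xs \<subseteq> UNIV \<and> length xs = n}"
  proof
    fix v :: "'a vec" assume "v \<in> carrier_vec n"
    then have "v = vec_of_list (list_of_vec v)" "length (list_of_vec v) = n" by (auto simp: vec_list)
    then show "v \<in> vec_of_list ` {xs. set xs \<subseteq> UNIV \<and> length xs = n}" by auto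
  qed
  show "finite (vec_of_list ` {xs :: 'a list. set xs \<subseteq> UNIV \<and> length xs = n})"
    by (intro finite_imageI finite_lists_length_eq) simp
qed

lemma finite_vsub: "vsub n W \<Longrightarrow> finite (W :: 'a::{field,finite} vec set)"
  using finite_subset[OF _ finite_carrier_vec] by (auto simp: vsub_def)

lemma card_span_list_Cons:
  fixes w :: "'a::{field,finite} vec"
  assumes ws: "set ws \<subseteq> carrier_vec n" and w: "w \<in> carrier_vec n" "w \<notin> span_list n ws"
  shows "card (span_list n (w # ws)) = CARD('a) * card (span_list n ws)"
proof -
  have "span_list n (w # ws) = (\<lambda>(u, a). u + a \<cdot>\<^sub>v w) ` (span_list n ws \<times> UNIV)" by auto
  moreover have "inj_on (\<lambda>(u, a). u + a \<cdot>\<^sub>v w) (span_list n ws \<times> UNIV)"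
    using span_list_Cons_unique[OF vsub_span_list[OF ws] w] by (auto simp: inj_on_def)
  ultimately show ?thesis by (simp add: card_image card_cartesian_product mult.commute)
qed

lemma card_carrier_vec: "card (carrier_vec n :: 'a::{field,finite} vec set) = CARD('a) ^ n"
proof -
  have "bij_betw vec_of_list {xs :: 'a list. set xs \<subseteq> UNIV \<and> length xs = n} (carrier_vec n)"
    by (rule bij_betwI[where g = list_of_vec]) (auto simp: vec_list list_vec intro: carrier_vecI)
  then have "card (carrier_vec n :: 'a vec set) = card {xs :: 'a list. set xs \<subseteq> UNIV \<and> length xs = n}"
    using bij_betw_same_card by fastforce
  also have "\<dots> = CARD('a) ^ n" by (rule card_lists_length_eq) simp
  finally show ?thesis .
qed

section \<open>Adapted chains and their character sums\<close>

context
  fixes n :: nat and f :: "'a::{field,finite} vec \<Rightarrow> 'a vec"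
    and \<psi> :: "'a \<Rightarrow> complex" and c :: "nat \<Rightarrow> 'a"
begin

definition f_pre :: "'a vec set \<Rightarrow> 'a vec set" where
  "f_pre W = {v \<in> carrier_vec n. f v \<in> W}"

text \<open>A list of full length is, in reverse order, a basis in which 1 + f is upper
  unitriangular.\<close>

fun adapted :: "'a vec list \<Rightarrow> bool" where
  "adapted [] \<longleftrightarrow> True"
| "adapted (w # ws) \<longleftrightarrow> w \<in> carrier_vec n \<and> w \<notin> span_list n ws \<and> f w \<in> span_list n ws \<and> adapted ws"

definition top_coeff :: "'a vec \<Rightarrow> 'a vec list \<Rightarrow> 'a vec \<Rightarrow> 'a" where
  "top_coeff w ws v = (THE a. \<exists>u\<in>span_list n ws. v = u + a \<cdot>\<^sub>v w)"

text \<open>The total weight of the k-step extensions of the chain \<open>w # ws\<close>. The new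
  vector is the column with index \<open>length (w # ws)\<close>, counted from 0, and
  \<open>top_coeff\<close> is the entry just above the diagonal in that column.\<close>

primrec ext_sum :: "nat \<Rightarrow> 'a vec \<Rightarrow> 'a vec list \<Rightarrow> complex" where
  "ext_sum 0 w ws = 1"
| "ext_sum (Suc k) w ws = (\<Sum>v\<in>f_pre (span_list n (w # ws)) - span_list n (w # ws).
     \<psi> (c (length (w # ws)) * top_coeff w ws (f v)) * ext_sum k v (w # ws))"

definition chains :: "nat \<Rightarrow> 'a vec list set" where
  "chains j = {vs. adapted vs \<and> length vs = j}"

fun chain_weight :: "'a vec list \<Rightarrow> complex" where
  "chain_weight (v # w # ws) = \<psi> (c (length (w # ws)) * top_coeff w ws (f v)) * chain_weight (w # ws)"
| "chain_weight _ = 1"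

context
  assumes f_carrier: "\<And>v. v \<in> carrier_vec n \<Longrightarrow> f v \<in> carrier_vec n"
    and f_add: "\<And>v w. v \<in> carrier_vec n \<Longrightarrow> w \<in> carrier_vec n \<Longrightarrow> f (v + w) = f v + f w"
    and f_smult: "\<And>a v. v \<in> carrier_vec n \<Longrightarrow> f (a \<cdot>\<^sub>v v) = a \<cdot>\<^sub>v f v"
begin

lemma f_0: "f (0\<^sub>v n) = 0\<^sub>v n"
proof -
  have "f (0 \<cdot>\<^sub>v 0\<^sub>v n) = 0 \<cdot>\<^sub>v f (0\<^sub>v n)" by (rule f_smult) simp
  moreover have "0 \<cdot>\<^sub>v 0\<^sub>v n = (0\<^sub>v n :: 'a vec)" "0 \<cdot>\<^sub>v f (0\<^sub>v n) = 0\<^sub>v n"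
    using f_carrier[of "0\<^sub>v n"] by (auto intro!: eq_vecI)
  ultimately show ?thesis by simp
qed

lemma vsub_f_pre: "vsub n W \<Longrightarrow> vsub n (f_pre W)"
  unfolding vsub_def[of n "f_pre W"] using vsubD[of n W] by (auto simp: f_pre_def f_add f_smult f_0)

lemma adapted_carrier: "adapted ws \<Longrightarrow> set ws \<subseteq> carrier_vec n"
  by (induction ws) auto

lemma adapted_vsub: "adapted ws \<Longrightarrow> vsub n (span_list n ws)"
  using vsub_span_list adapted_carrier by blast

lemma span_list_subset_Cons:
  assumes "set (w # ws) \<subseteq> carrier_vec n"
  shows "span_list n ws \<subseteq> span_list n (w # ws)"
proof
  fix u assume u: "u \<in> span_list n ws"
  then have "u \<in> carrier_vec n" using vsubD(1)[OF vsub_span_list[of ws n]] assms by auto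
  then have "u = u + 0 \<cdot>\<^sub>v w" using assms by (intro eq_vecI) auto
  then show "u \<in> span_list n (w # ws)" using u by auto
qed

text \<open>f lowers the flag by one step: the newest vector by adaptedness, the older ones by
  induction even further.\<close>

lemma adapted_f_span: "adapted (w # ws) \<Longrightarrow> span_list n (w # ws) \<subseteq> f_pre (span_list n ws)"
proof (induction ws arbitrary: w)
  case Nil
  show ?case
  proof
    fix v assume "v \<in> span_list n [w]"
    then obtain a where v: "v = 0\<^sub>v n + a \<cdot>\<^sub>v w" by auto
    have "f v = a \<cdot>\<^sub>v f w" using Nil by (simp add: v f_smult)
    then show "v \<in> f_pre (span_list n [])" using Nil by (auto simp: f_pre_def v intro!: eq_vecI)
  qed
next
  case (Cons w' ws)
  note U = vsubD[OF adapted_vsub[of "w' # ws"]]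
  have ad: "adapted (w' # ws)" and w: "w \<in> carrier_vec n" "f w \<in> span_list n (w' # ws)" using Cons.prems by auto
  show ?case
  proof
    fix v assume "v \<in> span_list n (w # w' # ws)"
    then obtain u a where u: "u \<in> span_list n (w' # ws)" "v = u + a \<cdot>\<^sub>v w" by auto
    have uc: "u \<in> carrier_vec n" by (rule U(1)[OF ad u(1)])
    have "f u \<in> span_list n ws" using Cons.IH[OF ad] u(1) by (auto simp: f_pre_def)
    then have "f u \<in> span_list n (w' # ws)"
      using span_list_subset_Cons[OF adapted_carrier[OF ad]] by blast
    then have "f v \<in> span_list n (w' # ws)"
      unfolding u(2) using uc w U(3,4)[OF ad] by (simp add: f_add f_smult del: span_list.simps)
    then show "v \<in> f_pre (span_list n (w' # ws))" using uc w(1) by (simp add: f_pre_def u(2))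
  qed
qed

lemma top_coeff_eq:
  assumes "adapted (w # ws)" "u \<in> span_list n ws"
  shows "top_coeff w ws (u + a \<cdot>\<^sub>v w) = a"
  unfolding top_coeff_def
proof (rule the_equality)
  show "\<exists>u'\<in>span_list n ws. u + a \<cdot>\<^sub>v w = u' + a \<cdot>\<^sub>v w" using assms(2) by blast
  fix a' assume "\<exists>u'\<in>span_list n ws. u + a \<cdot>\<^sub>v w = u' + a' \<cdot>\<^sub>v w"
  then show "a' = a"
    using span_list_Cons_unique(1)[OF adapted_vsub[of ws], of w] assms by fastforce
qed

lemma top_coeff_linear:
  assumes ad: "adapted (w # ws)" and v: "v \<in> span_list n (w # ws)" "v' \<in> span_list n (w # ws)"
  shows "top_coeff w ws (v + v') = top_coeff w ws v + top_coeff w ws v'"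
    "top_coeff w ws (b \<cdot>\<^sub>v v) = b * top_coeff w ws v"
    "top_coeff w ws v = 0 \<longleftrightarrow> v \<in> span_list n ws"
proof -
  have U: "vsub n (span_list n ws)" and w: "w \<in> carrier_vec n" using ad adapted_vsub by auto
  note D = vsubD[OF U]
  obtain u a u' a' where u: "u \<in> span_list n ws" "v = u + a \<cdot>\<^sub>v w" "u' \<in> span_list n ws" "v' = u' + a' \<cdot>\<^sub>v w"
    using v by auto
  have "v + v' = (u + u') + (a + a') \<cdot>\<^sub>v w" "b \<cdot>\<^sub>v v = (b \<cdot>\<^sub>v u) + (b * a) \<cdot>\<^sub>v w"
    using w D(1)[OF u(1)] D(1)[OF u(3)] by (auto simp: u algebra_simps intro!: eq_vecI)
  then show "top_coeff w ws (v + v') = top_coeff w ws v + top_coeff w ws v'"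
    "top_coeff w ws (b \<cdot>\<^sub>v v) = b * top_coeff w ws v"
    using top_coeff_eq[OF ad] u D(3)[OF u(1,3)] D(4)[OF u(1)] by auto
  have "v \<in> span_list n ws \<Longrightarrow> v = v + 0 \<cdot>\<^sub>v w" using w D(1) by (intro eq_vecI) auto
  moreover have "u + 0 \<cdot>\<^sub>v w = u" using w D(1)[OF u(1)] by (intro eq_vecI) auto
  ultimately show "top_coeff w ws v = 0 \<longleftrightarrow> v \<in> span_list n ws"
    using top_coeff_eq[OF ad, of v 0] top_coeff_eq[OF ad u(1), of a] u(1,2) by auto
qed

lemma card_span_adapted: "adapted ws \<Longrightarrow> card (span_list n ws) = CARD('a) ^ length ws"
proof (induction ws)
  case (Cons w ws)
  then show ?case using card_span_list_Cons[of ws n w] adapted_carrier by simp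
qed simp

context
  assumes \<psi>: "nontrivial_additive_character \<psi>"
    and c: "\<And>i. i \<in> {1..<n} \<Longrightarrow> c i \<noteq> 0"
    and nilp: "\<And>v. v \<in> carrier_vec n \<Longrightarrow> \<exists>m. (f ^^ m) v = 0\<^sub>v n"
begin

lemma \<psi>_0: "\<psi> 0 = 1"
  using \<psi> unfolding nontrivial_additive_character_def by (metis add_0 mult_cancel_right1)

text \<open>Otherwise a vector outside \<open>W\<close> would stay outside under all iterates of f,
  although some iterate is 0.\<close>

lemma f_pre_proper:
  assumes W: "vsub n W" "W \<noteq> carrier_vec n"
  shows "\<not> f_pre W \<subseteq> W"
proof
  assume sub: "f_pre W \<subseteq> W"
  obtain v where v: "v \<in> carrier_vec n" "v \<notin> W" using W vsubD(1)[OF W(1)] by blast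
  have "(f ^^ m) v \<in> carrier_vec n \<and> (f ^^ m) v \<notin> W" for m
    using v sub f_carrier by (induction m) (auto simp: f_pre_def)
  moreover obtain m where "(f ^^ m) v = 0\<^sub>v n" using nilp[OF v(1)] by blast
  ultimately show False using vsubD(2)[OF W(1)] by metis
qed

text \<open>Translation by a vector on which a h takes a value x with \<open>\<psi> x\<close>
  different from 1 rescales the sum by \<open>\<psi> x\<close>.\<close>

lemma sum_additive_character:
  assumes P: "vsub n P" and h: "\<And>v w. v \<in> P \<Longrightarrow> w \<in> P \<Longrightarrow> h (v + w) = h v + h w"
    "\<And>b v. v \<in> P \<Longrightarrow> h (b \<cdot>\<^sub>v v) = b * h v" and v0: "v0 \<in> P" "h v0 \<noteq> 0" and a: "a \<noteq> 0"
  shows "(\<Sum>v\<in>P. \<psi> (a * h v)) = 0"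
proof -
  note D = vsubD[OF P]
  obtain x where x: "\<psi> x \<noteq> 1" using \<psi> by (auto simp: nontrivial_additive_character_def)
  define v1 where "v1 = (x / (a * h v0)) \<cdot>\<^sub>v v0"
  have v1: "v1 \<in> P" "a * h v1 = x" using D(4)[OF v0(1)] v0 a by (simp_all add: v1_def h)
  have "(\<Sum>v\<in>P. \<psi> (a * h v)) = (\<Sum>v\<in>P. \<psi> (a * h (v + v1)))"
  proof (rule sum.reindex_bij_witness[where i = "\<lambda>v. v + v1" and j = "\<lambda>v. v - v1"])
    fix v assume v: "v \<in> P"
    show "v - v1 \<in> P" "v + v1 \<in> P" using D v v1 by auto
    show "v - v1 + v1 = v" "v + v1 - v1 = v" using D(1)[OF v] D(1)[OF v1(1)] by (auto intro!: eq_vecI)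
    then show "\<psi> (a * h (v - v1 + v1)) = \<psi> (a * h v)" by simp
  qed
  also have "\<dots> = \<psi> x * (\<Sum>v\<in>P. \<psi> (a * h v))"
    using \<psi> v1 unfolding sum_distrib_left nontrivial_additive_character_def
    by (intro sum.cong) (auto simp: h distrib_left)
  finally have "(1 - \<psi> x) * (\<Sum>v\<in>P. \<psi> (a * h v)) = 0" by (simp add: algebra_simps)
  then show ?thesis using x by simp
qed

lemma card_kernel_functional:
  assumes P: "vsub n P" and h: "\<And>v w. v \<in> P \<Longrightarrow> w \<in> P \<Longrightarrow> h (v + w) = h v + h w"
    "\<And>b v. v \<in> P \<Longrightarrow> h (b \<cdot>\<^sub>v v) = b * h v" and v0: "v0 \<in> P" "h v0 \<noteq> (0 :: 'a)"
  shows "card P = CARD('a) * card {v \<in> P. h v = 0}"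
proof -
  note D = vsubD[OF P]
  define v1 where "v1 = (1 / h v0) \<cdot>\<^sub>v v0"
  have v1: "v1 \<in> P" "h v1 = 1" using D(4)[OF v0(1)] v0 by (simp_all add: v1_def h)
  have "bij_betw (\<lambda>(u, b). u + b \<cdot>\<^sub>v v1) ({v \<in> P. h v = 0} \<times> UNIV) P"
  proof (rule bij_betwI[where g = "\<lambda>v. (v - h v \<cdot>\<^sub>v v1, h v)"])
    show "(\<lambda>(u, b). u + b \<cdot>\<^sub>v v1) \<in> {v \<in> P. h v = 0} \<times> UNIV \<rightarrow> P" using D v1 by auto
    have diff: "h (v - w) = h v - h w" if "v \<in> P" "w \<in> P" for v w
    proof -
      have "v = (v - w) + w" using D(1)[OF that(1)] D(1)[OF that(2)] by (intro eq_vecI) auto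
      then have "h v = h (v - w) + h w" using h(1)[OF D(5)[OF that] that(2)] by simp
      then show ?thesis by simp
    qed
    show "(\<lambda>v. (v - h v \<cdot>\<^sub>v v1, h v)) \<in> P \<rightarrow> {v \<in> P. h v = 0} \<times> UNIV"
      using D v1 by (auto simp: diff h)
    show "(\<lambda>v. (v - h v \<cdot>\<^sub>v v1, h v)) ((\<lambda>(u, b). u + b \<cdot>\<^sub>v v1) p) = p" if pP: "p \<in> {v \<in> P. h v = 0} \<times> UNIV" for p
    proof -
      obtain u b where p: "p = (u, b)" "u \<in> P" "h u = 0" using pP by auto
      have "h (u + b \<cdot>\<^sub>v v1) = b" using p v1 D(4)[OF v1(1)] by (simp add: h)
      moreover have "u + b \<cdot>\<^sub>v v1 - b \<cdot>\<^sub>v v1 = u" using D(1)[OF p(2)] D(1)[OF v1(1)] by (intro eq_vecI) auto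
      ultimately show ?thesis by (simp add: p)
    qed
    show "(\<lambda>(u, b). u + b \<cdot>\<^sub>v v1) ((\<lambda>v. (v - h v \<cdot>\<^sub>v v1, h v)) v) = v" if "v \<in> P" for v
      using D(1)[OF that] D(1)[OF v1(1)] by (auto intro!: eq_vecI)
  qed
  then have "card P = card ({v \<in> P. h v = 0} \<times> (UNIV :: 'a set))" by (rule bij_betw_same_card[symmetric])
  then show ?thesis by (simp add: card_cartesian_product)
qed

text \<open>The sum depends on the partial chain only through its length and the size of the preimage
  of the second largest subspace.\<close>

lemma ext_sum_eq:
  assumes "adapted (w # ws)" "length (w # ws) + k = n"
    and "card (f_pre (span_list n ws)) = CARD('a) ^ (l + length ws)"
  shows "ext_sum k w ws = (- 1) ^ (k + 1 + l) * (\<Prod>i\<in>{1..<l}. of_nat (CARD('a)) ^ i - 1) *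
    (\<Prod>i\<in>{length (w # ws)..<n}. of_nat (CARD('a)) ^ i)"
  using assms
proof (induction k arbitrary: w ws l)
  case 0
  have q: "1 < CARD('a)" using card_mono[of "UNIV :: 'a set" "{0, 1}"] by simp
  have U: "vsub n (span_list n ws)" and W: "vsub n (span_list n (w # ws))"
    using 0 adapted_vsub[of ws] adapted_vsub[of "w # ws"] by auto
  have "card (span_list n (w # ws)) = CARD('a) ^ n"
  proof -
    have "length (w # ws) = n" using 0(2) by simp
    then show ?thesis using card_span_adapted[OF 0(1)] by (simp only:)
  qed
  moreover have "card (span_list n (w # ws)) \<le> card (f_pre (span_list n ws))"
    by (intro card_mono finite_vsub[OF vsub_f_pre[OF U]] adapted_f_span[OF 0(1)])
  moreover have "card (f_pre (span_list n ws)) \<le> CARD('a) ^ n"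
    unfolding card_carrier_vec[symmetric] by (intro card_mono) (auto simp: f_pre_def)
  \<comment> \<open>The chain already spans everything, so the preimage of the previous span is the
    whole space, and l = 1.\<close>
  ultimately have "CARD('a) ^ (l + length ws) = CARD('a) ^ n" using 0(3) by simp
  then have "l + length ws = n" using q by (simp add: power_inject_exp)
  then have "l = 1" using 0(2) by simp
  then show ?case using 0(2) by simp
next
  case (Suc k)
  define q where "q = CARD('a)"
  define j where "j = length (w # ws)"
  define W where "W = span_list n (w # ws)"
  define P where "P = f_pre W"
  define P0 where "P0 = f_pre (span_list n ws)"
  \<comment> \<open>\<open>h\<close> is a linear functional on \<open>P\<close> with kernel
    \<open>P0\<close>; whether it vanishes decides between the two cases below.\<close>
  define h where "h = (\<lambda>v. top_coeff w ws (f v))"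
  have q: "1 < q" unfolding q_def using card_mono[of "UNIV :: 'a set" "{0, 1}"] by simp
  have j: "1 \<le> j" "j < n" using Suc.prems(2) by (auto simp: j_def)
  have U: "vsub n (span_list n ws)" and W: "vsub n W"
    using Suc.prems adapted_vsub[of ws] adapted_vsub[of "w # ws"] by (auto simp: W_def)
  note P = vsub_f_pre[OF W, folded P_def]
  note DP = vsubD[OF P]
  have cW: "card W = q ^ j" using card_span_adapted[OF Suc.prems(1)] by (simp add: W_def q_def j_def)
  have WP0: "W \<subseteq> P0" using adapted_f_span[OF Suc.prems(1)] by (simp add: W_def P0_def)
  have P0P: "P0 \<subseteq> P"
    using span_list_subset_Cons[OF adapted_carrier[OF Suc.prems(1)]] by (auto simp: P0_def P_def f_pre_def W_def)
  have finP: "finite P" by (rule finite_vsub[OF P])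
  have fP: "f v \<in> W" if "v \<in> P" for v using that by (simp add: P_def f_pre_def)
  have h: "h (v + v') = h v + h v'" "h (b \<cdot>\<^sub>v v) = b * h v" if "v \<in> P" "v' \<in> P" for v v' b
    using top_coeff_linear[OF Suc.prems(1) fP[OF that(1), unfolded W_def] fP[OF that(2), unfolded W_def]]
      DP(1)[OF that(1)] DP(1)[OF that(2)] by (simp_all add: h_def f_add f_smult)
  have P0: "P0 = {v \<in> P. h v = 0}"
    using P0P top_coeff_linear(3)[OF Suc.prems(1) fP[unfolded W_def] fP[unfolded W_def]] DP(1)
    by (auto simp: P0_def h_def f_pre_def)
  have IH: "ext_sum k v (w # ws) = (- 1) ^ (k + 1 + l') * (\<Prod>i\<in>{1..<l'}. of_nat q ^ i - 1) *
      (\<Prod>i\<in>{Suc j..<n}. of_nat q ^ i)"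
    if "v \<in> P - W" "card P = q ^ (l' + j)" for v l'
    using Suc.IH[of v "w # ws" l'] that Suc.prems(1,2)
    by (auto simp: P_def W_def f_pre_def j_def q_def simp del: span_list.simps)
  have prod: "(\<Prod>i\<in>{j..<n}. of_nat q ^ i) = (of_nat q ^ j :: complex) * (\<Prod>i\<in>{Suc j..<n}. of_nat q ^ i)"
    using j by (simp add: prod.atLeast_Suc_lessThan)
  \<comment> \<open>The value \<open>z\<close> of the extended chain is the same for every new
    vector, because it depends only on the size of \<open>P\<close>. The sum over
    \<open>P - W\<close> is thus a difference of two character sums.\<close>
  have ext: "ext_sum (Suc k) w ws = (\<Sum>v\<in>P. \<psi> (c j * h v)) * z - (\<Sum>v\<in>W. \<psi> (c j * h v)) * z"
    if "\<And>v. v \<in> P - W \<Longrightarrow> ext_sum k v (w # ws) = z" for z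
  proof -
    have "ext_sum (Suc k) w ws = (\<Sum>v\<in>P - W. \<psi> (c j * h v) * z)"
      unfolding ext_sum.simps W_def[symmetric] P_def[symmetric] j_def[symmetric]
      using that by (intro sum.cong) (auto simp: h_def)
    then show ?thesis
      using finP WP0 P0P by (simp add: sum_diff sum_distrib_right)
  qed
  have "(\<Sum>v\<in>W. \<psi> (c j * h v)) = (\<Sum>v\<in>W. 1)"
    using WP0 P0 by (intro sum.cong) (auto simp: \<psi>_0)
  then have sumW: "(\<Sum>v\<in>W. \<psi> (c j * h v)) = of_nat q ^ j" using cW by simp
  have cP0: "card P0 = q ^ (l + (j - 1))" using Suc.prems(3) by (simp add: P0_def q_def j_def)
  show ?case
  proof (cases "\<exists>v0\<in>P. h v0 \<noteq> 0")
    case True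
    then obtain v0 where v0: "v0 \<in> P" "h v0 \<noteq> 0" by blast
    \<comment> \<open>For a nonzero functional the preimage grows by a factor q, so l stays the
      same; the sum over \<open>P\<close> vanishes and only the term of \<open>W\<close> is
      left.\<close>
    have "card P = q * card P0"
      unfolding P0 q_def by (rule card_kernel_functional[of P h v0]) (use P h v0 in auto)
    then have cP: "card P = q ^ (l + j)" using cP0 j by (simp flip: power_Suc add_Suc_right)
    have "(\<Sum>v\<in>P. \<psi> (c j * h v)) = 0"
      by (rule sum_additive_character[of P h v0]) (use P h v0 c j in auto)
    then have "ext_sum (Suc k) w ws = - (of_nat q ^ j * ((- 1) ^ (k + 1 + l) *
        (\<Prod>i\<in>{1..<l}. of_nat q ^ i - 1) * (\<Prod>i\<in>{Suc j..<n}. of_nat q ^ i)))"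
      using ext[OF IH[OF _ cP]] sumW by simp
    then show ?thesis unfolding j_def[symmetric] q_def[symmetric] prod by simp
  next
    case False
    \<comment> \<open>For a vanishing functional the preimage does not grow, so l drops by one; the
      difference of the sums is q^j (q^(l-1) - 1), which supplies the next factor of the
      product.\<close>
    then have PP0: "P = P0" using P0 by auto
    have "W \<noteq> carrier_vec n"
    proof
      assume "W = carrier_vec n"
      then have "q ^ j = q ^ n" using cW card_carrier_vec[where 'a = 'a, of n] by (simp add: q_def)
      then show False using q j by (simp add: power_inject_exp)
    qed
    then have "W \<subset> P" using f_pre_proper[OF W] WP0 P0P by (auto simp: P_def)
    then have "q ^ j < q ^ (l + (j - 1))" using psubset_card_mono[OF finP] cW cP0 PP0 by metis
    then have "j < l + (j - 1)" using q by (simp add: power_strict_increasing_iff)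
    then obtain l' where l': "l = Suc l'" "1 \<le> l'" using j(1) by (cases l) auto
    have cP: "card P = q ^ (l' + j)" using cP0 PP0 l' j by simp
    have "(\<Sum>v\<in>P. \<psi> (c j * h v)) = (\<Sum>v\<in>P. 1)" using False by (intro sum.cong) (auto simp: \<psi>_0)
    then have sumP: "(\<Sum>v\<in>P. \<psi> (c j * h v)) = of_nat q ^ l' * of_nat q ^ j" using cP by (simp add: power_add)
    have "{1..<l} = insert l' {1..<l'}" using l' by auto
    then have prodl: "(\<Prod>i\<in>{1..<l}. of_nat q ^ i - 1) = (of_nat q ^ l' - 1 :: complex) * (\<Prod>i\<in>{1..<l'}. of_nat q ^ i - 1)"
      by simp
    have "ext_sum (Suc k) w ws = (of_nat q ^ l' * of_nat q ^ j - of_nat q ^ j) * ((- 1) ^ (k + 1 + l') *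
        (\<Prod>i\<in>{1..<l'}. of_nat q ^ i - 1) * (\<Prod>i\<in>{Suc j..<n}. of_nat q ^ i))"
      using ext[OF IH[OF _ cP]] sumP sumW by (simp add: left_diff_distrib del: ext_sum.simps)
    also have "\<dots> = (- 1) ^ (Suc k + 1 + l) * ((of_nat q ^ l' - 1) * (\<Prod>i\<in>{1..<l'}. of_nat q ^ i - 1)) *
        (of_nat q ^ j * (\<Prod>i\<in>{Suc j..<n}. of_nat q ^ i))"
      by (simp add: l' algebra_simps)
    finally show ?thesis unfolding j_def[symmetric] q_def[symmetric] prod prodl .
  qed
qed

lemma finite_chains: "finite (chains j)"
  by (rule finite_subset[OF _ finite_lists_length_eq[of "carrier_vec n :: 'a vec set" j]])
    (use adapted_carrier in \<open>auto simp: chains_def\<close>)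

text \<open>Summing out the head of the chain moves its weight into \<open>ext_sum\<close>.\<close>

lemma sum_chains_Suc:
  "(\<Sum>vs\<in>chains (Suc (Suc j)). chain_weight vs * ext_sum k (hd vs) (tl vs)) =
    (\<Sum>vs\<in>chains (Suc j). chain_weight vs * ext_sum (Suc k) (hd vs) (tl vs))"
proof -
  let ?D = "\<lambda>vs. f_pre (span_list n vs) - span_list n vs"
  have fin: "finite (?D vs)" for vs
    by (rule finite_subset[OF _ finite_carrier_vec[of n]]) (auto simp: f_pre_def)
  have "(\<Sum>vs\<in>chains (Suc j). chain_weight vs * ext_sum (Suc k) (hd vs) (tl vs)) =
      (\<Sum>vs\<in>chains (Suc j). \<Sum>v\<in>?D vs. chain_weight (v # vs) * ext_sum k v vs)"
  proof (rule sum.cong[OF refl])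
    fix vs assume "vs \<in> chains (Suc j)"
    then obtain w ws where vs: "vs = w # ws" by (cases vs) (auto simp: chains_def)
    show "chain_weight vs * ext_sum (Suc k) (hd vs) (tl vs) = (\<Sum>v\<in>?D vs. chain_weight (v # vs) * ext_sum k v vs)"
      unfolding vs by (simp add: sum_distrib_left ac_simps del: span_list.simps)
  qed
  also have "\<dots> = (\<Sum>(vs, v)\<in>(SIGMA vs:chains (Suc j). ?D vs). chain_weight (v # vs) * ext_sum k v vs)"
    by (rule sum.Sigma) (use finite_chains fin in auto)
  also have "\<dots> = (\<Sum>vs\<in>chains (Suc (Suc j)). chain_weight vs * ext_sum k (hd vs) (tl vs))"
    by (rule sum.reindex_bij_witness[where i = "\<lambda>vs. (tl vs, hd vs)" and j = "\<lambda>(vs, v). v # vs"])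
      (auto simp: chains_def f_pre_def length_Suc_conv simp del: span_list.simps)
  finally show ?thesis by simp
qed

text \<open>Summing out everything but the first vector leaves the nonzero vectors of the kernel,
  which carry no weight; their number q^l - 1 is the last factor of the first product.\<close>

theorem sum_chain_weight:
  assumes n: "1 \<le> n" and ker: "card (f_pre {0\<^sub>v n}) = CARD('a) ^ l"
  shows "(\<Sum>vs\<in>chains n. chain_weight vs) =
    (- 1) ^ (n + l) * (\<Prod>i\<in>{1..l}. of_nat (CARD('a)) ^ i - 1) * (\<Prod>i<n. of_nat (CARD('a)) ^ i)"
proof -
  have red: "(\<Sum>vs\<in>chains (Suc j). chain_weight vs * ext_sum k (hd vs) (tl vs)) =
      (\<Sum>vs\<in>chains 1. chain_weight vs * ext_sum (k + j) (hd vs) (tl vs))" for j k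
    by (induction j arbitrary: k) (simp_all add: sum_chains_Suc del: ext_sum.simps)
  have "l \<noteq> 0"
  proof
    assume "l = 0"
    then have card1: "card (f_pre {0\<^sub>v n}) = 1" using ker by simp
    have "vsub n {0\<^sub>v n}" using vsub_span_list[of "[]" n] by simp
    moreover have "{0\<^sub>v n} \<noteq> (carrier_vec n :: 'a vec set)"
    proof
      assume "{0\<^sub>v n} = (carrier_vec n :: 'a vec set)"
      then have "card (carrier_vec n :: 'a vec set) = 1" by (metis card_1_singleton_iff One_nat_def)
      then show False using n card_mono[of "UNIV :: 'a set" "{0, 1}"] by (simp add: card_carrier_vec)
    qed
    moreover have "f_pre {0\<^sub>v n} = {0\<^sub>v n}"
    proof -
      obtain x where "f_pre {0\<^sub>v n} = {x}" using card1 by (auto simp: card_1_singleton_iff)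
      moreover have "0\<^sub>v n \<in> f_pre {0\<^sub>v n}" using f_0 by (simp add: f_pre_def)
      ultimately show ?thesis by auto
    qed
    ultimately show False using f_pre_proper by blast
  qed
  then obtain l' where l: "l = Suc l'" by (cases l) auto
  have eq: "chains 1 = (\<lambda>v. [v]) ` (f_pre {0\<^sub>v n} - {0\<^sub>v n})"
    by (auto simp: chains_def f_pre_def length_Suc_conv)
  have "(\<Sum>vs\<in>chains n. chain_weight vs) = (\<Sum>vs\<in>chains 1. chain_weight vs * ext_sum (n - 1) (hd vs) (tl vs))"
    using red[where j = "n - 1" and k = 0] n by simp
  also have "\<dots> = (\<Sum>v\<in>f_pre {0\<^sub>v n} - {0\<^sub>v n}. ext_sum (n - 1) v [])"
    unfolding eq by (subst sum.reindex) (auto simp: inj_on_def)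
  also have "\<dots> = (\<Sum>v\<in>f_pre {0\<^sub>v n} - {0\<^sub>v n}. (- 1) ^ (n + l) * (\<Prod>i\<in>{1..<l}. of_nat (CARD('a)) ^ i - 1) *
      (\<Prod>i\<in>{1..<n}. of_nat (CARD('a)) ^ i))"
  proof (rule sum.cong[OF refl])
    fix v assume "v \<in> f_pre {0\<^sub>v n} - {0\<^sub>v n}"
    then have "adapted [v]" by (auto simp: f_pre_def)
    from ext_sum_eq[OF this, of "n - 1" l] n ker
    show "ext_sum (n - 1) v [] = (- 1) ^ (n + l) * (\<Prod>i\<in>{1..<l}. of_nat (CARD('a)) ^ i - 1) *
      (\<Prod>i\<in>{1..<n}. of_nat (CARD('a)) ^ i)" by simp
  qed
  also have "\<dots> = (of_nat (CARD('a)) ^ l - 1) * ((- 1) ^ (n + l) * (\<Prod>i\<in>{1..<l}. of_nat (CARD('a)) ^ i - 1) *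
      (\<Prod>i\<in>{1..<n}. of_nat (CARD('a)) ^ i))"
  proof -
    have "0\<^sub>v n \<in> f_pre {0\<^sub>v n}" using f_0 by (simp add: f_pre_def)
    then have "card (f_pre {0\<^sub>v n} - {0\<^sub>v n}) = CARD('a) ^ l - 1" using ker by (simp add: card_Diff_singleton)
    then show ?thesis by (simp add: of_nat_diff)
  qed
  also have "\<dots> = (- 1) ^ (n + l) * (\<Prod>i\<in>{1..l}. of_nat (CARD('a)) ^ i - 1) * (\<Prod>i<n. of_nat (CARD('a)) ^ i)"
  proof -
    have "{1..l} = insert l {1..<l}" "{..<n} = insert 0 {1..<n}" using l n by auto
    then show ?thesis by (simp add: ac_simps)
  qed
  finally show ?thesis .
qed

end

end

end

section \<open>The induced character on unipotent elements\<close>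

lemma GL_simps: "(\<otimes>\<^bsub>GL n\<^esub>) = (*)" "\<one>\<^bsub>GL n\<^esub> = 1\<^sub>m n"
  "carrier (GL n) = Units (ring_mat TYPE('a::{field,finite}) n ())" for n :: nat
  by (simp_all add: GL_def units_of_def ring_mat_def)

lemma GL_carrier_mat: "x \<in> carrier (GL n) \<Longrightarrow> x \<in> carrier_mat n n"
  by (simp add: GL_simps Units_def) (simp add: ring_mat_def)

lemma group_GL: "group (GL n :: 'a::{field,finite} mat monoid)"
proof -
  interpret ring "ring_mat TYPE('a) n ()" by (rule ring_mat)
  show ?thesis unfolding GL_def by (rule units_group)
qed

lemma GL_inv:
  assumes "x \<in> carrier (GL n)"
  shows "inv\<^bsub>GL n\<^esub> x \<in> carrier (GL n)" "inv\<^bsub>GL n\<^esub> x * x = 1\<^sub>m n" "x * inv\<^bsub>GL n\<^esub> x = 1\<^sub>m n"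
  using group.inv_closed[OF group_GL assms] group.l_inv[OF group_GL assms] group.r_inv[OF group_GL assms]
  by (simp_all add: GL_simps(1,2))

lemma GL_det_iff: "x \<in> carrier (GL n) \<longleftrightarrow> x \<in> carrier_mat n n \<and> det x \<noteq> 0"
  using GL_carrier_mat[of x n] unit_imp_det_non_zero[of x n "()"] det_non_zero_imp_unit[of x n "()"]
  by (auto simp: GL_simps)

lemma GL_mult_vec_cancel:
  assumes x: "x \<in> carrier (GL n)" and v: "v \<in> carrier_vec n"
  shows "inv\<^bsub>GL n\<^esub> x *\<^sub>v (x *\<^sub>v v) = v" "x *\<^sub>v (inv\<^bsub>GL n\<^esub> x *\<^sub>v v) = v"
proof -
  have c: "x \<in> carrier_mat n n" "inv\<^bsub>GL n\<^esub> x \<in> carrier_mat n n"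
    using GL_carrier_mat[OF x] GL_carrier_mat[OF GL_inv(1)[OF x]] .
  show "inv\<^bsub>GL n\<^esub> x *\<^sub>v (x *\<^sub>v v) = v"
    using assoc_mult_mat_vec[OF c(2,1) v] GL_inv(2)[OF x] v by simp
  show "x *\<^sub>v (inv\<^bsub>GL n\<^esub> x *\<^sub>v v) = v"
    using assoc_mult_mat_vec[OF c(1,2) v] GL_inv(3)[OF x] v by simp
qed

lemma vec_split_coord:
  fixes y :: "'a::field vec"
  assumes y: "y \<in> carrier_vec n" and j: "j < n"
  obtains y' :: "'a vec" where "y' \<in> carrier_vec n" "y = y' + y $ j \<cdot>\<^sub>v unit_vec n j" "y' $ j = 0"
    "\<And>i. i < n \<Longrightarrow> i \<noteq> j \<Longrightarrow> y' $ i = y $ i"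
proof -
  let ?y' = "vec n (\<lambda>i. if i = j then 0 else y $ i)"
  have "y = ?y' + y $ j \<cdot>\<^sub>v unit_vec n j" using y j by (intro eq_vecI) auto
  then show thesis using that[of ?y'] j by simp
qed

lemma mat_mult_unit_vec: "x \<in> carrier_mat n n \<Longrightarrow> j < n \<Longrightarrow> x *\<^sub>v unit_vec n j = (col x j :: 'a::field vec)"
  by (intro eq_vecI) auto

definition initial_vecs :: "nat \<Rightarrow> nat \<Rightarrow> 'a::field vec set" where
  "initial_vecs n j = {y \<in> carrier_vec n. \<forall>i<n. j \<le> i \<longrightarrow> y $ i = 0}"

lemma span_list_cols:
  fixes x :: "'a::field mat"
  assumes x: "x \<in> carrier_mat n n"
  shows "j \<le> n \<Longrightarrow> span_list n (rev (take j (cols x))) = (\<lambda>y. x *\<^sub>v y) ` initial_vecs n j"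
proof (induction j)
  case 0
  have "initial_vecs n 0 = {0\<^sub>v n :: 'a vec}" by (auto simp: initial_vecs_def intro!: eq_vecI)
  moreover have "x *\<^sub>v 0\<^sub>v n = 0\<^sub>v n" using x by (intro eq_vecI) auto
  ultimately show ?case by simp
next
  case (Suc j)
  then have j: "j < n" by simp
  have take: "rev (take (Suc j) (cols x)) = col x j # rev (take j (cols x))"
    using x j by (simp add: take_Suc_conv_app_nth)
  have add: "x *\<^sub>v (y + a \<cdot>\<^sub>v unit_vec n j) = x *\<^sub>v y + a \<cdot>\<^sub>v col x j" if "y \<in> carrier_vec n" for y a
    using that x j by (simp add: mult_add_distrib_mat_vec[OF x] mult_mat_vec[OF x] mat_mult_unit_vec)
  show ?case
  proof (intro equalityI subsetI)
    fix v assume "v \<in> span_list n (rev (take (Suc j) (cols x)))"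
    then obtain y a where y: "y \<in> initial_vecs n j" "v = x *\<^sub>v y + a \<cdot>\<^sub>v col x j"
      using Suc.IH j unfolding take by auto
    have "y + a \<cdot>\<^sub>v unit_vec n j \<in> initial_vecs n (Suc j)" using y(1) j by (auto simp: initial_vecs_def)
    moreover have "v = x *\<^sub>v (y + a \<cdot>\<^sub>v unit_vec n j)" using y add by (simp add: initial_vecs_def)
    ultimately show "v \<in> (\<lambda>y. x *\<^sub>v y) ` initial_vecs n (Suc j)" by blast
  next
    fix v assume "v \<in> (\<lambda>y. x *\<^sub>v y) ` initial_vecs n (Suc j)"
    then obtain y :: "'a vec" where y: "y \<in> carrier_vec n" "\<forall>i<n. Suc j \<le> i \<longrightarrow> y $ i = 0" "v = x *\<^sub>v y"
      by (auto simp: initial_vecs_def)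
    obtain y' :: "'a vec" where y': "y' \<in> carrier_vec n" "y = y' + y $ j \<cdot>\<^sub>v unit_vec n j" "y' $ j = 0"
      "\<And>i. i < n \<Longrightarrow> i \<noteq> j \<Longrightarrow> y' $ i = y $ i" using vec_split_coord[OF y(1) j] by blast
    have "y' $ i = 0" if "i < n" "j \<le> i" for i using that y(2) y'(3,4) by (cases "i = j") auto
    then have "y' \<in> initial_vecs n j" using y'(1) by (simp add: initial_vecs_def)
    moreover have "v = x *\<^sub>v y' + (y $ j) \<cdot>\<^sub>v col x j" unfolding y(3) by (subst y'(2)) (rule add[OF y'(1)])
    ultimately show "v \<in> span_list n (rev (take (Suc j) (cols x)))"
      using Suc.IH j unfolding take by auto
  qed
qed

context
  fixes n :: nat and g :: "'a::{field,finite} mat"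
  assumes g: "g \<in> carrier_mat n n"
begin

abbreviation nil_part :: "'a vec \<Rightarrow> 'a vec" where
  "nil_part v \<equiv> g *\<^sub>v v - v"

lemma nil_part_linear:
  shows "v \<in> carrier_vec n \<Longrightarrow> nil_part v \<in> carrier_vec n"
    and "v \<in> carrier_vec n \<Longrightarrow> w \<in> carrier_vec n \<Longrightarrow> nil_part (v + w) = nil_part v + nil_part w"
    and "v \<in> carrier_vec n \<Longrightarrow> nil_part (a \<cdot>\<^sub>v v) = a \<cdot>\<^sub>v nil_part v"
proof -
  show 1: "v \<in> carrier_vec n \<Longrightarrow> nil_part v \<in> carrier_vec n" for v using g by auto
  show "v \<in> carrier_vec n \<Longrightarrow> w \<in> carrier_vec n \<Longrightarrow> nil_part (v + w) = nil_part v + nil_part w"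
    using g by (intro eq_vecI) (auto simp: mult_add_distrib_mat_vec[OF g])
  show "v \<in> carrier_vec n \<Longrightarrow> nil_part (a \<cdot>\<^sub>v v) = a \<cdot>\<^sub>v nil_part v"
    using g by (intro eq_vecI) (auto simp: mult_mat_vec[OF g] algebra_simps)
qed

lemma nil_part_col:
  assumes x: "x \<in> carrier_mat n n" and u: "u \<in> carrier_mat n n" and gx: "g * x = x * u" and j: "j < n"
  shows "nil_part (col x j) = x *\<^sub>v (col u j - unit_vec n j)"
proof -
  have "g *\<^sub>v col x j = x *\<^sub>v col u j"
    using arg_cong[OF gx, of "\<lambda>m. col m j"] x u g j by simp
  moreover have "x *\<^sub>v (col u j - unit_vec n j) = x *\<^sub>v col u j - x *\<^sub>v unit_vec n j"
    using u j by (intro mult_minus_distrib_mat_vec[OF x]) auto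
  ultimately show ?thesis using x j by (simp add: mat_mult_unit_vec)
qed

text \<open>The relation g x = x u says that g - 1 maps column j of x to a combination of earlier
  columns whose last coefficient is the superdiagonal entry of u. The list is reversed because
  chains have the newest vector first.\<close>

lemma cols_adapted:
  fixes \<psi> c
  assumes x: "x \<in> carrier (GL n)" and u: "u \<in> unitriangular n" and gx: "g * x = x * u"
  shows "j \<le> n \<Longrightarrow> adapted n nil_part (rev (take j (cols x))) \<and>
    chain_weight n nil_part \<psi> c (rev (take j (cols x))) = (\<Prod>i\<in>{1..<j}. \<psi> (c i * u $$ (i - 1, i)))"
proof (induction j)
  case 0
  then show ?case by (simp add: adapted.simps)
next
  case (Suc j)
  then have j: "j < n" and ad: "adapted n nil_part (rev (take j (cols x)))"
    and wt: "chain_weight n nil_part \<psi> c (rev (take j (cols x))) = (\<Prod>i\<in>{1..<j}. \<psi> (c i * u $$ (i - 1, i)))"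
    by auto
  have xc: "x \<in> carrier_mat n n" and uc: "u \<in> carrier_mat n n"
    using GL_carrier_mat[OF x] u by (auto simp: unitriangular_def)
  have take: "rev (take (Suc k) (cols x)) = col x k # rev (take k (cols x))" if "k < n" for k
    using xc that by (simp add: take_Suc_conv_app_nth)
  let ?y = "col u j - unit_vec n j"
  have y: "?y \<in> initial_vecs n j"
    using u j by (auto simp: initial_vecs_def unitriangular_def)
  have fcol: "nil_part (col x j) = x *\<^sub>v ?y" by (rule nil_part_col[OF xc uc gx j])
  have notin: "col x j \<notin> span_list n (rev (take j (cols x)))"
  proof
    assume "col x j \<in> span_list n (rev (take j (cols x)))"
    then obtain y where y: "y \<in> initial_vecs n j" "col x j = x *\<^sub>v y"
      using span_list_cols[OF xc, of j] j by auto
    then have "x *\<^sub>v unit_vec n j = x *\<^sub>v y" using xc j by (simp add: mat_mult_unit_vec)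
    then have "unit_vec n j = y"
      using GL_mult_vec_cancel(1)[OF x, of "unit_vec n j"] GL_mult_vec_cancel(1)[OF x, of y] y(1)
      by (simp add: initial_vecs_def)
    then show False using y(1) j by (auto simp: initial_vecs_def)
  qed
  have ad': "adapted n nil_part (rev (take (Suc j) (cols x)))"
    unfolding take[OF j] adapted.simps
    using ad notin fcol y span_list_cols[OF xc, of j] j xc by (auto simp: col_dim)
  moreover have "chain_weight n nil_part \<psi> c (rev (take (Suc j) (cols x))) =
      (\<Prod>i\<in>{1..<Suc j}. \<psi> (c i * u $$ (i - 1, i)))"
  proof (cases j)
    case 0
    then show ?thesis unfolding take[OF j] by (simp add: chain_weight.simps)
  next
    case (Suc k)
    then have k: "k < n" using j by simp
    obtain y' :: "'a vec" where y': "y' \<in> carrier_vec n" "?y = y' + ?y $ k \<cdot>\<^sub>v unit_vec n k" "y' $ k = 0"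
      "\<And>i. i < n \<Longrightarrow> i \<noteq> k \<Longrightarrow> y' $ i = ?y $ i"
      using vec_split_coord[of ?y n k] y k by (auto simp: initial_vecs_def)
    have "y' $ i = 0" if "i < n" "k \<le> i" for i
      using that y y'(3,4) Suc by (cases "i = k") (auto simp: initial_vecs_def)
    then have y'i: "y' \<in> initial_vecs n k" using y'(1) by (simp add: initial_vecs_def)
    have "nil_part (col x j) = x *\<^sub>v y' + ?y $ k \<cdot>\<^sub>v col x k"
      unfolding fcol using y'(1) xc k
      by (subst y'(2)) (simp add: mult_add_distrib_mat_vec[OF xc] mult_mat_vec[OF xc] mat_mult_unit_vec)
    moreover have "x *\<^sub>v y' \<in> span_list n (rev (take k (cols x)))"
      using span_list_cols[OF xc, of k] k y'i by auto
    ultimately have "top_coeff n (col x k) (rev (take k (cols x))) (nil_part (col x j)) = ?y $ k"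
      using top_coeff_eq[OF nil_part_linear, of "col x k" "rev (take k (cols x))"] ad take[OF k] Suc by simp
    moreover have "?y $ k = u $$ (k, j)" using uc j k Suc by simp
    moreover have "length (rev (take j (cols x))) = j" using xc j by simp
    ultimately have "chain_weight n nil_part \<psi> c (rev (take (Suc j) (cols x))) =
        \<psi> (c j * u $$ (k, j)) * chain_weight n nil_part \<psi> c (rev (take j (cols x)))"
      unfolding take[OF j] unfolding Suc take[OF k] by (simp add: chain_weight.simps)
    moreover have "{1..<Suc j} = insert j {1..<j}" using Suc by auto
    ultimately show ?thesis using wt Suc by simp
  qed
  ultimately show ?case by blast
qed

text \<open>Together with \<open>cols_adapted\<close> this matches the full chains with the matrices
  summed over in the induced character.\<close>

lemma adapted_mat:
  assumes vs: "adapted n nil_part vs" and len: "length vs = n"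
  defines "x \<equiv> mat_of_cols n (rev vs)"
  shows "x \<in> carrier (GL n)" "cols x = rev vs" "inv\<^bsub>GL n\<^esub> x * g * x \<in> unitriangular n"
proof -
  have set: "set vs \<subseteq> carrier_vec n" by (rule adapted_carrier[OF nil_part_linear vs])
  have xc: "x \<in> carrier_mat n n" using len by (simp add: x_def mat_of_cols_def)
  show cols: "cols x = rev vs" using set by (simp add: x_def)
  have ad: "adapted n nil_part (rev (take j (cols x)))" if "j \<le> n" for j
  proof -
    have "adapted n nil_part (drop k vs)" for k
      using vs by (induction vs arbitrary: k) (auto simp: drop_Cons split: nat.split)
    then show ?thesis using that len by (simp add: cols rev_take)
  qed
  have take: "rev (take (Suc j) (cols x)) = col x j # rev (take j (cols x))" if "j < n" for j
    using xc that by (simp add: take_Suc_conv_app_nth)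
  have adc: "col x j \<notin> span_list n (rev (take j (cols x)))" "nil_part (col x j) \<in> span_list n (rev (take j (cols x)))"
    if "j < n" for j
    using ad[of "Suc j"] that unfolding take[OF that] adapted.simps by auto
  have "det x \<noteq> 0"
  proof
    assume "det x = 0"
    then obtain y where y: "y \<in> carrier_vec n" "y \<noteq> 0\<^sub>v n" "x *\<^sub>v y = 0\<^sub>v n"
      using det_0_iff_vec_prod_zero[OF xc] by blast
    \<comment> \<open>The highest nonzero coordinate of a kernel vector would express the
      corresponding column through earlier ones.\<close>
    define A where "A = {i. i < n \<and> y $ i \<noteq> 0}"
    have "A \<noteq> {}" using y(1,2) by (auto simp: A_def intro!: eq_vecI)
    moreover have finA: "finite A" by (simp add: A_def)
    ultimately have "Max A \<in> A" by (rule Max_in[rotated])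
    define j where "j = Max A"
    have j: "j < n" "y $ j \<noteq> 0" using \<open>Max A \<in> A\<close> by (auto simp: A_def j_def)
    have above: "y $ i = 0" if "i < n" "j < i" for i
    proof (rule ccontr)
      assume "y $ i \<noteq> 0"
      then have "i \<in> A" using that by (simp add: A_def)
      then have "i \<le> j" unfolding j_def by (rule Max_ge[OF finA])
      then show False using that by simp
    qed
    obtain y' :: "'a vec" where y': "y' \<in> carrier_vec n" "y = y' + y $ j \<cdot>\<^sub>v unit_vec n j" "y' $ j = 0"
      "\<And>i. i < n \<Longrightarrow> i \<noteq> j \<Longrightarrow> y' $ i = y $ i" using vec_split_coord[OF y(1) j(1)] by blast
    have "y' $ i = 0" if "i < n" "j \<le> i" for i using that above y'(3,4) by (cases "i = j") auto
    then have "x *\<^sub>v y' \<in> span_list n (rev (take j (cols x)))"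
      using span_list_cols[OF xc, of j] j y'(1) by (auto simp: initial_vecs_def)
    moreover have "x *\<^sub>v y' + y $ j \<cdot>\<^sub>v col x j = 0\<^sub>v n"
      using arg_cong[OF y'(2), of "\<lambda>v. x *\<^sub>v v"] y(3) y'(1) xc j
      by (simp add: mult_add_distrib_mat_vec[OF xc] mult_mat_vec[OF xc] mat_mult_unit_vec)
    moreover have "vsub n (span_list n (rev (take j (cols x))))"
      by (rule adapted_vsub[OF nil_part_linear ad[OF less_imp_le[OF j(1)]]])
    ultimately have "(- inverse (y $ j)) \<cdot>\<^sub>v (x *\<^sub>v y') \<in> span_list n (rev (take j (cols x)))"
      using vsubD(4) by blast
    moreover have "(- inverse (y $ j)) \<cdot>\<^sub>v (x *\<^sub>v y') = col x j"
    proof (rule eq_vecI)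
      fix i assume "i < dim_vec (col x j)"
      then have i: "i < n" using xc by simp
      have "(x *\<^sub>v y') $ i + y $ j * col x j $ i = 0"
        using arg_cong[OF \<open>x *\<^sub>v y' + y $ j \<cdot>\<^sub>v col x j = 0\<^sub>v n\<close>, of "\<lambda>v. vec_index v i"] i xc
        by (simp del: index_mult_mat_vec)
      then have "(x *\<^sub>v y') $ i = - (y $ j * col x j $ i)" by (simp only: add_eq_0_iff2)
      then show "((- inverse (y $ j)) \<cdot>\<^sub>v (x *\<^sub>v y')) $ i = col x j $ i"
        using i xc j(2) by (simp del: index_mult_mat_vec)
    qed (use xc in simp)
    ultimately show False using adc(1)[OF j(1)] by simp
  qed
  then show x: "x \<in> carrier (GL n)" using xc by (simp add: GL_det_iff)
  let ?u = "inv\<^bsub>GL n\<^esub> x * g * x"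
  have ic: "inv\<^bsub>GL n\<^esub> x \<in> carrier_mat n n" by (rule GL_carrier_mat[OF GL_inv(1)[OF x]])
  have uc: "?u \<in> carrier_mat n n" using ic g xc by simp
  have ucol: "\<exists>y\<in>initial_vecs n j. col ?u j = unit_vec n j + y" if j: "j < n" for j
  proof -
    obtain y where y: "y \<in> initial_vecs n j" "nil_part (col x j) = x *\<^sub>v y"
      using adc(2)[OF j] span_list_cols[OF xc, of j] j by auto
    have yc: "y \<in> carrier_vec n" using y(1) by (simp add: initial_vecs_def)
    have "g *\<^sub>v col x j = x *\<^sub>v unit_vec n j + x *\<^sub>v y"
      unfolding y(2)[symmetric] using g xc j by (simp add: mat_mult_unit_vec) (intro eq_vecI; auto)
    also have "\<dots> = x *\<^sub>v (unit_vec n j + y)" using yc by (simp add: mult_add_distrib_mat_vec[OF xc])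
    finally have "inv\<^bsub>GL n\<^esub> x *\<^sub>v (g *\<^sub>v col x j) = unit_vec n j + y"
      using GL_mult_vec_cancel(1)[OF x, of "unit_vec n j + y"] yc by simp
    moreover have "col ?u j = inv\<^bsub>GL n\<^esub> x *\<^sub>v (g *\<^sub>v col x j)"
      using ic g xc j by (simp add: assoc_mult_mat[OF ic g xc] col_mult2[of _ n n _ n])
    ultimately show ?thesis using y(1) by auto
  qed
  have entry: "?u $$ (i, j) = (if i = j then 1 else 0)" if ij: "j \<le> i" "i < n" for i j
  proof -
    obtain y where y: "y \<in> initial_vecs n j" "col ?u j = unit_vec n j + y"
      using ucol[of j] ij by auto
    have yc: "y \<in> carrier_vec n" and y0: "y $ i = 0" using y(1) ij by (auto simp: initial_vecs_def)
    have "?u $$ (i, j) = col ?u j $ i"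
      using carrier_matD[OF uc] ij by (intro index_col[symmetric]) linarith+
    also have "\<dots> = unit_vec n j $ i + y $ i"
      unfolding y(2) using carrier_vecD[OF yc] ij by (intro index_add_vec(1)) simp
    also have "\<dots> = (if i = j then 1 else 0)" using ij y0 by simp
    finally show ?thesis .
  qed
  show "?u \<in> unitriangular n"
    using uc by (simp add: unitriangular_def entry del: index_mult_mat)
qed

lemma prod_power_eq_card_unitriangular:
  "card (unitriangular n :: 'a mat set) = (\<Prod>i<n. CARD('a) ^ i)"
proof -
  let ?I = "SIGMA j:{..<n}. {..<j}"
  define F where "F = (\<lambda>h :: nat \<times> nat \<Rightarrow> 'a. mat n n (\<lambda>(i, j). if i = j then 1 else if i < j then h (j, i) else 0))"
  have "bij_betw F (?I \<rightarrow>\<^sub>E UNIV) (unitriangular n)"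
  proof (rule bij_betwI[where g = "\<lambda>u. \<lambda>(j, i)\<in>?I. u $$ (i, j)"])
    show "F \<in> (?I \<rightarrow>\<^sub>E UNIV) \<rightarrow> unitriangular n" by (auto simp: F_def unitriangular_def)
    show "(\<lambda>u. \<lambda>(j, i)\<in>?I. u $$ (i, j)) \<in> unitriangular n \<rightarrow> (?I \<rightarrow>\<^sub>E UNIV)" by auto
    show "(\<lambda>(j, i)\<in>?I. F h $$ (i, j)) = h" if "h \<in> ?I \<rightarrow>\<^sub>E UNIV" for h
    proof
      fix p
      show "(\<lambda>(j, i)\<in>?I. F h $$ (i, j)) p = h p"
        using that by (cases p; cases "p \<in> ?I") (auto simp: F_def PiE_iff extensional_def)
    qed
    show "F (\<lambda>(j, i)\<in>?I. u $$ (i, j)) = u" if "u \<in> unitriangular n" for u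
      using that by (intro eq_matI) (auto simp: F_def unitriangular_def)
  qed
  then have "card (unitriangular n :: 'a mat set) = card (?I \<rightarrow>\<^sub>E (UNIV :: 'a set))"
    by (rule bij_betw_same_card[symmetric])
  also have "\<dots> = (\<Prod>p\<in>?I. CARD('a))" by (rule card_PiE) simp
  also have "\<dots> = (\<Prod>i<n. \<Prod>k<i. CARD('a))" by (simp add: prod.Sigma split_def del: prod_constant)
  finally show ?thesis by simp
qed

text \<open>The order of the unitriangular group is the product of the q^i with i < n, which is
  exactly the last factor in \<open>sum_chain_weight\<close>.\<close>

theorem induced_char_nilpotent:
  assumes gG: "g \<in> carrier (GL n)" and n: "1 \<le> n" and \<psi>: "nontrivial_additive_character \<psi>"
    and c: "\<forall>i\<in>{1..<n}. c i \<noteq> 0"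
    and nilp: "\<And>v. v \<in> carrier_vec n \<Longrightarrow> \<exists>m. (nil_part ^^ m) v = 0\<^sub>v n"
    and ker: "card {v \<in> carrier_vec n. nil_part v = 0\<^sub>v n} = CARD('a) ^ l"
  shows "induced_char (GL n) (unitriangular n) (linear_char \<psi> n c) g =
    (- 1) ^ (n + l) * (\<Prod>i\<in>{1..l}. of_nat (CARD('a)) ^ i - 1)"
proof -
  let ?S = "{x \<in> carrier (GL n). inv\<^bsub>GL n\<^esub> x * g * x \<in> unitriangular n}"
  let ?w = "chain_weight n nil_part \<psi> c"
  have unit: "g * x = x * (inv\<^bsub>GL n\<^esub> x * g * x)" if "x \<in> carrier (GL n)" for x
  proof -
    have c: "x \<in> carrier_mat n n" "inv\<^bsub>GL n\<^esub> x \<in> carrier_mat n n"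
      using GL_carrier_mat[OF that] GL_carrier_mat[OF GL_inv(1)[OF that]] .
    have "x * (inv\<^bsub>GL n\<^esub> x * g * x) = (x * inv\<^bsub>GL n\<^esub> x) * (g * x)"
      using c g by (simp add: assoc_mult_mat[of _ n n _ n _ n])
    then show ?thesis using GL_inv(3)[OF that] c g by simp
  qed
  have "(\<Sum>x\<in>?S. linear_char \<psi> n c (inv\<^bsub>GL n\<^esub> x * g * x)) = (\<Sum>vs\<in>chains n nil_part n. ?w vs)"
  proof (rule sum.reindex_bij_witness[where j = "\<lambda>x. rev (cols x)" and i = "\<lambda>vs. mat_of_cols n (rev vs)"])
    fix x assume x: "x \<in> ?S"
    then have xG: "x \<in> carrier (GL n)" by simp
    have xc: "x \<in> carrier_mat n n" by (rule GL_carrier_mat[OF xG])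
    show "mat_of_cols n (rev (rev (cols x))) = x" using xc by (simp add: mat_of_cols_cols[of x, unfolded carrier_matD(1)[OF xc]])
    have ad: "adapted n nil_part (rev (take n (cols x))) \<and>
        ?w (rev (take n (cols x))) = (\<Prod>i\<in>{1..<n}. \<psi> (c i * (inv\<^bsub>GL n\<^esub> x * g * x) $$ (i - 1, i)))"
      using cols_adapted[OF xG _ unit[OF xG], of n] x by simp
    moreover have "take n (cols x) = cols x" using xc by simp
    ultimately show "rev (cols x) \<in> chains n nil_part n" using xc by (simp add: chains_def)
    show "?w (rev (cols x)) = linear_char \<psi> n c (inv\<^bsub>GL n\<^esub> x * g * x)"
      using ad \<open>take n (cols x) = cols x\<close> by (simp add: linear_char_def del: index_mult_mat)
  next
    fix vs assume "vs \<in> chains n nil_part n"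
    then have vs: "adapted n nil_part vs" "length vs = n" by (auto simp: chains_def)
    show "rev (cols (mat_of_cols n (rev vs))) = vs" using adapted_mat(2)[OF vs] by simp
    show "mat_of_cols n (rev vs) \<in> ?S" using adapted_mat(1,3)[OF vs] by simp
  qed
  also have "\<dots> = (- 1) ^ (n + l) * (\<Prod>i\<in>{1..l}. of_nat (CARD('a)) ^ i - 1) * (\<Prod>i<n. of_nat (CARD('a)) ^ i)"
    by (rule sum_chain_weight[OF nil_part_linear \<psi> _ nilp n]) (use c ker in \<open>auto simp: f_pre_def\<close>)
  finally have sum: "(\<Sum>x\<in>?S. linear_char \<psi> n c (inv\<^bsub>GL n\<^esub> x * g * x)) =
      (- 1) ^ (n + l) * (\<Prod>i\<in>{1..l}. of_nat (CARD('a)) ^ i - 1) * (\<Prod>i<n. of_nat (CARD('a)) ^ i)" .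
  have card: "of_nat (card (unitriangular n :: 'a mat set)) = (\<Prod>i<n. of_nat (CARD('a)) ^ i :: complex)"
    by (simp add: prod_power_eq_card_unitriangular)
  show ?thesis
    unfolding induced_char_def using gG sum by (simp add: GL_simps(1) card del: GL_simps(3))
qed

lemma induced_char_conj:
  assumes "induced_char (GL n) (unitriangular n) (linear_char \<psi> n c) g \<noteq> 0"
  obtains x where "x \<in> carrier (GL n)" "inv\<^bsub>GL n\<^esub> x * g * x \<in> unitriangular n"
proof -
  have "\<exists>x. x \<in> carrier (GL n) \<and> inv\<^bsub>GL n\<^esub> x * g * x \<in> unitriangular n"
  proof (rule ccontr)
    assume "\<not> ?thesis"
    then have "{x. x \<in> carrier (GL n) \<and> inv\<^bsub>GL n\<^esub> x \<otimes>\<^bsub>GL n\<^esub> g \<otimes>\<^bsub>GL n\<^esub> x \<in> unitriangular n} = {}"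
      by (simp add: GL_simps(1))
    note empty = this
    have "induced_char (GL n) (unitriangular n) (linear_char \<psi> n c) g = 0"
      unfolding induced_char_def empty by auto
    then show False using assms by simp
  qed
  then show thesis using that by blast
qed

end

section \<open>Unipotent conjugacy classes\<close>

lemma card_poly_degree_less:
  "card {r :: 'a::{field,finite} poly. r = 0 \<or> degree r < d} = CARD('a) ^ d"
proof (induction d)
  case 0
  have "{r :: 'a poly. r = 0 \<or> degree r < 0} = {0}" by auto
  then show ?case by simp
next
  case (Suc d)
  let ?A = "\<lambda>d. {r :: 'a poly. r = 0 \<or> degree r < d}"
  have "?A (Suc d) = (\<lambda>(a, p). pCons a p) ` (UNIV \<times> ?A d)"
  proof (intro equalityI subsetI)
    fix r assume "r \<in> ?A (Suc d)"
    moreover obtain a p where "r = pCons a p" by (cases r)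
    ultimately show "r \<in> (\<lambda>(a, p). pCons a p) ` (UNIV \<times> ?A d)"
      by (auto simp: image_iff split: if_splits)
  qed (auto split: if_splits)
  moreover have "inj_on (\<lambda>(a, p). pCons a p) (UNIV \<times> ?A d)" by (auto simp: inj_on_def)
  ultimately have "card (?A (Suc d)) = card ((UNIV :: 'a set) \<times> ?A d)" by (simp only: card_image)
  then show ?case using Suc by (simp add: card_cartesian_product)
qed

lemma degree_x_minus_1_power: "degree (x_minus_1 ^ k :: 'a::{field,finite} poly) = k"
  by (simp add: degree_power_eq)

lemma mod_x_minus_1_power_iff:
  "p mod x_minus_1 ^ m = p \<longleftrightarrow> p = 0 \<or> degree (p :: 'a::{field,finite} poly) < m"
proof
  have nz: "(x_minus_1 :: 'a poly) ^ m \<noteq> 0" by simp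
  assume "p mod x_minus_1 ^ m = p"
  then show "p = 0 \<or> degree p < m"
    using degree_mod_less[OF nz, of p] by (simp add: degree_x_minus_1_power)
next
  assume "p = 0 \<or> degree p < m"
  then show "p mod x_minus_1 ^ m = p" by (auto simp: mod_poly_less degree_x_minus_1_power)
qed

text \<open>The kernel consists of the multiples of (x - 1)^(m-k) by polynomials of degree below min
  k m; truncated subtraction covers k > m as well.\<close>

lemma card_kernel_cyclic:
  "card {p :: 'a::{field,finite} poly. p mod x_minus_1 ^ m = p \<and> (x_minus_1 ^ k * p) mod x_minus_1 ^ m = 0} =
    CARD('a) ^ min k m"
proof -
  let ?f = "x_minus_1 :: 'a poly"
  have fnz: "?f ^ j \<noteq> 0" for j by simp
  have "{p. p mod ?f ^ m = p \<and> (?f ^ k * p) mod ?f ^ m = 0} = (\<lambda>r. ?f ^ (m - k) * r) ` {r. r = 0 \<or> degree r < min k m}"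
  proof (intro equalityI subsetI)
    fix p assume p: "p \<in> {p. p mod ?f ^ m = p \<and> (?f ^ k * p) mod ?f ^ m = 0}"
    then have dvd: "?f ^ m dvd ?f ^ k * p" by (auto simp: mod_eq_0_iff_dvd)
    have "?f ^ (m - k) dvd p"
    proof (cases "k \<le> m")
      case True
      then have "?f ^ m = ?f ^ k * ?f ^ (m - k)" by (simp flip: power_add)
      then show ?thesis using dvd fnz[of k] by (metis dvd_mult_cancel_left)
    qed simp
    then obtain r where r: "p = ?f ^ (m - k) * r" by (elim dvdE)
    have "r = 0 \<or> degree r < min k m"
      using p fnz[of "m - k"] by (auto simp: mod_x_minus_1_power_iff r degree_mult_eq degree_x_minus_1_power)
    then show "p \<in> (\<lambda>r. ?f ^ (m - k) * r) ` {r. r = 0 \<or> degree r < min k m}" using r by blast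
  next
    fix p assume "p \<in> (\<lambda>r. ?f ^ (m - k) * r) ` {r. r = 0 \<or> degree r < min k m}"
    then obtain r where r: "p = ?f ^ (m - k) * r" "r = 0 \<or> degree r < min k m" by blast
    have "?f ^ m dvd ?f ^ k * ?f ^ (m - k)" unfolding power_add[symmetric] by (rule le_imp_power_dvd) simp
    then have "?f ^ m dvd ?f ^ k * p" unfolding r(1) mult.assoc[symmetric] by (rule dvd_mult2)
    moreover have "p = 0 \<or> degree p < m"
    proof (cases "r = 0")
      case False
      then have "degree p = (m - k) + degree r"
        unfolding r(1) using degree_mult_eq[OF fnz False, of "m - k"] by (simp add: degree_x_minus_1_power)
      then show ?thesis using r(2) False by auto
    qed (simp add: r(1))
    ultimately show "p \<in> {p. p mod ?f ^ m = p \<and> (?f ^ k * p) mod ?f ^ m = 0}"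
      by (simp add: mod_x_minus_1_power_iff mod_eq_0_iff_dvd)
  qed
  moreover have "inj_on (\<lambda>r. ?f ^ (m - k) * r) A" for A using fnz[of "m - k"] by (auto simp: inj_on_def)
  ultimately show ?thesis by (simp only: card_image card_poly_degree_less)
qed

definition unip :: "(nat \<Rightarrow> nat) \<Rightarrow> 'a::{field,finite} poly \<Rightarrow> nat \<Rightarrow> nat" where
  "unip \<nu> f = (if f = x_minus_1 then \<nu> else (\<lambda>i. 0))"

lemma unip_simps: "unip \<nu> x_minus_1 = \<nu>" "f \<noteq> x_minus_1 \<Longrightarrow> unip \<nu> f = (\<lambda>i. 0)"
  by (simp_all add: unip_def)

lemma unip_support: "part_size \<nu> \<noteq> 0 \<Longrightarrow> {f. unip \<nu> f \<noteq> (\<lambda>i. 0)} = {x_minus_1 :: 'a::{field,finite} poly}"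
  by (auto simp: unip_def part_size_def split: if_splits)

lemma P_norm_unip: "part_size \<nu> \<noteq> 0 \<Longrightarrow> P_norm (unip \<nu> :: 'a::{field,finite} poly \<Rightarrow> _) = part_size \<nu>"
  unfolding P_norm_def by (simp add: unip_support unip_simps)

text \<open>Away from \<open>x_minus_1\<close>, and where \<open>\<nu> i\<close> is 0, the modulus
  is 1 and reduced remainders vanish, so only the finitely many rows of \<open>\<nu>\<close>
  contribute a factor.\<close>

lemma card_kernel_cyclic_sum:
  assumes \<nu>: "is_partition \<nu>"
  shows "card {c \<in> cyclic_sum (unip \<nu> :: 'a::{field,finite} poly \<Rightarrow> _).
      \<forall>i. (x_minus_1 ^ k * c x_minus_1 i) mod x_minus_1 ^ \<nu> i = 0} =
    CARD('a) ^ (\<Sum>i | \<nu> i \<noteq> 0. min k (\<nu> i))"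
proof -
  let ?f = "x_minus_1 :: 'a poly"
  let ?K = "{c \<in> cyclic_sum (unip \<nu> :: 'a poly \<Rightarrow> _). \<forall>i. (?f ^ k * c ?f i) mod ?f ^ \<nu> i = 0}"
  let ?I = "{i. \<nu> i \<noteq> 0}"
  let ?D = "\<lambda>i. {p. p mod ?f ^ \<nu> i = p \<and> (?f ^ k * p) mod ?f ^ \<nu> i = 0}"
  have zero: "c f i = 0" if "c \<in> cyclic_sum (unip \<nu> :: 'a poly \<Rightarrow> _)" "f \<noteq> ?f \<or> \<nu> i = 0" for c f i
  proof -
    have "c f i mod f ^ unip \<nu> f i = c f i" using that(1) by (auto simp: cyclic_sum_def)
    moreover have "unip \<nu> f i = 0" using that(2) by (auto simp: unip_def)
    ultimately show ?thesis by simp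
  qed
  have cm: "c ?f i mod ?f ^ \<nu> i = c ?f i" if "c \<in> cyclic_sum (unip \<nu> :: 'a poly \<Rightarrow> _)" for c i
    using that unfolding cyclic_sum_def mem_Collect_eq by (metis unip_simps(1))
  have "bij_betw (\<lambda>c. restrict (c ?f) ?I) ?K (Pi\<^sub>E ?I ?D)"
  proof (rule bij_betwI[where g = "\<lambda>h f i. if f = ?f \<and> i \<in> ?I then h i else 0"])
    show "(\<lambda>c. restrict (c ?f) ?I) \<in> ?K \<rightarrow> Pi\<^sub>E ?I ?D"
      by (auto simp: restrict_PiE_iff cm)
    show "(\<lambda>h f i. if f = ?f \<and> i \<in> ?I then h i else 0) \<in> Pi\<^sub>E ?I ?D \<rightarrow> ?K"
      by (auto simp: cyclic_sum_def unip_simps PiE_iff)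
    show "(\<lambda>f i. if f = ?f \<and> i \<in> ?I then restrict (c ?f) ?I i else 0) = c" if "c \<in> ?K" for c
      using that zero[of c] by (auto simp: fun_eq_iff)
    show "restrict ((\<lambda>f i. if f = ?f \<and> i \<in> ?I then h i else 0) ?f) ?I = h" if "h \<in> Pi\<^sub>E ?I ?D" for h
      using that by (auto simp: fun_eq_iff PiE_iff extensional_def)
  qed
  then have "card ?K = card (Pi\<^sub>E ?I ?D)" by (rule bij_betw_same_card)
  also have "\<dots> = (\<Prod>i\<in>?I. card (?D i))" by (rule card_PiE) (use \<nu> in \<open>simp add: is_partition_def\<close>)
  also have "\<dots> = (\<Prod>i\<in>?I. CARD('a) ^ min k (\<nu> i))" by (simp only: card_kernel_cyclic)
  also have "\<dots> = CARD('a) ^ (\<Sum>i\<in>?I. min k (\<nu> i))" by (rule power_sum[symmetric])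
  finally show ?thesis .
qed

context
  fixes n :: nat and g :: "'a::{field,finite} mat"
  assumes g: "g \<in> carrier_mat n n"
begin

lemma poly_act_0: "poly_act n g 0 v = 0\<^sub>v n"
  by (simp add: poly_act_def)

lemma poly_act_pCons:
  assumes v: "v \<in> carrier_vec n"
  shows "poly_act n g (pCons a p) v = a \<cdot>\<^sub>v v + g *\<^sub>v poly_act n g p v"
proof (cases "p = 0 \<and> a = 0")
  case True
  have "0 \<cdot>\<^sub>v v + g *\<^sub>v 0\<^sub>v n = 0\<^sub>v n" using v g by (intro eq_vecI) auto
  then show ?thesis using True by (simp add: poly_act_0)
qed (auto simp: poly_act_def)

lemma poly_act_carrier: "v \<in> carrier_vec n \<Longrightarrow> poly_act n g p v \<in> carrier_vec n"
  by (induction p) (use g in \<open>auto simp: poly_act_0 poly_act_pCons\<close>)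

lemma poly_act_add_poly:
  assumes v: "v \<in> carrier_vec n"
  shows "poly_act n g (p + r) v = poly_act n g p v + poly_act n g r v"
proof (induction p r rule: poly_induct2)
  case (pCons a p b r)
  have c: "poly_act n g p v \<in> carrier_vec n" "poly_act n g r v \<in> carrier_vec n" using poly_act_carrier[OF v] by auto
  show ?case
    unfolding add_pCons poly_act_pCons[OF v] pCons mult_add_distrib_mat_vec[OF g c]
    using v c g by (intro eq_vecI) (auto simp: algebra_simps simp del: index_mult_mat_vec)
qed (use v in \<open>simp add: poly_act_0\<close>)

lemma poly_act_linear:
  shows "v \<in> carrier_vec n \<Longrightarrow> w \<in> carrier_vec n \<Longrightarrow> poly_act n g p (v + w) = poly_act n g p v + poly_act n g p w"
    and "v \<in> carrier_vec n \<Longrightarrow> poly_act n g p (a \<cdot>\<^sub>v v) = a \<cdot>\<^sub>v poly_act n g p v"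
proof -
  show "poly_act n g p (v + w) = poly_act n g p v + poly_act n g p w" if v: "v \<in> carrier_vec n" "w \<in> carrier_vec n"
  proof (induction p)
    case (pCons a p)
    have c: "poly_act n g p v \<in> carrier_vec n" "poly_act n g p w \<in> carrier_vec n" using poly_act_carrier v by auto
    have vw: "v + w \<in> carrier_vec n" using v by simp
    show ?case
      unfolding poly_act_pCons[OF vw] poly_act_pCons[OF v(1)] poly_act_pCons[OF v(2)] pCons(2) mult_add_distrib_mat_vec[OF g c]
      using v c g by (intro eq_vecI) (auto simp: algebra_simps simp del: index_mult_mat_vec)
  qed (simp add: poly_act_0)
  show "poly_act n g p (a \<cdot>\<^sub>v v) = a \<cdot>\<^sub>v poly_act n g p v" if v: "v \<in> carrier_vec n"
  proof (induction p)
    case 0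
    have "a \<cdot>\<^sub>v 0\<^sub>v n = 0\<^sub>v n" by (intro eq_vecI) auto
    then show ?case by (simp add: poly_act_0)
  next
    case (pCons b p)
    have c: "poly_act n g p v \<in> carrier_vec n" using poly_act_carrier v by auto
    have av: "a \<cdot>\<^sub>v v \<in> carrier_vec n" using v by simp
    show ?case
      unfolding poly_act_pCons[OF av] poly_act_pCons[OF v] pCons(2) mult_mat_vec[OF g c]
      using v c g by (intro eq_vecI) (auto simp: algebra_simps simp del: index_mult_mat_vec)
  qed
qed

lemma poly_act_smult:
  assumes v: "v \<in> carrier_vec n"
  shows "poly_act n g (smult a p) v = a \<cdot>\<^sub>v poly_act n g p v"
proof (induction p)
  case 0
  have "a \<cdot>\<^sub>v 0\<^sub>v n = 0\<^sub>v n" by (intro eq_vecI) auto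
  then show ?case by (simp add: poly_act_0)
next
  case (pCons b p)
  have c: "poly_act n g p v \<in> carrier_vec n" using poly_act_carrier v by auto
  show ?case
    unfolding smult_pCons poly_act_pCons[OF v] pCons(2) mult_mat_vec[OF g c]
    using v c g by (intro eq_vecI) (auto simp: algebra_simps simp del: index_mult_mat_vec)
qed

lemma poly_act_mult:
  assumes v: "v \<in> carrier_vec n"
  shows "poly_act n g (p * r) v = poly_act n g p (poly_act n g r v)"
proof (induction p)
  case 0
  show ?case by (simp add: poly_act_0)
next
  case (pCons a p)
  have c: "poly_act n g r v \<in> carrier_vec n" using poly_act_carrier v by auto
  have "poly_act n g (pCons a p * r) v = poly_act n g (smult a r) v + poly_act n g (pCons 0 (p * r)) v"
    by (simp add: poly_act_add_poly[OF v])
  also have "poly_act n g (pCons 0 (p * r)) v = g *\<^sub>v poly_act n g (p * r) v"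
    unfolding poly_act_pCons[OF v] using v g by (intro eq_vecI) auto
  finally show ?case
    unfolding poly_act_pCons[OF c] poly_act_smult[OF v] pCons(2) .
qed

abbreviation nilp :: "'a vec \<Rightarrow> 'a vec" where
  "nilp v \<equiv> g *\<^sub>v v - v"

lemma poly_act_x_minus_1:
  assumes v: "v \<in> carrier_vec n"
  shows "poly_act n g x_minus_1 v = nilp v"
proof -
  have "g *\<^sub>v (1 \<cdot>\<^sub>v v + g *\<^sub>v 0\<^sub>v n) = g *\<^sub>v v"
    by (rule arg_cong[of _ _ "\<lambda>w. g *\<^sub>v w"]) (use v g in \<open>auto intro!: eq_vecI\<close>)
  then show ?thesis
    unfolding poly_act_pCons[OF v] poly_act_0 using v g by (auto intro!: eq_vecI)
qed

lemma poly_act_x_minus_1_power: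
  assumes v: "v \<in> carrier_vec n"
  shows "poly_act n g (x_minus_1 ^ k) v = (nilp ^^ k) v" "(nilp ^^ k) v \<in> carrier_vec n"
proof -
  show *: "poly_act n g (x_minus_1 ^ k) v = (nilp ^^ k) v" for k
  proof (induction k)
    case 0
    have "poly_act n g [:1:] v = v"
      unfolding poly_act_pCons[OF v] poly_act_0 using v g by (auto intro!: eq_vecI)
    then show ?case by (simp add: one_pCons)
  next
    case (Suc k)
    have "poly_act n g (x_minus_1 ^ k) v \<in> carrier_vec n" by (rule poly_act_carrier[OF v])
    then show ?case unfolding power_Suc poly_act_mult[OF v] by (simp add: Suc poly_act_x_minus_1)
  qed
  show "(nilp ^^ k) v \<in> carrier_vec n" unfolding *[symmetric] by (rule poly_act_carrier[OF v])
qed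

end

definition module_iso :: "nat \<Rightarrow> 'a::{field,finite} mat \<Rightarrow> ('a poly \<Rightarrow> nat \<Rightarrow> nat) \<Rightarrow> ('a vec \<Rightarrow> 'a poly \<Rightarrow> nat \<Rightarrow> 'a poly) \<Rightarrow> bool" where
  "module_iso n g \<mu> T \<longleftrightarrow> bij_betw T (carrier_vec n) (cyclic_sum \<mu>) \<and>
     (\<forall>v\<in>carrier_vec n. \<forall>w\<in>carrier_vec n. T (v + w) = (\<lambda>f i. T v f i + T w f i)) \<and>
     (\<forall>v\<in>carrier_vec n. \<forall>p. T (poly_act n g p v) = (\<lambda>f i. (p * T v f i) mod f ^ \<mu> f i))"

lemma conj_class_iff:
  "g \<in> conj_class \<mu> \<longleftrightarrow> g \<in> carrier (GL (P_norm \<mu>)) \<and> (\<exists>T. module_iso (P_norm \<mu>) g \<mu> T)"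
  by (simp add: conj_class_def module_iso_def)

lemma conj_class_unip_iff:
  assumes "part_size \<nu> = n" "n \<noteq> 0"
  shows "g \<in> conj_class (unip \<nu> :: 'a::{field,finite} poly \<Rightarrow> _) \<longleftrightarrow>
    g \<in> carrier (GL n) \<and> (\<exists>T. module_iso n g (unip \<nu>) T)"
  using P_norm_unip[of \<nu>, where 'a = 'a] assms by (simp add: conj_class_iff)

text \<open>The isomorphism carries (g - 1)^k to multiplication by (x - 1)^k. These kernel sizes
  yield what is needed about the class: k = 1 gives the number of rows, k = n nilpotency, and all k
  together determine \<open>\<nu>\<close>.\<close>

lemma conj_class_kernel:
  fixes g :: "'a::{field,finite} mat"
  assumes \<nu>: "\<nu> \<in> partitions_of n" and n: "n \<noteq> 0" and gc: "g \<in> conj_class (unip \<nu>)"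
  shows "card {v \<in> carrier_vec n. ((\<lambda>v. g *\<^sub>v v - v) ^^ k) v = 0\<^sub>v n} = CARD('a) ^ (\<Sum>i | \<nu> i \<noteq> 0. min k (\<nu> i))"
proof -
  have part: "is_partition \<nu>" and size: "part_size \<nu> = n" using \<nu> by (auto simp: partitions_of_def)
  let ?f = "x_minus_1 :: 'a poly"
  let ?K = "{c \<in> cyclic_sum (unip \<nu> :: 'a poly \<Rightarrow> _). \<forall>i. (?f ^ k * c ?f i) mod ?f ^ \<nu> i = 0}"
  from gc have gG: "g \<in> carrier (GL n)" and "\<exists>T. module_iso n g (unip \<nu>) T"
    by (simp_all add: conj_class_unip_iff[OF size n])
  then obtain T where iso: "module_iso n g (unip \<nu>) T" by (elim exE)
  then have T: "bij_betw T (carrier_vec n) (cyclic_sum (unip \<nu>))" by (simp add: module_iso_def)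
  have Tact: "T (poly_act n g p v) = (\<lambda>f i. (p * T v f i) mod f ^ unip \<nu> f i)" if "v \<in> carrier_vec n" for v p
    using iso that by (simp add: module_iso_def)
  have gm: "g \<in> carrier_mat n n" by (rule GL_carrier_mat[OF gG])
  have T0: "T (0\<^sub>v n) = (\<lambda>f i. 0)"
    using Tact[of "0\<^sub>v n" 0] by (simp add: poly_act_0[OF gm])
  have iff: "((\<lambda>v. g *\<^sub>v v - v) ^^ k) v = 0\<^sub>v n \<longleftrightarrow> (\<forall>i. (?f ^ k * T v ?f i) mod ?f ^ \<nu> i = 0)"
    if v: "v \<in> carrier_vec n" for v
  proof -
    note act = poly_act_x_minus_1_power[OF gm v, of k]
    have Tv: "T v f i mod f ^ unip \<nu> f i = T v f i" for f i
      using bij_betwE[OF T] v by (auto simp: cyclic_sum_def)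
    have zero: "(?f ^ k * T v f i) mod f ^ unip \<nu> f i = 0" if "f \<noteq> ?f" for f i
      using that by (simp add: unip_simps)
    have "((\<lambda>v. g *\<^sub>v v - v) ^^ k) v = 0\<^sub>v n \<longleftrightarrow> T (((\<lambda>v. g *\<^sub>v v - v) ^^ k) v) = T (0\<^sub>v n)"
      using inj_on_eq_iff[OF bij_betw_imp_inj_on[OF T] act(2), of "0\<^sub>v n"] by auto
    also have "\<dots> \<longleftrightarrow> (\<forall>f i. (?f ^ k * T v f i) mod f ^ unip \<nu> f i = 0)"
      unfolding act(1)[symmetric] Tact[OF v] T0 by (simp add: fun_eq_iff)
    also have "\<dots> \<longleftrightarrow> (\<forall>i. (?f ^ k * T v ?f i) mod ?f ^ \<nu> i = 0)"
    proof (intro iffI allI)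
      fix i assume "\<forall>f i. (?f ^ k * T v f i) mod f ^ unip \<nu> f i = 0"
      then have "(?f ^ k * T v ?f i) mod ?f ^ unip \<nu> ?f i = 0" by (elim allE)
      then show "(?f ^ k * T v ?f i) mod ?f ^ \<nu> i = 0" by (simp only: unip_simps(1))
    next
      fix f i assume a: "\<forall>i. (?f ^ k * T v ?f i) mod ?f ^ \<nu> i = 0"
      show "(?f ^ k * T v f i) mod f ^ unip \<nu> f i = 0"
      proof (cases "f = ?f")
        case True
        show ?thesis unfolding True unip_simps(1) by (rule spec[OF a])
      qed (rule zero)
    qed
    finally show ?thesis .
  qed
  have "bij_betw T {v \<in> carrier_vec n. ((\<lambda>v. g *\<^sub>v v - v) ^^ k) v = 0\<^sub>v n} ?K"
    unfolding bij_betw_def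
  proof
    show "inj_on T {v \<in> carrier_vec n. ((\<lambda>v. g *\<^sub>v v - v) ^^ k) v = 0\<^sub>v n}"
      using bij_betw_imp_inj_on[OF T] by (rule inj_on_subset) auto
    show "T ` {v \<in> carrier_vec n. ((\<lambda>v. g *\<^sub>v v - v) ^^ k) v = 0\<^sub>v n} = ?K"
    proof (intro equalityI subsetI)
      fix c assume "c \<in> ?K"
      then have c: "c \<in> T ` carrier_vec n" "\<forall>i. (?f ^ k * c ?f i) mod ?f ^ \<nu> i = 0"
        unfolding bij_betw_imp_surj_on[OF T] by simp_all
      from c(1) obtain v where v: "v \<in> carrier_vec n" "c = T v" by (elim imageE)
      then show "c \<in> T ` {v \<in> carrier_vec n. ((\<lambda>v. g *\<^sub>v v - v) ^^ k) v = 0\<^sub>v n}"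
        using iff[OF v(1)] c(2) by simp
    next
      fix c assume "c \<in> T ` {v \<in> carrier_vec n. ((\<lambda>v. g *\<^sub>v v - v) ^^ k) v = 0\<^sub>v n}"
      then obtain v where v: "v \<in> carrier_vec n" "((\<lambda>v. g *\<^sub>v v - v) ^^ k) v = 0\<^sub>v n" "c = T v" by auto
      show "c \<in> ?K" using iff[OF v(1)] v(2) bij_betwE[OF T] v(1) unfolding v(3) by simp
    qed
  qed
  then show ?thesis using card_kernel_cyclic_sum[OF part, of k, where 'a = 'a] by (simp add: bij_betw_same_card)
qed

lemma conj_class_len:
  fixes g :: "'a::{field,finite} mat"
  assumes \<nu>: "\<nu> \<in> partitions_of n" and n: "n \<noteq> 0" and gc: "g \<in> conj_class (unip \<nu>)"
  shows "card {v \<in> carrier_vec n. g *\<^sub>v v - v = 0\<^sub>v n} = CARD('a) ^ part_len \<nu>"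
proof -
  have "(\<Sum>i | \<nu> i \<noteq> 0. min 1 (\<nu> i)) = (\<Sum>i | \<nu> i \<noteq> 0. 1)" by (rule sum.cong) auto
  then show ?thesis using conj_class_kernel[OF assms, of 1] by (simp add: part_len_def)
qed

lemma conj_class_nilpotent:
  fixes g :: "'a::{field,finite} mat"
  assumes \<nu>: "\<nu> \<in> partitions_of n" and n: "n \<noteq> 0" and gc: "g \<in> conj_class (unip \<nu>)" and v: "v \<in> carrier_vec n"
  shows "((\<lambda>v. g *\<^sub>v v - v) ^^ n) v = 0\<^sub>v n"
proof -
  have "(\<Sum>i | \<nu> i \<noteq> 0. min n (\<nu> i)) = (\<Sum>i | \<nu> i \<noteq> 0. \<nu> i)"
    using partition_le_size[OF \<nu>] by (intro sum.cong) auto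
  then have "(\<Sum>i | \<nu> i \<noteq> 0. min n (\<nu> i)) = n" using \<nu> by (simp add: partitions_of_def part_size_def)
  then have "card {v \<in> carrier_vec n. ((\<lambda>v. g *\<^sub>v v - v) ^^ n) v = 0\<^sub>v n} = card (carrier_vec n :: 'a vec set)"
    using conj_class_kernel[OF \<nu> n gc, of n] by (simp add: card_carrier_vec)
  then have "{v \<in> carrier_vec n. ((\<lambda>v. g *\<^sub>v v - v) ^^ n) v = 0\<^sub>v n} = carrier_vec n"
    by (intro card_subset_eq) auto
  then show ?thesis using v by blast
qed

text \<open>From k to k + 1 the sum of min k (\<open>\<nu> i\<close>) grows by the number of rows of
  length at least k + 1, so the kernel sizes determine the conjugate partition.\<close>

lemma conj_class_unique:
  fixes g :: "'a::{field,finite} mat"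
  assumes \<nu>: "\<nu> \<in> partitions_of n" "\<nu>' \<in> partitions_of n" and n: "n \<noteq> 0"
    and gc: "g \<in> conj_class (unip \<nu>)" "g \<in> conj_class (unip \<nu>')"
  shows "\<nu> = \<nu>'"
proof -
  have q: "1 < CARD('a)" using card_mono[of "UNIV :: 'a set" "{0, 1}"] by simp
  have eq: "(\<Sum>i | \<nu> i \<noteq> 0. min k (\<nu> i)) = (\<Sum>i | \<nu>' i \<noteq> 0. min k (\<nu>' i))" for k
    using conj_class_kernel[OF \<nu>(1) n gc(1), of k] conj_class_kernel[OF \<nu>(2) n gc(2), of k] q
    by (simp add: power_inject_exp)
  have card: "card {i. Suc k \<le> \<nu> i} = (\<Sum>i | \<nu> i \<noteq> 0. min (Suc k) (\<nu> i)) - (\<Sum>i | \<nu> i \<noteq> 0. min k (\<nu> i))"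
    if "\<nu> \<in> partitions_of n" for \<nu> k
  proof -
    have fin: "finite {i. \<nu> i \<noteq> 0}" using that by (auto simp: partitions_of_def is_partition_def)
    have "(\<Sum>i | \<nu> i \<noteq> 0. min (Suc k) (\<nu> i)) = (\<Sum>i | \<nu> i \<noteq> 0. min k (\<nu> i) + (if Suc k \<le> \<nu> i then 1 else 0))"
      by (rule sum.cong) auto
    also have "\<dots> = (\<Sum>i | \<nu> i \<noteq> 0. min k (\<nu> i)) + card {i. \<nu> i \<noteq> 0 \<and> Suc k \<le> \<nu> i}"
      using fin by (simp add: sum.distrib sum.If_cases Collect_conj_eq)
    also have "{i. \<nu> i \<noteq> 0 \<and> Suc k \<le> \<nu> i} = {i. Suc k \<le> \<nu> i}" by auto
    finally show ?thesis by simp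
  qed
  show ?thesis
  proof (rule partition_eqI)
    fix r :: nat assume "0 < r"
    then obtain k where "r = Suc k" by (cases r) auto
    then show "card {i. r \<le> \<nu> i} = card {i. r \<le> \<nu>' i}" using card[OF \<nu>(1)] card[OF \<nu>(2)] eq by simp
  qed (use \<nu> in \<open>auto simp: partitions_of_def\<close>)
qed

section \<open>Existence of a class for every unipotent matrix\<close>

lemma vsub_unit_vecs:
  fixes W :: "'a::field vec set"
  assumes W: "vsub n W" and unit: "\<And>j. j < n \<Longrightarrow> unit_vec n j \<in> W"
  shows "W = carrier_vec n"
proof -
  note D = vsubD[OF W]
  have "j \<le> n \<Longrightarrow> initial_vecs n j \<subseteq> W" for j
  proof (induction j)
    case 0
    have "initial_vecs n 0 \<subseteq> {0\<^sub>v n :: 'a vec}" by (auto simp: initial_vecs_def intro!: eq_vecI)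
    then show ?case using D(2) by blast
  next
    case (Suc j)
    show ?case
    proof
      fix y :: "'a vec" assume y: "y \<in> initial_vecs n (Suc j)"
      have j: "j < n" using Suc by simp
      obtain y' :: "'a vec" where y': "y' \<in> carrier_vec n" "y = y' + vec_index y j \<cdot>\<^sub>v unit_vec n j"
        "vec_index y' j = 0" "\<And>i. i < n \<Longrightarrow> i \<noteq> j \<Longrightarrow> vec_index y' i = vec_index y i"
        using vec_split_coord[of y n j] y j by (auto simp: initial_vecs_def)
      have "vec_index y' i = 0" if "i < n" "j \<le> i" for i
        using y y'(3,4) that by (cases "i = j") (auto simp: initial_vecs_def)
      then have "y' \<in> W" using y'(1) Suc by (auto simp: initial_vecs_def)
      then have "y' + vec_index y j \<cdot>\<^sub>v unit_vec n j \<in> W" using D(3,4) unit[OF j] by blast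
      then show "y \<in> W" using y'(2) by simp
    qed
  qed
  from this[of n] show ?thesis using D(1) by (auto simp: initial_vecs_def)
qed

text \<open>Generators of cyclic summands. Independence of the summands is not part of the definition: since
  the sizes add up to \<open>n\<close>, it follows by counting.\<close>

definition jordan_gens :: "nat \<Rightarrow> 'a::field mat \<Rightarrow> (nat \<times> 'a vec) list \<Rightarrow> bool" where
  "jordan_gens n g ps \<longleftrightarrow> sum_list (map fst ps) = n \<and>
     (\<forall>(m, e)\<in>set ps. e \<in> carrier_vec n \<and> ((\<lambda>v. g *\<^sub>v v - v) ^^ m) e = 0\<^sub>v n) \<and>
     (\<forall>W. vsub n W \<longrightarrow> (\<forall>v\<in>W. g *\<^sub>v v \<in> W) \<longrightarrow> snd ` set ps \<subseteq> W \<longrightarrow> W = carrier_vec n)"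

lemma jordan_block_unit_vec:
  assumes j: "j < m"
  shows "jordan_block m (1 :: 'a::field) *\<^sub>v unit_vec m j - unit_vec m j = (if j = 0 then 0\<^sub>v m else unit_vec m (j - 1))"
proof (rule eq_vecI)
  fix i assume "i < dim_vec (if j = 0 then 0\<^sub>v m else unit_vec m (j - 1) :: 'a vec)"
  then have i: "i < m" by (simp split: if_splits)
  have c: "jordan_block m (1 :: 'a) \<in> carrier_mat m m" by (rule carrier_matI) simp_all
  show "vec_index (jordan_block m (1 :: 'a) *\<^sub>v unit_vec m j - unit_vec m j) i =
      vec_index (if j = 0 then 0\<^sub>v m else unit_vec m (j - 1)) i"
    unfolding mat_mult_unit_vec[OF c j] using i j by auto
qed simp

lemma jordan_block_unit_vec_power:
  assumes j: "j < m"
  shows "((\<lambda>v. jordan_block m (1 :: 'a::field) *\<^sub>v v - v) ^^ k) (unit_vec m j) =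
    (if k \<le> j then unit_vec m (j - k) else 0\<^sub>v m)"
proof (induction k)
  case (Suc k)
  let ?N = "\<lambda>v. jordan_block m (1 :: 'a) *\<^sub>v v - v"
  have "(?N ^^ Suc k) (unit_vec m j) = ?N (if k \<le> j then unit_vec m (j - k) else 0\<^sub>v m)"
    unfolding funpow.simps comp_apply Suc.IH ..
  also have "\<dots> = (if Suc k \<le> j then unit_vec m (j - Suc k) else 0\<^sub>v m)"
  proof (cases "k \<le> j")
    case True
    have jk: "j - k < m" using j by simp
    show ?thesis unfolding if_P[OF True] jordan_block_unit_vec[OF jk] using True by (cases "j = k") auto
  next
    case False
    have z: "jordan_block m (1 :: 'a) *\<^sub>v 0\<^sub>v m - 0\<^sub>v m = 0\<^sub>v m" by (intro eq_vecI) auto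
    show ?thesis unfolding if_not_P[OF False] z using False by simp
  qed
  finally show ?case .
qed simp

text \<open>In each block the last unit vector generates, because the block minus 1 lowers the index
  of a unit vector by one. Blocks of size 0 are allowed.\<close>

lemma jordan_gens_jordan_matrix:
  "\<exists>ps. jordan_gens (sum_list ms) (jordan_matrix (map (\<lambda>m. (m, 1 :: 'a::field)) ms)) ps"
proof (induction ms)
  case Nil
  have "jordan_gens 0 (jordan_matrix [] :: 'a mat) []"
    unfolding jordan_gens_def
  proof (intro conjI allI impI)
    fix W :: "'a vec set" assume "vsub 0 W"
    then show "W = carrier_vec 0" by (rule vsub_unit_vecs) simp
  qed simp_all
  then show ?case by auto
next
  case (Cons m ms)
  let ?N = "sum_list ms"
  let ?A = "jordan_block m (1 :: 'a)" and ?D = "jordan_matrix (map (\<lambda>m. (m, 1 :: 'a)) ms)"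
  let ?J = "jordan_matrix (map (\<lambda>m. (m, 1 :: 'a)) (m # ms))"
  obtain ps where ps: "jordan_gens ?N ?D ps" using Cons by blast
  have A: "?A \<in> carrier_mat m m" by (rule carrier_matI) simp_all
  have D: "?D \<in> carrier_mat ?N ?N" by (rule carrier_matI) (simp_all add: o_def)
  have J: "?J *\<^sub>v (a @\<^sub>v d) = (?A *\<^sub>v a) @\<^sub>v (?D *\<^sub>v d)" if "a \<in> carrier_vec m" "d \<in> carrier_vec ?N" for a d
    using mult_mat_vec_split[OF A D that] by (simp add: jordan_matrix_Cons o_def)
  have NJ: "?J *\<^sub>v (a @\<^sub>v d) - (a @\<^sub>v d) = (?A *\<^sub>v a - a) @\<^sub>v (?D *\<^sub>v d - d)"
    if "a \<in> carrier_vec m" "d \<in> carrier_vec ?N" for a d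
    unfolding J[OF that] using that A D by (intro eq_vecI) auto
  have cA: "?A *\<^sub>v a - a \<in> carrier_vec m" if "a \<in> carrier_vec m" for a
    using mult_mat_vec_carrier[OF A that] that by simp
  have cD: "?D *\<^sub>v d - d \<in> carrier_vec ?N" if "d \<in> carrier_vec ?N" for d
    using mult_mat_vec_carrier[OF D that] that by simp
  have NJk: "((\<lambda>v. ?J *\<^sub>v v - v) ^^ k) (a @\<^sub>v d) = ((\<lambda>v. ?A *\<^sub>v v - v) ^^ k) a @\<^sub>v ((\<lambda>v. ?D *\<^sub>v v - v) ^^ k) d \<and>
      ((\<lambda>v. ?A *\<^sub>v v - v) ^^ k) a \<in> carrier_vec m \<and> ((\<lambda>v. ?D *\<^sub>v v - v) ^^ k) d \<in> carrier_vec ?N"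
    if "a \<in> carrier_vec m" "d \<in> carrier_vec ?N" for a d k
  proof (induction k)
    case (Suc k)
    then show ?case unfolding funpow.simps comp_apply using NJ cA cD by (metis (no_types, lifting))
  qed (use that in simp)
  have Az: "?A *\<^sub>v 0\<^sub>v m = 0\<^sub>v m" using A by (auto intro!: eq_vecI)
  have Dz: "?D *\<^sub>v 0\<^sub>v ?N = 0\<^sub>v ?N" by (rule eq_vecI) (simp_all add: o_def scalar_prod_def)
  have A0: "((\<lambda>v. ?A *\<^sub>v v - v) ^^ k) (0\<^sub>v m) = 0\<^sub>v m" for k
    by (induction k) (auto intro!: eq_vecI)
  have D0: "((\<lambda>v. ?D *\<^sub>v v - v) ^^ k) (0\<^sub>v ?N) = 0\<^sub>v ?N" for k
    by (induction k) (simp_all add: Dz)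
  have app0: "0\<^sub>v m @\<^sub>v 0\<^sub>v ?N = (0\<^sub>v (m + ?N) :: 'a vec)" by (intro eq_vecI) auto
  let ?e = "unit_vec m (m - 1) :: 'a vec"
  define ps' where "ps' = (m, ?e @\<^sub>v 0\<^sub>v ?N) # map (\<lambda>(k, e). (k, 0\<^sub>v m @\<^sub>v e)) ps"
  have "jordan_gens (sum_list (m # ms)) ?J ps'"
    unfolding jordan_gens_def
  proof (intro conjI allI impI)
    have "map fst ps' = m # map fst ps" unfolding ps'_def by (induction ps) auto
    then show "sum_list (map fst ps') = sum_list (m # ms)" using ps by (simp add: jordan_gens_def)
    have "((\<lambda>v. ?A *\<^sub>v v - v) ^^ m) ?e = 0\<^sub>v m"
    proof (cases "m = 0")
      case False
      then have "m - 1 < m" "\<not> m \<le> m - 1" by simp_all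
      then show ?thesis using jordan_block_unit_vec_power[of "m - 1" m m, where 'a = 'a] by (simp only: if_False)
    qed (auto intro: eq_vecI)
    then have 1: "((\<lambda>v. ?J *\<^sub>v v - v) ^^ m) (?e @\<^sub>v 0\<^sub>v ?N) = 0\<^sub>v (m + ?N)"
      using NJk[of ?e "0\<^sub>v ?N" m] by (simp only: D0 app0) auto
    have 2: "e \<in> carrier_vec ?N" "((\<lambda>v. ?J *\<^sub>v v - v) ^^ k) (0\<^sub>v m @\<^sub>v e) = 0\<^sub>v (m + ?N)" if "(k, e) \<in> set ps" for k e
    proof -
      show e: "e \<in> carrier_vec ?N" using that ps by (auto simp: jordan_gens_def)
      have "((\<lambda>v. ?D *\<^sub>v v - v) ^^ k) e = 0\<^sub>v ?N" using that ps by (auto simp: jordan_gens_def)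
      then show "((\<lambda>v. ?J *\<^sub>v v - v) ^^ k) (0\<^sub>v m @\<^sub>v e) = 0\<^sub>v (m + ?N)"
        using NJk[OF zero_carrier_vec e, of k] by (simp only: A0 app0)
    qed
    show "\<forall>(k, e)\<in>set ps'. e \<in> carrier_vec (sum_list (m # ms)) \<and>
        ((\<lambda>v. ?J *\<^sub>v v - v) ^^ k) e = 0\<^sub>v (sum_list (m # ms))"
    proof (intro ballI, clarify)
      fix k e assume "(k, e) \<in> set ps'"
      then consider (new) "k = m" "e = ?e @\<^sub>v 0\<^sub>v ?N" | (old) e' where "(k, e') \<in> set ps" "e = 0\<^sub>v m @\<^sub>v e'"
        by (auto simp: ps'_def)
      then show "e \<in> carrier_vec (sum_list (m # ms)) \<and> ((\<lambda>v. ?J *\<^sub>v v - v) ^^ k) e = 0\<^sub>v (sum_list (m # ms))"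
      proof cases
        case new
        show ?thesis unfolding new sum_list.Cons 1 by auto
      next
        case old
        show ?thesis unfolding old(2) sum_list.Cons 2(2)[OF old(1)] using 2(1)[OF old(1)] by auto
      qed
    qed
    fix W assume W: "vsub (sum_list (m # ms)) W" and inv: "\<forall>v\<in>W. ?J *\<^sub>v v \<in> W" and gens: "snd ` set ps' \<subseteq> W"
    note WD = vsubD[OF W]
    have addA: "(a + a') @\<^sub>v (0\<^sub>v ?N :: 'a vec) = (a @\<^sub>v 0\<^sub>v ?N) + (a' @\<^sub>v 0\<^sub>v ?N)"
      if "a \<in> carrier_vec m" "a' \<in> carrier_vec m" for a a' using that by (intro eq_vecI) auto
    have smultA: "(b \<cdot>\<^sub>v a) @\<^sub>v (0\<^sub>v ?N :: 'a vec) = b \<cdot>\<^sub>v (a @\<^sub>v 0\<^sub>v ?N)"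
      if "a \<in> carrier_vec m" for a b using that by (intro eq_vecI) auto
    have addD: "(0\<^sub>v m :: 'a vec) @\<^sub>v (d + d') = (0\<^sub>v m @\<^sub>v d) + (0\<^sub>v m @\<^sub>v d')"
      if "d \<in> carrier_vec ?N" "d' \<in> carrier_vec ?N" for d d' using that by (intro eq_vecI) auto
    have smultD: "(0\<^sub>v m :: 'a vec) @\<^sub>v (b \<cdot>\<^sub>v d) = b \<cdot>\<^sub>v (0\<^sub>v m @\<^sub>v d)"
      if "d \<in> carrier_vec ?N" for d b using that by (intro eq_vecI) auto
    \<comment> \<open>It suffices to treat the intersections of \<open>W\<close> with the two
      coordinate subspaces: they are invariant under the two diagonal blocks, and each turns out to
      be everything.\<close>
    let ?WA = "{a \<in> carrier_vec m. a @\<^sub>v 0\<^sub>v ?N \<in> W}" and ?WD = "{d \<in> carrier_vec ?N. 0\<^sub>v m @\<^sub>v d \<in> W}"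
    have subA: "vsub m ?WA" unfolding vsub_def using WD(2-4) by (auto simp: addA smultA app0)
    have subD: "vsub ?N ?WD" unfolding vsub_def using WD(2-4) by (auto simp: addD smultD app0)
    have invA: "?A *\<^sub>v a \<in> ?WA" if a: "a \<in> ?WA" for a
    proof -
      have "?J *\<^sub>v (a @\<^sub>v 0\<^sub>v ?N) \<in> W" using a inv by blast
      then show ?thesis using a mult_mat_vec_carrier[OF A, of a] J[of a "0\<^sub>v ?N"] by (simp add: Dz)
    qed
    have invD: "?D *\<^sub>v d \<in> ?WD" if d: "d \<in> ?WD" for d
    proof -
      have "?J *\<^sub>v (0\<^sub>v m @\<^sub>v d) \<in> W" using d inv by blast
      then show ?thesis using d mult_mat_vec_carrier[OF D, of d] J[of "0\<^sub>v m" d] by (simp add: Az)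
    qed
    have "snd ` set ps \<subseteq> ?WD"
    proof clarify
      fix k e assume ke: "(k, e) \<in> set ps"
      then have "(k, 0\<^sub>v m @\<^sub>v e) \<in> set ps'" by (force simp: ps'_def)
      then have "0\<^sub>v m @\<^sub>v e \<in> W" using gens by force
      then show "snd (k, e) \<in> carrier_vec ?N \<and> 0\<^sub>v m @\<^sub>v snd (k, e) \<in> W" using 2(1)[OF ke] by simp
    qed
    then have WDall: "?WD = carrier_vec ?N" using ps subD invD unfolding jordan_gens_def by blast
    have "unit_vec m (m - 1 - k) \<in> ?WA" if "0 < m" for k
    proof (induction k)
      case 0
      then show ?case using gens by (auto simp: ps'_def)
    next
      case (Suc k)
      show ?case
      proof (cases "m - 1 - k = 0")
        case False
        have "?A *\<^sub>v unit_vec m (m - 1 - k) - unit_vec m (m - 1 - k) \<in> ?WA"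
          by (rule vsubD(5)[OF subA invA[OF Suc] Suc])
        then show ?thesis using jordan_block_unit_vec[of "m - 1 - k" m, where 'a = 'a] False by simp
      qed (use Suc in simp)
    qed
    then have "unit_vec m j \<in> ?WA" if "j < m" for j
    proof -
      have "m - 1 - (m - 1 - j) = j" "0 < m" using that by simp_all
      then show ?thesis using \<open>\<And>k. 0 < m \<Longrightarrow> unit_vec m (m - 1 - k) \<in> ?WA\<close>[of "m - 1 - j"] by (simp only:)
    qed
    then have WAall: "?WA = carrier_vec m" by (rule vsub_unit_vecs[OF subA])
    show "W = carrier_vec (sum_list (m # ms))"
    proof (intro equalityI subsetI)
      fix v :: "'a vec" assume "v \<in> carrier_vec (sum_list (m # ms))"
      then have v: "v \<in> carrier_vec (m + ?N)" by simp
      have a: "vec_first v m \<in> ?WA" and d: "vec_last v ?N \<in> ?WD" unfolding WAall WDall by auto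
      have "v = vec_first v m @\<^sub>v vec_last v ?N" by (rule vec_first_last_append[OF v, symmetric])
      also have "\<dots> = (vec_first v m @\<^sub>v 0\<^sub>v ?N) + (0\<^sub>v m @\<^sub>v vec_last v ?N)"
        by (intro eq_vecI) auto
      also have "\<dots> \<in> W" using a d WD(3) by blast
      finally show "v \<in> W" .
    qed (use WD(1) in blast)
  qed
  then show ?case by blast
qed

lemma poly_act_sum:
  fixes g :: "'a::{field,finite} mat" and w :: "nat \<Rightarrow> 'a vec"
  assumes g: "g \<in> carrier_mat n n" and w: "\<And>i. i < l \<Longrightarrow> w i \<in> carrier_vec n"
  shows "poly_act n g p (vec n (\<lambda>t. \<Sum>i<l. vec_index (w i) t)) = vec n (\<lambda>t. \<Sum>i<l. vec_index (poly_act n g p (w i)) t)"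
  using w
proof (induction l)
  case 0
  have "poly_act n g p (0 \<cdot>\<^sub>v 0\<^sub>v n) = 0 \<cdot>\<^sub>v poly_act n g p (0\<^sub>v n)"
    by (rule poly_act_linear(2)[OF g]) simp
  moreover have "0 \<cdot>\<^sub>v poly_act n g p (0\<^sub>v n) = 0\<^sub>v n"
    using poly_act_carrier[OF g zero_carrier_vec, of p] by (intro eq_vecI) auto
  moreover have "0 \<cdot>\<^sub>v 0\<^sub>v n = (0\<^sub>v n :: 'a vec)" by (intro eq_vecI) auto
  moreover have "vec n (\<lambda>t. \<Sum>i<0. vec_index (w' i) t) = (0\<^sub>v n :: 'a vec)" for w' :: "nat \<Rightarrow> 'a vec" by (intro eq_vecI) auto
  ultimately show ?case by simp
next
  case (Suc l)
  have wl: "w l \<in> carrier_vec n" using Suc.prems by simp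
  have split: "vec n (\<lambda>t. \<Sum>i<Suc l. vec_index (w' i) t) = vec n (\<lambda>t. \<Sum>i<l. vec_index (w' i) t) + w' l"
    if "w' l \<in> carrier_vec n" for w' :: "nat \<Rightarrow> 'a vec"
    using that by (intro eq_vecI) auto
  have IH: "poly_act n g p (vec n (\<lambda>t. \<Sum>i<l. vec_index (w i) t)) = vec n (\<lambda>t. \<Sum>i<l. vec_index (poly_act n g p (w i)) t)"
    by (rule Suc.IH) (use Suc.prems in simp)
  show ?case
    unfolding split[of w, OF wl] split[of "\<lambda>i. poly_act n g p (w i)", OF poly_act_carrier[OF g wl]] IH[symmetric]
    by (rule poly_act_linear(1)[OF g]) (use wl in auto)
qed

lemma poly_act_x: "g \<in> carrier_mat n n \<Longrightarrow> v \<in> carrier_vec n \<Longrightarrow> poly_act n g [:0, 1:] v = g *\<^sub>v (v :: 'a::{field,finite} vec)"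
proof -
  assume g: "g \<in> carrier_mat n n" and v: "v \<in> carrier_vec n"
  have "1 \<cdot>\<^sub>v v + g *\<^sub>v 0\<^sub>v n = v" using v g by (intro eq_vecI) auto
  then show ?thesis
    unfolding poly_act_pCons[OF g v] poly_act_0[OF g] using v g by (auto intro!: eq_vecI)
qed

lemma poly_act_pCons_0: "g \<in> carrier_mat n n \<Longrightarrow> v \<in> carrier_vec n \<Longrightarrow> poly_act n g [:a:] v = a \<cdot>\<^sub>v (v :: 'a::{field,finite} vec)"
  by (simp only: poly_act_pCons poly_act_0) (auto intro!: eq_vecI)

text \<open>The map \<open>S\<close> sends c to the sum of the vectors c_i(g) e_i. It respects the
  module structure, and its image is invariant and contains the generators, hence is everything.
  Both sides have q^n elements, so it is bijective, and its inverse is the required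
  isomorphism.\<close>

lemma module_iso_of_gens:
  fixes g :: "'a::{field,finite} mat"
  assumes g: "g \<in> carrier_mat n n" and gens: "jordan_gens n g qs"
    and \<nu>: "is_partition \<nu>" "part_size \<nu> = n" and n: "n \<noteq> 0"
    and nth: "\<And>i. \<nu> i = (if i < length qs then fst (qs ! i) else 0)"
  shows "\<exists>T. module_iso n g (unip \<nu>) T"
proof -
  let ?f = "x_minus_1 :: 'a poly" and ?L = "length qs"
  let ?C = "cyclic_sum (unip \<nu> :: 'a poly \<Rightarrow> _)"
  define e where "e i = snd (qs ! i)" for i
  define S where "S c = vec n (\<lambda>t. \<Sum>i<?L. vec_index (poly_act n g (c ?f i) (e i)) t)" for c :: "'a poly \<Rightarrow> nat \<Rightarrow> 'a poly"
  have e: "e i \<in> carrier_vec n" "poly_act n g (?f ^ \<nu> i) (e i) = 0\<^sub>v n" if "i < ?L" for i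
  proof -
    have "qs ! i \<in> set qs" using that by simp
    then have *: "e i \<in> carrier_vec n \<and> ((\<lambda>v. g *\<^sub>v v - v) ^^ \<nu> i) (e i) = 0\<^sub>v n"
      using gens that unfolding jordan_gens_def e_def nth by (auto simp: case_prod_beta)
    then show "e i \<in> carrier_vec n" "poly_act n g (?f ^ \<nu> i) (e i) = 0\<^sub>v n"
      using poly_act_x_minus_1_power(1)[OF g, of "e i" "\<nu> i"] by simp_all
  qed
  have Sc: "S c \<in> carrier_vec n" for c by (simp add: S_def)
  have zero: "poly_act n g p (0\<^sub>v n) = 0\<^sub>v n" for p
    using poly_act_mult[OF g zero_carrier_vec, of p 0] by (simp add: poly_act_0[OF g])
  have Smod: "poly_act n g (p mod ?f ^ \<nu> i) (e i) = poly_act n g p (e i)" if "i < ?L" for p i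
  proof -
    note ei = e[OF that]
    have "poly_act n g p (e i) = poly_act n g (p div ?f ^ \<nu> i * ?f ^ \<nu> i + p mod ?f ^ \<nu> i) (e i)"
      by (simp only: div_mult_mod_eq)
    also have "\<dots> = poly_act n g (p div ?f ^ \<nu> i * ?f ^ \<nu> i) (e i) + poly_act n g (p mod ?f ^ \<nu> i) (e i)"
      by (rule poly_act_add_poly[OF g ei(1)])
    also have "\<dots> = poly_act n g (p mod ?f ^ \<nu> i) (e i)"
      unfolding poly_act_mult[OF g ei(1)] ei(2) zero using poly_act_carrier[OF g ei(1)] by simp
    finally show ?thesis ..
  qed
  have Sadd: "S (\<lambda>f i. c f i + c' f i) = S c + S c'" for c c'
  proof (rule eq_vecI)
    fix t assume "t < dim_vec (S c + S c')"
    then have t: "t < n" by (simp add: S_def)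
    have "vec_index (poly_act n g (c ?f i + c' ?f i) (e i)) t =
        vec_index (poly_act n g (c ?f i) (e i)) t + vec_index (poly_act n g (c' ?f i) (e i)) t" if "i < ?L" for i
      unfolding poly_act_add_poly[OF g e(1)[OF that]]
      using poly_act_carrier[OF g e(1)[OF that], of "c' ?f i"] t by simp
    then show "vec_index (S (\<lambda>f i. c f i + c' f i)) t = vec_index (S c + S c') t"
      using t by (simp add: S_def sum.distrib)
  qed (simp add: S_def)
  have Sact: "S (\<lambda>f i. (p * c f i) mod f ^ unip \<nu> f i) = poly_act n g p (S c)" for p c
  proof -
    have "poly_act n g ((p * c ?f i) mod ?f ^ \<nu> i) (e i) = poly_act n g p (poly_act n g (c ?f i) (e i))" if "i < ?L" for i
      unfolding Smod[OF that] by (rule poly_act_mult[OF g e(1)[OF that]])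
    then have "S (\<lambda>f i. (p * c f i) mod f ^ unip \<nu> f i) =
        vec n (\<lambda>t. \<Sum>i<?L. vec_index (poly_act n g p (poly_act n g (c ?f i) (e i))) t)"
      unfolding S_def unip_simps(1) by (intro arg_cong[of _ _ "vec n"] ext sum.cong) simp_all
    also have "\<dots> = poly_act n g p (S c)"
      unfolding S_def by (rule poly_act_sum[OF g, symmetric]) (simp add: poly_act_carrier[OF g] e)
    finally show ?thesis .
  qed
  have Cadd: "(\<lambda>f i. c f i + c' f i) \<in> ?C" if "c \<in> ?C" "c' \<in> ?C" for c c'
    using that by (simp add: cyclic_sum_def poly_mod_add_left)
  have Cact: "(\<lambda>f i. (p * c f i) mod f ^ unip \<nu> f i) \<in> ?C" for p c
    by (simp add: cyclic_sum_def)
  have "S ` ?C = carrier_vec n"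
  proof -
    have "vsub n (S ` ?C)"
      unfolding vsub_def
    proof (intro conjI ballI allI)
      have "S (\<lambda>f i. 0) = 0\<^sub>v n" by (rule eq_vecI) (simp_all add: S_def poly_act_0[OF g])
      moreover have "(\<lambda>f i. 0) \<in> ?C" by (simp add: cyclic_sum_def)
      ultimately show "0\<^sub>v n \<in> S ` ?C" by (metis imageI)
      show "v + w \<in> S ` ?C" if "v \<in> S ` ?C" "w \<in> S ` ?C" for v w
      proof -
        from that obtain c c' where c: "v = S c" "c \<in> ?C" "w = S c'" "c' \<in> ?C" by (elim imageE)
        show ?thesis unfolding c(1,3) Sadd[symmetric] by (rule imageI[OF Cadd[OF c(2,4)]])
      qed
      show "a \<cdot>\<^sub>v v \<in> S ` ?C" if "v \<in> S ` ?C" for a v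
      proof -
        from that obtain c where c: "v = S c" by (elim imageE)
        show ?thesis unfolding c poly_act_pCons_0[OF g Sc, symmetric] Sact[symmetric] by (rule imageI[OF Cact])
      qed
    qed (use Sc in blast)
    moreover have "\<forall>v\<in>S ` ?C. g *\<^sub>v v \<in> S ` ?C"
    proof
      fix v assume "v \<in> S ` ?C"
      then obtain c where c: "v = S c" by (elim imageE)
      show "g *\<^sub>v v \<in> S ` ?C" unfolding c poly_act_x[OF g Sc, symmetric] Sact[symmetric] by (rule imageI[OF Cact])
    qed
    moreover have "snd ` set qs \<subseteq> S ` ?C"
    proof
      fix v assume "v \<in> snd ` set qs"
      then obtain i where i: "i < ?L" "v = e i" by (auto simp: in_set_conv_nth e_def)
      \<comment> \<open>The entries must be reduced remainders; for a summand with exponent 0 the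
        entry becomes 0, in agreement with the vanishing of its generator.\<close>
      let ?c = "\<lambda>f j. (if j = i then 1 else 0) mod f ^ unip \<nu> f j :: 'a poly"
      have "poly_act n g (?c ?f j) (e j) = (if j = i then e i else 0\<^sub>v n)" if "j < ?L" for j
        unfolding unip_simps(1) Smod[OF that]
        using poly_act_pCons_0[OF g e(1)[OF that], of 1] e(1)[OF that] by (auto simp: one_pCons poly_act_0[OF g])
      then have "S ?c = vec n (\<lambda>t. \<Sum>j<?L. vec_index (if j = i then e i else 0\<^sub>v n) t)"
        unfolding S_def by (intro arg_cong[of _ _ "vec n"] ext sum.cong) simp_all
      also have "\<dots> = e i"
      proof (rule eq_vecI)
        fix t assume "t < dim_vec (e i)"
        then have t: "t < n" using e(1)[OF i(1)] by simp
        have "(\<Sum>j<?L. vec_index (if j = i then e i else 0\<^sub>v n) t) = (\<Sum>j<?L. if j = i then vec_index (e i) t else 0)"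
          using t by (intro sum.cong) auto
        then show "vec_index (vec n (\<lambda>t. \<Sum>j<?L. vec_index (if j = i then e i else 0\<^sub>v n) t)) t = vec_index (e i) t"
          using t i by simp
      qed (use e(1)[OF i(1)] in simp)
      finally have v: "v = S ?c" using i by simp
      have "?c \<in> ?C" by (simp add: cyclic_sum_def)
      then show "v \<in> S ` ?C" unfolding v by (rule imageI)
    qed
    ultimately show ?thesis using gens unfolding jordan_gens_def by blast
  qed
  moreover have "card ?C = card (carrier_vec n :: 'a vec set)" "finite ?C"
  proof -
    have le: "\<nu> i \<le> n" for i using partition_le_size[of \<nu> n i] \<nu> by (simp add: partitions_of_def)
    \<comment> \<open>Every exponent is at most n, so (x - 1)^n kills the whole module, and the
      kernel count at k = n gives its size.\<close>
    have "(?f ^ n * p) mod ?f ^ \<nu> i = 0" for p i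
      unfolding mod_eq_0_iff_dvd by (intro dvd_mult2 le_imp_power_dvd le)
    then have "{c \<in> ?C. \<forall>i. (?f ^ n * c ?f i) mod ?f ^ \<nu> i = 0} = ?C" by blast
    moreover have "(\<Sum>i | \<nu> i \<noteq> 0. min n (\<nu> i)) = n"
      using \<nu>(2) le by (simp add: part_size_def min.absorb2)
    ultimately show "card ?C = card (carrier_vec n :: 'a vec set)"
      using card_kernel_cyclic_sum[OF \<nu>(1), of n, where 'a = 'a] by (simp add: card_carrier_vec)
    then show "finite ?C" by (simp add: card_carrier_vec card_ge_0_finite)
  qed
  ultimately have inj: "inj_on S ?C" by (intro eq_card_imp_inj_on) simp_all
  with \<open>S ` ?C = carrier_vec n\<close> have bij: "bij_betw S ?C (carrier_vec n)" by (simp add: bij_betw_def)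
  let ?T = "inv_into ?C S"
  have TC: "?T v \<in> ?C" "S (?T v) = v" if "v \<in> carrier_vec n" for v
    using that inv_into_into[of v S ?C] f_inv_into_f[of v S ?C] unfolding \<open>S ` ?C = carrier_vec n\<close> by simp_all
  have TI: "?T v = c" if "S c = v" "c \<in> ?C" for v c using that inj by auto
  have "module_iso n g (unip \<nu>) ?T"
    unfolding module_iso_def
  proof (intro conjI ballI allI)
    show "bij_betw ?T (carrier_vec n) ?C" by (rule bij_betw_inv_into[OF bij])
  next
    fix v w :: "'a vec" assume vw: "v \<in> carrier_vec n" "w \<in> carrier_vec n"
    show "?T (v + w) = (\<lambda>f i. ?T v f i + ?T w f i)"
      by (rule TI[OF _ Cadd[OF TC(1)[OF vw(1)] TC(1)[OF vw(2)]]]) (simp add: Sadd TC vw)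
  next
    fix v :: "'a vec" and p assume v: "v \<in> carrier_vec n"
    show "?T (poly_act n g p v) = (\<lambda>f i. (p * ?T v f i) mod f ^ unip \<nu> f i)"
      by (rule TI[OF _ Cact]) (simp add: Sact TC v)
  qed
  then show ?thesis by blast
qed

text \<open>Sorting the generators by decreasing block size turns the sizes into a
  partition.\<close>

lemma conj_class_of_gens:
  fixes g :: "'a::{field,finite} mat"
  assumes g: "g \<in> carrier (GL n)" and gens: "jordan_gens n g ps" and n: "n \<noteq> 0"
  shows "\<exists>\<nu>\<in>partitions_of n. g \<in> conj_class (unip \<nu>)"
proof -
  define qs where "qs = rev (sort_key fst ps)"
  define \<nu> where "\<nu> i = (if i < length qs then fst (qs ! i) else 0)" for i
  have set: "set qs = set ps" by (simp add: qs_def)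
  have "mset (map fst qs) = mset (map fst ps)" by (simp add: qs_def)
  then have sl: "sum_list (map fst qs) = sum_list (map fst ps)" by (metis sum_mset_sum_list)
  have gens': "jordan_gens n g qs" using gens unfolding jordan_gens_def set sl .
  have sorted: "sorted (rev (map fst qs))" by (simp add: qs_def rev_map)
  have part: "is_partition \<nu>"
    unfolding is_partition_def
  proof
    show "antimono \<nu>"
    proof (rule antimonoI)
      fix i j :: nat assume "i \<le> j"
      then show "\<nu> j \<le> \<nu> i" using sorted_rev_nth_mono[OF sorted, of i j] by (simp add: \<nu>_def)
    qed
    show "finite {i. \<nu> i \<noteq> 0}" by (rule finite_subset[of _ "{..<length qs}"]) (auto simp: \<nu>_def)
  qed
  have "part_size \<nu> = (\<Sum>i<length qs. \<nu> i)"
    unfolding part_size_def by (rule sum.mono_neutral_left) (auto simp: \<nu>_def)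
  also have "\<dots> = sum_list (map fst qs)" by (simp add: sum_list_sum_nth \<nu>_def atLeast0LessThan)
  also have "\<dots> = n" using gens' by (simp add: jordan_gens_def)
  finally have size: "part_size \<nu> = n" .
  have "\<exists>T. module_iso n g (unip \<nu>) T"
    by (rule module_iso_of_gens[OF GL_carrier_mat[OF g] gens' part size n \<nu>_def])
  then have "g \<in> conj_class (unip \<nu>)" using g by (simp add: conj_class_unip_iff[OF size n])
  then show ?thesis using part size by (auto simp: partitions_of_def)
qed

text \<open>A subspace invariant under g is pulled back along R to one invariant under J.\<close>

lemma jordan_gens_transport:
  fixes g :: "'a::field mat"
  assumes c: "g \<in> carrier_mat n n" "J \<in> carrier_mat n n" "R \<in> carrier_mat n n" "R' \<in> carrier_mat n n"
    and inv: "R * R' = 1\<^sub>m n" and eq: "g * R = R * J" and gens: "jordan_gens n J ps"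
  shows "jordan_gens n g (map (\<lambda>(m, e). (m, R *\<^sub>v e)) ps)"
proof -
  have gR: "g *\<^sub>v (R *\<^sub>v v) = R *\<^sub>v (J *\<^sub>v v)" if "v \<in> carrier_vec n" for v
    using assoc_mult_mat_vec[OF c(1,3) that] assoc_mult_mat_vec[OF c(3,2) that] eq by simp
  have Rv: "R *\<^sub>v v \<in> carrier_vec n" "J *\<^sub>v v \<in> carrier_vec n" if "v \<in> carrier_vec n" for v
    using mult_mat_vec_carrier[OF c(3) that] mult_mat_vec_carrier[OF c(2) that] .
  have pow: "((\<lambda>v. g *\<^sub>v v - v) ^^ k) (R *\<^sub>v e) = R *\<^sub>v ((\<lambda>v. J *\<^sub>v v - v) ^^ k) e \<and> ((\<lambda>v. J *\<^sub>v v - v) ^^ k) e \<in> carrier_vec n"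
    if "e \<in> carrier_vec n" for e k
  proof (induction k)
    case (Suc k)
    let ?v = "((\<lambda>v. J *\<^sub>v v - v) ^^ k) e"
    have v: "?v \<in> carrier_vec n" using Suc by simp
    have "g *\<^sub>v (R *\<^sub>v ?v) - R *\<^sub>v ?v = R *\<^sub>v (J *\<^sub>v ?v - ?v)"
      unfolding gR[OF v] by (rule mult_minus_distrib_mat_vec[OF c(3) Rv(2)[OF v] v, symmetric])
    then show ?case using Suc v Rv(2)[OF v] by simp
  qed (use that in simp)
  have R0: "R *\<^sub>v 0\<^sub>v n = 0\<^sub>v n" using c(3) by (auto intro!: eq_vecI)
  show ?thesis
    unfolding jordan_gens_def
  proof (intro conjI allI impI)
    have "map fst (map (\<lambda>(m, e). (m, R *\<^sub>v e)) ps) = map fst ps" by (induction ps) auto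
    then show "sum_list (map fst (map (\<lambda>(m, e). (m, R *\<^sub>v e)) ps)) = n"
      using gens by (simp only: jordan_gens_def)
    have "R *\<^sub>v e \<in> carrier_vec n \<and> ((\<lambda>v. g *\<^sub>v v - v) ^^ m) (R *\<^sub>v e) = 0\<^sub>v n" if "(m, e) \<in> set ps" for m e
    proof -
      have "e \<in> carrier_vec n" "((\<lambda>v. J *\<^sub>v v - v) ^^ m) e = 0\<^sub>v n" using that gens by (auto simp: jordan_gens_def)
      then show ?thesis using pow[of e m] R0 Rv(1) by simp
    qed
    then show "\<forall>(m, e)\<in>set (map (\<lambda>(m, e). (m, R *\<^sub>v e)) ps). e \<in> carrier_vec n \<and> ((\<lambda>v. g *\<^sub>v v - v) ^^ m) e = 0\<^sub>v n"
      by (intro ballI) auto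
    fix W assume W: "vsub n W" and invW: "\<forall>v\<in>W. g *\<^sub>v v \<in> W"
      and sub: "snd ` set (map (\<lambda>(m, e). (m, R *\<^sub>v e)) ps) \<subseteq> W"
    let ?W = "{v \<in> carrier_vec n. R *\<^sub>v v \<in> W}"
    have "vsub n ?W"
      unfolding vsub_def
      using vsubD[OF W] R0 mult_add_distrib_mat_vec[OF c(3)] mult_mat_vec[OF c(3)] by simp
    moreover have "\<forall>v\<in>?W. J *\<^sub>v v \<in> ?W"
    proof
      fix v assume v: "v \<in> ?W"
      then have "g *\<^sub>v (R *\<^sub>v v) \<in> W" using invW by simp
      then show "J *\<^sub>v v \<in> ?W" using gR[of v] Rv(2)[of v] v by simp
    qed
    moreover have "snd ` set ps \<subseteq> ?W"
    proof
      fix v assume "v \<in> snd ` set ps"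
      then obtain m where m: "(m, v) \<in> set ps" by auto
      then have "v \<in> carrier_vec n" using gens by (auto simp: jordan_gens_def)
      moreover have "R *\<^sub>v v \<in> W" using sub m by force
      ultimately show "v \<in> ?W" by simp
    qed
    ultimately have all: "?W = carrier_vec n" using gens unfolding jordan_gens_def by blast
    show "W = carrier_vec n"
    proof (intro equalityI subsetI)
      fix v :: "'a vec" assume v: "v \<in> carrier_vec n"
      have R'v: "R' *\<^sub>v v \<in> ?W" unfolding all by (rule mult_mat_vec_carrier[OF c(4) v])
      have "R *\<^sub>v (R' *\<^sub>v v) = v" using assoc_mult_mat_vec[OF c(3,4) v] inv v by simp
      then show "v \<in> W" using R'v by simp
    qed (use vsubD(1)[OF W] in blast)
  qed
qed

text \<open>The eigenvalues of a unitriangular matrix are its diagonal entries, so all Jordan blocks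
  have eigenvalue 1; their generators are transported to g by the matrix x P.\<close>

lemma unipotent_conj_class:
  fixes g :: "'a::{field,finite} mat"
  assumes g: "g \<in> carrier (GL n)" and x: "x \<in> carrier (GL n)" and n: "n \<noteq> 0"
    and u: "inv\<^bsub>GL n\<^esub> x * g * x \<in> unitriangular n"
  shows "\<exists>\<nu>\<in>partitions_of n. g \<in> conj_class (unip \<nu>)"
proof -
  let ?x' = "inv\<^bsub>GL n\<^esub> x"
  let ?u = "?x' * g * x"
  note gm = GL_carrier_mat[OF g] and xm = GL_carrier_mat[OF x] and x'm = GL_carrier_mat[OF GL_inv(1)[OF x]]
  have um: "?u \<in> carrier_mat n n" using gm xm x'm by simp
  have tri: "upper_triangular ?u" using u um by (auto simp: unitriangular_def upper_triangular_def)
  define ns where "ns = triangular_to_jnf_vector ?u"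
  have nf: "jordan_nf ?u ns" unfolding ns_def by (rule triangular_to_jnf_vector[OF um tri])
  have one: "a = 1" if ma: "(m, a) \<in> set ns" for m a
  proof -
    \<comment> \<open>Blocks of a Jordan normal form are nonempty, so \<open>a\<close> really is a
      root of the characteristic polynomial.\<close>
    have "m \<noteq> 0" using nf ma by (force simp: jordan_nf_def)
    then have "poly ([:- a, 1:] ^ m) a = 0" by simp
    then have "poly (char_poly ?u) a = 0"
      unfolding jordan_nf_char_poly[OF nf] poly_prod_list_zero_iff using ma by force
    then obtain d where d: "d \<in> set (diag_mat ?u)" "poly [:- d, 1:] a = 0"
      unfolding char_poly_upper_triangular[OF um tri] poly_prod_list_zero_iff by auto
    have "d = 1" using d(1) u um by (auto simp: diag_mat_def unitriangular_def)
    then show "a = 1" using d(2) by simp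
  qed
  define ms where "ms = map fst ns"
  have ns: "ns = map (\<lambda>m. (m, 1)) ms"
    unfolding ms_def map_map o_def by (rule map_idI[symmetric]) (use one in force)
  obtain P Q where wit: "similar_mat_wit ?u (jordan_matrix ns) P Q"
    using nf unfolding jordan_nf_def similar_mat_def by blast
  have J: "jordan_matrix ns \<in> carrier_mat n n" "P \<in> carrier_mat n n" "Q \<in> carrier_mat n n"
    and PQ: "P * Q = 1\<^sub>m n" "Q * P = 1\<^sub>m n" and uP: "?u = P * jordan_matrix ns * Q"
    using similar_mat_witD2[OF um wit] by (simp_all only:)
  have "sum_list ms = n" using J(1) by (auto simp: ms_def)
  then obtain ps where ps: "jordan_gens n (jordan_matrix ns) ps"
    using jordan_gens_jordan_matrix[of ms, where 'a = 'a] unfolding ns[symmetric] by blast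
  have "g * (x * P) = (x * P) * jordan_matrix ns"
  proof -
    have "x * ?u = (x * ?x') * (g * x)"
      using assoc_mult_mat[OF xm x'm mult_carrier_mat[OF gm xm]] assoc_mult_mat[OF x'm gm xm] by simp
    then have "x * ?u = g * x" using GL_inv(3)[OF x] left_mult_one_mat[OF mult_carrier_mat[OF gm xm]] by simp
    moreover have "?u * P = P * jordan_matrix ns"
      unfolding uP
      using assoc_mult_mat[OF mult_carrier_mat[OF J(2,1)] J(3,2)] PQ(2) right_mult_one_mat[OF mult_carrier_mat[OF J(2,1)]] by simp
    ultimately show ?thesis
      using assoc_mult_mat[OF gm xm J(2)] assoc_mult_mat[OF xm um J(2)] assoc_mult_mat[OF xm J(2,1)] by simp
  qed
  moreover have "(x * P) * (Q * ?x') = 1\<^sub>m n"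
  proof -
    have "P * (Q * ?x') = ?x'" using assoc_mult_mat[OF J(2,3) x'm] PQ(1) left_mult_one_mat[OF x'm] by simp
    then show ?thesis using assoc_mult_mat[OF xm J(2) mult_carrier_mat[OF J(3) x'm]] GL_inv(3)[OF x] by simp
  qed
  ultimately have "jordan_gens n g (map (\<lambda>(m, e). (m, (x * P) *\<^sub>v e)) ps)"
    by (intro jordan_gens_transport[OF gm J(1) mult_carrier_mat[OF xm J(2)] mult_carrier_mat[OF J(3) x'm] _ _ ps])
  then show ?thesis by (rule conj_class_of_gens[OF g _ n])
qed

section \<open>Conjugation invariance of the classes\<close>

lemma poly_act_conj:
  fixes g :: "'a::{field,finite} mat"
  assumes g: "g \<in> carrier_mat n n" and x: "x \<in> carrier (GL n)" and v: "v \<in> carrier_vec n"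
  shows "x *\<^sub>v poly_act n (inv\<^bsub>GL n\<^esub> x * g * x) p v = poly_act n g p (x *\<^sub>v v)"
proof (induction p)
  case 0
  note xm = GL_carrier_mat[OF x] and x'm = GL_carrier_mat[OF GL_inv(1)[OF x]]
  have "x *\<^sub>v 0\<^sub>v n = 0\<^sub>v n" using xm by (auto intro!: eq_vecI)
  moreover have "inv\<^bsub>GL n\<^esub> x * g * x \<in> carrier_mat n n" using g xm x'm by simp
  ultimately show ?case by (simp only: poly_act_0[OF g] poly_act_0)
next
  case (pCons a p)
  note xm = GL_carrier_mat[OF x] and x'm = GL_carrier_mat[OF GL_inv(1)[OF x]]
  let ?g = "inv\<^bsub>GL n\<^esub> x * g * x"
  have gm: "?g \<in> carrier_mat n n" using g xm x'm by simp
  have xv: "x *\<^sub>v v \<in> carrier_vec n" by (rule mult_mat_vec_carrier[OF xm v])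
  let ?w = "poly_act n ?g p v"
  have w: "?w \<in> carrier_vec n" by (rule poly_act_carrier[OF gm v])
  have "x * ?g = (x * inv\<^bsub>GL n\<^esub> x) * (g * x)"
    using assoc_mult_mat[OF xm x'm mult_carrier_mat[OF g xm]] assoc_mult_mat[OF x'm g xm] by simp
  then have "x * ?g = g * x" using GL_inv(3)[OF x] left_mult_one_mat[OF mult_carrier_mat[OF g xm]] by simp
  then have "x *\<^sub>v (?g *\<^sub>v ?w) = g *\<^sub>v (x *\<^sub>v ?w)"
    using assoc_mult_mat_vec[OF xm gm w] assoc_mult_mat_vec[OF g xm w] by simp
  then show ?case
    unfolding poly_act_pCons[OF gm v] poly_act_pCons[OF g xv]
    using mult_add_distrib_mat_vec[OF xm smult_carrier_vec[THEN iffD2, OF v] mult_mat_vec_carrier[OF gm w], of a]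
      mult_mat_vec[OF xm v, of a] pCons(2) by simp
qed

lemma conj_class_conj:
  fixes g :: "'a::{field,finite} mat"
  assumes g: "g \<in> conj_class \<mu>" and x: "x \<in> carrier (GL (P_norm \<mu>))"
  shows "inv\<^bsub>GL (P_norm \<mu>)\<^esub> x * g * x \<in> conj_class \<mu>"
proof -
  let ?n = "P_norm \<mu>"
  let ?x' = "inv\<^bsub>GL ?n\<^esub> x"
  have gG: "g \<in> carrier (GL ?n)" and "\<exists>T. module_iso ?n g \<mu> T" using g by (simp_all add: conj_class_iff)
  then obtain T where T: "module_iso ?n g \<mu> T" by (elim exE)
  note gm = GL_carrier_mat[OF gG] and xm = GL_carrier_mat[OF x] and x'm = GL_carrier_mat[OF GL_inv(1)[OF x]]
  note G = group_GL[of ?n, where 'a = 'a]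
  have "?x' * g * x \<in> carrier (GL ?n)"
    using group.subgroup_self[OF G] monoid.m_closed[OF group.is_monoid[OF G]] GL_inv(1)[OF x] gG x by (metis GL_simps(1))
  moreover have "module_iso ?n (?x' * g * x) \<mu> (\<lambda>v. T (x *\<^sub>v v))"
    unfolding module_iso_def
  proof (intro conjI ballI allI)
    have "bij_betw (\<lambda>v. x *\<^sub>v v) (carrier_vec ?n) (carrier_vec ?n)"
      by (rule bij_betwI[where g = "\<lambda>v. ?x' *\<^sub>v v"])
        (auto simp: GL_mult_vec_cancel[OF x] intro: mult_mat_vec_carrier[OF xm] mult_mat_vec_carrier[OF x'm])
    moreover have "bij_betw T (carrier_vec ?n) (cyclic_sum \<mu>)" using T by (simp add: module_iso_def)
    ultimately have "bij_betw (T \<circ> (\<lambda>v. x *\<^sub>v v)) (carrier_vec ?n) (cyclic_sum \<mu>)" by (rule bij_betw_trans)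
    then show "bij_betw (\<lambda>v. T (x *\<^sub>v v)) (carrier_vec ?n) (cyclic_sum \<mu>)" by (simp only: comp_def)
  next
    fix v w :: "'a vec" assume vw: "v \<in> carrier_vec ?n" "w \<in> carrier_vec ?n"
    show "T (x *\<^sub>v (v + w)) = (\<lambda>f i. T (x *\<^sub>v v) f i + T (x *\<^sub>v w) f i)"
      unfolding mult_add_distrib_mat_vec[OF xm vw]
      using T mult_mat_vec_carrier[OF xm vw(1)] mult_mat_vec_carrier[OF xm vw(2)] by (simp add: module_iso_def)
  next
    fix v :: "'a vec" and p assume v: "v \<in> carrier_vec ?n"
    show "T (x *\<^sub>v poly_act ?n (?x' * g * x) p v) = (\<lambda>f i. (p * T (x *\<^sub>v v) f i) mod f ^ \<mu> f i)"
      unfolding poly_act_conj[OF gm x v]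
      using T mult_mat_vec_carrier[OF xm v] by (simp add: module_iso_def)
  qed
  ultimately show ?thesis by (subst conj_class_iff) (intro conjI exI)
qed

lemma conj_class_dim:
  assumes "g \<in> conj_class \<mu>" "g \<in> carrier_mat n n"
  shows "n = P_norm \<mu>"
proof -
  have "g \<in> carrier_mat (P_norm \<mu>) (P_norm \<mu>)" using assms(1) GL_carrier_mat by (auto simp: conj_class_iff)
  then show ?thesis using assms(2) by (auto simp: carrier_matD)
qed

section \<open>The characteristic of the induced character\<close>

text \<open>\<open>is_characteristic_map\<close> gives linearity only on \<open>class_funs\<close>,
  so the indicators have to be shown to belong there.\<close>

lemma conj_class_indicator_class_fun:
  "(\<lambda>A :: 'a::{field,finite} mat. if A \<in> conj_class \<mu> then 1 else 0) \<in> class_funs"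
proof -
  let ?N = "P_norm \<mu>"
  have conj: "inv\<^bsub>GL n\<^esub> x * g * x \<in> conj_class \<mu> \<longleftrightarrow> g \<in> conj_class \<mu>"
    if g: "g \<in> carrier (GL n)" and x: "x \<in> carrier (GL n)" for n and g x :: "'a mat"
  proof -
    let ?x' = "inv\<^bsub>GL n\<^esub> x"
    note gm = GL_carrier_mat[OF g] and xm = GL_carrier_mat[OF x] and x'm = GL_carrier_mat[OF GL_inv(1)[OF x]]
    have um: "?x' * g * x \<in> carrier_mat n n" using gm xm x'm by simp
    show ?thesis
    proof
      assume gc: "g \<in> conj_class \<mu>"
      have n: "n = ?N" by (rule conj_class_dim[OF gc gm])
      show "?x' * g * x \<in> conj_class \<mu>" using conj_class_conj[OF gc, of x] x unfolding n by simp
    next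
      assume uc: "?x' * g * x \<in> conj_class \<mu>"
      have n: "n = ?N" by (rule conj_class_dim[OF uc um])
      note G = group_GL[of n, where 'a = 'a]
      have "inv\<^bsub>GL n\<^esub> ?x' * (?x' * g * x) * ?x' \<in> conj_class \<mu>"
        using conj_class_conj[OF uc, of ?x'] GL_inv(1)[OF x] unfolding n by simp
      also have "inv\<^bsub>GL n\<^esub> ?x' = x" by (rule group.inv_inv[OF G x])
      also have "x * (?x' * g * x) * ?x' = g"
      proof -
        have "x * (?x' * g * x) = (x * ?x') * (g * x)"
          using assoc_mult_mat[OF xm x'm mult_carrier_mat[OF gm xm]] assoc_mult_mat[OF x'm gm xm] by simp
        also have "\<dots> = g * x" using GL_inv(3)[OF x] left_mult_one_mat[OF mult_carrier_mat[OF gm xm]] by simp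
        finally show ?thesis
          using assoc_mult_mat[OF gm xm x'm] GL_inv(3)[OF x] right_mult_one_mat[OF gm] by simp
      qed
      finally show "g \<in> conj_class \<mu>" .
    qed
  qed
  have off: "g \<notin> conj_class \<mu>" if "g \<in> carrier (GL n)" "?N < n" for n and g :: "'a mat"
    using conj_class_dim[OF _ GL_carrier_mat[OF that(1)], of \<mu>] that(2) by auto
  show ?thesis
    unfolding class_funs_def mem_Collect_eq GL_simps(1)
  proof (intro conjI allI ballI impI exI[of _ ?N])
    fix A :: "'a mat" assume "A \<notin> (\<Union>n. carrier (GL n))"
    then show "(if A \<in> conj_class \<mu> then 1 else 0 :: complex) = 0" by (auto simp: conj_class_iff)
  qed (simp_all add: conj off)
qed

text \<open>The classes of distinct partitions are disjoint, so at most one summand is nonzero. The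
  sign (-1)^l is absorbed by reversing each factor q^i - 1.\<close>

lemma induced_char_unipotent_expansion:
  fixes c :: "nat \<Rightarrow> 'a::{field,finite}"
  assumes n: "1 \<le> n" and \<psi>: "nontrivial_additive_character \<psi>" and c: "\<forall>i\<in>{1..<n}. c i \<noteq> 0"
  shows "induced_char (GL n) (unitriangular n) (linear_char \<psi> n c) A =
    (\<Sum>\<nu>\<in>partitions_of n. (- 1) ^ n * (\<Prod>j<part_len \<nu>. 1 - of_nat CARD('a) ^ Suc j) *
      (if A \<in> conj_class (unip \<nu>) then 1 else 0))" (is "?L = ?R")
proof -
  have n0: "n \<noteq> 0" using n by simp
  have fin: "finite (partitions_of n)" by (rule finite_partitions_of)
  have sgn: "(- 1) ^ (n + l) * (\<Prod>i\<in>{1..l}. of_nat CARD('a) ^ i - 1) =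
      ((- 1) ^ n * (\<Prod>j<l. 1 - of_nat CARD('a) ^ Suc j) :: complex)" for l
    by (induction l) (simp_all add: prod.atLeast_Suc_atMost_Suc_shift algebra_simps)
  show ?thesis
  proof (cases "\<exists>\<nu>\<in>partitions_of n. A \<in> conj_class (unip \<nu>)")
    case True
    then obtain \<nu> where \<nu>: "\<nu> \<in> partitions_of n" "A \<in> conj_class (unip \<nu>)" by (elim bexE)
    have A: "A \<in> carrier (GL n)"
      using \<nu> conj_class_unip_iff[of \<nu> n A] n0 by (simp add: partitions_of_def)
    have "?R = (\<Sum>\<nu>'\<in>partitions_of n. if \<nu>' = \<nu> then (- 1) ^ n * (\<Prod>j<part_len \<nu>. 1 - of_nat CARD('a) ^ Suc j) else 0)"
    proof (rule sum.cong[OF refl])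
      fix \<nu>' assume \<nu>': "\<nu>' \<in> partitions_of n"
      show "(- 1) ^ n * (\<Prod>j<part_len \<nu>'. 1 - of_nat CARD('a) ^ Suc j) * (if A \<in> conj_class (unip \<nu>') then 1 else 0) =
          (if \<nu>' = \<nu> then (- 1) ^ n * (\<Prod>j<part_len \<nu>. 1 - of_nat CARD('a) ^ Suc j) else 0 :: complex)"
      proof (cases "\<nu>' = \<nu>")
        case True
        show ?thesis unfolding True if_P[OF \<nu>(2)] by simp
      next
        case False
        then have "A \<notin> conj_class (unip \<nu>')" using conj_class_unique[OF \<nu>' \<nu>(1) n0 _ \<nu>(2)] by iprover
        then show ?thesis using False by (simp only: if_False mult_zero_right)
      qed
    qed
    also have "\<dots> = (- 1) ^ n * (\<Prod>j<part_len \<nu>. 1 - of_nat CARD('a) ^ Suc j)"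
      using \<nu>(1) fin by simp
    also have "\<dots> = ?L"
    proof -
      have nilp: "\<exists>m. ((\<lambda>v. A *\<^sub>v v - v) ^^ m) v = 0\<^sub>v n" if "v \<in> carrier_vec n" for v
        using conj_class_nilpotent[OF \<nu>(1) n0 \<nu>(2) that] by (rule exI)
      show ?thesis
        unfolding sgn[symmetric]
        by (rule induced_char_nilpotent[OF GL_carrier_mat[OF A] A n \<psi> c nilp conj_class_len[OF \<nu>(1) n0 \<nu>(2)], symmetric])
    qed
    finally show ?thesis ..
  next
    case False
    have "?L = 0"
    proof (rule ccontr)
      assume nz: "?L \<noteq> 0"
      then have A: "A \<in> carrier (GL n)" by (auto simp: induced_char_def split: if_splits)
      obtain x where "x \<in> carrier (GL n)" "inv\<^bsub>GL n\<^esub> x * A * x \<in> unitriangular n"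
        by (rule induced_char_conj[OF GL_carrier_mat[OF A] nz])
      then show False using unipotent_conj_class[OF A _ n0] False by blast
    qed
    moreover have "?R = 0"
    proof (rule sum.neutral, rule ballI)
      fix \<nu> assume "\<nu> \<in> partitions_of n"
      then have "A \<notin> conj_class (unip \<nu>)" using False by blast
      then show "(- 1) ^ n * (\<Prod>j<part_len \<nu>. 1 - of_nat CARD('a) ^ Suc j) * (if A \<in> conj_class (unip \<nu>) then 1 else 0) = (0 :: complex)"
        by (simp only: if_False mult_zero_right)
    qed
    ultimately show ?thesis by simp
  qed
qed

lemma class_funs_add:
  assumes "F \<in> class_funs" "G \<in> class_funs"
  shows "(\<lambda>A. F A + G A) \<in> class_funs"
proof -
  obtain N M where "\<forall>n>N. \<forall>g\<in>carrier (GL n). F g = 0" "\<forall>n>M. \<forall>g\<in>carrier (GL n). G g = 0"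
    using assms by (auto simp: class_funs_def)
  then have bound: "\<exists>K. \<forall>n>K. \<forall>g\<in>carrier (GL n). F g + G g = 0"
    by (intro exI[of _ "max N M"]) (metis add.left_neutral max_less_iff_conj)
  show ?thesis
    unfolding class_funs_def mem_Collect_eq
    by (intro conjI bound) (use assms in \<open>simp_all add: class_funs_def\<close>)
qed

lemma class_funs_scale: "F \<in> class_funs \<Longrightarrow> (\<lambda>A. a * F A) \<in> class_funs"
proof -
  assume F: "F \<in> class_funs"
  then obtain N where "\<forall>n>N. \<forall>g\<in>carrier (GL n). F g = 0" by (auto simp: class_funs_def)
  then have bound: "\<exists>K. \<forall>n>K. \<forall>g\<in>carrier (GL n). a * F g = 0"
    by (intro exI[of _ N] allI impI ballI) simp
  show ?thesis
    unfolding class_funs_def mem_Collect_eq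
    by (intro conjI bound) (use F in \<open>simp_all add: class_funs_def\<close>)
qed

lemma class_funs_0: "(\<lambda>A. 0) \<in> class_funs"
  unfolding class_funs_def by auto

lemma characteristic_map_sum:
  assumes ch: "is_characteristic_map ch" and "finite I" "\<And>i. i \<in> I \<Longrightarrow> F i \<in> class_funs"
  shows "(\<lambda>A. \<Sum>i\<in>I. a i * F i A) \<in> class_funs \<and> ch (\<lambda>A. \<Sum>i\<in>I. a i * F i A) = (\<Sum>i\<in>I. const (a i) * ch (F i))"
  using assms(2,3)
proof (induction I)
  case empty
  have scale: "ch (\<lambda>g. a * F g) = const a * ch F" if "F \<in> class_funs" for a F
    using ch that by (simp add: is_characteristic_map_def)
  have "ch (\<lambda>g. 0) = 0" using scale[OF class_funs_0, of 0] by (simp add: const_0)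
  then show ?case by (simp add: class_funs_0)
next
  case (insert i I)
  have add: "ch (\<lambda>g. F g + G g) = ch F + ch G" if "F \<in> class_funs" "G \<in> class_funs" for F G
    using ch that by (simp add: is_characteristic_map_def)
  have scale: "ch (\<lambda>g. a * F g) = const a * ch F" if "F \<in> class_funs" for a F
    using ch that by (simp add: is_characteristic_map_def)
  have Fi: "F i \<in> class_funs" using insert.prems by simp
  have IH: "(\<lambda>A. \<Sum>i\<in>I. a i * F i A) \<in> class_funs"
    "ch (\<lambda>A. \<Sum>i\<in>I. a i * F i A) = (\<Sum>i\<in>I. const (a i) * ch (F i))"
    using insert.IH insert.prems by simp_all
  have "(\<lambda>A. \<Sum>i\<in>insert i I. a i * F i A) = (\<lambda>A. a i * F i A + (\<Sum>i\<in>I. a i * F i A))"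
    using insert.hyps by simp
  then show ?case
    using class_funs_add[OF class_funs_scale[OF Fi] IH(1), of "a i"] add[OF class_funs_scale[OF Fi] IH(1), of "a i"]
      scale[OF Fi, of "a i"] IH(2) insert.hyps by simp
qed

text \<open>Once the character is a combination of class indicators, linearity of \<open>ch\<close>
  applies. For these classes \<open>P_tilde\<close> has the single factor at x - 1, of degree 1, and
  \<open>sum_HL_tilde\<close> evaluates the sum.\<close>

lemma characteristic_induced_char:
  fixes c :: "nat \<Rightarrow> 'a::{field,finite}"
  assumes n: "1 \<le> n" and \<psi>: "nontrivial_additive_character \<psi>" and c: "\<forall>i\<in>{1..<n}. c i \<noteq> 0"
    and ch: "is_characteristic_map ch"
  shows "ch (induced_char (GL n) (unitriangular n) (linear_char \<psi> n c)) =
    in_vars (alphabet x_minus_1) (const ((- 1) ^ n) * EH_sym (of_nat CARD('a)) n)"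
proof -
  let ?z = "alphabet (x_minus_1 :: 'a poly)"
  let ?\<gamma> = "\<lambda>\<nu>. \<Prod>j<part_len \<nu>. 1 - of_nat CARD('a) ^ Suc j :: complex"
  have P: "ch (\<lambda>A. if A \<in> conj_class (unip \<nu>) then 1 else 0) = in_vars ?z (HL_tilde \<nu> CARD('a))"
    if \<nu>: "\<nu> \<in> partitions_of n" for \<nu>
  proof -
    have size: "part_size \<nu> \<noteq> 0" using \<nu> n by (simp add: partitions_of_def)
    note supp = unip_support[OF size, where 'a = 'a]
    have "(unip \<nu> :: 'a poly \<Rightarrow> _) \<in> P_Phi"
      unfolding P_Phi_def mem_Collect_eq supp
      using \<nu> x_minus_1_Phi[OF refl, where 'a = 'a]
      by (auto simp: unip_def partitions_of_def is_partition_def antimono_def)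
    then have "ch (\<lambda>A. if A \<in> conj_class (unip \<nu>) then 1 else 0) = P_tilde (unip \<nu>)"
      using ch by (simp add: is_characteristic_map_def)
    also have "\<dots> = in_vars ?z (HL_tilde \<nu> CARD('a))" unfolding P_tilde_def supp by (simp add: unip_simps)
    finally show ?thesis .
  qed
  have "ch (induced_char (GL n) (unitriangular n) (linear_char \<psi> n c)) =
      ch (\<lambda>A. \<Sum>\<nu>\<in>partitions_of n. ((- 1) ^ n * ?\<gamma> \<nu>) * (if A \<in> conj_class (unip \<nu>) then 1 else 0))"
    by (rule arg_cong[of _ _ ch], rule ext, rule induced_char_unipotent_expansion[OF n \<psi> c])
  also have "\<dots> = (\<Sum>\<nu>\<in>partitions_of n. const ((- 1) ^ n * ?\<gamma> \<nu>) * ch (\<lambda>A. if A \<in> conj_class (unip \<nu>) then 1 else 0))"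
    by (rule conjunct2[OF characteristic_map_sum[OF ch finite_partitions_of,
          where F = "\<lambda>\<nu> A. if A \<in> conj_class (unip \<nu>) then 1 else 0"]])
      (rule conj_class_indicator_class_fun)
  also have "\<dots> = (\<Sum>\<nu>\<in>partitions_of n. in_vars ?z (const ((- 1) ^ n) * (const (?\<gamma> \<nu>) * HL_tilde \<nu> CARD('a))))"
    by (rule sum.cong) (simp_all add: P const_mult in_vars_mult[OF inj_alphabet] in_vars_const[OF inj_alphabet] mult.assoc)
  also have "\<dots> = in_vars ?z (const ((- 1) ^ n) * EH_sym (of_nat CARD('a)) n)"
    unfolding in_vars_sum[OF inj_alphabet, symmetric] sum_distrib_left[symmetric]
      sum_HL_tilde[OF card_field_ge_2[OF refl, where 'a = 'a]] ..
  finally show ?thesis .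
qed

theorem corollary3p17:
  fixes n :: nat
    and c :: "nat \<Rightarrow> 'a::{field,finite}"
    and \<psi> :: "'a \<Rightarrow> complex"
    and ch :: "('a mat \<Rightarrow> complex) \<Rightarrow> (nat \<times> 'a poly) mseries"
    and \<iota> :: "(nat \<times> 'a level_char set set) mseries \<Rightarrow> (nat \<times> 'a poly) mseries"
    and \<rho> :: "(nat \<times> 'a poly) mseries \<Rightarrow> nat mseries"
    and \<omega>\<^sub>Y :: "nat mseries \<Rightarrow> nat mseries"
    and \<omega>\<^sub>X :: "(nat \<times> 'a poly) mseries \<Rightarrow> (nat \<times> 'a poly) mseries"
  assumes "1 \<le> n"
    and "nontrivial_additive_character \<psi>"
    and "\<forall>i\<in>{1..<n}. c i \<noteq> 0"
    and "is_characteristic_map ch"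
    and "is_identification \<iota>"
    and "is_rho \<iota> \<rho>"
    and "is_omega Y \<omega>\<^sub>Y"
    and "is_omega (alphabet x_minus_1) \<omega>\<^sub>X"
  shows "let \<Gamma> = induced_char (GL n) (unitriangular n) (linear_char \<psi> n c);
             \<rho>\<^sub>n = \<rho> (ch \<Gamma>)
         in ch \<Gamma> = change_vars (\<omega>\<^sub>Y \<rho>\<^sub>n) \<and>
            change_vars (\<omega>\<^sub>Y \<rho>\<^sub>n) =
              const (of_nat (CARD('a) ^ (n - 1) * (CARD('a) - 1))) *
              \<omega>\<^sub>X (in_vars (alphabet x_minus_1) (HL_tilde (one_row n) CARD('a)))"
proof -
  have n: "0 < n" using assms(1) by simp
  show ?thesis
    unfolding Let_def characteristic_induced_char[OF assms(1-4)] change_vars_omega_rho[OF assms(5-7)]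
      omega_HL_tilde_one_row[OF inj_alphabet assms(8) card_field_ge_2[OF refl, where 'a = 'a] n]
    by simp
qed

end
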